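(* Let $1\le r\le\alpha<\infty$, $\gamma\in\mathbb{R}\setminus\{0\}$, $q\in(0,\infty)$, and assume one of: (a) $r\in(n,\infty)$; (b) $r\in[1,n]$, $\gamma\in(0,\infty)$, and $n(\frac1r-\frac1q)<1$; (c) $r\in(1,n]$, $\gamma\in(-\infty,0)$, and $q\in(0,r)$; (d) $r=n=q=1$ and $\gamma\in(-\infty,-1)$. Then for every $f\in C^1(\mathbb{R}^n)$ with $|\nabla f|\in C_{\mathrm c}(\mathbb{R}^n)$, $$\sup_{\lambda>0}\lambda\left\|\left[\int_{\mathbb{R}^n}\mathbf{1}_{E_{\lambda,\gamma/q}[f]}(\cdot,y)|\cdot-y|^{\gamma-n}dy\right]^{1/q}\right\|_{M^\alpha_r(\mathbb{R}^n)}\sim\|\,|\nabla f|\,\|_{M^\alpha_r(\mathbb{R}^n)},$$ with positive equivalence constants independent of $f$. Moreover, for every such $f$: (i) if $\gamma\in(0,\infty)$, then $\lim_{\lambda\to\infty}\lambda\left\|\left[\int_{\mathbb{R}^n}\mathbf{1}_{E_{\lambda,\gamma/q}[f]}(\cdot,y)|\cdot-y|^{\gamma-n}dy\right]^{1/q}\right\|_{M^\alpha_r(\mathbb{R}^n)}=\left[\frac{\kappa(q,n)}{\gamma}\right]^{1/q}\|\,|\nabla f|\,\|_{M^\alpha_r(\mathbb{R}^n)}$; (ii) if $\gamma\in(-\infty,0)$ and in addition either $n\ge2$ and $q\in(0,\frac{n-\gamma}{n}r)$, or $n=1$, $\gamma\in(-\infty,-1)$ and $q\in(0,-\gamma r)$,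 then $\lim_{\lambda\to0^+}\lambda\left\|\left[\int_{\mathbb{R}^n}\mathbf{1}_{E_{\lambda,\gamma/q}[f]}(\cdot,y)|\cdot-y|^{\gamma-n}dy\right]^{1/q}\right\|_{M^\alpha_r(\mathbb{R}^n)}=\left[-\frac{\kappa(q,n)}{\gamma}\right]^{1/q}\|\,|\nabla f|\,\|_{M^\alpha_r(\mathbb{R}^n)}$.
   Context: For $0<r\le\alpha<\infty$, the Morrey space $M^\alpha_r(\mathbb{R}^n)$ is the set of measurable $f$ on $\mathbb{R}^n$ with $\|f\|_{M^\alpha_r(\mathbb{R}^n)}:=\sup_B|B|^{\frac1\alpha-\frac1r}\|f\|_{L^r(B)}<\infty$, the supremum over all balls $B\subset\mathbb{R}^n$. For $\lambda>0$, $\beta\in\mathbb{R}$, $E_{\lambda,\beta}[f]:=\{(x,y):x\ne y,\ |f(x)-f(y)|/|x-y|^{1+\beta}>\lambda\}$. $\kappa(q,n):=\int_{\mathbb{S}^{n-1}}|e\cdot\omega|^q\,d\omega$, $e$ a unit vector. *)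

theory Defs
  imports "HOL-Analysis.Analysis"
begin

text \<open>Power of an extended nonnegative real by a POSITIVE real exponent
  (only used with positive exponents): infinity stays infinity.\<close>
definition epowr :: "ennreal \<Rightarrow> real \<Rightarrow> ennreal" where
  "epowr x p = (if x = \<infinity> then \<infinity> else ennreal (enn2real x powr p))"

definition morrey_norm :: "real \<Rightarrow> real \<Rightarrow> ('a::euclidean_space \<Rightarrow> ennreal) \<Rightarrow> ennreal" where
  "morrey_norm \<alpha> r F =
     (SUP xr \<in> UNIV \<times> {0<..}.
        ennreal (measure lebesgue (ball (fst xr) (snd xr)) powr (1/\<alpha> - 1/r)) *
        epowr (\<integral>\<^sup>+ y \<in> ball (fst xr) (snd xr). epowr (F y) r \<partial>lebesgue) (1/r))"

definition Eset :: "real \<Rightarrow> real \<Rightarrow> ('a::euclidean_space \<Rightarrow> real) \<Rightarrow> ('a \<times> 'a) set" where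
  "Eset lam \<beta> f = {(x, y). x \<noteq> y \<and> \<bar>f x - f y\<bar> / (dist x y powr (1 + \<beta>)) > lam}"

definition Efun :: "real \<Rightarrow> real \<Rightarrow> real \<Rightarrow> ('a::euclidean_space \<Rightarrow> real) \<Rightarrow> 'a \<Rightarrow> ennreal" where
  "Efun lam \<gamma> q f x =
     epowr (\<integral>\<^sup>+ y. indicator (Eset lam (\<gamma> / q) f) (x, y) *
                    ennreal (dist x y powr (\<gamma> - real DIM('a))) \<partial>lebesgue) (1/q)"

definition Qfun :: "real \<Rightarrow> real \<Rightarrow> real \<Rightarrow> real \<Rightarrow> ('a::euclidean_space \<Rightarrow> real) \<Rightarrow> real \<Rightarrow> ennreal" where
  "Qfun \<alpha> r \<gamma> q f lam = ennreal lam * morrey_norm \<alpha> r (Efun lam \<gamma> q f)"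

text \<open>kappa(q,n) = \<integral>_{S^{n-1}} |e.w|^q dsigma(w), with the surface measure on the
  unit sphere given by the polar-coordinates (cone) formula
  \<integral>_{S^{n-1}} g dsigma = n \<integral>_{B(0,1)} g(x/|x|) dx; e is a fixed unit (basis) vector.\<close>
definition kappa :: "real \<Rightarrow> 'a::euclidean_space itself \<Rightarrow> real" where
  "kappa q _ = real DIM('a) *
     (LINT x : ball (0::'a) 1 | lebesgue. \<bar>(SOME e. e \<in> (Basis::'a set)) \<bullet> (x /\<^sub>R norm x)\<bar> powr q)"

end

theory Submission
  imports Defs
begin

text \<open>Write \<open>g = |\<nabla>f|\<close> and \<open>\<beta> = \<gamma>/q\<close>.

  Upper bound. By scaling \<open>\<lambda> = 1\<close>. If \<open>|x - y| \<approx> 2^K\<close> and \<open>|f x - f y| > |x - y|^(1+\<beta>)\<close>, then telescoping the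
  averages of \<open>f\<close> over shrinking balls around \<open>x\<close> and \<open>y\<close> produces a \<open>j \<ge> 0\<close> such that the average of
  \<open>g^p\<close> over the ball of radius \<open>2^(K-j)\<close> around \<open>x\<close> or around \<open>y\<close> is at least
  \<open>c 2^(j \<eta> p) 2^(K \<beta> p)\<close>. The points \<open>y\<close> of the second kind are counted by Chebyshev's inequality,
  and the Sobolev condition \<open>n (1/p - 1/q) < 1\<close> makes all series in \<open>j\<close> converge. Thus the inner
  integral at \<open>x\<close> is dominated by a geometric superposition of the functions
  \<open>\<Sum>_K 2^(K \<gamma>) 1{average of (t g)^p over B(x, 2^K) is \<ge> 2^(K \<beta> p)}\<close>, and only for these a Morrey bound
  is needed. For \<open>r > 1\<close> one takes \<open>p < r\<close> and uses the maximal function; for \<open>p = r = 1\<close> and \<open>\<gamma> > 0\<close> the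
  disjoint maximal, for \<open>\<gamma> < -n\<close> the disjoint minimal, dyadic cubes with large average replace it.

  Limits. Rescaling by \<open>s = \<lambda>^(-q/\<gamma>) \<rightarrow> 0\<close> turns the inner integral into one whose integrand converges to
  that of the linear function \<open>h \<mapsto> \<nabla>f(x) \<bullet> h\<close>, which polar coordinates evaluate to
  \<open>\<kappa>(q,n) |\<nabla>f(x)|^q / |\<gamma>|\<close>. Fatou's lemma gives the lower estimate (hence also the lower bound in the
  equivalence), uniform continuity of the gradient the upper one for close points; for distant
  points the integrand vanishes (\<open>\<gamma> > 0\<close>) or is a fixed function in the Morrey space times \<open>\<lambda>\<close>
  (\<open>\<gamma> < 0\<close>), because \<open>f\<close> is constant near infinity, or at both ends if \<open>n = 1\<close>.\<close>

section \<open>Powers of extended nonnegative reals and sums over the integers\<close>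

text \<open>Since \<open>q\<close> and \<open>r / q\<close> may be smaller than 1, no step relies on
  a norm inequality. Sums are raised to powers by \<open>epowr_suminf_le\<close> and
  \<open>epowr_add_le\<close>; the weights of the former are harmless because every series decays
  geometrically. The obstacle in the upper bound is the second point \<open>y\<close>: an average
  centred at \<open>y\<close> does not control the same average at \<open>x\<close>. Chebyshev's
  inequality counts such \<open>y\<close> through the average at \<open>x\<close> of scale
  \<open>K + 1\<close>. Its power \<open>s \<le> 1\<close> balances two demands:
  \<open>s / q < 1 / p\<close> sums over the sizes of that average, and
  \<open>n (1/p - s/q) < \<eta>\<close> sums over the depths \<open>j\<close>, while
  \<open>\<eta> < 1\<close> is what the weights \<open>2^(-j)\<close> in the pointwise estimate of
  \<open>f\<close> tolerate. The Sobolev condition is equivalent to the existence of such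
  \<open>s\<close> and \<open>\<eta>\<close>. For \<open>r = 1\<close> the maximal operator is only
  of weak type, so the sum over scales needs its own integral bound. If \<open>\<gamma> > 0\<close>
  it is dominated by its largest weight; if \<open>\<gamma> < -n\<close>, heaviness passes to larger
  cells, and weight times cell volume decays with the scale.\<close>

lemma epowr_top [simp]: "epowr \<infinity> p = \<infinity>" "epowr top p = top"
  by (auto simp: epowr_def infinity_ennreal_def)

lemma epowr_ennreal: "0 \<le> a \<Longrightarrow> epowr (ennreal a) p = ennreal (a powr p)"
  by (simp add: epowr_def)

lemma epowr_0 [simp]: "epowr 0 p = 0"
  by (simp add: epowr_def)

lemma epowr_one [simp]: "epowr 1 p = 1"
  using epowr_ennreal[of 1 p] by simp

lemma epowr_1 [simp]: "epowr x 1 = x"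
  by (cases x) (auto simp: epowr_def)

lemma epowr_mono: "0 \<le> p \<Longrightarrow> x \<le> y \<Longrightarrow> epowr x p \<le> epowr y p"
  by (cases x; cases y) (auto simp: epowr_ennreal top_unique intro!: ennreal_leI powr_mono2)

lemma epowr_mult: "0 < p \<Longrightarrow> epowr (x * y) p = epowr x p * epowr y p"
proof (cases x; cases y)
  fix a b assume "x = ennreal a" "0 \<le> a" "y = ennreal b" "0 \<le> b"
  then show "epowr (x * y) p = epowr x p * epowr y p"
    by (simp add: ennreal_mult[symmetric] epowr_ennreal powr_mult)
next
  fix a assume "0 < p" "x = ennreal a" "0 \<le> a" "y = top"
  then show "epowr (x * y) p = epowr x p * epowr y p"
    by (cases "a = 0") (auto simp: epowr_ennreal ennreal_mult_top)
next
  fix a assume "0 < p" "y = ennreal a" "0 \<le> a" "x = top"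
  then show "epowr (x * y) p = epowr x p * epowr y p"
    by (cases "a = 0") (auto simp: epowr_ennreal ennreal_top_mult)
qed auto

lemma epowr_epowr: "epowr (epowr x p) p' = epowr x (p * p')"
  by (cases x) (auto simp: epowr_ennreal powr_powr)

lemma epowr_add: "epowr x (p + p') = epowr x p * epowr x p'"
  by (cases x) (auto simp: epowr_ennreal ennreal_mult[symmetric] powr_add)

lemma epowr_inverse: "0 < p \<Longrightarrow> epowr (epowr x p) (1/p) = x" "0 < p \<Longrightarrow> epowr (epowr x (1/p)) p = x"
  by (auto simp: epowr_epowr)

lemma epowr_le_iff: "0 < p \<Longrightarrow> epowr x p \<le> epowr y p \<longleftrightarrow> x \<le> y"
  using epowr_mono[of p x y] epowr_mono[of "1/p" "epowr x p" "epowr y p"] by (auto simp: epowr_inverse)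

lemma epowr_le_conv: "0 < p \<Longrightarrow> epowr x p \<le> y \<longleftrightarrow> x \<le> epowr y (1/p)"
  using epowr_le_iff[of p x "epowr y (1/p)"] by (simp add: epowr_inverse)

lemma epowr_eq_top [simp]: "epowr x p = top \<longleftrightarrow> x = top"
  by (cases x) (auto simp: epowr_ennreal)

lemma epowr_SUP:
  assumes "0 < p"
  shows "epowr (SUP i\<in>I. f i) p = (SUP i\<in>I. epowr (f i) p)"
proof (rule antisym)
  show "epowr (SUP i\<in>I. f i) p \<le> (SUP i\<in>I. epowr (f i) p)"
    using assms by (auto simp: epowr_le_conv intro!: SUP_least) (auto simp: epowr_le_conv[symmetric] intro: SUP_upper)
  show "(SUP i\<in>I. epowr (f i) p) \<le> epowr (SUP i\<in>I. f i) p"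
    using assms by (auto intro!: SUP_least epowr_mono SUP_upper)
qed

lemma measurable_epowr [measurable]: "(\<lambda>x. epowr x p) \<in> borel_measurable borel"
  unfolding epowr_def by measurable

lemma borel_measurable_epowr [measurable (raw)]:
  "f \<in> borel_measurable M \<Longrightarrow> (\<lambda>x. epowr (f x) p) \<in> borel_measurable M"
  by (rule measurable_compose[OF _ measurable_epowr])

lemma continuous_on_epowr: "0 < p \<Longrightarrow> continuous_on UNIV (\<lambda>x. epowr x p)"
proof (rule continuous_onI_mono)
  assume p: "0 < p"
  have "range (\<lambda>x. epowr x p) = UNIV"
    using p by (metis epowr_inverse(2) surj_def)
  then show "open ((\<lambda>x. epowr x p) ` UNIV)" by simp
qed (auto intro: epowr_mono)

text \<open>Substitute for Minkowski's inequality, with a constant arbitrarily close to 1 in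
  front of the main term.\<close>
lemma epowr_add_le:
  fixes e :: real
  assumes "0 < p" "0 < e"
  shows "epowr (a + b) p \<le> ennreal ((1 + e) powr p) * epowr a p + ennreal ((1 + 1/e) powr p) * epowr b p"
proof (cases "b \<le> ennreal e * a")
  \<comment> \<open>The smaller of \<open>b\<close> and \<open>e a\<close> decides which summand
    absorbs the other: here \<open>b\<close> goes into \<open>a\<close> at the cost of the factor
    \<open>1 + e\<close>, in the other case \<open>a\<close> goes into \<open>b\<close> at the cost
    of \<open>1 + 1/e\<close>.\<close>
  case True
  then have "a + b \<le> ennreal (1 + e) * a"
    using assms by (simp add: ennreal_plus distrib_right add_left_mono del: ennreal_plus[symmetric])
  then have "epowr (a + b) p \<le> epowr (ennreal (1 + e) * a) p"
    using assms by (intro epowr_mono) auto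
  also have "\<dots> = ennreal ((1 + e) powr p) * epowr a p"
    using assms by (simp add: epowr_mult epowr_ennreal del: ennreal_plus)
  finally show ?thesis by (rule order_trans) simp
next
  case False
  then have "ennreal (1/e) * (ennreal e * a) \<le> ennreal (1/e) * b"
    by (intro mult_left_mono) auto
  then have "a \<le> ennreal (1/e) * b"
    using assms by (simp add: mult.assoc[symmetric] ennreal_mult[symmetric])
  then have "a + b \<le> ennreal (1 + 1/e) * b"
    using assms by (simp add: ennreal_plus distrib_right add_mono add.commute del: ennreal_plus[symmetric])
  then have "epowr (a + b) p \<le> epowr (ennreal (1 + 1/e) * b) p"
    using assms by (intro epowr_mono) auto
  also have "\<dots> = ennreal ((1 + 1/e) powr p) * epowr b p"
    using assms by (simp add: epowr_mult epowr_ennreal del: ennreal_plus)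
  finally show ?thesis by (rule order_trans) simp
qed

lemma le_suminf_ennreal: "u j \<le> (\<Sum>j. u j :: ennreal)"
  using sum_le_suminf[of u "{j}"] by (auto simp: summableI)

text \<open>With \<open>\<rho>^t = \<sigma>\<close>, each \<open>u j\<close> is at most
  \<open>\<rho>^j\<close> times the supremum of all \<open>\<rho>^(-i) u i\<close>, so the sum is at
  most a geometric series times that supremum; powers commute with suprema, and a supremum is at
  most the sum. This covers \<open>t < 1\<close> and \<open>t \<ge> 1\<close> alike.\<close>

lemma epowr_suminf_le:
  assumes t: "0 < t" and s: "0 < \<sigma>" "\<sigma> < (1::real)"
  shows "\<exists>C>0. \<forall>u. epowr (\<Sum>j. u j) t \<le> ennreal C * (\<Sum>j. ennreal (\<sigma> powr - real j) * epowr (u j) t)"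
proof -
  define \<rho> where "\<rho> = \<sigma> powr (1/t)"
  have r: "0 < \<rho>" "\<rho> < 1" using s t powr_less_mono2[of "1/t" \<sigma> 1] by (auto simp: \<rho>_def)
  have rt: "\<rho> powr t = \<sigma>" using s t by (simp add: \<rho>_def powr_powr)
  show ?thesis
  proof (intro exI[of _ "(1/(1-\<rho>)) powr t"] conjI allI)
    show "0 < (1/(1-\<rho>)) powr t" using r by simp
    fix u :: "nat \<Rightarrow> ennreal"
    define s' where "s' = (SUP j. ennreal (\<rho> powr - real j) * u j)"
    have u: "u j \<le> ennreal (\<rho> ^ j) * s'" for j
    proof -
      have "ennreal (\<rho> ^ j) * (ennreal (\<rho> powr - real j) * u j) \<le> ennreal (\<rho> ^ j) * s'"
        unfolding s'_def by (intro mult_left_mono SUP_upper) auto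
      moreover have "ennreal (\<rho> ^ j) * (ennreal (\<rho> powr - real j) * u j) = u j"
        using r by (simp add: mult.assoc[symmetric] ennreal_mult[symmetric] powr_realpow[symmetric] powr_add[symmetric])
      ultimately show ?thesis by simp
    qed
    have "(\<Sum>j. u j) \<le> (\<Sum>j. ennreal (\<rho> ^ j) * s')"
      by (intro suminf_le u) auto
    also have "\<dots> = (\<Sum>j. ennreal (\<rho> ^ j)) * s'" by simp
    also have "(\<Sum>j. ennreal (\<rho> ^ j)) = ennreal (1/(1-\<rho>))"
      using r by (intro suminf_ennreal_eq) (auto intro!: geometric_sums)
    finally have "epowr (\<Sum>j. u j) t \<le> epowr (ennreal (1/(1-\<rho>)) * s') t"
      using t by (intro epowr_mono) auto
    also have "\<dots> = ennreal ((1/(1-\<rho>)) powr t) * epowr s' t"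
      using t r by (simp add: epowr_mult epowr_ennreal)
    also have "\<dots> \<le> ennreal ((1/(1-\<rho>)) powr t) * (\<Sum>j. ennreal (\<sigma> powr - real j) * epowr (u j) t)"
    proof (rule mult_left_mono)
    have "epowr s' t = (SUP j. epowr (ennreal (\<rho> powr - real j) * u j) t)"
      unfolding s'_def using t by (rule epowr_SUP)
    also have "\<dots> = (SUP j. ennreal (\<sigma> powr - real j) * epowr (u j) t)"
    proof -
      have "\<sigma> powr - real j = \<rho> powr - (t * real j)" for j
        using rt[symmetric] by (simp add: powr_powr)
      then show ?thesis using t by (simp add: epowr_mult epowr_ennreal powr_powr mult.commute[of _ t])
    qed
    also have "\<dots> \<le> (\<Sum>j. ennreal (\<sigma> powr - real j) * epowr (u j) t)"
      by (intro SUP_least le_suminf_ennreal)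
    finally show "epowr s' t \<le> (\<Sum>j. ennreal (\<sigma> powr - real j) * epowr (u j) t)" .
    qed simp
    finally show "epowr (\<Sum>j. u j) t \<le> ennreal ((1/(1-\<rho>)) powr t) * (\<Sum>j. ennreal (\<sigma> powr - real j) * epowr (u j) t)" .
  qed
qed

text \<open>Sums over all integer scales are integrals for the counting measure, so that
  monotonicity, Tonelli's theorem and substitution are available as rules for
  \<open>nn_integral\<close>.\<close>

abbreviation isum :: "(int \<Rightarrow> ennreal) \<Rightarrow> ennreal" (binder "\<Sum>\<^sub>Z" 10) where
  "isum f \<equiv> \<integral>\<^sup>+K. f K \<partial>count_space UNIV"

lemma isum_uminus: "(\<Sum>\<^sub>ZK. f (- K)) = isum f"
  by (rule nn_integral_bij_count_space[where g=uminus]) (auto intro!: bij_betwI[of _ _ _ uminus])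

lemma isum_ge: "f K \<le> isum f"
  by (rule nn_integral_ge_point) simp

lemma isum_atMost_eq: 
  "(\<Sum>\<^sub>ZK. if K \<le> K0 then f K else 0) = (\<Sum>j. f (K0 - int j))"
proof -
  have "(\<Sum>\<^sub>ZK. if K \<le> K0 then f K else 0) = (\<integral>\<^sup>+K. f K * indicator {..K0} K \<partial>count_space UNIV)"
    by (intro nn_integral_cong) auto
  also have "\<dots> = (\<integral>\<^sup>+K. f K \<partial>count_space {..K0})"
    by (subst nn_integral_count_space_indicator) (auto simp: )
  also have "\<dots> = (\<integral>\<^sup>+j. f (K0 - int j) \<partial>count_space UNIV)"
    by (rule nn_integral_bij_count_space[symmetric]) 
      (auto intro!: bij_betwI[of _ _ _ "\<lambda>K. nat (K0 - K)"])
  finally show ?thesis by (simp add: nn_integral_count_space_nat)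
qed

text \<open>The sum of the series \<open>2^(-j \<bar>a\<bar>)\<close> over natural \<open>j\<close>,
  for \<open>a\<close> different from 0. The absolute value lets one constant serve increasing and
  decreasing progressions.\<close>

definition geoC :: "real \<Rightarrow> real" where "geoC a = 1 / (1 - 2 powr - \<bar>a\<bar>)"

lemma geoC_pos: "a \<noteq> 0 \<Longrightarrow> 0 < geoC a"
  unfolding geoC_def using powr_less_one[of 2 "- \<bar>a\<bar>"] by (auto simp: powr_less_one)

text \<open>The admissible terms form a geometric progression whose largest member, at
  \<open>K0\<close>, is itself at most \<open>z\<close>.\<close>

lemma isum_geometric_pos:
  assumes "0 < a"
  shows "(\<Sum>\<^sub>ZK. if ennreal (2 powr (of_int K * a)) \<le> z then ennreal (2 powr (of_int K * a)) else 0) \<le> ennreal (geoC a) * z"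
proof (cases z)
  case top
  then show ?thesis using geoC_pos[of a] assms by (auto simp: ennreal_mult_top)
next
  case (real x)
  show ?thesis
  proof (cases "x = 0")
    case True with real show ?thesis by auto
  next
    case False
    with real have x: "0 < x" by simp
    define K0 where "K0 = \<lfloor>log 2 x / a\<rfloor>"
    have K0: "2 powr (of_int K * a) \<le> x \<longleftrightarrow> K \<le> K0" for K :: int
    proof -
      have "2 powr (of_int K * a) \<le> x \<longleftrightarrow> of_int K * a \<le> log 2 x"
        using x by (simp add: le_log_iff)
      also have "\<dots> \<longleftrightarrow> of_int K \<le> log 2 x / a" using assms by (simp add: field_simps)
      also have "\<dots> \<longleftrightarrow> K \<le> K0" by (simp add: K0_def le_floor_iff)
      finally show ?thesis .
    qed
    define \<rho> where "\<rho> = 2 powr - a"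
    have r: "0 < \<rho>" "\<rho> < 1" using assms by (auto simp: \<rho>_def powr_less_one)
    have "(\<Sum>\<^sub>ZK. if ennreal (2 powr (of_int K * a)) \<le> z then ennreal (2 powr (of_int K * a)) else 0)
        = (\<Sum>\<^sub>ZK. if K \<le> K0 then ennreal (2 powr (of_int K * a)) else 0)"
      using real K0 by (intro nn_integral_cong) (auto simp: ennreal_le_iff)
    also have "\<dots> = (\<Sum>j. ennreal (2 powr (of_int (K0 - int j) * a)))"
      by (rule isum_atMost_eq)
    also have "\<dots> = (\<Sum>j. ennreal (2 powr (of_int K0 * a) * \<rho> ^ j))"
      using r by (intro suminf_cong) 
        (simp add: \<rho>_def powr_realpow[symmetric] powr_powr powr_add[symmetric] algebra_simps)
    also have "\<dots> = ennreal (2 powr (of_int K0 * a) * (1/(1-\<rho>)))"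
      using r by (intro suminf_ennreal_eq sums_mult geometric_sums) auto
    also have "\<dots> \<le> ennreal (x * (1/(1-\<rho>)))"
      using K0[of K0] r by (intro ennreal_leI mult_right_mono) auto
    also have "\<dots> = ennreal (geoC a) * z"
      using real r assms by (simp add: geoC_def \<rho>_def ennreal_mult[symmetric] mult.commute)
    finally show ?thesis .
  qed
qed

lemma isum_geometric:
  assumes "a \<noteq> 0"
  shows "(\<Sum>\<^sub>ZK. if ennreal (2 powr (of_int K * a)) \<le> z then ennreal (2 powr (of_int K * a)) else 0) \<le> ennreal (geoC a) * z"
proof (cases "0 < a")
  case True then show ?thesis by (rule isum_geometric_pos)
next
  case False
  with assms have a: "0 < - a" by simp
  have "(\<Sum>\<^sub>ZK. if ennreal (2 powr (of_int K * a)) \<le> z then ennreal (2 powr (of_int K * a)) else 0)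
     = (\<Sum>\<^sub>ZK. if ennreal (2 powr (of_int K * - a)) \<le> z then ennreal (2 powr (of_int K * - a)) else 0)"
    by (subst isum_uminus[symmetric]) (simp cong: if_cong)
  with isum_geometric_pos[OF a, of z] show ?thesis by (simp add: geoC_def)
qed

lemma isum_geometric_le:
  assumes "a \<noteq> 0" "\<And>K. Q K \<Longrightarrow> ennreal (2 powr (of_int K * a)) \<le> z"
  shows "(\<Sum>\<^sub>ZK. if Q K then ennreal (2 powr (of_int K * a)) else 0) \<le> ennreal (geoC a) * z"
  by (rule order_trans[OF nn_integral_mono isum_geometric[OF assms(1), of z]]) (use assms(2) in auto)

lemma borel_measurable_isum [measurable (raw)]:
  assumes "\<And>K. f K \<in> borel_measurable M"
  shows "(\<lambda>x. \<Sum>\<^sub>ZK. f K x) \<in> borel_measurable M"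
proof -
  have "(\<Sum>\<^sub>ZK. f K x) = (\<Sum>j. f (from_nat_into UNIV j) x)" for x
  proof -
    have "(\<integral>\<^sup>+j. f (from_nat_into UNIV j) x \<partial>count_space (UNIV::nat set)) = (\<Sum>\<^sub>ZK. f K x)"
      by (rule nn_integral_bij_count_space) (auto intro!: bij_betw_from_nat_into infinite_UNIV_int)
    then show ?thesis by (simp add: nn_integral_count_space_nat)
  qed
  then show ?thesis using assms by simp
qed

lemma nn_integral_isum:
  assumes "\<And>K. f K \<in> borel_measurable M"
  shows "(\<integral>\<^sup>+x. (\<Sum>\<^sub>ZK. f K x) \<partial>M) = (\<Sum>\<^sub>ZK. \<integral>\<^sup>+x. f K x \<partial>M)"
  by (rule nn_integral_count_space_nn_integral) (auto simp: assms)

lemma isum_cmult: "(\<Sum>\<^sub>ZK. c * f K) = c * isum f"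
  by (rule nn_integral_cmult) simp

lemma isum_mono: "(\<And>K. f K \<le> g K) \<Longrightarrow> isum f \<le> isum g"
  by (intro nn_integral_mono) auto

lemma isum_swap: "(\<Sum>\<^sub>ZK. \<Sum>\<^sub>ZK'. f K K') = (\<Sum>\<^sub>ZK'. \<Sum>\<^sub>ZK. f K K')"
  by (rule nn_integral_isum) simp

lemma isum_shift: "(\<Sum>\<^sub>ZK. f (K + c)) = isum f"
  by (rule nn_integral_bij_count_space[where g="\<lambda>K. K + c"]) (auto intro!: bij_betwI[of _ _ _ "\<lambda>K. K - c"])

lemma isum_suminf: "(\<Sum>\<^sub>ZK. \<Sum>j. f K j) = (\<Sum>j. \<Sum>\<^sub>ZK. f K j)"
  by (rule nn_integral_suminf) simp

section \<open>Dyadic cells and heavy cells\<close>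

lemma nn_integral_lborel_affine:
  fixes t :: "'a::euclidean_space"
  assumes [measurable]: "f \<in> borel_measurable borel" and "c \<noteq> 0"
  shows "(\<integral>\<^sup>+x. f x \<partial>lborel) = ennreal (\<bar>c\<bar> ^ DIM('a)) * (\<integral>\<^sup>+x. f (t + c *\<^sub>R x) \<partial>lborel)"
  by (subst lborel_affine[OF assms(2), of t]) (simp add: nn_integral_density nn_integral_distr nn_integral_cmult)

lemma nn_integral_lborel_shift:
  fixes t :: "'a::euclidean_space"
  assumes "f \<in> borel_measurable borel"
  shows "(\<integral>\<^sup>+x. f (t + x) \<partial>lborel) = (\<integral>\<^sup>+x. f x \<partial>lborel)"
  using nn_integral_lborel_affine[OF assms, of 1 t] by simp

lemma nn_integral_lborel_reflect:
  fixes t :: "'a::euclidean_space"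
  assumes "f \<in> borel_measurable borel"
  shows "(\<integral>\<^sup>+x. f (t - x) \<partial>lborel) = (\<integral>\<^sup>+x. f x \<partial>lborel)"
  using nn_integral_lborel_affine[OF assms, of "-1" t] by simp

definition Bvol :: "'a::euclidean_space itself \<Rightarrow> real" where
  "Bvol _ = measure lborel (ball (0::'a) 1)"

lemma Bvol_pos: "0 < Bvol TYPE('a::euclidean_space)"
  unfolding Bvol_def using content_ball_pos[of 1 "0::'a"] by simp

lemma emeasure_lborel_ball_Bvol:
  assumes "0 \<le> \<rho>"
  shows "emeasure lborel (ball (x::'a::euclidean_space) \<rho>) = ennreal (Bvol TYPE('a) * \<rho> ^ DIM('a))"
proof -
  have "emeasure lborel (ball x \<rho>) \<noteq> top" using emeasure_lborel_ball_finite[of x \<rho>] by auto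
  then show ?thesis using content_ball_conv_unit_ball[OF assms, of x]
    by (simp add: Bvol_def emeasure_eq_ennreal_measure mult.commute)
qed

lemma measure_lebesgue_ball_Bvol:
  "0 \<le> \<rho> \<Longrightarrow> measure lebesgue (ball (x::'a::euclidean_space) \<rho>) = Bvol TYPE('a) * \<rho> ^ DIM('a)"
  using content_ball_conv_unit_ball[of \<rho> x] by (simp add: Bvol_def mult.commute)

lemma nn_integral_ball_const:
  assumes "0 \<le> \<rho>"
  shows "(\<integral>\<^sup>+y. (if dist (x::'a::euclidean_space) y < \<rho> then c else 0) \<partial>lborel) = c * ennreal (Bvol TYPE('a) * \<rho> ^ DIM('a))"
proof -
  have "(\<integral>\<^sup>+y. (if dist x y < \<rho> then c else 0) \<partial>lborel) = (\<integral>\<^sup>+y. c * indicator (ball x \<rho>) y \<partial>lborel)"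
    by (intro nn_integral_cong) auto
  then show ?thesis by (simp add: nn_integral_cmult_indicator emeasure_lborel_ball_Bvol[OF assms])
qed

text \<open>Normalised by \<open>2^(K n)\<close>, not by the volume of the ball.\<close>

definition Pav :: "int \<Rightarrow> ('a::euclidean_space \<Rightarrow> ennreal) \<Rightarrow> 'a \<Rightarrow> ennreal" where
  "Pav K h x = ennreal (2 powr - (of_int K * real DIM('a))) *
     (\<integral>\<^sup>+y. (if dist x y < 2 powr of_int K then h y else 0) \<partial>lborel)"

lemma borel_measurable_Pav [measurable (raw)]:
  assumes [measurable]: "h \<in> borel_measurable borel" "f \<in> borel_measurable M"
  shows "(\<lambda>x. Pav K h (f x)) \<in> borel_measurable M"
proof -
  have "Pav K h \<in> borel_measurable borel"
    unfolding Pav_def by measurable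
  from measurable_compose[OF assms(2) this] show ?thesis .
qed

lemma Pav_mono: "(\<And>y. dist x y < 2 powr of_int K \<Longrightarrow> h y \<le> h' y) \<Longrightarrow> Pav K h x \<le> Pav K h' x"
  unfolding Pav_def by (intro mult_left_mono nn_integral_mono) auto

text \<open>The half-open dyadic cubes of side \<open>2^K\<close>, encoded as an equivalence
  relation on points. No index set of cubes and no choice of representatives is then needed, and
  measurability in both points is immediate.\<close>

definition samecell :: "int \<Rightarrow> 'a::euclidean_space \<Rightarrow> 'a \<Rightarrow> bool" where
  "samecell K x y \<longleftrightarrow> (\<forall>b\<in>Basis. \<lfloor>2 powr - of_int K * (x \<bullet> b)\<rfloor> = \<lfloor>2 powr - of_int K * (y \<bullet> b)\<rfloor>)"

lemma samecell_refl [simp]: "samecell K x x"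
  and samecell_sym: "samecell K x y \<Longrightarrow> samecell K y x"
  and samecell_trans: "samecell K x y \<Longrightarrow> samecell K y z \<Longrightarrow> samecell K x z"
  by (auto simp: samecell_def)

lemma samecell_commute: "samecell K x y \<longleftrightarrow> samecell K y x"
  by (auto simp: samecell_def)

text \<open>Dyadic cubes are nested, because the cell index at scale \<open>K + m\<close> is the
  integer quotient of the index at scale \<open>K\<close> by \<open>2^m\<close>.\<close>

lemma samecell_mono:
  assumes "K \<le> K'" "samecell K x y"
  shows "samecell K' x y"
proof -
  define m where "m = nat (K' - K)"
  have K': "of_int K' = (of_int K + real m :: real)" using assms by (simp add: m_def)
  have *: "\<lfloor>2 powr - of_int K' * a\<rfloor> = \<lfloor>2 powr - of_int K * a\<rfloor> div 2 ^ m" for a :: real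
  proof -
    have "2 powr - of_int K' * a = (2 powr - of_int K * a) / of_int (2 ^ m)"
      unfolding K' by (simp add: powr_add powr_minus powr_realpow field_simps powr_diff)
    then show ?thesis by (simp only: floor_divide_real_eq_div zero_le_power zero_le_numeral)
  qed
  show ?thesis using assms(2) unfolding samecell_def * by auto
qed

lemma pred_samecell' [measurable (raw)]:
  assumes [measurable]: "f \<in> borel_measurable M" "g \<in> borel_measurable M"
  shows "Measurable.pred M (\<lambda>x. samecell K (f x) (g x))"
  unfolding samecell_def by measurable

text \<open>A half-open cube lies between the open and the closed box with corners \<open>l\<close>
  and \<open>u\<close>, and both boxes have the same volume.\<close>

lemma emeasure_cell:
  "emeasure lborel {y. samecell K (x::'a::euclidean_space) y} = ennreal (2 powr (of_int K * real DIM('a)))"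
proof -
  define l where "l = (\<Sum>b\<in>Basis. (2 powr of_int K * of_int \<lfloor>2 powr - of_int K * (x \<bullet> b)\<rfloor>) *\<^sub>R b)"
  define u where "u = l + (\<Sum>b\<in>Basis. (2 powr of_int K) *\<^sub>R (b::'a))"
  have l: "l \<bullet> b = 2 powr of_int K * of_int \<lfloor>2 powr - of_int K * (x \<bullet> b)\<rfloor>" if "b \<in> Basis" for b
    using that by (simp add: l_def)
  have u: "u \<bullet> b = l \<bullet> b + 2 powr of_int K" if "b \<in> Basis" for b
    using that by (simp add: u_def inner_add_left)
  have cell: "samecell K x y \<longleftrightarrow> (\<forall>b\<in>Basis. l \<bullet> b \<le> y \<bullet> b \<and> y \<bullet> b < u \<bullet> b)" for y
  proof -
    have "\<lfloor>2 powr - of_int K * (x \<bullet> b)\<rfloor> = \<lfloor>2 powr - of_int K * (y \<bullet> b)\<rfloor> \<longleftrightarrow> l \<bullet> b \<le> y \<bullet> b \<and> y \<bullet> b < u \<bullet> b"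
      if b: "b \<in> Basis" for b
    proof -
      have "\<lfloor>2 powr - of_int K * (y \<bullet> b)\<rfloor> = i \<longleftrightarrow> 2 powr of_int K * of_int i \<le> y \<bullet> b \<and> y \<bullet> b < 2 powr of_int K * of_int i + 2 powr of_int K" for i
        by (simp add: floor_eq_iff powr_minus field_simps)
      then show ?thesis unfolding u[OF b] l[OF b] by metis
    qed
    then show ?thesis by (auto simp: samecell_def)
  qed
  have vol: "(\<Prod>b\<in>Basis. (u - l) \<bullet> b) = 2 powr (of_int K * real DIM('a))"
    by (simp add: inner_diff_left u powr_powr[symmetric] powr_realpow)
  have le: "\<And>b. b \<in> Basis \<Longrightarrow> l \<bullet> b \<le> u \<bullet> b" by (simp add: u)
  have "emeasure lborel (box l u) \<le> emeasure lborel {y. samecell K x y}"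
    by (intro emeasure_mono) (auto simp: cell mem_box intro: less_imp_le)
  moreover have "emeasure lborel {y. samecell K x y} \<le> emeasure lborel (cbox l u)"
    by (intro emeasure_mono) (auto simp: cell mem_box less_imp_le)
  ultimately show ?thesis
    using le vol by (simp add: emeasure_lborel_box_eq emeasure_lborel_cbox_eq)
qed

lemma nn_integral_cell_const:
  "(\<integral>\<^sup>+y. (if samecell K x y then c else 0) \<partial>lborel) = c * ennreal (2 powr (of_int K * real DIM('a)))"
  for x :: "'a::euclidean_space"
proof -
  have "(\<integral>\<^sup>+y. (if samecell K x y then c else 0) \<partial>lborel) = (\<integral>\<^sup>+y. c * indicator {y. samecell K x y} y \<partial>lborel)"
    by (intro nn_integral_cong) auto
  then show ?thesis by (simp add: nn_integral_cmult_indicator emeasure_cell)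
qed

lemma ennreal_powr_cancel [simp]:
  "ennreal (2 powr - a) * ennreal (2 powr a) = 1" "ennreal (2 powr a) * ennreal (2 powr - a) = 1"
  by (auto simp: ennreal_mult[symmetric] powr_add[symmetric])

lemma isum_unique_le:
  assumes "\<And>K K'. Q K \<Longrightarrow> Q K' \<Longrightarrow> K = K'"
  shows "(\<Sum>\<^sub>ZK. if Q K then c else 0) \<le> c"
proof (cases "\<exists>K. Q K")
  case True
  then obtain K0 where "Q K0" by auto
  then have "(\<Sum>\<^sub>ZK. if Q K then c else 0) = (\<integral>\<^sup>+K. c * indicator {K0} K \<partial>count_space UNIV)"
    using assms by (intro nn_integral_cong) (auto simp: indicator_def)
  then show ?thesis by (simp add: nn_integral_cmult_indicator)
qed auto

text \<open>The predicate \<open>Sel K\<close> marks a union of cells of scale \<open>K\<close>, and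
  by \<open>uniq\<close> all marked cells are pairwise disjoint. Integrating over \<open>z\<close>,
  with weight 1 over the cell volume, counts every marked cell once, so the left side is the
  integral of \<open>h\<close> over the union of the marked cells.\<close>

lemma nn_integral_selected_cells_le:
  fixes h :: "'a::euclidean_space \<Rightarrow> ennreal"
  assumes [measurable]: "h \<in> borel_measurable borel" "\<And>K. Measurable.pred borel (Sel K)"
    and inv: "\<And>K z z'. samecell K z z' \<Longrightarrow> Sel K z \<Longrightarrow> Sel K z'"
    and uniq: "\<And>K K' v. Sel K v \<Longrightarrow> Sel K' v \<Longrightarrow> K = K'"
  shows "(\<Sum>\<^sub>ZK. \<integral>\<^sup>+z. (if Sel K z then ennreal (2 powr - (of_int K * real DIM('a))) *
            (\<integral>\<^sup>+v. (if samecell K z v then h v else 0) \<partial>lborel) else 0) \<partial>lborel) \<le> (\<integral>\<^sup>+v. h v \<partial>lborel)"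
proof -
  have *: "(\<integral>\<^sup>+z. (if Sel K z then ennreal (2 powr - (of_int K * real DIM('a))) *
            (\<integral>\<^sup>+v. (if samecell K z v then h v else 0) \<partial>lborel) else 0) \<partial>lborel)
     = (\<integral>\<^sup>+v. (if Sel K v then h v else 0) \<partial>lborel)" for K
  proof -
    have "(\<integral>\<^sup>+z. (if Sel K z then ennreal (2 powr - (of_int K * real DIM('a))) *
            (\<integral>\<^sup>+v. (if samecell K z v then h v else 0) \<partial>lborel) else 0) \<partial>lborel)
      = (\<integral>\<^sup>+z. (\<integral>\<^sup>+v. (if Sel K z \<and> samecell K z v then ennreal (2 powr - (of_int K * real DIM('a))) * h v else 0) \<partial>lborel) \<partial>lborel)"
      by (subst nn_integral_cmult[symmetric], measurable) (auto intro!: nn_integral_cong)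
    also have "\<dots> = (\<integral>\<^sup>+v. (\<integral>\<^sup>+z. (if Sel K z \<and> samecell K z v then ennreal (2 powr - (of_int K * real DIM('a))) * h v else 0) \<partial>lborel) \<partial>lborel)"
      by (rule lborel_pair.Fubini') measurable
    also have "\<dots> = (\<integral>\<^sup>+v. (if Sel K v then h v else 0) \<partial>lborel)"
    proof (intro nn_integral_cong)
      fix v
      have "(\<integral>\<^sup>+z. (if Sel K z \<and> samecell K z v then ennreal (2 powr - (of_int K * real DIM('a))) * h v else 0) \<partial>lborel)
        = (\<integral>\<^sup>+z. (if samecell K v z then (if Sel K v then ennreal (2 powr - (of_int K * real DIM('a))) * h v else 0) else 0) \<partial>lborel)"
        using inv[of K] by (intro nn_integral_cong) (auto simp: samecell_commute)
      also have "\<dots> = (if Sel K v then h v else 0)"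
        unfolding nn_integral_cell_const by (auto simp: mult_ac)
      finally show "(\<integral>\<^sup>+z. (if Sel K z \<and> samecell K z v then ennreal (2 powr - (of_int K * real DIM('a))) * h v else 0) \<partial>lborel)
        = (if Sel K v then h v else 0)" .
    qed
    finally show ?thesis .
  qed
  have "(\<Sum>\<^sub>ZK. \<integral>\<^sup>+v. (if Sel K v then h v else 0) \<partial>lborel) = (\<integral>\<^sup>+v. (\<Sum>\<^sub>ZK. if Sel K v then h v else 0) \<partial>lborel)"
    by (rule nn_integral_isum[symmetric]) measurable
  also have "\<dots> \<le> (\<integral>\<^sup>+v. h v \<partial>lborel)"
    by (intro nn_integral_mono isum_unique_le uniq)
  finally show ?thesis unfolding * .
qed

text \<open>Vectors with coordinates in {-1,0,1}: a ball of radius \<open>2^K\<close> is covered by the cells of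
  scale \<open>K\<close> around its centre shifted by \<open>2^K\<close> times these vectors.\<close>
definition offsets :: "'a::euclidean_space set" where
  "offsets = {e. \<forall>b\<in>Basis. e \<bullet> b \<in> {-1, 0, 1}}"

lemma finite_offsets: "finite (offsets :: 'a::euclidean_space set)"
proof (rule finite_subset)
  show "(offsets :: 'a set) \<subseteq> (\<lambda>f. \<Sum>b\<in>Basis. f b *\<^sub>R b) ` (Basis \<rightarrow>\<^sub>E {-1, 0, 1})"
  proof
    fix e :: 'a assume e: "e \<in> offsets"
    have "e = (\<Sum>b\<in>Basis. restrict (\<lambda>b. e \<bullet> b) Basis b *\<^sub>R b)"
      by (simp add: euclidean_representation)
    moreover have "restrict (\<lambda>b. e \<bullet> b) Basis \<in> Basis \<rightarrow>\<^sub>E {-1, 0, 1}"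
      using e by (auto simp: offsets_def)
    ultimately show "e \<in> (\<lambda>f. \<Sum>b\<in>Basis. f b *\<^sub>R b) ` (Basis \<rightarrow>\<^sub>E {-1, 0, 1})" by blast
  qed
qed (auto intro!: finite_imageI finite_PiE)

lemma card_offsets_pos: "0 < card (offsets :: 'a::euclidean_space set)"
  using finite_offsets[where 'a='a] by (auto simp: card_gt_0_iff offsets_def intro: exI[of _ 0])

lemma norm_offsets: "e \<in> offsets \<Longrightarrow> norm (e::'a::euclidean_space) \<le> DIM('a)"
  using norm_le_l1[of e] sum_mono[of Basis "\<lambda>b. \<bar>e \<bullet> b\<bar>" "\<lambda>_. 1"] by (force simp: offsets_def)

text \<open>Each coordinate of \<open>y\<close> differs from that of \<open>x\<close> by less than
  \<open>2^K\<close>, so the cell indices differ by -1, 0 or 1. Moving \<open>x\<close> by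
  \<open>2^K\<close> times this difference of indices changes the indices by exactly that
  amount.\<close>

lemma ball_covered_by_offset_cells:
  assumes "dist x y < 2 powr of_int K"
  shows "\<exists>e\<in>offsets. samecell K (x + (2 powr of_int K) *\<^sub>R e) (y::'a::euclidean_space)"
proof -
  define d where "d b = \<lfloor>2 powr - of_int K * (y \<bullet> b)\<rfloor> - \<lfloor>2 powr - of_int K * (x \<bullet> b)\<rfloor>" for b
  have d: "d b \<in> {-1, 0, 1}" if "b \<in> Basis" for b
  proof -
    have "\<bar>(y - x) \<bullet> b\<bar> < 2 powr of_int K"
      using Basis_le_norm[OF that, of "y - x"] assms by (simp add: dist_norm norm_minus_commute)
    then have "\<bar>2 powr - of_int K * (y \<bullet> b) - 2 powr - of_int K * (x \<bullet> b)\<bar> < 1"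
      by (simp add: inner_diff_left right_diff_distrib[symmetric] abs_mult powr_minus field_simps)
    then show ?thesis unfolding d_def by (simp, linarith)
  qed
  define e where "e = (\<Sum>b\<in>Basis. of_int (d b) *\<^sub>R b)"
  have eb: "e \<bullet> b = of_int (d b)" if "b \<in> Basis" for b using that by (simp add: e_def)
  have "e \<in> offsets" using d by (fastforce simp: offsets_def eb)
  moreover have "samecell K (x + (2 powr of_int K) *\<^sub>R e) y"
    unfolding samecell_def
  proof
    fix b :: 'a assume b: "b \<in> Basis"
    have "2 powr - of_int K * ((x + (2 powr of_int K) *\<^sub>R e) \<bullet> b) = 2 powr - of_int K * (x \<bullet> b) + of_int (d b)"
      by (simp add: inner_add_left eb[OF b] distrib_left powr_minus)
    then show "\<lfloor>2 powr - of_int K * ((x + (2 powr of_int K) *\<^sub>R e) \<bullet> b)\<rfloor> = \<lfloor>2 powr - of_int K * (y \<bullet> b)\<rfloor>"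
      by (simp add: d_def)
  qed
  ultimately show ?thesis by blast
qed

lemma dist_samecell_le:
  assumes "samecell K x (y::'a::euclidean_space)"
  shows "dist x y \<le> DIM('a) * 2 powr of_int K"
proof -
  have "\<bar>(x - y) \<bullet> b\<bar> \<le> 2 powr of_int K" if "b \<in> Basis" for b
  proof -
    have "\<lfloor>2 powr - of_int K * (x \<bullet> b)\<rfloor> = \<lfloor>2 powr - of_int K * (y \<bullet> b)\<rfloor>"
      using assms that by (auto simp: samecell_def)
    then have "\<bar>2 powr - of_int K * (x \<bullet> b) - 2 powr - of_int K * (y \<bullet> b)\<bar> \<le> 1" by linarith
    then show ?thesis
      by (simp add: inner_diff_left right_diff_distrib[symmetric] abs_mult powr_minus field_simps)
  qed
  then have "(\<Sum>b\<in>Basis. \<bar>(x - y) \<bullet> b\<bar>) \<le> DIM('a) * 2 powr of_int K"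
    by (intro sum_bounded_above)
  with norm_le_l1[of "x - y"] show ?thesis by (simp add: dist_norm)
qed

text \<open>The cell average of \<open>h\<close> is at least \<open>w K\<close> up to the number of
  offsets. This loss is what a ball average costs when the ball is replaced by the best of its
  covering cells; the inequality is kept in multiplied form to avoid division in
  \<open>ennreal\<close>.\<close>

definition heavy :: "('a::euclidean_space \<Rightarrow> ennreal) \<Rightarrow> (int \<Rightarrow> real) \<Rightarrow> int \<Rightarrow> 'a \<Rightarrow> bool" where
  "heavy h w K z \<longleftrightarrow> ennreal (w K * 2 powr (of_int K * real DIM('a)))
     \<le> of_nat (card (offsets :: 'a set)) * (\<integral>\<^sup>+v. (if samecell K z v then h v else 0) \<partial>lborel)"

lemma heavy_samecell: "samecell K z z' \<Longrightarrow> heavy h w K z \<longleftrightarrow> heavy h w K z'"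
proof -
  assume s: "samecell K z z'"
  then have "samecell K z v = samecell K z' v" for v
    by (meson samecell_sym samecell_trans)
  then show ?thesis by (simp add: heavy_def)
qed

lemma pred_heavy [measurable (raw)]:
  assumes [measurable]: "h \<in> borel_measurable borel" "f \<in> borel_measurable M"
  shows "Measurable.pred M (\<lambda>x. heavy h w K (f x))"
proof -
  have "Measurable.pred borel (\<lambda>z. heavy h w K z)"
    unfolding heavy_def by measurable
  from measurable_compose[OF assms(2) this] show ?thesis .
qed

text \<open>Pigeonhole: the offset cells cover the ball, so the one with the largest integral
  carries at least the fraction \<open>1 / ?M\<close> of the integral over the ball.\<close>

lemma Pav_ge_imp_heavy:
  fixes h :: "'a::euclidean_space \<Rightarrow> ennreal"
  assumes [measurable]: "h \<in> borel_measurable borel" and "0 < w K" "ennreal (w K) \<le> Pav K h x"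
  shows "\<exists>e\<in>offsets. heavy h w K (x + (2 powr of_int K) *\<^sub>R e)"
proof (rule ccontr)
  let ?M = "card (offsets :: 'a set)"
  let ?I = "\<lambda>e. \<integral>\<^sup>+v. (if samecell K (x + (2 powr of_int K) *\<^sub>R e) v then h v else 0) \<partial>lborel"
  assume "\<not> ?thesis"
  then have lt: "of_nat ?M * ?I e < ennreal (w K * 2 powr (of_int K * real DIM('a)))" if "e \<in> offsets" for e
    using that by (auto simp: heavy_def not_le)
  have ne: "?I ` offsets \<noteq> {}" using card_offsets_pos[where 'a='a] by (auto simp: card_gt_0_iff)
  have fin: "finite (?I ` offsets)" using finite_offsets by blast
  obtain e0 where e0: "e0 \<in> offsets" "?I e0 = Max (?I ` offsets)"
    using Max_in[OF fin ne] by auto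
  have "(\<Sum>e\<in>offsets. ?I e) \<le> of_nat ?M * ?I e0"
    by (rule sum_bounded_above) (use Max_ge[OF fin] e0 in auto)
  also have "\<dots> < ennreal (w K * 2 powr (of_int K * real DIM('a)))" by (rule lt[OF e0(1)])
  finally have a: "(\<Sum>e\<in>offsets. ?I e) < ennreal (w K * 2 powr (of_int K * real DIM('a)))" .
  have "(\<integral>\<^sup>+y. (if dist x y < 2 powr of_int K then h y else 0) \<partial>lborel)
     \<le> (\<integral>\<^sup>+y. (\<Sum>e\<in>offsets. if samecell K (x + (2 powr of_int K) *\<^sub>R e) y then h y else 0) \<partial>lborel)"
  proof (intro nn_integral_mono)
    fix y
    show "(if dist x y < 2 powr of_int K then h y else 0) \<le> (\<Sum>e\<in>offsets. if samecell K (x + (2 powr of_int K) *\<^sub>R e) y then h y else 0)"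
    proof (cases "dist x y < 2 powr of_int K")
      case True
      then obtain e where e: "e \<in> offsets" "samecell K (x + (2 powr of_int K) *\<^sub>R e) y"
        using ball_covered_by_offset_cells by blast
      have "(if samecell K (x + (2 powr of_int K) *\<^sub>R e) y then h y else 0) \<le> (\<Sum>e\<in>offsets. if samecell K (x + (2 powr of_int K) *\<^sub>R e) y then h y else 0)"
        by (rule member_le_sum) (use e finite_offsets in auto)
      with e True show ?thesis by simp
    qed simp
  qed
  also have "\<dots> = (\<Sum>e\<in>offsets. ?I e)" by (rule nn_integral_sum) measurable
  finally have "Pav K h x \<le> ennreal (2 powr - (of_int K * real DIM('a))) * (\<Sum>e\<in>offsets. ?I e)"
    unfolding Pav_def by (intro mult_left_mono) auto
  also have "\<dots> < ennreal (2 powr - (of_int K * real DIM('a))) * ennreal (w K * 2 powr (of_int K * real DIM('a)))"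
    using a by (intro ennreal_mult_strict_left_mono) auto
  also have "\<dots> = ennreal (w K)"
    using assms(2) by (simp add: ennreal_mult[symmetric] mult.left_commute powr_add[symmetric])
  finally show False using assms(3) by simp
qed

text \<open>The volume of a ball of radius \<open>(2 n + 1) 2^K\<close> relative to a cell of scale
  \<open>K\<close>, times the loss in the definition of \<open>heavy\<close>.\<close>

definition VC :: "'a::euclidean_space itself \<Rightarrow> real" where
  "VC _ = Bvol TYPE('a) * (2 * real DIM('a) + 1) ^ DIM('a) * real (card (offsets :: 'a set))"

lemma VC_pos: "0 < VC TYPE('a::euclidean_space)"
  unfolding VC_def using Bvol_pos[where 'a='a] card_offsets_pos[where 'a='a] by (intro mult_pos_pos) auto

lemma heavy_cell_integral_le:
  fixes h :: "'a::euclidean_space \<Rightarrow> ennreal"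
  assumes "heavy h w K z" "0 < w K"
  shows "ennreal (w K) \<le> of_nat (card (offsets :: 'a set)) * (ennreal (2 powr - (of_int K * real DIM('a))) *
    (\<integral>\<^sup>+v. (if samecell K z v then h v else 0) \<partial>lborel))"
proof -
  have "ennreal (w K) = ennreal (2 powr - (of_int K * real DIM('a))) * ennreal (w K * 2 powr (of_int K * real DIM('a)))"
    using assms(2) by (simp add: ennreal_mult[symmetric] mult.left_commute powr_add[symmetric])
  also have "\<dots> \<le> ennreal (2 powr - (of_int K * real DIM('a))) * (of_nat (card (offsets :: 'a set)) * (\<integral>\<^sup>+v. (if samecell K z v then h v else 0) \<partial>lborel))"
    using assms(1) unfolding heavy_def by (intro mult_left_mono) auto
  finally show ?thesis by (simp add: mult_ac)
qed

text \<open>For constant \<open>w\<close> this is the weak (1,1) inequality for the maximal function. Every heavy cell lies in a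
  maximal heavy cell \<open>mx\<close>; these are disjoint, and on each of them the weight is bounded by the average of \<open>h\<close>.
  Sums over cells are written as integrals over their points, divided by the volume of the cell.\<close>

theorem nn_integral_SUP_heavy_weight_le:
  fixes h :: "'a::euclidean_space \<Rightarrow> ennreal"
  assumes [measurable]: "h \<in> borel_measurable borel" and fin: "(\<integral>\<^sup>+x. h x \<partial>lborel) < top"
    and w: "\<And>K. 0 < w K" "mono w"
  shows "(\<integral>\<^sup>+x. (SUP K. if ennreal (w K) \<le> Pav K h x then ennreal (w K) else 0) \<partial>lborel)
     \<le> ennreal (VC TYPE('a)) * (\<integral>\<^sup>+x. h x \<partial>lborel)"
proof -
  let ?n = "real DIM('a)" and ?M = "card (offsets :: 'a set)"
  define mx where "mx K z \<longleftrightarrow> heavy h w K z \<and> (\<forall>K'. K < K' \<longrightarrow> \<not> heavy h w K' z)" for K z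
  have [measurable]: "Measurable.pred borel (mx K)" for K
    unfolding mx_def by measurable
  \<comment> \<open>Scales of heavy cells above \<open>K\<close> are bounded: for
    \<open>K' > 0\<close> monotonicity of \<open>w\<close> and \<open>n \<ge> 1\<close> give
    \<open>w K * 2^K' \<le> w K' * 2^(K' n)\<close>, which is at most the total mass
    \<open>A\<close>.\<close>
  have mx_ex: "\<exists>K1\<ge>K. mx K1 z" if hv: "heavy h w K z" for K z
  proof -
    obtain A where A: "0 \<le> A" "of_nat ?M * (\<integral>\<^sup>+x. h x \<partial>lborel) = ennreal A"
      using fin by (cases "of_nat ?M * (\<integral>\<^sup>+x. h x \<partial>lborel)") (auto simp: ennreal_mult_eq_top_iff)
    define B where "B = max 0 \<lceil>log 2 (A / w K)\<rceil>"
    have bd: "K' \<le> B" if "K \<le> K'" "heavy h w K' z" for K'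
    proof (cases "0 < K'")
      case True
      have "ennreal (w K' * 2 powr (of_int K' * ?n)) \<le> of_nat ?M * (\<integral>\<^sup>+v. (if samecell K' z v then h v else 0) \<partial>lborel)"
        using that(2) by (simp add: heavy_def)
      also have "\<dots> \<le> of_nat ?M * (\<integral>\<^sup>+v. h v \<partial>lborel)"
        by (intro mult_left_mono nn_integral_mono) auto
      finally have "w K' * 2 powr (of_int K' * ?n) \<le> A"
        using A by (simp add: ennreal_le_iff)
      moreover have "w K * 2 powr of_int K' \<le> w K' * 2 powr (of_int K' * ?n)"
        using w(1)[of K] w(1)[of K'] monoD[OF w(2) that(1)] True by (intro mult_mono) (auto simp: )
      ultimately have "2 powr of_int K' \<le> A / w K" using w(1)[of K] by (simp add: field_simps)
      moreover from this have "0 < A / w K" by (rule less_le_trans[rotated]) simp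
      ultimately have "of_int K' \<le> log 2 (A / w K)" by (simp add: le_log_iff)
      then show ?thesis unfolding B_def by linarith
    qed (auto simp: B_def)
    define S where "S = {K'. K \<le> K' \<and> heavy h w K' z}"
    have "finite S" by (rule finite_subset[of _ "{K..B}"]) (use bd in \<open>auto simp: S_def\<close>)
    moreover have "K \<in> S" using hv by (auto simp: S_def)
    ultimately have 1: "Max S \<in> S" "\<And>K'. K' \<in> S \<Longrightarrow> K' \<le> Max S"
      by (auto intro: Max_in)
    have "\<not> heavy h w K' z" if "Max S < K'" for K'
    proof
      assume "heavy h w K' z"
      moreover have "K \<le> K'" using 1(2)[OF \<open>K \<in> S\<close>] that by linarith
      ultimately have "K' \<in> S" by (simp add: S_def)
      from 1(2)[OF this] that show False by simp
    qed
    moreover have "heavy h w (Max S) z" using 1(1) unfolding S_def by blast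
    ultimately have "mx (Max S) z" by (simp add: mx_def)
    with 1(2)[OF \<open>K \<in> S\<close>] show ?thesis by blast
  qed
  have mx_inv: "mx K z'" if "samecell K z z'" "mx K z" for K z z'
    using that heavy_samecell[OF samecell_mono[OF _ that(1)]] unfolding mx_def
    by (metis order_refl less_imp_le)
  have mx_uniq: "K = K'" if "mx K v" "mx K' v" for K K' v
    using that unfolding mx_def by (metis linorder_neq_iff)
  \<comment> \<open>\<open>Q K z x\<close> spreads the weight of the maximal cell of
    \<open>z\<close> over a ball around \<open>z\<close>. The factor \<open>2^(-K n)\<close> is
    chosen so that integrating over all points \<open>z\<close> of one cell returns
    \<open>w K\<close> at every \<open>x\<close> near that cell.\<close>
  define Q where "Q K z x = (if mx K z \<and> dist x z < (2 * ?n + 1) * 2 powr of_int K then ennreal (w K) * ennreal (2 powr - (of_int K * ?n)) else 0)" for K z x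
  have [measurable]: "(\<lambda>(x, z). Q K z x) \<in> borel_measurable (borel \<Otimes>\<^sub>M borel)" for K
    unfolding Q_def by measurable
  have ptw: "(SUP K. if ennreal (w K) \<le> Pav K h x then ennreal (w K) else 0) \<le> (\<Sum>\<^sub>ZK. \<integral>\<^sup>+z. Q K z x \<partial>lborel)" for x
  proof (rule SUP_least)
    fix K
    show "(if ennreal (w K) \<le> Pav K h x then ennreal (w K) else 0) \<le> (\<Sum>\<^sub>ZK. \<integral>\<^sup>+z. Q K z x \<partial>lborel)"
    proof (cases "ennreal (w K) \<le> Pav K h x")
      case True
      obtain e where e: "e \<in> offsets" "heavy h w K (x + (2 powr of_int K) *\<^sub>R e)"
        using Pav_ge_imp_heavy[of h w K x] w(1) True by auto
      define z0 where "z0 = x + (2 powr of_int K) *\<^sub>R e"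
      obtain K1 where K1: "K \<le> K1" "mx K1 z0" using mx_ex e(2) z0_def by blast
      have Kle: "2 powr of_int K \<le> (2::real) powr of_int K1" using K1(1) by simp
      \<comment> \<open>Origin of the radius \<open>2 n + 1\<close>: at most \<open>n\<close> units
        of \<open>2^K1\<close> lead from \<open>x\<close> to the shifted point \<open>z0\<close>, at
        most \<open>n\<close> more lead across the cell of \<open>z0\<close>, and the remaining unit
        makes the inequality strict.\<close>
      have near: "dist x z < (2 * ?n + 1) * 2 powr of_int K1" if "samecell K1 z0 z" for z
      proof -
        have "dist x z \<le> dist x z0 + dist z0 z" by (rule dist_triangle)
        also have "dist x z0 \<le> ?n * 2 powr of_int K1"
          using norm_offsets[OF e(1)] mult_mono[OF Kle norm_offsets[OF e(1)]] by (simp add: z0_def dist_norm mult.commute)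
        also have "dist z0 z \<le> ?n * 2 powr of_int K1" by (rule dist_samecell_le[OF that])
        also have "?n * 2 powr of_int K1 + ?n * 2 powr of_int K1 < (2 * ?n + 1) * 2 powr of_int K1"
          by (simp add: algebra_simps)
        finally show ?thesis by simp
      qed
      have "ennreal (w K) \<le> ennreal (w K1)" using w(2) K1(1) by (intro ennreal_leI) (auto dest: monoD)
      also have "\<dots> = (\<integral>\<^sup>+z. (if samecell K1 z0 z then ennreal (w K1) * ennreal (2 powr - (of_int K1 * ?n)) else 0) \<partial>lborel)"
        by (simp add: nn_integral_cell_const mult.assoc)
      also have "\<dots> \<le> (\<integral>\<^sup>+z. Q K1 z x \<partial>lborel)"
        using near mx_inv K1(2) by (intro nn_integral_mono) (auto simp: Q_def)
      also have "\<dots> \<le> (\<Sum>\<^sub>ZK. \<integral>\<^sup>+z. Q K z x \<partial>lborel)" by (rule isum_ge)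
      finally show ?thesis by simp
    qed simp
  qed
  have Qx: "(\<integral>\<^sup>+x. Q K z x \<partial>lborel) \<le> ennreal (VC TYPE('a)) * (if mx K z then ennreal (2 powr - (of_int K * ?n)) *
            (\<integral>\<^sup>+v. (if samecell K z v then h v else 0) \<partial>lborel) else 0)" for K z
  proof (cases "mx K z")
    case True
    have "(\<integral>\<^sup>+x. Q K z x \<partial>lborel) = (\<integral>\<^sup>+x. (if dist z x < (2 * ?n + 1) * 2 powr of_int K then ennreal (w K) * ennreal (2 powr - (of_int K * ?n)) else 0) \<partial>lborel)"
      using True by (intro nn_integral_cong) (auto simp: Q_def dist_commute)
    also have "\<dots> = ennreal (w K) * ennreal (2 powr - (of_int K * ?n)) * ennreal (Bvol TYPE('a) * ((2 * ?n + 1) * 2 powr of_int K) ^ DIM('a))"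
      by (rule nn_integral_ball_const) simp
    also have "\<dots> = ennreal (Bvol TYPE('a) * (2 * ?n + 1) ^ DIM('a)) * ennreal (w K)"
    proof -
      have pn: "2 powr - (of_int K * ?n) * (2 powr of_int K) ^ DIM('a) = 1"
        by (simp add: powr_realpow[symmetric] powr_powr powr_add[symmetric])
      have "w K * 2 powr - (of_int K * ?n) * (Bvol TYPE('a) * ((2 * ?n + 1) * 2 powr of_int K) ^ DIM('a))
        = Bvol TYPE('a) * (2 * ?n + 1) ^ DIM('a) * w K * (2 powr - (of_int K * ?n) * (2 powr of_int K) ^ DIM('a))"
        unfolding power_mult_distrib by (simp only: mult_ac)
      then show ?thesis
        unfolding pn using Bvol_pos[where 'a='a] w(1)[of K] by (simp add: ennreal_mult[symmetric])
    qed
    also have "\<dots> \<le> ennreal (Bvol TYPE('a) * (2 * ?n + 1) ^ DIM('a)) * (of_nat ?M * (ennreal (2 powr - (of_int K * ?n)) *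
            (\<integral>\<^sup>+v. (if samecell K z v then h v else 0) \<partial>lborel)))"
      using True w(1)[of K] by (intro mult_left_mono heavy_cell_integral_le) (auto simp: mx_def)
    also have "\<dots> = ennreal (VC TYPE('a)) * (ennreal (2 powr - (of_int K * ?n)) *
            (\<integral>\<^sup>+v. (if samecell K z v then h v else 0) \<partial>lborel))"
      using Bvol_pos[where 'a='a] by (simp add: VC_def ennreal_mult ennreal_of_nat_eq_real_of_nat mult.assoc)
    finally show ?thesis using True by simp
  qed (simp add: Q_def)
  have "(\<integral>\<^sup>+x. (SUP K. if ennreal (w K) \<le> Pav K h x then ennreal (w K) else 0) \<partial>lborel)
      \<le> (\<integral>\<^sup>+x. (\<Sum>\<^sub>ZK. \<integral>\<^sup>+z. Q K z x \<partial>lborel) \<partial>lborel)"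
    by (intro nn_integral_mono ptw)
  also have "\<dots> = (\<Sum>\<^sub>ZK. \<integral>\<^sup>+x. \<integral>\<^sup>+z. Q K z x \<partial>lborel \<partial>lborel)"
    by (rule nn_integral_isum) measurable
  also have "\<dots> = (\<Sum>\<^sub>ZK. \<integral>\<^sup>+z. \<integral>\<^sup>+x. Q K z x \<partial>lborel \<partial>lborel)"
    by (intro nn_integral_cong lborel_pair.Fubini'[symmetric]) measurable
  also have "\<dots> \<le> (\<Sum>\<^sub>ZK. \<integral>\<^sup>+z. ennreal (VC TYPE('a)) * (if mx K z then ennreal (2 powr - (of_int K * ?n)) *
            (\<integral>\<^sup>+v. (if samecell K z v then h v else 0) \<partial>lborel) else 0) \<partial>lborel)"
    by (intro isum_mono nn_integral_mono Qx)
  also have "\<dots> = ennreal (VC TYPE('a)) * (\<Sum>\<^sub>ZK. \<integral>\<^sup>+z. (if mx K z then ennreal (2 powr - (of_int K * ?n)) *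
            (\<integral>\<^sup>+v. (if samecell K z v then h v else 0) \<partial>lborel) else 0) \<partial>lborel)"
    by (subst nn_integral_cmult, measurable) (rule isum_cmult)
  also have "\<dots> \<le> ennreal (VC TYPE('a)) * (\<integral>\<^sup>+x. h x \<partial>lborel)"
    by (rule mult_left_mono[OF nn_integral_selected_cells_le[OF assms(1) _ mx_inv mx_uniq]]) auto
  finally show ?thesis .
qed

text \<open>Here heaviness is inherited by larger cells, so the weights of the heavy cells containing a minimal
  heavy cell \<open>mn\<close> form a geometric series; boundedness of \<open>h\<close> guarantees that minimal heavy cells exist.\<close>

theorem nn_integral_isum_heavy_weight_le:
  fixes h :: "'a::euclidean_space \<Rightarrow> ennreal"
  assumes [measurable]: "h \<in> borel_measurable borel" and bdd: "\<And>x. h x \<le> ennreal b"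
    and g: "\<gamma> < - real DIM('a)"
  shows "(\<integral>\<^sup>+x. (\<Sum>\<^sub>ZK. if ennreal (2 powr (of_int K * \<gamma>)) \<le> Pav K h x then ennreal (2 powr (of_int K * \<gamma>)) else 0) \<partial>lborel)
     \<le> ennreal ((real (card (offsets :: 'a set)))\<^sup>2 * geoC (\<gamma> + real DIM('a))) * (\<integral>\<^sup>+x. h x \<partial>lborel)"
proof -
  let ?n = "real DIM('a)" and ?M = "card (offsets :: 'a set)"
  define w where "w K = 2 powr (of_int K * \<gamma>)" for K :: int
  have w: "0 < w K" for K by (simp add: w_def)
  have wn: "w K * 2 powr (of_int K * ?n) = 2 powr (of_int K * (\<gamma> + ?n))" for K
    by (simp add: w_def powr_add[symmetric] distrib_left)
  define hv where "hv = heavy h w"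
  have hvc: "hv K z \<longleftrightarrow> hv K z'" if "samecell K z z'" for K z z'
    using heavy_samecell[OF that] by (simp add: hv_def)
  \<comment> \<open>Passing to a larger cell, the mass can only grow, while the required mass
    \<open>2^(K (\<gamma> + n))\<close> decreases because \<open>\<gamma> + n < 0\<close>.\<close>
  have hv_up: "hv K' z" if "K \<le> K'" "hv K z" for K K' z
  proof -
    have "(of_int K') * (\<gamma> + ?n) \<le> (of_int K) * (\<gamma> + ?n)" using that g by (intro mult_right_mono_neg) auto
    then have "ennreal (w K' * 2 powr (of_int K' * ?n)) \<le> ennreal (w K * 2 powr (of_int K * ?n))"
      unfolding wn by (intro ennreal_leI) auto
    also have "\<dots> \<le> of_nat ?M * (\<integral>\<^sup>+v. (if samecell K z v then h v else 0) \<partial>lborel)"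
      using that by (simp add: hv_def heavy_def)
    also have "\<dots> \<le> of_nat ?M * (\<integral>\<^sup>+v. (if samecell K' z v then h v else 0) \<partial>lborel)"
      using samecell_mono[OF that(1)] by (intro mult_left_mono nn_integral_mono) auto
    finally show ?thesis by (simp add: hv_def heavy_def)
  qed
  \<comment> \<open>A bound \<open>b\<close> on \<open>h\<close> bounds all cell averages, hence
    forces \<open>2^(K \<gamma>)\<close> to stay below a constant; as \<open>\<gamma> < 0\<close>
    this bounds \<open>K\<close> from below. The summand 1 keeps the argument of the logarithm
    visibly positive.\<close>
  define KB where "KB = - \<lceil>log 2 (real ?M * max b 1 + 1) / - \<gamma>\<rceil>"
  have KB: "KB \<le> K" if "hv K z" for K z
  proof -
    have "ennreal (w K * 2 powr (of_int K * ?n)) \<le> of_nat ?M * (\<integral>\<^sup>+v. (if samecell K z v then h v else 0) \<partial>lborel)"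
      using that by (simp add: hv_def heavy_def)
    also have "\<dots> \<le> of_nat ?M * (\<integral>\<^sup>+v. (if samecell K z v then ennreal (max b 1) else 0) \<partial>lborel)"
      by (intro mult_left_mono nn_integral_mono) (auto intro!: order_trans[OF bdd ennreal_leI])
    also have "\<dots> = ennreal (real ?M * max b 1 * 2 powr (of_int K * ?n))"
      by (simp add: nn_integral_cell_const ennreal_mult ennreal_of_nat_eq_real_of_nat mult.assoc)
    finally have "w K \<le> real ?M * max b 1" by (simp add: ennreal_le_iff mult_le_cancel_right)
    then have "w K \<le> real ?M * max b 1 + 1" by simp
    moreover have "0 < real ?M * max b 1 + 1" by (intro add_nonneg_pos mult_nonneg_nonneg) auto
    ultimately have "of_int K * \<gamma> \<le> log 2 (real ?M * max b 1 + 1)"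
      by (simp add: w_def le_log_iff)
    then have "of_int (- K) \<le> log 2 (real ?M * max b 1 + 1) / - \<gamma>"
      using g by (simp add: field_simps)
    then have "- K \<le> \<lceil>log 2 (real ?M * max b 1 + 1) / - \<gamma>\<rceil>" by linarith
    then show ?thesis by (simp add: KB_def)
  qed
  \<comment> \<open>Minimality is stated as measure zero rather than emptiness, so that
    \<open>mn K\<close> is measurable as a condition on a parametric integral. Nothing is lost,
    since the heavy points of scale \<open>K - 1\<close> form a union of cells of positive volume;
    and by \<open>hv_up\<close> the scale \<open>K - 1\<close> speaks for all smaller ones.\<close>
  define mn where "mn K v \<longleftrightarrow> hv K v \<and> (\<integral>\<^sup>+u. (if samecell K v u \<and> hv (K - 1) u then 1 else 0) \<partial>lborel) = (0::ennreal)" for K v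
  have [measurable (raw)]: "f \<in> borel_measurable M \<Longrightarrow> Measurable.pred M (\<lambda>x. hv K (f x))" for K f and M :: "'z measure"
    unfolding hv_def by measurable
  have [measurable]: "Measurable.pred borel (mn K)" for K
    unfolding mn_def hv_def by measurable
  have mn_inv: "mn K z'" if "samecell K z z'" "mn K z" for K z z'
  proof -
    have "samecell K z' u = samecell K z u" for u using that(1) by (meson samecell_sym samecell_trans)
    then show ?thesis using that hvc[OF that(1)] by (simp add: mn_def)
  qed
  have mn_uniq': "\<not> K < K'" if "mn K v" "mn K' v" for K K' v
  proof
    assume "K < K'"
    then have "hv (K' - 1) v" using hv_up[of K "K' - 1" v] that by (auto simp: mn_def)
    then have "(\<integral>\<^sup>+u. (if samecell (K' - 1) v u then 1 else 0) \<partial>lborel) \<le> (\<integral>\<^sup>+u. (if samecell K' v u \<and> hv (K' - 1) u then 1 else (0::ennreal)) \<partial>lborel)"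
      using hvc samecell_mono[of "K' - 1" K' v] by (intro nn_integral_mono) auto
    then show False using that(2) by (simp add: mn_def nn_integral_cell_const)
  qed
  then have mn_uniq: "K = K'" if "mn K v" "mn K' v" for K K' v
    using that by (meson linorder_neq_iff)
  have mn_ex: "\<exists>K'\<le>K. \<exists>v. samecell K z v \<and> mn K' v" if "hv K z" for K z
  proof -
    \<comment> \<open>All scales up to \<open>K\<close> at which some point of the cell of
      \<open>z\<close> is heavy. By \<open>KB\<close> the set is finite, and at its least element
      \<open>Min S\<close> the heavy point \<open>v\<close> has no heavy cell of scale
      \<open>Min S - 1\<close> within its cell.\<close>
    define S where "S = {K'. K' \<le> K \<and> (\<exists>v. samecell K z v \<and> hv K' v)}"
    have "finite S" by (rule finite_subset[of _ "{KB..K}"]) (use KB in \<open>auto simp: S_def\<close>)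
    moreover have "K \<in> S" using that samecell_refl[of K z] by (auto simp: S_def simp del: samecell_refl)
    ultimately have 1: "Min S \<in> S" "\<And>K'. K' \<in> S \<Longrightarrow> Min S \<le> K'" by (auto intro: Min_in)
    then obtain v where v: "samecell K z v" "hv (Min S) v" "Min S \<le> K" by (auto simp: S_def)
    have "\<not> (samecell (Min S) v u \<and> hv (Min S - 1) u)" for u
    proof
      assume u: "samecell (Min S) v u \<and> hv (Min S - 1) u"
      then have "samecell K z u" using samecell_mono[OF v(3)] v(1) samecell_trans by blast
      then have "Min S - 1 \<in> S" using u v(3) by (auto simp: S_def)
      then show False using 1(2) by force
    qed
    then have "(\<integral>\<^sup>+u. (if samecell (Min S) v u \<and> hv (Min S - 1) u then 1 else 0) \<partial>lborel) = (\<integral>\<^sup>+u. 0 \<partial>(lborel :: 'a measure) :: ennreal)"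
      by (intro nn_integral_cong) (simp only: if_False)
    then have "mn (Min S) v" using v by (simp add: mn_def)
    with v show ?thesis by blast
  qed
  \<comment> \<open>The incidence of a cell of scale \<open>K\<close> with a minimal heavy cell of
    scale \<open>K'\<close> inside it, normalised by the volume of the small cell. Integrating over
    its points thus gives \<open>w K\<close> once per minimal cell contained in the large
    one.\<close>
  define T where "T K K' z v = (if K' \<le> K \<and> samecell K z v \<and> mn K' v then ennreal (w K) * ennreal (2 powr - (of_int K' * ?n)) else 0)" for K K' z v
  have [measurable]: "(\<lambda>(z, v). T K K' z v) \<in> borel_measurable (borel \<Otimes>\<^sub>M borel)" for K K'
    unfolding T_def by measurable
  have hvT: "(if hv K z then ennreal (w K) else 0) \<le> (\<integral>\<^sup>+v. (\<Sum>\<^sub>ZK'. T K K' z v) \<partial>lborel)" for K z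
  proof (cases "hv K z")
    case True
    then obtain K' v where v: "K' \<le> K" "samecell K z v" "mn K' v" using mn_ex by blast
    have zx: "samecell K z x" "mn K' x" if "samecell K' v x" for x
      using samecell_trans[OF v(2) samecell_mono[OF v(1) that]] mn_inv[OF that v(3)] by auto
    have "ennreal (w K) = (\<integral>\<^sup>+u. (if samecell K' v u then ennreal (w K) * ennreal (2 powr - (of_int K' * ?n)) else 0) \<partial>lborel)"
      by (simp add: nn_integral_cell_const mult.assoc)
    also have "\<dots> \<le> (\<integral>\<^sup>+u. T K K' z u \<partial>lborel)"
      using v zx by (intro nn_integral_mono) (auto simp: T_def)
    also have "\<dots> \<le> (\<integral>\<^sup>+v. (\<Sum>\<^sub>ZK'. T K K' z v) \<partial>lborel)"
      by (intro nn_integral_mono isum_ge)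
    finally show ?thesis using True by simp
  qed simp
  have Tint: "(\<integral>\<^sup>+z. \<integral>\<^sup>+v. (\<Sum>\<^sub>ZK'. T K K' z v) \<partial>lborel \<partial>lborel)
      = (\<Sum>\<^sub>ZK'. \<integral>\<^sup>+v. (if K' \<le> K \<and> mn K' v then ennreal (2 powr (of_int K * (\<gamma> + ?n))) * ennreal (2 powr - (of_int K' * ?n)) else 0) \<partial>lborel)" for K
  proof -
    have "(\<integral>\<^sup>+z. \<integral>\<^sup>+v. (\<Sum>\<^sub>ZK'. T K K' z v) \<partial>lborel \<partial>lborel) = (\<integral>\<^sup>+v. \<integral>\<^sup>+z. (\<Sum>\<^sub>ZK'. T K K' z v) \<partial>lborel \<partial>lborel)"
      by (rule lborel_pair.Fubini'[symmetric]) (simp add: split_beta', measurable)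
    also have "\<dots> = (\<integral>\<^sup>+v. (\<Sum>\<^sub>ZK'. \<integral>\<^sup>+z. T K K' z v \<partial>lborel) \<partial>lborel)"
      by (intro nn_integral_cong nn_integral_isum) measurable
    also have "\<dots> = (\<Sum>\<^sub>ZK'. \<integral>\<^sup>+v. \<integral>\<^sup>+z. T K K' z v \<partial>lborel \<partial>lborel)"
      by (intro nn_integral_isum) measurable
    also have "\<dots> = (\<Sum>\<^sub>ZK'. \<integral>\<^sup>+v. (if K' \<le> K \<and> mn K' v then ennreal (2 powr (of_int K * (\<gamma> + ?n))) * ennreal (2 powr - (of_int K' * ?n)) else 0) \<partial>lborel)"
    proof (intro nn_integral_cong)
      fix K' v
      have "(\<integral>\<^sup>+z. T K K' z v \<partial>lborel) = (\<integral>\<^sup>+z. (if samecell K v z then (if K' \<le> K \<and> mn K' v then ennreal (w K) * ennreal (2 powr - (of_int K' * ?n)) else 0) else 0) \<partial>lborel)"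
        by (intro nn_integral_cong) (auto simp: T_def samecell_commute)
      also have "\<dots> = (if K' \<le> K \<and> mn K' v then ennreal (2 powr (of_int K * (\<gamma> + ?n))) * ennreal (2 powr - (of_int K' * ?n)) else 0)"
        unfolding nn_integral_cell_const by (auto simp: wn[symmetric] ennreal_mult w less_imp_le mult_ac)
      finally show "(\<integral>\<^sup>+z. T K K' z v \<partial>lborel) = (if K' \<le> K \<and> mn K' v then ennreal (2 powr (of_int K * (\<gamma> + ?n))) * ennreal (2 powr - (of_int K' * ?n)) else 0)" .
    qed
    finally show ?thesis .
  qed
  \<comment> \<open>For a fixed minimal cell, the weight times the volume of the enclosing cells of
    scale \<open>K \<ge> K'\<close> is \<open>2^(K (\<gamma> + n))\<close>, a decreasing progression
    dominated by its term \<open>K = K'\<close>; the latter is controlled by the heaviness of the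
    minimal cell.\<close>
  have sumK: "(\<Sum>\<^sub>ZK. if K' \<le> K \<and> mn K' v then ennreal (2 powr (of_int K * (\<gamma> + ?n))) * ennreal (2 powr - (of_int K' * ?n)) else 0)
     \<le> ennreal (geoC (\<gamma> + ?n) * real ?M) * (if mn K' v then ennreal (2 powr - (of_int K' * ?n)) * (\<integral>\<^sup>+u. (if samecell K' v u then h u else 0) \<partial>lborel) else 0)" for K' v
  proof (cases "mn K' v")
    case True
    have "(\<Sum>\<^sub>ZK. if K' \<le> K \<and> mn K' v then ennreal (2 powr (of_int K * (\<gamma> + ?n))) * ennreal (2 powr - (of_int K' * ?n)) else 0)
      = (\<Sum>\<^sub>ZK. ennreal (2 powr - (of_int K' * ?n)) * (if K' \<le> K then ennreal (2 powr (of_int K * (\<gamma> + ?n))) else 0))"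
      using True by (intro nn_integral_cong) (auto simp: mult_ac)
    also have "\<dots> = ennreal (2 powr - (of_int K' * ?n)) * (\<Sum>\<^sub>ZK. (if K' \<le> K then ennreal (2 powr (of_int K * (\<gamma> + ?n))) else 0))"
      by (rule isum_cmult)
    also have "\<dots> \<le> ennreal (2 powr - (of_int K' * ?n)) * (ennreal (geoC (\<gamma> + ?n)) * ennreal (2 powr (of_int K' * (\<gamma> + ?n))))"
    proof (intro mult_left_mono isum_geometric_le)
      fix K assume "K' \<le> K"
      then have "(of_int K) * (\<gamma> + ?n) \<le> (of_int K') * (\<gamma> + ?n)" using g by (intro mult_right_mono_neg) auto
      then show "ennreal (2 powr (of_int K * (\<gamma> + ?n))) \<le> ennreal (2 powr (of_int K' * (\<gamma> + ?n)))" by (intro ennreal_leI) auto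
    qed (use g in auto)
    also have "\<dots> = ennreal (geoC (\<gamma> + ?n)) * ennreal (w K') * (ennreal (2 powr - (of_int K' * ?n)) * ennreal (2 powr (of_int K' * ?n)))"
      unfolding wn[symmetric] by (simp only: ennreal_mult[OF less_imp_le[OF w] powr_ge_zero] mult_ac)
    also have "\<dots> = ennreal (geoC (\<gamma> + ?n)) * ennreal (w K')" by simp
    also have "\<dots> \<le> ennreal (geoC (\<gamma> + ?n)) * (of_nat ?M * (ennreal (2 powr - (of_int K' * ?n)) * (\<integral>\<^sup>+u. (if samecell K' v u then h u else 0) \<partial>lborel)))"
      using True w by (intro mult_left_mono heavy_cell_integral_le) (auto simp: mn_def hv_def)
    finally show ?thesis using True geoC_pos[of "\<gamma> + ?n"] g
      by (simp add: ennreal_mult ennreal_of_nat_eq_real_of_nat mult.assoc less_imp_le)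
  qed simp
  have shift: "(\<integral>\<^sup>+x. (if hv K (x + (2 powr of_int K) *\<^sub>R e) then ennreal (w K) else 0) \<partial>lborel) = (\<integral>\<^sup>+z. (if hv K z then ennreal (w K) else 0) \<partial>lborel)" for K e
    using nn_integral_lborel_shift[of "\<lambda>z. if hv K z then ennreal (w K) else 0" "(2 powr of_int K) *\<^sub>R e"]
    by (simp add: add.commute)
  have "(\<integral>\<^sup>+x. (\<Sum>\<^sub>ZK. if ennreal (w K) \<le> Pav K h x then ennreal (w K) else 0) \<partial>lborel)
    = (\<Sum>\<^sub>ZK. \<integral>\<^sup>+x. (if ennreal (w K) \<le> Pav K h x then ennreal (w K) else 0) \<partial>lborel)"
    by (rule nn_integral_isum) measurable
  also have "\<dots> \<le> (\<Sum>\<^sub>ZK. \<integral>\<^sup>+x. (\<Sum>e\<in>offsets. if hv K (x + (2 powr of_int K) *\<^sub>R e) then ennreal (w K) else 0) \<partial>lborel)"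
  proof (intro isum_mono nn_integral_mono)
    fix K x
    show "(if ennreal (w K) \<le> Pav K h x then ennreal (w K) else 0) \<le> (\<Sum>e\<in>offsets. if hv K (x + (2 powr of_int K) *\<^sub>R e) then ennreal (w K) else 0)"
    proof (cases "ennreal (w K) \<le> Pav K h x")
      case True
      then obtain e where e: "e \<in> offsets" "hv K (x + (2 powr of_int K) *\<^sub>R e)"
        using Pav_ge_imp_heavy[of h w K x] w unfolding hv_def by auto
      have "(if hv K (x + (2 powr of_int K) *\<^sub>R e) then ennreal (w K) else 0) \<le> (\<Sum>e\<in>offsets. if hv K (x + (2 powr of_int K) *\<^sub>R e) then ennreal (w K) else 0)"
        by (rule member_le_sum) (use e finite_offsets in auto)
      with True e show ?thesis by simp
    qed simp
  qed
  also have "\<dots> = (\<Sum>\<^sub>ZK. \<Sum>e\<in>(offsets::'a set). \<integral>\<^sup>+x. (if hv K (x + (2 powr of_int K) *\<^sub>R e) then ennreal (w K) else 0) \<partial>lborel)"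
    by (intro nn_integral_cong nn_integral_sum) measurable
  also have "\<dots> = of_nat ?M * (\<Sum>\<^sub>ZK. \<integral>\<^sup>+z. (if hv K z then ennreal (w K) else 0) \<partial>lborel)"
    by (simp add: shift isum_cmult)
  also have "\<dots> \<le> of_nat ?M * (\<Sum>\<^sub>ZK. \<integral>\<^sup>+z. \<integral>\<^sup>+v. (\<Sum>\<^sub>ZK'. T K K' z v) \<partial>lborel \<partial>lborel)"
    by (intro mult_left_mono isum_mono nn_integral_mono hvT) auto
  also have "\<dots> = of_nat ?M * (\<Sum>\<^sub>ZK'. \<Sum>\<^sub>ZK. \<integral>\<^sup>+v. (if K' \<le> K \<and> mn K' v then ennreal (2 powr (of_int K * (\<gamma> + ?n))) * ennreal (2 powr - (of_int K' * ?n)) else 0) \<partial>lborel)"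
    unfolding Tint by (rule arg_cong[OF isum_swap])
  also have "\<dots> = of_nat ?M * (\<Sum>\<^sub>ZK'. \<integral>\<^sup>+v. (\<Sum>\<^sub>ZK. if K' \<le> K \<and> mn K' v then ennreal (2 powr (of_int K * (\<gamma> + ?n))) * ennreal (2 powr - (of_int K' * ?n)) else 0) \<partial>lborel)"
    by (intro arg_cong[where f="(*) (of_nat ?M)"] nn_integral_cong nn_integral_isum[symmetric]) measurable
  also have "\<dots> \<le> of_nat ?M * (\<Sum>\<^sub>ZK'. \<integral>\<^sup>+v. ennreal (geoC (\<gamma> + ?n) * real ?M) * (if mn K' v then ennreal (2 powr - (of_int K' * ?n)) * (\<integral>\<^sup>+u. (if samecell K' v u then h u else 0) \<partial>lborel) else 0) \<partial>lborel)"
    by (intro mult_left_mono isum_mono nn_integral_mono sumK) auto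
  also have "\<dots> = of_nat ?M * (ennreal (geoC (\<gamma> + ?n) * real ?M) * (\<Sum>\<^sub>ZK'. \<integral>\<^sup>+v. (if mn K' v then ennreal (2 powr - (of_int K' * ?n)) * (\<integral>\<^sup>+u. (if samecell K' v u then h u else 0) \<partial>lborel) else 0) \<partial>lborel))"
    by (subst nn_integral_cmult, measurable) (simp only: isum_cmult)
  also have "\<dots> \<le> of_nat ?M * (ennreal (geoC (\<gamma> + ?n) * real ?M) * (\<integral>\<^sup>+x. h x \<partial>lborel))"
    by (rule mult_left_mono[OF mult_left_mono[OF nn_integral_selected_cells_le[OF assms(1) _ mn_inv mn_uniq]]]) auto
  also have "\<dots> = ennreal ((real ?M)\<^sup>2 * geoC (\<gamma> + ?n)) * (\<integral>\<^sup>+x. h x \<partial>lborel)"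
    using geoC_pos[of "\<gamma> + ?n"] g
    by (simp add: ennreal_mult ennreal_of_nat_eq_real_of_nat power2_eq_square mult_ac less_imp_le)
  finally show ?thesis unfolding w_def .
qed

section \<open>Morrey norms and localization\<close>

text \<open>The Morrey norm of \<open>F\<close> is the \<open>1/r\<close>-th power of \<open>Nmor (1 - r/\<alpha>)\<close> applied to \<open>F^r\<close>. Working with \<open>Nmor\<close>
  avoids Minkowski's inequality, since it is sublinear for trivial reasons.\<close>

definition Nmor :: "real \<Rightarrow> ('a::euclidean_space \<Rightarrow> ennreal) \<Rightarrow> ennreal" where
  "Nmor \<tau> h = (SUP (x, \<rho>) \<in> UNIV \<times> {0<..}. ennreal ((Bvol TYPE('a) * \<rho> ^ DIM('a)) powr - \<tau>) *
     (\<integral>\<^sup>+y. (if dist x y < \<rho> then h y else 0) \<partial>lborel))"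

lemma ennreal_powr_uminus_cancel: "0 < v \<Longrightarrow> ennreal (v powr a) * ennreal (v powr - a) = 1"
  by (subst ennreal_mult[symmetric]) (auto simp: powr_add[symmetric])

text \<open>Together with \<open>Nmor_le\<close> this describes \<open>Nmor \<tau> h\<close> as the
  best constant in the estimate of the integral of \<open>h\<close> over a ball by the volume to the
  power \<open>\<tau>\<close>. All later estimates use only these two directions.\<close>

lemma Nmor_ball:
  fixes h :: "'a::euclidean_space \<Rightarrow> ennreal"
  assumes "0 < \<rho>"
  shows "(\<integral>\<^sup>+y. (if dist x y < \<rho> then h y else 0) \<partial>lborel) \<le> ennreal ((Bvol TYPE('a) * \<rho> ^ DIM('a)) powr \<tau>) * Nmor \<tau> h"
proof -
  let ?v = "Bvol TYPE('a) * \<rho> ^ DIM('a)" and ?I = "\<integral>\<^sup>+y. (if dist x y < \<rho> then h y else 0) \<partial>lborel"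
  have v: "0 < ?v" using assms Bvol_pos[where 'a='a] by simp
  have "ennreal (?v powr - \<tau>) * ?I \<le> Nmor \<tau> h"
    unfolding Nmor_def using assms by (intro SUP_upper2[of "(x, \<rho>)"]) auto
  then have "ennreal (?v powr \<tau>) * (ennreal (?v powr - \<tau>) * ?I) \<le> ennreal (?v powr \<tau>) * Nmor \<tau> h"
    by (rule mult_left_mono) simp
  moreover have "ennreal (?v powr \<tau>) * ennreal (?v powr - \<tau>) = 1"
    by (rule ennreal_powr_uminus_cancel[OF v])
  ultimately show ?thesis by (simp add: mult.assoc[symmetric])
qed

lemma Nmor_le:
  fixes h :: "'a::euclidean_space \<Rightarrow> ennreal"
  assumes "\<And>x \<rho>. 0 < \<rho> \<Longrightarrow> (\<integral>\<^sup>+y. (if dist x y < \<rho> then h y else 0) \<partial>lborel) \<le> ennreal ((Bvol TYPE('a) * \<rho> ^ DIM('a)) powr \<tau>) * X"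
  shows "Nmor \<tau> h \<le> X"
  unfolding Nmor_def
proof (rule SUP_least, clarify)
  fix x :: 'a and \<rho> :: real assume "0 < \<rho>"
  let ?v = "Bvol TYPE('a) * \<rho> ^ DIM('a)" and ?I = "\<integral>\<^sup>+y. (if dist x y < \<rho> then h y else 0) \<partial>lborel"
  have v: "0 < ?v" using \<open>0 < \<rho>\<close> Bvol_pos[where 'a='a] by simp
  have "ennreal (?v powr - \<tau>) * ?I \<le> ennreal (?v powr - \<tau>) * (ennreal (?v powr \<tau>) * X)"
    using assms[OF \<open>0 < \<rho>\<close>] by (intro mult_left_mono) auto
  also have "\<dots> = ennreal (?v powr - \<tau>) * ennreal (?v powr \<tau>) * X" by (simp only: mult.assoc)
  also have "ennreal (?v powr - \<tau>) * ennreal (?v powr \<tau>) = 1"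
    using ennreal_powr_uminus_cancel[OF v, of "- \<tau>"] by simp
  finally show "ennreal (?v powr - \<tau>) * ?I \<le> X" by simp
qed

lemma Nmor_mono: "(\<And>x. h x \<le> h' x) \<Longrightarrow> Nmor \<tau> h \<le> Nmor \<tau> h'"
  unfolding Nmor_def by (rule SUP_subset_mono) (auto intro!: mult_left_mono nn_integral_mono)

lemma nn_integral_if_cmult:
  assumes [measurable]: "h \<in> borel_measurable M" "Measurable.pred M P"
  shows "(\<integral>\<^sup>+y. (if P y then c * h y else 0) \<partial>M) = c * (\<integral>\<^sup>+y. (if P y then h y else 0) \<partial>M)"
  by (subst nn_integral_cmult[symmetric], measurable) (auto intro!: nn_integral_cong)

lemma Nmor_cmult:
  assumes [measurable]: "h \<in> borel_measurable borel"
  shows "Nmor \<tau> (\<lambda>x. c * h x) = c * Nmor \<tau> h"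
  unfolding Nmor_def by (simp add: nn_integral_if_cmult SUP_mult_left_ennreal split_beta mult.left_commute)

lemma Nmor_add:
  fixes h :: "'a::euclidean_space \<Rightarrow> ennreal"
  assumes [measurable]: "h \<in> borel_measurable borel" "h' \<in> borel_measurable borel"
  shows "Nmor \<tau> (\<lambda>x. h x + h' x) \<le> Nmor \<tau> h + Nmor \<tau> h'"
proof (rule Nmor_le)
  fix x :: 'a and \<rho> :: real assume r: "0 < \<rho>"
  have "(\<integral>\<^sup>+y. (if dist x y < \<rho> then h y + h' y else 0) \<partial>lborel)
    = (\<integral>\<^sup>+y. (if dist x y < \<rho> then h y else 0) \<partial>lborel) + (\<integral>\<^sup>+y. (if dist x y < \<rho> then h' y else 0) \<partial>lborel)"
    by (subst nn_integral_add[symmetric], measurable) (auto intro!: nn_integral_cong)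
  also have "\<dots> \<le> ennreal ((Bvol TYPE('a) * \<rho> ^ DIM('a)) powr \<tau>) * Nmor \<tau> h + ennreal ((Bvol TYPE('a) * \<rho> ^ DIM('a)) powr \<tau>) * Nmor \<tau> h'"
    by (intro add_mono Nmor_ball r)
  finally show "(\<integral>\<^sup>+y. (if dist x y < \<rho> then h y + h' y else 0) \<partial>lborel) \<le> ennreal ((Bvol TYPE('a) * \<rho> ^ DIM('a)) powr \<tau>) * (Nmor \<tau> h + Nmor \<tau> h')"
    by (simp add: distrib_left)
qed

lemma Nmor_suminf:
  fixes h :: "nat \<Rightarrow> 'a::euclidean_space \<Rightarrow> ennreal"
  assumes [measurable]: "\<And>i. h i \<in> borel_measurable borel"
  shows "Nmor \<tau> (\<lambda>x. \<Sum>i. h i x) \<le> (\<Sum>i. Nmor \<tau> (h i))"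
proof (rule Nmor_le)
  fix x :: 'a and \<rho> :: real assume r: "0 < \<rho>"
  have "(\<integral>\<^sup>+y. (if dist x y < \<rho> then \<Sum>i. h i y else 0) \<partial>lborel)
    = (\<integral>\<^sup>+y. (\<Sum>i. if dist x y < \<rho> then h i y else 0) \<partial>lborel)"
    by (intro nn_integral_cong) auto
  also have "\<dots> = (\<Sum>i. \<integral>\<^sup>+y. (if dist x y < \<rho> then h i y else 0) \<partial>lborel)"
    by (rule nn_integral_suminf) measurable
  also have "\<dots> \<le> (\<Sum>i. ennreal ((Bvol TYPE('a) * \<rho> ^ DIM('a)) powr \<tau>) * Nmor \<tau> (h i))"
    by (intro suminf_le Nmor_ball r) auto
  finally show "(\<integral>\<^sup>+y. (if dist x y < \<rho> then \<Sum>i. h i y else 0) \<partial>lborel) \<le> ennreal ((Bvol TYPE('a) * \<rho> ^ DIM('a)) powr \<tau>) * (\<Sum>i. Nmor \<tau> (h i))"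
    by simp
qed

text \<open>The exponent satisfies \<open>1/\<alpha> - 1/r = - (1 - r/\<alpha>) / r\<close>, and the
  \<open>1/r\<close>-th power commutes with the supremum over balls. Upper integrals for the
  completed measure and for \<open>lborel\<close> agree for every function, so one may work with
  \<open>lborel\<close> from here on.\<close>

lemma morrey_norm_eq_Nmor:
  fixes F :: "'a::euclidean_space \<Rightarrow> ennreal"
  assumes "0 < r"
  shows "morrey_norm \<alpha> r F = epowr (Nmor (1 - r/\<alpha>) (\<lambda>y. epowr (F y) r)) (1/r)"
proof -
  have *: "ennreal (measure lebesgue (ball x \<rho>) powr (1/\<alpha> - 1/r)) * epowr (\<integral>\<^sup>+ y \<in> ball x \<rho>. epowr (F y) r \<partial>lebesgue) (1/r)
    = epowr (ennreal ((Bvol TYPE('a) * \<rho> ^ DIM('a)) powr - (1 - r/\<alpha>)) * (\<integral>\<^sup>+y. (if dist x y < \<rho> then epowr (F y) r else 0) \<partial>lborel)) (1/r)"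
    if "0 < \<rho>" for x :: 'a and \<rho>
  proof -
    have "(\<integral>\<^sup>+ y \<in> ball x \<rho>. epowr (F y) r \<partial>lebesgue) = (\<integral>\<^sup>+y. (if dist x y < \<rho> then epowr (F y) r else 0) \<partial>lborel)"
      unfolding nn_integral_completion by (intro nn_integral_cong) auto
    moreover have "(1/\<alpha> - 1/r) = - (1 - r/\<alpha>) * (1/r)" using assms by (simp add: field_simps)
    ultimately show ?thesis
      using assms that Bvol_pos[where 'a='a]
      by (simp only: epowr_mult[of "1/r"] measure_lebesgue_ball_Bvol epowr_ennreal powr_powr powr_ge_zero less_imp_le zero_less_divide_1_iff)
  qed
  have "epowr (Nmor (1 - r/\<alpha>) (\<lambda>y. epowr (F y) r)) (1/r) =
    (SUP z\<in>UNIV \<times> {0<..}. epowr (case z of (x, \<rho>) \<Rightarrow> ennreal ((Bvol TYPE('a) * \<rho> ^ DIM('a)) powr - (1 - r/\<alpha>)) * (\<integral>\<^sup>+y. (if dist x y < \<rho> then epowr (F y) r else 0) \<partial>lborel)) (1/r))"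
    unfolding Nmor_def using assms by (intro epowr_SUP) simp
  also have "\<dots> = morrey_norm \<alpha> r F"
    unfolding morrey_norm_def
  proof (rule SUP_cong[OF refl], clarify)
    fix x :: 'a and \<rho> :: real assume "0 < \<rho>"
    from *[OF this, of x] show "epowr (ennreal ((Bvol TYPE('a) * \<rho> ^ DIM('a)) powr - (1 - r/\<alpha>)) * (\<integral>\<^sup>+y. (if dist x y < \<rho> then epowr (F y) r else 0) \<partial>lborel)) (1/r)
       = ennreal (measure lebesgue (ball (fst (x, \<rho>)) (snd (x, \<rho>))) powr (1/\<alpha> - 1/r)) * epowr (\<integral>\<^sup>+ y \<in> ball (fst (x, \<rho>)) (snd (x, \<rho>)). epowr (F y) r \<partial>lebesgue) (1/r)"
      unfolding fst_conv snd_conv by (rule sym)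
  qed
  finally show ?thesis by (rule sym)
qed

text \<open>Jensen's inequality up to a constant, by integrating \<open>h \<le> t + t^(1-u) h^u\<close> for a suitable \<open>t\<close>.\<close>
lemma epowr_Pav_le:
  fixes h :: "'a::euclidean_space \<Rightarrow> ennreal"
  assumes [measurable]: "h \<in> borel_measurable borel" and u: "1 \<le> u"
  shows "epowr (Pav K h x) u \<le> ennreal (2 * (2 * Bvol TYPE('a)) powr (u - 1)) * Pav K (\<lambda>y. epowr (h y) u) x"
proof -
  let ?P = "Pav K (\<lambda>y. epowr (h y) u) x" and ?b = "Bvol TYPE('a)"
  have b: "0 < ?b" by (rule Bvol_pos)
  have step: "Pav K h x \<le> ennreal (t * ?b) + ennreal (t powr (1 - u)) * ?P" if t: "0 < t" for t
  proof -
    have le: "h y \<le> ennreal t + ennreal (t powr (1 - u)) * epowr (h y) u" for y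
    proof (cases "h y")
      case (real a)
      show ?thesis
      proof (cases "a \<le> t")
        case True then show ?thesis using real by (intro add_increasing2) (auto intro: ennreal_leI)
      next
        case False
        then have "1 \<le> (a / t) powr (u - 1)" using t u by (intro ge_one_powr_ge_zero) auto
        then have "a * 1 \<le> a * (a / t) powr (u - 1)" using real by (intro mult_left_mono) auto
        also have "\<dots> = t powr (1 - u) * a powr u"
          using False t by (simp add: powr_divide powr_diff divide_simps)
        finally show ?thesis using real by (intro add_increasing) (auto simp: epowr_ennreal ennreal_mult[symmetric])
      qed
    qed (use t in \<open>auto simp: ennreal_mult_top\<close>)
    have "Pav K h x \<le> Pav K (\<lambda>y. ennreal t + ennreal (t powr (1 - u)) * epowr (h y) u) x"
      by (intro Pav_mono le)
    also have "\<dots> = ennreal (2 powr - (of_int K * real DIM('a))) * (\<integral>\<^sup>+y. ((if dist x y < 2 powr of_int K then ennreal t else 0) + ennreal (t powr (1 - u)) * (if dist x y < 2 powr of_int K then epowr (h y) u else 0)) \<partial>lborel)"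
      unfolding Pav_def by (intro arg_cong[where f="(*) _"] nn_integral_cong) auto
    also have "\<dots> = ennreal (2 powr - (of_int K * real DIM('a))) * (ennreal t * ennreal (?b * (2 powr of_int K) ^ DIM('a)) + ennreal (t powr (1 - u)) * (\<integral>\<^sup>+y. (if dist x y < 2 powr of_int K then epowr (h y) u else 0) \<partial>lborel))"
      by (subst nn_integral_add, measurable) (simp add: nn_integral_ball_const nn_integral_cmult)
    also have "\<dots> = ennreal (2 powr - (of_int K * real DIM('a))) * (ennreal t * ennreal (?b * (2 powr of_int K) ^ DIM('a))) + ennreal (t powr (1 - u)) * ?P"
      unfolding Pav_def distrib_left by (simp only: mult.left_commute)
    also have "ennreal (2 powr - (of_int K * real DIM('a))) * (ennreal t * ennreal (?b * (2 powr of_int K) ^ DIM('a))) = ennreal (t * ?b)"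
    proof -
      have "2 powr - (of_int K * real DIM('a)) * (2 powr of_int K) ^ DIM('a) = 1"
        by (simp add: powr_realpow[symmetric] powr_powr powr_add[symmetric])
      moreover have "2 powr - (of_int K * real DIM('a)) * (t * (?b * (2 powr of_int K) ^ DIM('a))) = t * ?b * (2 powr - (of_int K * real DIM('a)) * (2 powr of_int K) ^ DIM('a))"
        by (simp only: mult_ac)
      ultimately show ?thesis using t b by (simp add: ennreal_mult[symmetric])
    qed
    finally show ?thesis .
  qed
  show ?thesis
  proof (cases "Pav K h x")
    case top
    then have "?P = top" using step[of 1] by (auto simp: top_unique)
    then show ?thesis using b by (simp add: ennreal_mult_top)
  next
    case (real s)
    show ?thesis
    proof (cases "s = 0")
      case True with real show ?thesis by simp
    next
      case False
      with real have s: "0 < s" by simp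
      show ?thesis
      proof (cases ?P)
        case top then show ?thesis using b by (simp add: ennreal_mult_top)
      next
        case (real P)
        \<comment> \<open>This value of \<open>t\<close> makes the first term of \<open>step\<close>
          equal to \<open>s / 2\<close>, which is absorbed by the left side.\<close>
        have t: "0 < s / (2 * ?b)" using s b by simp
        have "ennreal s \<le> ennreal (s / (2 * ?b) * ?b) + ennreal ((s / (2 * ?b)) powr (1 - u)) * ennreal P"
          using step[OF t] \<open>Pav K h x = ennreal s\<close> real by simp
        also have "\<dots> = ennreal (s / (2 * ?b) * ?b + (s / (2 * ?b)) powr (1 - u) * P)"
          using real t b s by (subst ennreal_plus) (auto simp: ennreal_mult)
        finally have "ennreal s \<le> ennreal (s / (2 * ?b) * ?b + (s / (2 * ?b)) powr (1 - u) * P)" .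
        then have "s \<le> s / 2 + (s / (2 * ?b)) powr (1 - u) * P"
          using real t b s by (subst (asm) ennreal_le_iff) auto
        then have "s / 2 * (s / (2 * ?b)) powr (u - 1) \<le> (s / (2 * ?b)) powr (1 - u) * P * (s / (2 * ?b)) powr (u - 1)"
          by (intro mult_right_mono) auto
        also have "\<dots> = P * ((s / (2 * ?b)) powr (1 - u) * (s / (2 * ?b)) powr (u - 1))" by simp
        also have "(s / (2 * ?b)) powr (1 - u) * (s / (2 * ?b)) powr (u - 1) = 1"
          using t s b by (subst powr_add[symmetric]) simp
        finally have "s / 2 * (s powr (u - 1) / (2 * ?b) powr (u - 1)) \<le> P"
          using s b by (simp add: powr_divide)
        moreover have "s * s powr (u - 1) = s powr u" using s by (simp add: powr_diff)
        ultimately have "s powr u \<le> 2 * (2 * ?b) powr (u - 1) * P"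
          using b by (simp add: field_simps)
        then show ?thesis using real s b \<open>Pav K h x = ennreal s\<close>
          by (simp add: epowr_ennreal ennreal_mult[symmetric] ennreal_leI)
      qed
    qed
  qed
qed

text \<open>Passing from global bounds to Morrey bounds: near a ball only the restriction of \<open>h\<close> to the
  doubled ball matters, and at larger scales the averages are bounded by the Morrey norm.\<close>
lemma Nmor_localize:
  fixes T :: "('a::euclidean_space \<Rightarrow> ennreal) \<Rightarrow> 'a \<Rightarrow> ennreal"
  assumes u: "1 \<le> u" and tau: "0 \<le> \<tau>" "\<tau> < 1" and C: "0 < C0" "0 < C1"
    and meas: "\<And>h. h \<in> borel_measurable borel \<Longrightarrow> T h \<in> borel_measurable borel"
    and glob: "\<And>h b. h \<in> borel_measurable borel \<Longrightarrow> (\<And>x. h x \<le> ennreal b) \<Longrightarrow>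
        (\<integral>\<^sup>+x. epowr (h x) u \<partial>lborel) < top \<Longrightarrow> (\<integral>\<^sup>+x. T h x \<partial>lborel) \<le> ennreal C0 * (\<integral>\<^sup>+x. epowr (h x) u \<partial>lborel)"
    and loc: "\<And>h h' x (R::real) Z. h \<in> borel_measurable borel \<Longrightarrow> 0 < R \<Longrightarrow>
        (\<And>K. 2 powr of_int K \<le> R \<Longrightarrow> Pav K h x \<le> Pav K h' x) \<Longrightarrow>
        (\<And>K. R < 2 powr of_int K \<Longrightarrow> epowr (Pav K h x) u \<le> Z) \<Longrightarrow> T h x \<le> T h' x + ennreal C1 * Z"
  shows "\<exists>C>0. \<forall>h b. h \<in> borel_measurable borel \<longrightarrow> (\<forall>x. h x \<le> ennreal b) \<longrightarrow>
     Nmor \<tau> (T h) \<le> ennreal C * Nmor \<tau> (\<lambda>x. epowr (h x) u)"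
proof -
  let ?n = "real DIM('a)" and ?b = "Bvol TYPE('a)"
  have b: "0 < ?b" by (rule Bvol_pos)
  define CJ where "CJ = 2 * (2 * ?b) powr (u - 1)"
  define C where "C = C0 * 2 powr (?n * \<tau>) + C1 * CJ * ?b"
  have CJ: "0 < CJ" using b by (simp add: CJ_def)
  have Cpos: "0 < C" unfolding C_def using b CJ C by (intro add_pos_pos mult_pos_pos) auto
  show ?thesis
  proof (intro exI[of _ C] conjI Cpos allI impI)
    fix h :: "'a \<Rightarrow> ennreal" and bd
    assume h[measurable]: "h \<in> borel_measurable borel" and bdd: "\<forall>x. h x \<le> ennreal bd"
    note [measurable] = meas
    define X where "X = Nmor \<tau> (\<lambda>x. epowr (h x) u)"
    show "Nmor \<tau> (T h) \<le> ennreal C * Nmor \<tau> (\<lambda>x. epowr (h x) u)"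
    proof (cases "X < top")
      case False
      then show ?thesis using Cpos by (auto simp: X_def ennreal_mult_top less_top[symmetric])
    next
      case True
      show ?thesis unfolding X_def[symmetric]
      proof (rule Nmor_le)
        fix c :: 'a and R :: real assume R: "0 < R"
        let ?V = "?b * R ^ DIM('a)"
        have V: "0 < ?V" using R b by simp
        define h' where "h' y = (if dist c y < 2 * R then h y else 0)" for y
        have [measurable]: "h' \<in> borel_measurable borel" unfolding h'_def by measurable
        \<comment> \<open>Bound for the \<open>u\<close>-th powers of the averages at all scales
          above \<open>R\<close>. Its integral over the ball is of order
          \<open>?V powr \<tau>\<close>, which is exactly what the Morrey norm permits.\<close>
        define Z where "Z = ennreal (CJ * ?b * ?V powr (\<tau> - 1)) * X"
        have I: "(\<integral>\<^sup>+y. epowr (h' y) u \<partial>lborel) \<le> ennreal (2 powr (?n * \<tau>) * ?V powr \<tau>) * X"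
        proof -
          have "(\<integral>\<^sup>+y. epowr (h' y) u \<partial>lborel) = (\<integral>\<^sup>+y. (if dist c y < 2 * R then epowr (h y) u else 0) \<partial>lborel)"
            by (intro nn_integral_cong) (auto simp: h'_def)
          also have "\<dots> \<le> ennreal ((?b * (2 * R) ^ DIM('a)) powr \<tau>) * X"
            unfolding X_def using R by (intro Nmor_ball) simp
          also have "(?b * (2 * R) ^ DIM('a)) powr \<tau> = 2 powr (?n * \<tau>) * ?V powr \<tau>"
            using b R by (simp add: powr_mult power_mult_distrib powr_realpow[symmetric] powr_powr)
          finally show ?thesis .
        qed
        have Ifin: "(\<integral>\<^sup>+y. epowr (h' y) u \<partial>lborel) < top"
          using I by (rule order.strict_trans1) (use True in \<open>simp add: ennreal_mult_less_top\<close>)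
        have bdd': "h' x \<le> ennreal bd" for x using bdd by (auto simp: h'_def)
        have near: "T h x \<le> T h' x + ennreal C1 * Z" if x: "dist c x < R" for x
        proof (rule loc[where R=R])
          show "h \<in> borel_measurable borel" by fact
          show "0 < R" by fact
        next
          fix K assume K: "2 powr of_int K \<le> R"
          show "Pav K h x \<le> Pav K h' x"
          proof (rule Pav_mono)
            fix y assume "dist x y < 2 powr of_int K"
            then have "dist c y < 2 * R" using dist_triangle[of c y x] K x by simp
            then show "h y \<le> h' y" by (simp add: h'_def)
          qed
        next
          fix K assume K: "R < 2 powr of_int K"
          have "epowr (Pav K h x) u \<le> ennreal CJ * Pav K (\<lambda>y. epowr (h y) u) x"
            unfolding CJ_def by (rule epowr_Pav_le[OF h u])
          also have "\<dots> \<le> ennreal CJ * (ennreal (2 powr - (of_int K * ?n)) * (ennreal ((?b * (2 powr of_int K) ^ DIM('a)) powr \<tau>) * X))"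
            unfolding Pav_def X_def by (intro mult_left_mono Nmor_ball) auto
          also have "\<dots> = ennreal (CJ * (2 powr - (of_int K * ?n) * (?b * (2 powr of_int K) ^ DIM('a)) powr \<tau>)) * X"
            using CJ by (simp add: ennreal_mult mult.assoc less_imp_le)
          also have "\<dots> \<le> Z"
          proof -
            have V': "0 < ?b * (2 powr of_int K) ^ DIM('a)" using b by simp
            have "2 powr - (of_int K * ?n) * (?b * (2 powr of_int K) ^ DIM('a)) powr \<tau>
               = ?b * (?b * (2 powr of_int K) ^ DIM('a)) powr (\<tau> - 1)"
              using b V' by (simp add: powr_diff powr_minus powr_realpow[symmetric] powr_powr field_simps)
            \<comment> \<open>The exponent \<open>\<tau> - 1\<close> is negative and the ball of
              radius \<open>2^K\<close> is larger than the ball of radius \<open>R\<close>, so the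
              volume factor is worst at \<open>R\<close>.\<close>
            also have "\<dots> \<le> ?b * ?V powr (\<tau> - 1)"
              using b K R tau by (intro mult_left_mono powr_mono2' mult_left_mono power_mono) auto
            finally show ?thesis unfolding Z_def using CJ
              by (intro mult_right_mono ennreal_leI) (auto simp: mult.assoc)
          qed
          finally show "epowr (Pav K h x) u \<le> Z" .
        qed
        have "(\<integral>\<^sup>+y. (if dist c y < R then T h y else 0) \<partial>lborel)
           \<le> (\<integral>\<^sup>+y. T h' y + (if dist c y < R then ennreal C1 * Z else 0) \<partial>lborel)"
          by (intro nn_integral_mono) (auto simp: near)
        also have "\<dots> = (\<integral>\<^sup>+y. T h' y \<partial>lborel) + ennreal C1 * Z * ennreal ?V"
          by (subst nn_integral_add, measurable) (simp add: nn_integral_ball_const R less_imp_le)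
        also have "\<dots> \<le> ennreal C0 * (ennreal (2 powr (?n * \<tau>) * ?V powr \<tau>) * X) + ennreal C1 * Z * ennreal ?V"
          by (intro add_mono order_trans[OF glob[OF _ bdd' Ifin]] mult_left_mono I) auto
        also have "\<dots> = ennreal (C0 * (2 powr (?n * \<tau>) * ?V powr \<tau>)) * X + ennreal (C1 * (CJ * ?b * ?V powr (\<tau> - 1)) * ?V) * X"
          unfolding Z_def using C CJ b V R by (simp add: ennreal_mult mult_ac less_imp_le)
        also have "\<dots> = ennreal (C0 * (2 powr (?n * \<tau>) * ?V powr \<tau>) + C1 * (CJ * ?b * ?V powr (\<tau> - 1)) * ?V) * X"
          using C CJ b V R by (subst ennreal_plus) (auto simp: distrib_right intro!: mult_nonneg_nonneg)
        also have "C0 * (2 powr (?n * \<tau>) * ?V powr \<tau>) + C1 * (CJ * ?b * ?V powr (\<tau> - 1)) * ?V = ?V powr \<tau> * C"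
        proof -
          have "?V powr (\<tau> - 1) * ?V = ?V powr \<tau>" using V by (simp add: powr_diff)
          then have "C1 * (CJ * ?b * ?V powr (\<tau> - 1)) * ?V = C1 * CJ * ?b * ?V powr \<tau>"
            by (metis mult.assoc)
          then show ?thesis by (simp add: C_def algebra_simps)
        qed
        finally show "(\<integral>\<^sup>+y. (if dist c y < R then T h y else 0) \<partial>lborel) \<le> ennreal (?V powr \<tau>) * (ennreal C * X)"
          using Cpos by (simp add: ennreal_mult mult.assoc)
      qed
    qed
  qed
qed

section \<open>The maximal function and the level functions\<close>

lemma Pav_const: "Pav K (\<lambda>y. c) (x::'a::euclidean_space) = c * ennreal (Bvol TYPE('a))"
proof -
  have *: "2 powr - (of_int K * real DIM('a)) * (2 powr of_int K) ^ DIM('a) = 1"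
    by (simp add: powr_realpow[symmetric] powr_powr powr_add[symmetric])
  have "Pav K (\<lambda>y. c) x = c * ennreal (2 powr - (of_int K * real DIM('a)) * (Bvol TYPE('a) * (2 powr of_int K) ^ DIM('a)))"
    unfolding Pav_def using Bvol_pos[where 'a='a] by (subst nn_integral_ball_const) (simp_all add: ennreal_mult mult_ac)
  also have "2 powr - (of_int K * real DIM('a)) * (Bvol TYPE('a) * (2 powr of_int K) ^ DIM('a)) = Bvol TYPE('a)"
    using * by (metis mult.left_commute mult.right_neutral)
  finally show ?thesis .
qed

lemma Pav_add:
  assumes [measurable]: "h \<in> borel_measurable borel" "h' \<in> borel_measurable borel"
  shows "Pav K (\<lambda>y. h y + h' y) x = Pav K h x + Pav K h' x"
  unfolding Pav_def distrib_left[symmetric]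
  by (subst nn_integral_add[symmetric], measurable) (auto intro!: arg_cong[where f="(*) _"] nn_integral_cong)

text \<open>Dyadic form of Marcinkiewicz interpolation. At level \<open>2^k\<close> only the part of
  \<open>h\<close> above \<open>s k\<close> matters, because the rest contributes at most half of
  the level; the weak (1,1) bound is applied to that part. Summing over \<open>k\<close> below
  \<open>2 b h(y)\<close> produces \<open>h(y)^(u - 1)\<close> by a geometric series, which needs
  \<open>u > 1\<close>.\<close>

lemma nn_integral_maximal_le:
  fixes h :: "'a::euclidean_space \<Rightarrow> ennreal"
  assumes [measurable]: "h \<in> borel_measurable borel" and u: "1 < u"
    and fin: "(\<integral>\<^sup>+x. epowr (h x) u \<partial>lborel) < top"
  shows "(\<integral>\<^sup>+x. epowr (SUP K. Pav K h x) u \<partial>lborel)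
     \<le> ennreal (2 powr (u + 1) * VC TYPE('a) * geoC (u - 1) * (2 * Bvol TYPE('a)) powr (u - 1)) * (\<integral>\<^sup>+x. epowr (h x) u \<partial>lborel)"
proof -
  let ?b = "Bvol TYPE('a)"
  have b: "0 < ?b" by (rule Bvol_pos)
  have VC: "0 < VC TYPE('a)" by (rule VC_pos)
  have gC: "0 < geoC (u - 1)" using u by (intro geoC_pos) simp
  define lv where "lv k = (2 powr of_int k :: real)" for k :: int
  define s where "s k = lv k / (2 * ?b)" for k
  have lv: "0 < lv k" for k by (simp add: lv_def)
  have s: "0 < s k" for k using lv b by (simp add: s_def)
  define hk where "hk k y = (if ennreal (s k) < h y then h y else 0)" for k y
  have [measurable]: "hk k \<in> borel_measurable borel" for k unfolding hk_def by measurable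
  \<comment> \<open>Where \<open>h\<close> exceeds \<open>s k\<close> it is at most
    \<open>s k powr (1 - u)\<close> times \<open>h^u\<close>, so the truncated function is
    integrable, as the weak type bound demands.\<close>
  have hkfin: "(\<integral>\<^sup>+y. hk k y \<partial>lborel) < top" for k
  proof -
    have "hk k y \<le> ennreal (s k powr (1 - u)) * epowr (h y) u" for y
    proof (cases "h y")
      case (real a)
      show ?thesis
      proof (cases "s k < a")
        case True
        then have "1 \<le> (a / s k) powr (u - 1)" using s[of k] u by (intro ge_one_powr_ge_zero) auto
        then have "a * 1 \<le> a * (a / s k) powr (u - 1)" using real by (intro mult_left_mono) auto
        also have "\<dots> = s k powr (1 - u) * a powr u"
          using True s[of k] by (simp add: powr_divide powr_diff divide_simps)
        finally show ?thesis using real by (auto simp: hk_def epowr_ennreal ennreal_mult[symmetric] intro: ennreal_leI)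
      next
        case False then show ?thesis using real s[of k] by (auto simp: hk_def ennreal_less_iff)
      qed
    qed (use s[of k] in \<open>auto simp: ennreal_mult_top\<close>)
    then have "(\<integral>\<^sup>+y. hk k y \<partial>lborel) \<le> (\<integral>\<^sup>+y. ennreal (s k powr (1 - u)) * epowr (h y) u \<partial>lborel)"
      by (intro nn_integral_mono)
    also have "\<dots> < top" using fin by (simp add: nn_integral_cmult ennreal_mult_less_top)
    finally show ?thesis .
  qed
  have lvl: "ennreal (lv k / 2) \<le> Pav K (hk k) x" if "ennreal (lv k) < Pav K h x" for k K x
  proof -
    have "Pav K h x \<le> Pav K (\<lambda>y. hk k y + ennreal (s k)) x"
      by (intro Pav_mono) (auto simp: hk_def)
    also have "\<dots> = Pav K (hk k) x + ennreal (s k * ?b)"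
      using s[of k] b by (simp add: Pav_add Pav_const ennreal_mult less_imp_le)
    also have "s k * ?b = lv k / 2" using b by (simp add: s_def)
    finally have "ennreal (lv k) < Pav K (hk k) x + ennreal (lv k / 2)" using that by simp
    moreover have "ennreal (lv k) = ennreal (lv k / 2) + ennreal (lv k / 2)"
      using lv[of k] by (subst ennreal_plus[symmetric]) auto
    ultimately show ?thesis by (metis add_right_mono leD linear)
  qed
  \<comment> \<open>Only a finite positive average can be placed between two consecutive levels
    \<open>2^k\<close> and \<open>2^(k + 1)\<close>.\<close>
  have fin_Pav: "Pav K h x < top" for K x
  proof -
    have "Pav K (\<lambda>y. epowr (h y) u) x \<le> ennreal (2 powr - (of_int K * real DIM('a))) * (\<integral>\<^sup>+y. epowr (h y) u \<partial>lborel)"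
      unfolding Pav_def by (intro mult_left_mono nn_integral_mono) auto
    also have "\<dots> < top" using fin by (simp add: ennreal_mult_less_top)
    finally have "epowr (Pav K h x) u < top"
      using epowr_Pav_le[of h u K x] u by (auto simp: ennreal_mult_less_top intro: order.strict_trans1)
    then show ?thesis by (simp add: less_top[symmetric])
  qed
  have ptw: "epowr (SUP K. Pav K h x) u \<le> (\<Sum>\<^sub>Zk. if \<exists>K. ennreal (lv k) < Pav K h x then ennreal (2 powr u * lv k powr u) else 0)" for x
  proof -
    have "epowr (SUP K. Pav K h x) u = (SUP K. epowr (Pav K h x) u)"
      using u by (intro epowr_SUP) simp
    also have "\<dots> \<le> (\<Sum>\<^sub>Zk. if \<exists>K. ennreal (lv k) < Pav K h x then ennreal (2 powr u * lv k powr u) else 0)"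
    proof (rule SUP_least)
      fix K
      obtain a where a: "0 \<le> a" "Pav K h x = ennreal a" using fin_Pav[of K x] by (cases "Pav K h x") auto
      show "epowr (Pav K h x) u \<le> (\<Sum>\<^sub>Zk. if \<exists>K. ennreal (lv k) < Pav K h x then ennreal (2 powr u * lv k powr u) else 0)"
      proof (cases "a = 0")
        case False
        \<comment> \<open>Rounding up and subtracting 1 gives the strict inequality on the left:
          \<open>lv k < a \<le> 2 * lv k\<close>.\<close>
        define k where "k = \<lceil>log 2 a\<rceil> - 1"
        have "of_int k < log 2 a" "log 2 a \<le> of_int k + 1" unfolding k_def by linarith+
        then have k: "lv k < a" "a \<le> 2 * lv k"
          using a False by (auto simp: lv_def less_log_iff log_le_iff powr_add)
        have "epowr (Pav K h x) u \<le> ennreal ((2 * lv k) powr u)"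
          using a k u by (auto simp: epowr_ennreal intro!: ennreal_leI powr_mono2)
        also have "\<dots> = (if \<exists>K. ennreal (lv k) < Pav K h x then ennreal (2 powr u * lv k powr u) else 0)"
          using a k lv[of k] by (auto simp: powr_mult ennreal_less_iff intro!: exI[of _ K])
        also have "\<dots> \<le> (\<Sum>\<^sub>Zk. if \<exists>K. ennreal (lv k) < Pav K h x then ennreal (2 powr u * lv k powr u) else 0)"
          by (rule isum_ge)
        finally show ?thesis .
      qed (use a in simp)
    qed
    finally show ?thesis .
  qed
  have lev: "(\<integral>\<^sup>+x. (if \<exists>K. ennreal (lv k) < Pav K h x then ennreal (2 powr u * lv k powr u) else 0) \<partial>lborel)
     \<le> ennreal (2 powr (u + 1) * VC TYPE('a)) * (\<integral>\<^sup>+y. ennreal (lv k powr (u - 1)) * hk k y \<partial>lborel)" for k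
  proof -
    have "(\<integral>\<^sup>+x. (if \<exists>K. ennreal (lv k) < Pav K h x then ennreal (2 powr u * lv k powr u) else 0) \<partial>lborel)
      \<le> (\<integral>\<^sup>+x. ennreal (2 powr (u + 1) * lv k powr (u - 1)) * (SUP K. if ennreal (lv k / 2) \<le> Pav K (hk k) x then ennreal (lv k / 2) else 0) \<partial>lborel)"
    proof (intro nn_integral_mono)
      fix x
      show "(if \<exists>K. ennreal (lv k) < Pav K h x then ennreal (2 powr u * lv k powr u) else 0)
        \<le> ennreal (2 powr (u + 1) * lv k powr (u - 1)) * (SUP K. if ennreal (lv k / 2) \<le> Pav K (hk k) x then ennreal (lv k / 2) else 0)"
      proof (cases "\<exists>K. ennreal (lv k) < Pav K h x")
        case True
        then obtain K where "ennreal (lv k) < Pav K h x" ..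
        from lvl[OF this] have "ennreal (lv k / 2) \<le> (SUP K. if ennreal (lv k / 2) \<le> Pav K (hk k) x then ennreal (lv k / 2) else 0)"
          by (intro SUP_upper2[of K]) auto
        moreover have "ennreal (2 powr u * lv k powr u) = ennreal (2 powr (u + 1) * lv k powr (u - 1)) * ennreal (lv k / 2)"
          using lv[of k] by (simp add: ennreal_mult[symmetric] powr_add powr_diff)
        ultimately show ?thesis using True by (simp add: mult_left_mono)
      qed simp
    qed
    also have "\<dots> = ennreal (2 powr (u + 1) * lv k powr (u - 1)) * (\<integral>\<^sup>+x. (SUP K. if ennreal (lv k / 2) \<le> Pav K (hk k) x then ennreal (lv k / 2) else 0) \<partial>lborel)"
      by (rule nn_integral_cmult) measurable
    also have "\<dots> \<le> ennreal (2 powr (u + 1) * lv k powr (u - 1)) * (ennreal (VC TYPE('a)) * (\<integral>\<^sup>+y. hk k y \<partial>lborel))"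
      using lv[of k] by (intro mult_left_mono nn_integral_SUP_heavy_weight_le hkfin) (auto intro: monoI)
    also have "\<dots> = ennreal (2 powr (u + 1) * VC TYPE('a)) * (ennreal (lv k powr (u - 1)) * (\<integral>\<^sup>+y. hk k y \<partial>lborel))"
      using VC by (simp add: ennreal_mult less_imp_le mult_ac)
    also have "\<dots> = ennreal (2 powr (u + 1) * VC TYPE('a)) * (\<integral>\<^sup>+y. ennreal (lv k powr (u - 1)) * hk k y \<partial>lborel)"
      by (subst nn_integral_cmult) auto
    finally show ?thesis .
  qed
  have sumk: "(\<Sum>\<^sub>Zk. ennreal (lv k powr (u - 1)) * hk k y) \<le> ennreal (geoC (u - 1) * (2 * ?b) powr (u - 1)) * epowr (h y) u" for y
  proof -
    have "(\<Sum>\<^sub>Zk. ennreal (lv k powr (u - 1)) * hk k y) = (\<Sum>\<^sub>Zk. h y * (if ennreal (s k) < h y then ennreal (2 powr (of_int k * (u - 1))) else 0))"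
      by (intro nn_integral_cong) (auto simp: hk_def lv_def powr_powr mult.commute)
    also have "\<dots> = h y * (\<Sum>\<^sub>Zk. (if ennreal (s k) < h y then ennreal (2 powr (of_int k * (u - 1))) else 0))"
      by (rule isum_cmult)
    also have "\<dots> \<le> h y * (ennreal (geoC (u - 1)) * epowr (ennreal (2 * ?b) * h y) (u - 1))"
    proof (intro mult_left_mono isum_geometric_le)
      fix k assume "ennreal (s k) < h y"
      then have "ennreal (2 * ?b) * ennreal (s k) \<le> ennreal (2 * ?b) * h y" by (intro mult_left_mono) auto
      moreover have "ennreal (2 * ?b) * ennreal (s k) = ennreal (lv k)" using b s[of k] by (simp add: ennreal_mult[symmetric] s_def less_imp_le)
      ultimately have "epowr (ennreal (lv k)) (u - 1) \<le> epowr (ennreal (2 * ?b) * h y) (u - 1)"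
        using u by (intro epowr_mono) auto
      then show "ennreal (2 powr (of_int k * (u - 1))) \<le> epowr (ennreal (2 * ?b) * h y) (u - 1)"
        by (simp add: epowr_ennreal lv_def powr_powr)
    qed (use u in auto)
    also have "\<dots> = ennreal (geoC (u - 1) * (2 * ?b) powr (u - 1)) * (epowr (h y) (u - 1) * epowr (h y) 1)"
    proof -
      have "epowr (ennreal (2 * ?b) * h y) (u - 1) = ennreal ((2 * ?b) powr (u - 1)) * epowr (h y) (u - 1)"
        using u b by (subst epowr_mult) (auto simp only: epowr_ennreal less_imp_le diff_gt_0_iff_gt mult_pos_pos zero_less_numeral)
      then show ?thesis using gC by (simp add: ennreal_mult less_imp_le mult_ac)
    qed
    also have "epowr (h y) (u - 1) * epowr (h y) 1 = epowr (h y) u"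
      by (subst epowr_add[symmetric]) simp
    finally show ?thesis .
  qed
  have "(\<integral>\<^sup>+x. epowr (SUP K. Pav K h x) u \<partial>lborel) \<le> (\<integral>\<^sup>+x. (\<Sum>\<^sub>Zk. if \<exists>K. ennreal (lv k) < Pav K h x then ennreal (2 powr u * lv k powr u) else 0) \<partial>lborel)"
    by (intro nn_integral_mono ptw)
  also have "\<dots> = (\<Sum>\<^sub>Zk. \<integral>\<^sup>+x. (if \<exists>K. ennreal (lv k) < Pav K h x then ennreal (2 powr u * lv k powr u) else 0) \<partial>lborel)"
    by (rule nn_integral_isum) measurable
  also have "\<dots> \<le> (\<Sum>\<^sub>Zk. ennreal (2 powr (u + 1) * VC TYPE('a)) * (\<integral>\<^sup>+y. ennreal (lv k powr (u - 1)) * hk k y \<partial>lborel))"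
    by (intro isum_mono lev)
  also have "\<dots> = ennreal (2 powr (u + 1) * VC TYPE('a)) * (\<Sum>\<^sub>Zk. \<integral>\<^sup>+y. ennreal (lv k powr (u - 1)) * hk k y \<partial>lborel)"
    by (rule isum_cmult)
  also have "(\<Sum>\<^sub>Zk. \<integral>\<^sup>+y. ennreal (lv k powr (u - 1)) * hk k y \<partial>lborel) = (\<integral>\<^sup>+y. (\<Sum>\<^sub>Zk. ennreal (lv k powr (u - 1)) * hk k y) \<partial>lborel)"
    by (rule nn_integral_isum[symmetric]) measurable
  also have "ennreal (2 powr (u + 1) * VC TYPE('a)) * \<dots> \<le> ennreal (2 powr (u + 1) * VC TYPE('a)) * (\<integral>\<^sup>+y. ennreal (geoC (u - 1) * (2 * ?b) powr (u - 1)) * epowr (h y) u \<partial>lborel)"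
    by (intro mult_left_mono nn_integral_mono sumk) auto
  also have "\<dots> = ennreal (2 powr (u + 1) * VC TYPE('a) * geoC (u - 1) * (2 * ?b) powr (u - 1)) * (\<integral>\<^sup>+x. epowr (h x) u \<partial>lborel)"
    using VC gC by (subst nn_integral_cmult, measurable) (simp add: ennreal_mult less_imp_le mult_ac)
  finally show ?thesis .
qed

text \<open>The weight \<open>2^(K \<gamma>)\<close> is the order of magnitude of the integral of
  \<open>\<bar>h\<bar>^(\<gamma> - n)\<close> over the shell
  \<open>\<bar>h\<bar> \<approx> 2^K\<close>, and the threshold is the \<open>p\<close>-th power of
  \<open>2^(K \<gamma> / q)\<close>, the difference quotient required at that distance.\<close>

definition Hfun :: "real \<Rightarrow> real \<Rightarrow> real \<Rightarrow> ('a::euclidean_space \<Rightarrow> ennreal) \<Rightarrow> 'a \<Rightarrow> ennreal" where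
  "Hfun p q \<gamma> g x = (\<Sum>\<^sub>ZK. if ennreal (2 powr (of_int K * (\<gamma> * p / q))) \<le> Pav K (\<lambda>y. epowr (g y) p) x
      then ennreal (2 powr (of_int K * \<gamma>)) else 0)"

lemma borel_measurable_Hfun [measurable (raw)]:
  assumes [measurable]: "g \<in> borel_measurable borel" "f \<in> borel_measurable M"
  shows "(\<lambda>x. Hfun p q \<gamma> g (f x)) \<in> borel_measurable M"
  unfolding Hfun_def by measurable

text \<open>The only place where the four cases of the theorem differ: \<open>Hbound\<close> holds for \<open>1 \<le> p < r\<close>, for
  \<open>p = r = 1\<close> and \<open>\<gamma> > 0\<close>, and for \<open>p = q = r = 1\<close> and \<open>\<gamma> < -n\<close>.\<close>

definition Hbound :: "real \<Rightarrow> real \<Rightarrow> real \<Rightarrow> real \<Rightarrow> real \<Rightarrow> 'a::euclidean_space itself \<Rightarrow> bool" where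
  "Hbound \<tau> p q r \<gamma> _ \<longleftrightarrow> (\<exists>C>0. \<forall>(g::'a \<Rightarrow> ennreal) b. g \<in> borel_measurable borel \<longrightarrow> (\<forall>x. g x \<le> ennreal b) \<longrightarrow>
     Nmor \<tau> (\<lambda>x. epowr (Hfun p q \<gamma> g x) (r / q)) \<le> ennreal C * Nmor \<tau> (\<lambda>x. epowr (g x) r))"

text \<open>Reduces \<open>Hbound\<close> to an operator \<open>T\<close> acting on
  \<open>h = g^p\<close>: the exponent \<open>r\<close> for \<open>g\<close> becomes
  \<open>r / p\<close> for \<open>h\<close>, which is the exponent \<open>u\<close> of the
  localization.\<close>

lemma HboundI:
  assumes C: "0 < C" and D: "0 < D" and p: "0 < p"
    and le: "\<And>(h::'a::euclidean_space \<Rightarrow> ennreal) b. h \<in> borel_measurable borel \<longrightarrow> (\<forall>x. h x \<le> ennreal b) \<longrightarrow>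
        Nmor \<tau> (T h) \<le> ennreal C * Nmor \<tau> (\<lambda>x. epowr (h x) (r / p))"
    and HT: "\<And>g x. g \<in> borel_measurable borel \<Longrightarrow> epowr (Hfun p q \<gamma> g x) (r / q) \<le> ennreal D * T (\<lambda>y. epowr (g y) p) x"
    and meas: "\<And>h. h \<in> borel_measurable borel \<Longrightarrow> T h \<in> borel_measurable borel"
  shows "Hbound \<tau> p q r \<gamma> TYPE('a)"
  unfolding Hbound_def
proof (intro exI[of _ "D * C"] conjI allI impI)
  fix g :: "'a \<Rightarrow> ennreal" and b assume g[measurable]: "g \<in> borel_measurable borel" and bdd: "\<forall>x. g x \<le> ennreal b"
  have bdd': "\<forall>x. epowr (g x) p \<le> ennreal ((max b 0) powr p)"
  proof
    fix x
    have "epowr (g x) p \<le> epowr (ennreal (max b 0)) p"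
      using bdd p by (intro epowr_mono) (auto simp: max_def ennreal_neg)
    then show "epowr (g x) p \<le> ennreal ((max b 0) powr p)" by (simp add: epowr_ennreal)
  qed
  have "Nmor \<tau> (\<lambda>x. epowr (Hfun p q \<gamma> g x) (r / q)) \<le> Nmor \<tau> (\<lambda>x. ennreal D * T (\<lambda>y. epowr (g y) p) x)"
    by (intro Nmor_mono HT g)
  also have "\<dots> = ennreal D * Nmor \<tau> (T (\<lambda>y. epowr (g y) p))"
    by (rule Nmor_cmult) (auto intro: meas)
  also have "\<dots> \<le> ennreal D * (ennreal C * Nmor \<tau> (\<lambda>x. epowr (epowr (g x) p) (r / p)))"
    using le[of "\<lambda>y. epowr (g y) p"] bdd' by (intro mult_left_mono) auto
  also have "\<dots> = ennreal (D * C) * Nmor \<tau> (\<lambda>x. epowr (g x) r)"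
    using p C D by (simp add: epowr_epowr ennreal_mult mult.assoc)
  finally show "Nmor \<tau> (\<lambda>x. epowr (Hfun p q \<gamma> g x) (r / q)) \<le> ennreal (D * C) * Nmor \<tau> (\<lambda>x. epowr (g x) r)" .
qed (use C D in simp)

text \<open>Every contributing scale satisfies \<open>2^(K \<gamma>) \<le> S^(q/p)\<close> with
  \<open>S\<close> the maximal function of \<open>g^p\<close>, so the sum over scales is at most a
  multiple of \<open>S^(q/p)\<close>. Its power \<open>r / q\<close> is \<open>S^(r/p)\<close>, and
  \<open>r / p > 1\<close> allows the strong maximal inequality. Localization splits the supremum at
  the scale \<open>R\<close>.\<close>

lemma Hbound_maximal:
  assumes p: "1 \<le> p" "p < r" and q: "0 < q" and g: "\<gamma> \<noteq> 0" and tau: "0 \<le> \<tau>" "\<tau> < 1"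
  shows "Hbound \<tau> p q r \<gamma> TYPE('a::euclidean_space)"
proof -
  define u where "u = r / p"
  have u: "1 < u" using p by (simp add: u_def)
  define T where "T h x = epowr (SUP K. Pav K h x) u" for h :: "'a \<Rightarrow> ennreal" and x
  let ?C0 = "2 powr (u + 1) * VC TYPE('a) * geoC (u - 1) * (2 * Bvol TYPE('a)) powr (u - 1)"
  have C0: "0 < ?C0" using VC_pos[where 'a='a] Bvol_pos[where 'a='a] geoC_pos[of "u - 1"] u by (intro mult_pos_pos) auto
  have meas: "T h \<in> borel_measurable borel" if [measurable]: "h \<in> borel_measurable borel" for h
    unfolding T_def by measurable
  obtain C where C: "C > 0" "\<And>h b. h \<in> borel_measurable borel \<longrightarrow> (\<forall>x. h x \<le> ennreal b) \<longrightarrow>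
        Nmor \<tau> (T h) \<le> ennreal C * Nmor \<tau> (\<lambda>x. epowr (h x) u)"
  proof (atomize_elim, rule Nmor_localize[of u \<tau> ?C0 1 T])
    fix h h' :: "'a \<Rightarrow> ennreal" and x R Z
    assume a: "\<And>K. 2 powr of_int K \<le> (R::real) \<Longrightarrow> Pav K h x \<le> Pav K h' x" "\<And>K. R < 2 powr of_int K \<Longrightarrow> epowr (Pav K h x) u \<le> Z"
    show "T h x \<le> T h' x + ennreal 1 * Z"
      unfolding T_def epowr_SUP[OF less_trans[OF zero_less_one u]]
    proof (rule SUP_least)
      fix K
      show "epowr (Pav K h x) u \<le> (SUP K. epowr (Pav K h' x) u) + ennreal 1 * Z"
      proof (cases "2 powr of_int K \<le> R")
        case True
        have "epowr (Pav K h x) u \<le> (SUP K. epowr (Pav K h' x) u)"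
          using u a(1)[OF True] by (intro SUP_upper2[of K] epowr_mono) auto
        then show ?thesis by (rule add_increasing2[rotated]) simp
      next
        case False
        then show ?thesis using a(2)[of K] by (intro add_increasing) auto
      qed
    qed
  qed (use u tau C0 meas in \<open>auto simp: T_def intro!: nn_integral_maximal_le\<close>)
  have D: "0 < geoC \<gamma> powr (r / q)" using geoC_pos[OF g] by simp
  show ?thesis
  proof (rule HboundI[OF C(1) D _ C(2)[unfolded u_def]])
    fix f :: "'a \<Rightarrow> ennreal" and x
    let ?S = "SUP K. Pav K (\<lambda>y. epowr (f y) p) x"
    have "Hfun p q \<gamma> f x \<le> ennreal (geoC \<gamma>) * epowr ?S (q / p)"
      unfolding Hfun_def
    proof (rule isum_geometric_le[OF g])
      fix K assume "ennreal (2 powr (of_int K * (\<gamma> * p / q))) \<le> Pav K (\<lambda>y. epowr (f y) p) x"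
      also have "\<dots> \<le> ?S" by (rule SUP_upper) simp
      finally have "epowr (ennreal (2 powr (of_int K * (\<gamma> * p / q)))) (q / p) \<le> epowr ?S (q / p)"
        using p q by (intro epowr_mono) auto
      then show "ennreal (2 powr (of_int K * \<gamma>)) \<le> epowr ?S (q / p)"
        using p q by (simp add: epowr_ennreal powr_powr)
    qed
    then have "epowr (Hfun p q \<gamma> f x) (r / q) \<le> epowr (ennreal (geoC \<gamma>) * epowr ?S (q / p)) (r / q)"
      using p q by (intro epowr_mono) auto
    also have "\<dots> = ennreal (geoC \<gamma> powr (r / q)) * epowr ?S u"
      using p q geoC_pos[OF g] by (simp add: epowr_mult epowr_ennreal epowr_epowr u_def)
    finally show "epowr (Hfun p q \<gamma> f x) (r / q) \<le> ennreal (geoC \<gamma> powr (r / q)) * T (\<lambda>y. epowr (f y) p) x"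
      by (simp add: T_def)
  qed (use p meas in auto)
qed

text \<open>For \<open>\<gamma> > 0\<close> weights and thresholds increase with the scale, so the
  sum is controlled by the supremum \<open>T\<close> of the thresholds that are reached: each weight
  is the \<open>q\<close>-th power of its threshold. The weak type estimate with varying weights
  bounds the integral of this supremum.\<close>

lemma Hbound_pos:
  assumes q: "0 < q" and g: "0 < \<gamma>" and tau: "0 \<le> \<tau>" "\<tau> < 1"
  shows "Hbound \<tau> 1 q 1 \<gamma> TYPE('a::euclidean_space)"
proof -
  define w where "w K = 2 powr (of_int K * (\<gamma> / q))" for K :: int
  have w0: "0 < w K" for K by (simp add: w_def)
  have wmono: "mono w" using q g by (auto simp: mono_def w_def intro!: divide_right_mono mult_right_mono)
  define T where "T h x = (SUP K. if ennreal (w K) \<le> Pav K h x then ennreal (w K) else 0)" for h :: "'a \<Rightarrow> ennreal" and x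
  have meas: "T h \<in> borel_measurable borel" if [measurable]: "h \<in> borel_measurable borel" for h
    unfolding T_def by measurable
  obtain C where C: "C > 0" "\<And>h b. h \<in> borel_measurable borel \<longrightarrow> (\<forall>x. h x \<le> ennreal b) \<longrightarrow>
        Nmor \<tau> (T h) \<le> ennreal C * Nmor \<tau> (\<lambda>x. epowr (h x) 1)"
  proof (atomize_elim, rule Nmor_localize[of 1 \<tau> "VC TYPE('a)" 1 T])
    fix h h' :: "'a \<Rightarrow> ennreal" and x R Z
    assume a: "\<And>K. 2 powr of_int K \<le> (R::real) \<Longrightarrow> Pav K h x \<le> Pav K h' x" "\<And>K. R < 2 powr of_int K \<Longrightarrow> epowr (Pav K h x) 1 \<le> Z"
    show "T h x \<le> T h' x + ennreal 1 * Z"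
      unfolding T_def
    proof (rule SUP_least)
      fix K
      show "(if ennreal (w K) \<le> Pav K h x then ennreal (w K) else 0) \<le> (SUP K. if ennreal (w K) \<le> Pav K h' x then ennreal (w K) else 0) + ennreal 1 * Z"
      proof (cases "2 powr of_int K \<le> R")
        case True
        have "(if ennreal (w K) \<le> Pav K h x then ennreal (w K) else 0) \<le> (SUP K. if ennreal (w K) \<le> Pav K h' x then ennreal (w K) else 0)"
          using a(1)[OF True] by (intro SUP_upper2[of K]) auto
        then show ?thesis by (rule add_increasing2[rotated]) simp
      next
        case False
        then have "(if ennreal (w K) \<le> Pav K h x then ennreal (w K) else 0) \<le> Z" using a(2)[of K] by auto
        then show ?thesis by (intro add_increasing) auto
      qed
    qed
  next
    fix h :: "'a \<Rightarrow> ennreal" assume "h \<in> borel_measurable borel" "(\<integral>\<^sup>+ x. epowr (h x) 1 \<partial>lborel) < top"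
    then show "(\<integral>\<^sup>+x. T h x \<partial>lborel) \<le> ennreal (VC TYPE('a)) * (\<integral>\<^sup>+ x. epowr (h x) 1 \<partial>lborel)"
      unfolding T_def epowr_1 using wmono w0 by (intro nn_integral_SUP_heavy_weight_le) auto
  qed (use tau VC_pos[where 'a='a] meas in auto)
  have g': "\<gamma> \<noteq> 0" using g by simp
  have D: "0 < geoC \<gamma> powr (1 / q)" using geoC_pos[OF g'] by simp
  have C': "\<And>h b. h \<in> borel_measurable borel \<longrightarrow> (\<forall>x. h x \<le> ennreal b) \<longrightarrow>
        Nmor \<tau> (T h) \<le> ennreal C * Nmor \<tau> (\<lambda>x. epowr (h x) (1/1))" using C(2) by simp
  show ?thesis
  proof (rule HboundI[OF C(1) D _ C'])
    fix f :: "'a \<Rightarrow> ennreal" and x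
    have "Hfun 1 q \<gamma> f x \<le> ennreal (geoC \<gamma>) * epowr (T f x) q"
      unfolding Hfun_def
    proof (rule isum_geometric_le[OF g'])
      fix K assume "ennreal (2 powr (of_int K * (\<gamma> * 1 / q))) \<le> Pav K (\<lambda>y. epowr (f y) 1) x"
      then have "ennreal (w K) \<le> T f x"
        unfolding T_def by (intro SUP_upper2[of K]) (auto simp: w_def)
      then have "epowr (ennreal (w K)) q \<le> epowr (T f x) q"
        using q by (intro epowr_mono) auto
      then show "ennreal (2 powr (of_int K * \<gamma>)) \<le> epowr (T f x) q"
        using q by (simp add: epowr_ennreal powr_powr w_def)
    qed
    then have "epowr (Hfun 1 q \<gamma> f x) (1 / q) \<le> epowr (ennreal (geoC \<gamma>) * epowr (T f x) q) (1 / q)"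
      using q by (intro epowr_mono) auto
    also have "\<dots> = ennreal (geoC \<gamma> powr (1 / q)) * T f x"
      using q geoC_pos[OF g'] by (simp add: epowr_mult epowr_ennreal epowr_epowr)
    finally show "epowr (Hfun 1 q \<gamma> f x) (1 / q) \<le> ennreal (geoC \<gamma> powr (1 / q)) * T (\<lambda>y. epowr (f y) 1) x"
      by simp
  qed (use meas in auto)
qed

text \<open>For \<open>p = q = 1\<close> the threshold equals the weight. The scales above
  \<open>R\<close> therefore add only weights not exceeding \<open>Z\<close>, whose geometric sum
  explains the localization constant \<open>geoC \<gamma>\<close>; the global bound is the one for
  minimal heavy cells.\<close>

lemma Hbound_neg:
  assumes g: "\<gamma> < - real DIM('a::euclidean_space)" and tau: "0 \<le> \<tau>" "\<tau> < 1"
  shows "Hbound \<tau> 1 1 1 \<gamma> TYPE('a)"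
proof -
  define w where "w K = 2 powr (of_int K * \<gamma>)" for K :: int
  have g': "\<gamma> \<noteq> 0" "\<gamma> + real DIM('a) \<noteq> 0" using g by auto
  define T where "T h x = (\<Sum>\<^sub>ZK. if ennreal (w K) \<le> Pav K h x then ennreal (w K) else 0)" for h :: "'a \<Rightarrow> ennreal" and x
  have meas: "T h \<in> borel_measurable borel" if [measurable]: "h \<in> borel_measurable borel" for h
    unfolding T_def by measurable
  let ?C0 = "(real (card (offsets :: 'a set)))\<^sup>2 * geoC (\<gamma> + real DIM('a))"
  have C0: "0 < ?C0" using card_offsets_pos[where 'a='a] geoC_pos[OF g'(2)] by simp
  obtain C where C: "C > 0" "\<And>h b. h \<in> borel_measurable borel \<longrightarrow> (\<forall>x. h x \<le> ennreal b) \<longrightarrow>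
        Nmor \<tau> (T h) \<le> ennreal C * Nmor \<tau> (\<lambda>x. epowr (h x) 1)"
  proof (atomize_elim, rule Nmor_localize[of 1 \<tau> ?C0 "geoC \<gamma>" T])
    fix h h' :: "'a \<Rightarrow> ennreal" and x R Z
    assume a: "\<And>K. 2 powr of_int K \<le> (R::real) \<Longrightarrow> Pav K h x \<le> Pav K h' x" "\<And>K. R < 2 powr of_int K \<Longrightarrow> epowr (Pav K h x) 1 \<le> Z"
    have "T h x \<le> (\<Sum>\<^sub>ZK. (if ennreal (w K) \<le> Pav K h' x then ennreal (w K) else 0) + (if ennreal (w K) \<le> Z then ennreal (w K) else 0))"
      unfolding T_def
    proof (rule isum_mono)
      fix K
      show "(if ennreal (w K) \<le> Pav K h x then ennreal (w K) else 0) \<le> (if ennreal (w K) \<le> Pav K h' x then ennreal (w K) else 0) + (if ennreal (w K) \<le> Z then ennreal (w K) else 0)"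
        using a(1)[of K] a(2)[of K] by (cases "2 powr of_int K \<le> R") auto
    qed
    also have "\<dots> = T h' x + (\<Sum>\<^sub>ZK. if ennreal (w K) \<le> Z then ennreal (w K) else 0)"
      unfolding T_def by (rule nn_integral_add) auto
    also have "\<dots> \<le> T h' x + ennreal (geoC \<gamma>) * Z"
      unfolding w_def using g' by (intro add_left_mono isum_geometric_le) auto
    finally show "T h x \<le> T h' x + ennreal (geoC \<gamma>) * Z" .
  next
    fix h :: "'a \<Rightarrow> ennreal" and b assume "h \<in> borel_measurable borel" "\<And>x. h x \<le> ennreal b"
    then show "(\<integral>\<^sup>+x. T h x \<partial>lborel) \<le> ennreal ?C0 * (\<integral>\<^sup>+ x. epowr (h x) 1 \<partial>lborel)"
      unfolding T_def epowr_1 w_def using g by (intro nn_integral_isum_heavy_weight_le) auto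
  qed (use tau C0 geoC_pos[OF g'(1)] meas in auto)
  have C': "\<And>h b. h \<in> borel_measurable borel \<longrightarrow> (\<forall>x. h x \<le> ennreal b) \<longrightarrow>
        Nmor \<tau> (T h) \<le> ennreal C * Nmor \<tau> (\<lambda>x. epowr (h x) (1/1))" using C(2) by simp
  show ?thesis
  proof (rule HboundI[OF C(1) zero_less_one _ C'])
    show "epowr (Hfun 1 1 \<gamma> f x) (1 / 1) \<le> ennreal 1 * T (\<lambda>y. epowr (f y) 1) x" for f x
      unfolding Hfun_def T_def w_def by simp
  qed (use meas in auto)
qed

section \<open>Differences of functions and averages of the gradient\<close>

definition C1_grad :: "('a::euclidean_space \<Rightarrow> real) \<Rightarrow> ('a \<Rightarrow> 'a) \<Rightarrow> bool" where
  "C1_grad f G \<longleftrightarrow> (\<forall>x. (f has_derivative (\<lambda>h. G x \<bullet> h)) (at x)) \<and> continuous_on UNIV G"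

lemma C1_grad_continuous: "C1_grad f G \<Longrightarrow> continuous_on UNIV f" "C1_grad f G \<Longrightarrow> continuous_on UNIV G"
  by (auto simp: C1_grad_def intro: has_derivative_continuous_on has_derivative_at_withinI)

lemma C1_grad_measurable: "C1_grad f G \<Longrightarrow> f \<in> borel_measurable borel" "C1_grad f G \<Longrightarrow> G \<in> borel_measurable borel"
  by (blast intro: borel_measurable_continuous_onI C1_grad_continuous)+

text \<open>Fundamental theorem of calculus along the segment from \<open>u\<close> to
  \<open>u + h\<close>. Leaving out the null set \<open>t = 0\<close> makes the parameter range a
  disjoint union of the dyadic intervals from \<open>2^(-j-1)\<close> to
  \<open>2^(-j)\<close>.\<close>

lemma C1_grad_diff_le:
  fixes f :: "'a::euclidean_space \<Rightarrow> real"
  assumes fG: "C1_grad f G"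
  shows "ennreal \<bar>f (u + h) - f u\<bar> \<le> (\<integral>\<^sup>+t. (if 0 < t \<and> t \<le> 1 then ennreal (norm h * norm (G (u + t *\<^sub>R h))) else 0) \<partial>lborel)"
proof -
  define \<phi> where "\<phi> t = G (u + t *\<^sub>R h) \<bullet> h" for t :: real
  have d: "DERIV (\<lambda>t. f (u + t *\<^sub>R h)) t :> \<phi> t" for t
  proof -
    have "((\<lambda>t. f (u + t *\<^sub>R h)) has_derivative (\<lambda>s. G (u + t *\<^sub>R h) \<bullet> (s *\<^sub>R h))) (at t)"
    proof (rule has_derivative_compose[where g=f and f="\<lambda>t. u + t *\<^sub>R h"])
      show "((\<lambda>t. u + t *\<^sub>R h) has_derivative (\<lambda>s. s *\<^sub>R h)) (at t)"
        by (auto intro!: derivative_eq_intros)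
      show "(f has_derivative (\<bullet>) (G (u + t *\<^sub>R h))) (at (u + t *\<^sub>R h))"
        using fG by (auto simp: C1_grad_def)
    qed
    then show ?thesis by (simp add: has_field_derivative_def \<phi>_def mult.commute[of _ "_ \<bullet> _"])
  qed
  have cont: "isCont \<phi> t" for t
  proof -
    have "continuous_on UNIV \<phi>" unfolding \<phi>_def using C1_grad_continuous(2)[OF fG]
      by (auto intro!: continuous_intros intro: continuous_on_compose2)
    then show ?thesis by (simp add: continuous_on_eq_continuous_at)
  qed
  have "has_bochner_integral lborel (\<lambda>t. \<phi> t * indicator {0..1} t) (f (u + 1 *\<^sub>R h) - f (u + 0 *\<^sub>R h))"
    using d cont by (intro has_bochner_integral_FTC_Icc_real) auto
  then have I: "integrable lborel (\<lambda>t. \<phi> t * indicator {0..1} t)" "integral\<^sup>L lborel (\<lambda>t. \<phi> t * indicator {0..1} t) = f (u + h) - f u"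
    by (auto simp: has_bochner_integral_iff)
  have "ennreal \<bar>f (u + h) - f u\<bar> \<le> (\<integral>\<^sup>+t. ennreal (norm (\<phi> t * indicator {0..1} t)) \<partial>lborel)"
    using integral_norm_bound_ennreal[OF I(1)] I(2) by simp
  also have "\<dots> \<le> (\<integral>\<^sup>+t. (if 0 < t \<and> t \<le> 1 then ennreal (norm h * norm (G (u + t *\<^sub>R h))) else 0) \<partial>lborel)"
  proof (rule nn_integral_mono_AE)
    have cs: "\<bar>\<phi> t\<bar> \<le> norm h * norm (G (u + t *\<^sub>R h))" for t
      using Cauchy_Schwarz_ineq2[of "G (u + t *\<^sub>R h)" h] by (simp add: \<phi>_def mult.commute)
    have "AE t in lborel. t \<noteq> (0::real)" by (rule AE_lborel_singleton)
    then show "AE t in lborel. ennreal (norm (\<phi> t * indicator {0..1} t)) \<le> (if 0 < t \<and> t \<le> 1 then ennreal (norm h * norm (G (u + t *\<^sub>R h))) else 0)"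
      by (rule eventually_mono) (use cs in \<open>auto simp: indicator_def intro!: ennreal_leI\<close>)
  qed
  finally show ?thesis .
qed

lemma nn_integral_Ioc_const: "a \<le> b \<Longrightarrow> (\<integral>\<^sup>+t. (if a < t \<and> t \<le> b then c else 0) \<partial>lborel) = c * ennreal (b - a)"
  for a b :: real
proof -
  assume "a \<le> b"
  have "(\<integral>\<^sup>+t. (if a < t \<and> t \<le> b then c else 0) \<partial>lborel) = (\<integral>\<^sup>+t. c * indicator {a<..b} t \<partial>lborel)"
    by (intro nn_integral_cong) auto
  then show ?thesis using \<open>a \<le> b\<close> by (simp add: nn_integral_cmult_indicator)
qed

text \<open>For fixed \<open>t\<close> the substitution \<open>w = t h\<close> turns the integral
  over \<open>h\<close> into an integral over the ball of radius \<open>t 2^m\<close>, with Jacobian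
  \<open>t^(-n)\<close>. For \<open>t\<close> between \<open>2^(-j-1)\<close> and
  \<open>2^(-j)\<close> this is comparable to an average at scale \<open>m - j\<close>, and the
  length of the \<open>t\<close>-interval supplies the weight \<open>2^(-j)\<close>.\<close>

lemma C1_grad_ball_oscillation:
  fixes f :: "'a::euclidean_space \<Rightarrow> real"
  assumes fG: "C1_grad f G"
  shows "(\<integral>\<^sup>+h. (if norm h < 2 powr of_int m then ennreal \<bar>f (u + h) - f u\<bar> else 0) \<partial>lborel)
    \<le> ennreal (2 powr (of_int m * (real DIM('a) + 1) + real DIM('a))) * (\<Sum>j. ennreal (2 powr - real j) * Pav (m - int j) (\<lambda>y. ennreal (norm (G y))) u)"
proof -
  let ?n = "real DIM('a)"
  let ?g = "\<lambda>y. ennreal (norm (G y))"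
  have [measurable]: "G \<in> borel_measurable borel" "f \<in> borel_measurable borel" using C1_grad_measurable[OF fG] by auto
  define c where "c j = ennreal (2 powr ((real j + 1) * ?n + of_int m)) * (ennreal (2 powr ((of_int m - real j) * ?n)) * Pav (m - int j) ?g u)" for j :: nat
  have inner: "(\<integral>\<^sup>+h. (if norm h < 2 powr of_int m \<and> 0 < t \<and> t \<le> 1 then ennreal (norm h * norm (G (u + t *\<^sub>R h))) else 0) \<partial>lborel)
     \<le> (\<Sum>j. if 2 powr - (real j + 1) < t \<and> t \<le> 2 powr - real j then c j else 0)" for t :: real
  proof (cases "0 < t \<and> t \<le> 1")
    case True
    \<comment> \<open>The index of the dyadic interval containing \<open>t\<close>; it is a natural
      number because \<open>t \<le> 1\<close>.\<close>
    define j where "j = nat \<lfloor>- log 2 t\<rfloor>"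
    have l: "0 \<le> - log 2 t" using True by simp
    then have "real j \<le> - log 2 t" "- log 2 t < real j + 1" unfolding j_def by linarith+
    then have "log 2 t \<le> - real j" "- (real j + 1) < log 2 t" by linarith+
    then have j: "t \<le> 2 powr - real j" "2 powr - (real j + 1) < t" using True
      by (auto simp: log_le_iff less_log_iff)
    define F where "F w = (if norm w < t * 2 powr of_int m then ?g (u + w) else 0)" for w
    have [measurable]: "F \<in> borel_measurable borel" unfolding F_def by measurable
    have "(\<integral>\<^sup>+h. (if norm h < 2 powr of_int m \<and> 0 < t \<and> t \<le> 1 then ennreal (norm h * norm (G (u + t *\<^sub>R h))) else 0) \<partial>lborel)
      \<le> (\<integral>\<^sup>+h. ennreal (2 powr of_int m) * F (0 + t *\<^sub>R h) \<partial>lborel)"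
      using True by (intro nn_integral_mono) (auto simp: F_def ennreal_mult[symmetric] intro!: ennreal_leI mult_right_mono)
    also have "\<dots> = ennreal (2 powr of_int m) * (\<integral>\<^sup>+h. F (0 + t *\<^sub>R h) \<partial>lborel)"
      by (rule nn_integral_cmult) measurable
    also have "(\<integral>\<^sup>+h. F (0 + t *\<^sub>R h) \<partial>lborel) = ennreal (t powr - ?n) * (\<integral>\<^sup>+w. F w \<partial>lborel)"
    proof -
      have "(\<integral>\<^sup>+w. F w \<partial>lborel) = ennreal (t powr ?n) * (\<integral>\<^sup>+h. F (0 + t *\<^sub>R h) \<partial>lborel)"
        using nn_integral_lborel_affine[of F t 0] True by (simp add: powr_realpow)
      moreover have "ennreal (t powr - ?n) * ennreal (t powr ?n) = 1" 
        using True ennreal_powr_uminus_cancel[of t "- ?n"] by simp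
      ultimately show ?thesis by (metis mult.assoc mult_1)
    qed
    also have "\<dots> \<le> ennreal (2 powr ((real j + 1) * ?n)) * (\<integral>\<^sup>+w. F w \<partial>lborel)"
    proof (intro mult_right_mono ennreal_leI)
      have "t powr - ?n \<le> (2 powr - (real j + 1)) powr - ?n"
        using j by (intro powr_mono2') auto
      then show "t powr - ?n \<le> 2 powr ((real j + 1) * ?n)" by (simp add: powr_powr algebra_simps)
    qed simp
    also have "(\<integral>\<^sup>+w. F w \<partial>lborel) \<le> (\<integral>\<^sup>+w. (if dist u (u + w) < 2 powr of_int (m - int j) then ?g (u + w) else 0) \<partial>lborel)"
    proof (intro nn_integral_mono)
      fix w
      have "t * 2 powr of_int m \<le> 2 powr - real j * 2 powr of_int m" using j by simp
      also have "\<dots> = 2 powr of_int (m - int j)" by (simp add: powr_add[symmetric])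
      finally show "F w \<le> (if dist u (u + w) < 2 powr of_int (m - int j) then ?g (u + w) else 0)"
        by (auto simp: F_def dist_norm)
    qed
    also have "\<dots> = (\<integral>\<^sup>+y. (if dist u y < 2 powr of_int (m - int j) then ?g y else 0) \<partial>lborel)"
      by (rule nn_integral_lborel_shift[where f="\<lambda>y. if dist u y < 2 powr of_int (m - int j) then ?g y else 0"]) measurable
    also have "\<dots> = ennreal (2 powr ((of_int m - real j) * ?n)) * Pav (m - int j) ?g u"
      unfolding Pav_def by (simp add: mult.assoc[symmetric])
    finally have "(\<integral>\<^sup>+h. (if norm h < 2 powr of_int m \<and> 0 < t \<and> t \<le> 1 then ennreal (norm h * norm (G (u + t *\<^sub>R h))) else 0) \<partial>lborel)
      \<le> ennreal (2 powr of_int m) * (ennreal (2 powr ((real j + 1) * ?n)) * (ennreal (2 powr ((of_int m - real j) * ?n)) * Pav (m - int j) ?g u))"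
      by (simp add: mult_left_mono)
    also have "\<dots> = c j" unfolding c_def by (simp add: powr_add ennreal_mult mult_ac)
    also have "\<dots> = (if 2 powr - (real j + 1) < t \<and> t \<le> 2 powr - real j then c j else 0)" using j by simp
    also have "\<dots> \<le> (\<Sum>j. if 2 powr - (real j + 1) < t \<and> t \<le> 2 powr - real j then c j else 0)"
      by (rule le_suminf_ennreal)
    finally show ?thesis .
  qed auto
  have "(\<integral>\<^sup>+h. (if norm h < 2 powr of_int m then ennreal \<bar>f (u + h) - f u\<bar> else 0) \<partial>lborel)
     \<le> (\<integral>\<^sup>+h. \<integral>\<^sup>+t. (if norm h < 2 powr of_int m \<and> 0 < t \<and> t \<le> 1 then ennreal (norm h * norm (G (u + t *\<^sub>R h))) else 0) \<partial>lborel \<partial>lborel)"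
    using C1_grad_diff_le[OF fG, of u] by (intro nn_integral_mono) auto
  also have "\<dots> = (\<integral>\<^sup>+t. \<integral>\<^sup>+h. (if norm h < 2 powr of_int m \<and> 0 < t \<and> t \<le> 1 then ennreal (norm h * norm (G (u + t *\<^sub>R h))) else 0) \<partial>lborel \<partial>lborel)"
    by (rule lborel_pair.Fubini'[symmetric]) measurable
  also have "\<dots> \<le> (\<integral>\<^sup>+t. (\<Sum>j. if 2 powr - (real j + 1) < t \<and> t \<le> 2 powr - real j then c j else 0) \<partial>lborel)"
    by (intro nn_integral_mono inner)
  also have "\<dots> = (\<Sum>j. \<integral>\<^sup>+t. (if 2 powr - (real j + 1) < t \<and> t \<le> 2 powr - real j then c j else 0) \<partial>lborel)"
    by (rule nn_integral_suminf) measurable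
  also have "\<dots> = (\<Sum>j. c j * ennreal (2 powr - real j - 2 powr - (real j + 1)))"
    by (intro suminf_cong nn_integral_Ioc_const) simp
  also have "\<dots> \<le> (\<Sum>j. ennreal (2 powr (of_int m * (?n + 1) + ?n)) * (ennreal (2 powr - real j) * Pav (m - int j) ?g u))"
  proof (intro suminf_le)
    fix j
    have "c j * ennreal (2 powr - real j - 2 powr - (real j + 1)) \<le> c j * ennreal (2 powr - real j)"
      by (intro mult_left_mono ennreal_leI) auto
    also have "\<dots> = ennreal (2 powr ((real j + 1) * ?n + of_int m) * 2 powr ((of_int m - real j) * ?n)) * (ennreal (2 powr - real j) * Pav (m - int j) ?g u)"
      unfolding c_def by (simp add: ennreal_mult mult_ac)
    also have "2 powr ((real j + 1) * ?n + of_int m) * 2 powr ((of_int m - real j) * ?n) = 2 powr (of_int m * (?n + 1) + ?n)"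
      by (simp add: powr_add[symmetric] algebra_simps)
    finally show "c j * ennreal (2 powr - real j - 2 powr - (real j + 1)) \<le> ennreal (2 powr (of_int m * (?n + 1) + ?n)) * (ennreal (2 powr - real j) * Pav (m - int j) ?g u)" .
  qed auto
  finally show ?thesis by simp
qed

text \<open>Compare both values with \<open>f z\<close> and integrate over \<open>z\<close> in the
  ball of radius \<open>2^k\<close> around \<open>x\<close>. Such \<open>z\<close> are within
  \<open>2^(k+1)\<close> of both \<open>x\<close> and \<open>y\<close>, which is why the averages
  start at scale \<open>k + 1\<close>.\<close>

lemma C1_grad_diff_le_averages:
  fixes f :: "'a::euclidean_space \<Rightarrow> real"
  assumes fG: "C1_grad f G" and xy: "dist x y < 2 powr of_int k"
  defines "g \<equiv> \<lambda>y. ennreal (norm (G y))"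
  shows "ennreal \<bar>f x - f y\<bar> \<le> ennreal (2 powr (of_int k + 2 * real DIM('a) + 1) / Bvol TYPE('a)) *
    (\<Sum>j. ennreal (2 powr - real j) * (Pav (k + 1 - int j) g x + Pav (k + 1 - int j) g y))"
proof -
  let ?n = "real DIM('a)" and ?b = "Bvol TYPE('a)"
  let ?C = "2 powr (of_int (k + 1) * (?n + 1) + ?n)"
  let ?S = "\<lambda>x. \<Sum>j. ennreal (2 powr - real j) * Pav (k + 1 - int j) g x"
  have b: "0 < ?b" by (rule Bvol_pos)
  have [measurable]: "G \<in> borel_measurable borel" "f \<in> borel_measurable borel" using C1_grad_measurable[OF fG] by auto
  have osc: "(\<integral>\<^sup>+z. (if dist v z < 2 powr of_int (k + 1) then ennreal \<bar>f z - f v\<bar> else 0) \<partial>lborel) \<le> ennreal ?C * ?S v" for v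
  proof -
    have "(\<integral>\<^sup>+z. (if dist v z < 2 powr of_int (k + 1) then ennreal \<bar>f z - f v\<bar> else 0) \<partial>lborel)
      = (\<integral>\<^sup>+h. (if dist v (v + h) < 2 powr of_int (k + 1) then ennreal \<bar>f (v + h) - f v\<bar> else 0) \<partial>lborel)"
      by (rule nn_integral_lborel_shift[symmetric, where f="\<lambda>z. if dist v z < 2 powr of_int (k + 1) then ennreal \<bar>f z - f v\<bar> else 0"]) measurable
    also have "\<dots> = (\<integral>\<^sup>+h. (if norm h < 2 powr of_int (k + 1) then ennreal \<bar>f (v + h) - f v\<bar> else 0) \<partial>lborel)"
      by (simp add: dist_norm)
    also note C1_grad_ball_oscillation[OF fG]
    finally show ?thesis by (simp add: g_def)
  qed
  have "ennreal \<bar>f x - f y\<bar> * ennreal (?b * (2 powr of_int k) ^ DIM('a)) = (\<integral>\<^sup>+z. (if dist x z < 2 powr of_int k then ennreal \<bar>f x - f y\<bar> else 0) \<partial>lborel)"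
    by (rule nn_integral_ball_const[symmetric]) simp
  also have "\<dots> \<le> (\<integral>\<^sup>+z. (if dist x z < 2 powr of_int (k + 1) then ennreal \<bar>f z - f x\<bar> else 0) + (if dist y z < 2 powr of_int (k + 1) then ennreal \<bar>f z - f y\<bar> else 0) \<partial>lborel)"
  proof (intro nn_integral_mono)
    fix z
    show "(if dist x z < 2 powr of_int k then ennreal \<bar>f x - f y\<bar> else 0) \<le> (if dist x z < 2 powr of_int (k + 1) then ennreal \<bar>f z - f x\<bar> else 0) + (if dist y z < 2 powr of_int (k + 1) then ennreal \<bar>f z - f y\<bar> else 0)"
    proof (cases "dist x z < 2 powr of_int k")
      case True
      have kk: "2 powr of_int (k + 1) = 2 * (2::real) powr of_int k" by (simp add: powr_add)
      have "dist x z < 2 powr of_int (k + 1)" "dist y z < 2 powr of_int (k + 1)"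
        using True xy dist_triangle3[of y z x] powr_gt_zero[of 2 "of_int k"] unfolding kk
        by (simp_all only: dist_commute) linarith+
      then show ?thesis by (auto simp: ennreal_plus[symmetric] simp del: ennreal_plus intro!: ennreal_leI)
    qed simp
  qed
  also have "\<dots> \<le> ennreal ?C * ?S x + ennreal ?C * ?S y"
    by (subst nn_integral_add, measurable) (rule add_mono[OF osc osc])
  also have "\<dots> = ennreal ?C * (\<Sum>j. ennreal (2 powr - real j) * (Pav (k + 1 - int j) g x + Pav (k + 1 - int j) g y))"
    unfolding distrib_left[symmetric] by (subst suminf_add[OF summableI summableI]) (simp add: distrib_left)
  finally have le: "ennreal \<bar>f x - f y\<bar> * ennreal (?b * (2 powr of_int k) ^ DIM('a)) \<le> \<dots>" .
  have v: "0 < ?b * (2 powr of_int k) ^ DIM('a)" using b by simp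
  let ?v = "?b * (2 powr of_int k) ^ DIM('a)"
  have "ennreal \<bar>f x - f y\<bar> = ennreal \<bar>f x - f y\<bar> * ennreal ?v * ennreal (1 / ?v)"
    using v b by (simp add: mult.assoc ennreal_mult[symmetric])
  also have "\<dots> \<le> ennreal ?C * (\<Sum>j. ennreal (2 powr - real j) * (Pav (k + 1 - int j) g x + Pav (k + 1 - int j) g y)) * ennreal (1 / ?v)"
    by (intro mult_right_mono le) simp
  also have "\<dots> = ennreal (?C * (1 / ?v)) * (\<Sum>j. ennreal (2 powr - real j) * (Pav (k + 1 - int j) g x + Pav (k + 1 - int j) g y))"
  proof -
    have "ennreal (?C * (1 / ?v)) = ennreal ?C * ennreal (1 / ?v)"
      using v by (intro ennreal_mult) auto
    then show ?thesis by (simp only: mult_ac)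
  qed
  also have "?C * (1 / ?v) = 2 powr (of_int k + 2 * ?n + 1) / ?b"
  proof -
    have "?C = 2 powr (of_int k + 2 * ?n + 1) * 2 powr (of_int k * ?n)"
      unfolding powr_add[symmetric] by (rule arg_cong[where f="(powr) 2"]) (simp add: algebra_simps)
    moreover have "(2 powr of_int k) ^ DIM('a) = (2::real) powr (of_int k * ?n)"
      by (simp add: powr_realpow[symmetric] powr_powr)
    ultimately show ?thesis using b by (simp only:) simp
  qed
  finally show ?thesis .
qed

text \<open>If all averages were below a multiple of \<open>2^(j \<eta>) 2^(k \<beta>)\<close>, the
  weights \<open>2^(-j)\<close> would still leave a convergent series because
  \<open>\<eta> < 1\<close>, and \<open>f x - f y\<close> would be too small. Jensen's inequality
  then passes from the average of \<open>\<bar>G\<bar>\<close> to that of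
  \<open>\<bar>G\<bar>^p\<close>.\<close>

lemma C1_grad_large_diff:
  fixes f :: "'a::euclidean_space \<Rightarrow> real"
  assumes \<eta>: "0 < \<eta>" "\<eta> < 1" and p: "1 \<le> p" and c1: "0 < c1"
  shows "\<exists>c>0. \<forall>(f::'a \<Rightarrow> real) G x y (k::int). C1_grad f G \<longrightarrow> dist x y < 2 powr of_int k \<longrightarrow>
     c1 * 2 powr (of_int k * (1 + \<beta>)) < \<bar>f x - f y\<bar> \<longrightarrow>
     (\<exists>j::nat. \<exists>z\<in>{x, y}. ennreal (c * 2 powr (real j * (\<eta> * p)) * 2 powr (of_int (k + 1) * (\<beta> * p)))
        \<le> Pav (k + 1 - int j) (\<lambda>y. epowr (ennreal (norm (G y))) p) z)"
proof -
  let ?n = "real DIM('a)" and ?b = "Bvol TYPE('a)"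
  have b: "0 < ?b" by (rule Bvol_pos)
  define C where "C = 2 powr (2 * ?n + 1) / ?b"
  have C: "0 < C" using b by (simp add: C_def)
  define \<rho> where "\<rho> = 2 powr (\<eta> - 1)"
  have r: "0 < \<rho>" "\<rho> < 1" using \<eta> by (auto simp: \<rho>_def powr_less_one)
  \<comment> \<open>Chosen so that the geometric series in the indirect argument adds up to exactly
    \<open>c1 2^(k (1 + \<beta>))\<close>.\<close>
  define c2 where "c2 = c1 * (1 - \<rho>) / (2 * C)"
  have c2: "0 < c2" using c1 r C by (simp add: c2_def)
  define CJ where "CJ = 2 * (2 * ?b) powr (p - 1)"
  have CJ: "0 < CJ" using b by (simp add: CJ_def)
  \<comment> \<open>\<open>CJ\<close> is the Jensen constant; the last factor rewrites the threshold
    in terms of the scale \<open>k + 1\<close>, the scale at which the averages begin.\<close>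
  define c where "c = c2 powr p / CJ * 2 powr - (\<beta> * p)"
  have c: "0 < c" using c2 CJ by (simp add: c_def)
  show ?thesis
  proof (intro exI[of _ c] conjI c allI impI)
    fix f :: "'a \<Rightarrow> real" and G :: "'a \<Rightarrow> 'a" and x y :: 'a and k :: int
    assume fG: "C1_grad f G" and xy: "dist x y < 2 powr of_int k"
      and big: "c1 * 2 powr (of_int k * (1 + \<beta>)) < \<bar>f x - f y\<bar>"
    have [measurable]: "G \<in> borel_measurable borel" using C1_grad_measurable[OF fG] by auto
    define g where "g y = ennreal (norm (G y))" for y
    have [measurable]: "g \<in> borel_measurable borel" unfolding g_def by measurable
    define s where "s j = c2 * 2 powr (real j * \<eta>) * 2 powr (of_int k * \<beta>)" for j :: nat
    have s: "0 < s j" for j using c2 by (simp add: s_def)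
    have ex: "\<exists>j. \<exists>z\<in>{x, y}. ennreal (s j) \<le> Pav (k + 1 - int j) g z"
    proof (rule ccontr)
      assume "\<not> ?thesis"
      then have lt: "Pav (k + 1 - int j) g x \<le> ennreal (s j)" "Pav (k + 1 - int j) g y \<le> ennreal (s j)" for j
        by (auto simp: not_le intro: less_imp_le)
      have "(\<Sum>j. ennreal (2 powr - real j) * (Pav (k + 1 - int j) g x + Pav (k + 1 - int j) g y))
         \<le> (\<Sum>j. ennreal (2 * c2 * 2 powr (of_int k * \<beta>) * \<rho> ^ j))"
      proof (intro suminf_le)
        fix j
        have "ennreal (2 powr - real j) * (Pav (k + 1 - int j) g x + Pav (k + 1 - int j) g y) \<le> ennreal (2 powr - real j) * (ennreal (s j) + ennreal (s j))"
          using lt by (intro mult_left_mono add_mono) auto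
        also have "\<dots> = ennreal (2 powr - real j * (s j + s j))"
          using s[of j] by (simp add: ennreal_plus[symmetric] ennreal_mult[symmetric] del: ennreal_plus)
        also have "2 powr - real j * (s j + s j) = 2 * c2 * 2 powr (of_int k * \<beta>) * \<rho> ^ j"
        proof -
          have "2 powr - real j * 2 powr (real j * \<eta>) = \<rho> ^ j"
            by (simp add: \<rho>_def powr_realpow[symmetric] powr_powr powr_add[symmetric] algebra_simps)
          then show ?thesis unfolding s_def by (metis (no_types, opaque_lifting) mult.assoc mult.commute mult_2)
        qed
        finally show "ennreal (2 powr - real j) * (Pav (k + 1 - int j) g x + Pav (k + 1 - int j) g y) \<le> ennreal (2 * c2 * 2 powr (of_int k * \<beta>) * \<rho> ^ j)" .
      qed auto
      also have "\<dots> = ennreal (2 * c2 * 2 powr (of_int k * \<beta>) * (1 / (1 - \<rho>)))"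
        using r c2 by (intro suminf_ennreal_eq sums_mult geometric_sums) auto
      finally have S: "(\<Sum>j. ennreal (2 powr - real j) * (Pav (k + 1 - int j) g x + Pav (k + 1 - int j) g y)) \<le> ennreal (2 * c2 * 2 powr (of_int k * \<beta>) * (1 / (1 - \<rho>)))" .
      have "2 powr (of_int k + 2 * ?n + 1) / ?b = C * 2 powr of_int k"
        by (simp add: C_def powr_add)
      then have "ennreal \<bar>f x - f y\<bar> \<le> ennreal (C * 2 powr of_int k) * (\<Sum>j. ennreal (2 powr - real j) * (Pav (k + 1 - int j) g x + Pav (k + 1 - int j) g y))"
        using C1_grad_diff_le_averages[OF fG xy] unfolding g_def by metis
      also have "\<dots> \<le> ennreal (C * 2 powr of_int k) * ennreal (2 * c2 * 2 powr (of_int k * \<beta>) * (1 / (1 - \<rho>)))"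
        by (intro mult_left_mono S) simp
      finally have "ennreal \<bar>f x - f y\<bar> \<le> ennreal (C * 2 powr of_int k) * ennreal (2 * c2 * 2 powr (of_int k * \<beta>) * (1 / (1 - \<rho>)))" .
      also have "\<dots> = ennreal (c1 * 2 powr (of_int k * (1 + \<beta>)))"
      proof -
        have "C * X * (2 * c2 * Y * (1 / (1 - \<rho>))) = c1 * (X * Y)" for X Y
          using C r by (simp add: c2_def field_simps)
        moreover have "2 powr (of_int k * (1 + \<beta>)) = 2 powr of_int k * 2 powr (of_int k * \<beta>)"
          by (simp add: powr_add[symmetric] algebra_simps)
        ultimately show ?thesis using C r c2 by (simp add: ennreal_mult[symmetric])
      qed
      finally have "\<bar>f x - f y\<bar> \<le> c1 * 2 powr (of_int k * (1 + \<beta>))"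
        using c1 by (subst (asm) ennreal_le_iff) auto
      then show False using big by simp
    qed
    then obtain j z where jz: "z \<in> {x, y}" "ennreal (s j) \<le> Pav (k + 1 - int j) g z" by blast
    have "epowr (ennreal (s j)) p \<le> epowr (Pav (k + 1 - int j) g z) p" using jz p by (intro epowr_mono) auto
    also have "\<dots> \<le> ennreal CJ * Pav (k + 1 - int j) (\<lambda>y. epowr (g y) p) z"
      unfolding CJ_def by (rule epowr_Pav_le) (use p in auto)
    finally have "ennreal (1 / CJ) * ennreal (s j powr p) \<le> ennreal (1 / CJ) * (ennreal CJ * Pav (k + 1 - int j) (\<lambda>y. epowr (g y) p) z)"
      using s[of j] by (intro mult_left_mono) (auto simp: epowr_ennreal less_imp_le)
    also have "\<dots> = Pav (k + 1 - int j) (\<lambda>y. epowr (g y) p) z"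
      using CJ by (simp add: mult.assoc[symmetric] ennreal_mult[symmetric])
    also have "ennreal (1 / CJ) * ennreal (s j powr p) = ennreal (c * 2 powr (real j * (\<eta> * p)) * 2 powr (of_int (k + 1) * (\<beta> * p)))"
    proof -
      have "2 powr - (\<beta> * p) * 2 powr (of_int (k + 1) * (\<beta> * p)) = 2 powr (of_int k * \<beta> * p)"
        by (simp add: powr_add[symmetric] algebra_simps)
      moreover have "s j powr p = c2 powr p * 2 powr (real j * (\<eta> * p)) * 2 powr (of_int k * \<beta> * p)"
        using c2 by (simp add: s_def powr_mult powr_powr mult.assoc)
      ultimately have "1 / CJ * s j powr p = c * 2 powr (real j * (\<eta> * p)) * 2 powr (of_int (k + 1) * (\<beta> * p))"
        unfolding c_def by (simp add: mult_ac)
      then show ?thesis using CJ by (simp add: ennreal_mult[symmetric])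
    qed
    finally show "\<exists>j. \<exists>z\<in>{x, y}. ennreal (c * 2 powr (real j * (\<eta> * p)) * 2 powr (of_int (k + 1) * (\<beta> * p)))
        \<le> Pav (k + 1 - int j) (\<lambda>y. epowr (ennreal (norm (G y))) p) z"
      using jz(1) unfolding g_def by blast
  qed
qed

section \<open>Domination by level functions\<close>

definition Hlev :: "real \<Rightarrow> real \<Rightarrow> real \<Rightarrow> ('a::euclidean_space \<Rightarrow> ennreal) \<Rightarrow> real \<Rightarrow> 'a \<Rightarrow> ennreal" where
  "Hlev p q \<gamma> g L x = (\<Sum>\<^sub>ZK. if ennreal (L * 2 powr (of_int K * (\<gamma> * p / q))) \<le> Pav K (\<lambda>y. epowr (g y) p) x
      then ennreal (2 powr (of_int K * \<gamma>)) else 0)"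

lemma borel_measurable_Hlev [measurable (raw)]:
  assumes [measurable]: "g \<in> borel_measurable borel" "f \<in> borel_measurable M"
  shows "(\<lambda>x. Hlev p q \<gamma> g L (f x)) \<in> borel_measurable M"
  unfolding Hlev_def by measurable

lemma ennreal_mult_le_iff: "0 < L \<Longrightarrow> ennreal (L * a) \<le> P \<longleftrightarrow> ennreal a \<le> ennreal (1 / L) * P"
proof safe
  assume L: "0 < L"
  { assume "ennreal (L * a) \<le> P"
    then have "ennreal (1 / L) * ennreal (L * a) \<le> ennreal (1 / L) * P" by (rule mult_left_mono) simp
    then show "ennreal a \<le> ennreal (1 / L) * P" using L by (cases "0 \<le> a") (auto simp: ennreal_mult[symmetric] ennreal_neg) }
  { assume "ennreal a \<le> ennreal (1 / L) * P"
    then have "ennreal L * ennreal a \<le> ennreal L * (ennreal (1 / L) * P)" by (rule mult_left_mono) simp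
    then show "ennreal (L * a) \<le> P" using L
      by (cases "0 \<le> a") (auto simp: mult.assoc[symmetric] ennreal_mult[symmetric] ennreal_neg mult_nonneg_nonpos) }
qed

lemma Pav_cmult:
  assumes [measurable]: "h \<in> borel_measurable borel"
  shows "Pav K (\<lambda>y. c * h y) x = c * Pav K h x"
  unfolding Pav_def by (subst nn_integral_if_cmult) (auto simp: mult_ac)

text \<open>Averages of \<open>g^p\<close> are homogeneous of degree \<open>p\<close>, so raising
  all thresholds by the factor \<open>L\<close> amounts to replacing \<open>g\<close> by
  \<open>L^(-1/p) g\<close>. The right side scales with the power \<open>r\<close>, whence the gain
  \<open>L^(-r/p)\<close>.\<close>

lemma Nmor_Hlev_le:
  assumes hb: "Hbound \<tau> p q r \<gamma> TYPE('a::euclidean_space)" and p: "0 < p" and q: "0 < q" and r: "0 < r"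
  shows "\<exists>C>0. \<forall>(g::'a \<Rightarrow> ennreal) b L. g \<in> borel_measurable borel \<longrightarrow> (\<forall>x. g x \<le> ennreal b) \<longrightarrow> 0 < L \<longrightarrow>
     Nmor \<tau> (\<lambda>x. epowr (Hlev p q \<gamma> g L x) (r / q)) \<le> ennreal (C * L powr (- r / p)) * Nmor \<tau> (\<lambda>x. epowr (g x) r)"
proof -
  from hb obtain C where C: "0 < C" "\<And>(g::'a \<Rightarrow> ennreal) b. g \<in> borel_measurable borel \<Longrightarrow> (\<forall>x. g x \<le> ennreal b) \<Longrightarrow>
     Nmor \<tau> (\<lambda>x. epowr (Hfun p q \<gamma> g x) (r / q)) \<le> ennreal C * Nmor \<tau> (\<lambda>x. epowr (g x) r)"
    unfolding Hbound_def by auto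
  show ?thesis
  proof (intro exI[of _ C] conjI C allI impI)
    fix g :: "'a \<Rightarrow> ennreal" and b L :: real
    assume g[measurable]: "g \<in> borel_measurable borel" and bdd: "\<forall>x. g x \<le> ennreal b" and L: "0 < L"
    define c where "c = L powr (- 1 / p)"
    have c: "0 < c" "c powr p = 1 / L" "c powr r = L powr (- r / p)"
    proof -
      show "0 < c" using L by (simp add: c_def)
      have "c powr p = L powr (- 1)" unfolding c_def powr_powr using p by simp
      then show "c powr p = 1 / L" using L by (simp add: powr_minus_divide)
      show "c powr r = L powr (- r / p)" unfolding c_def powr_powr by simp
    qed
    define g' where "g' y = ennreal c * g y" for y
    have [measurable]: "g' \<in> borel_measurable borel" unfolding g'_def by measurable
    have bdd': "\<forall>x. g' x \<le> ennreal (c * max b 0)"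
    proof
      fix x
      have "g' x \<le> ennreal c * ennreal (max b 0)" unfolding g'_def
        using bdd by (intro mult_left_mono) (auto intro: order_trans[OF _ ennreal_leI])
      then show "g' x \<le> ennreal (c * max b 0)" using c by (simp add: ennreal_mult)
    qed
    have "Hlev p q \<gamma> g L x = Hfun p q \<gamma> g' x" for x
    proof -
      have "Pav K (\<lambda>y. epowr (g' y) p) x = ennreal (1 / L) * Pav K (\<lambda>y. epowr (g y) p) x" for K
        unfolding g'_def using p c by (simp add: epowr_mult epowr_ennreal Pav_cmult)
      then show ?thesis unfolding Hlev_def Hfun_def by (simp only: ennreal_mult_le_iff[OF L])
    qed
    then have "Nmor \<tau> (\<lambda>x. epowr (Hlev p q \<gamma> g L x) (r / q)) \<le> ennreal C * Nmor \<tau> (\<lambda>x. epowr (g' x) r)"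
      using C(2)[OF _ bdd'] by simp
    also have "Nmor \<tau> (\<lambda>x. epowr (g' x) r) = ennreal (L powr (- r / p)) * Nmor \<tau> (\<lambda>x. epowr (g x) r)"
      unfolding g'_def using r c by (simp add: epowr_mult epowr_ennreal Nmor_cmult)
    finally show "Nmor \<tau> (\<lambda>x. epowr (Hlev p q \<gamma> g L x) (r / q)) \<le> ennreal (C * L powr (- r / p)) * Nmor \<tau> (\<lambda>x. epowr (g x) r)"
      using C(1) by (simp add: ennreal_mult mult.assoc)
  qed
qed

text \<open>The decay \<open>\<rho> = \<sigma>^2\<close> is spent in two halves: one factor
  \<open>\<sigma>^i\<close> pays for the weights of \<open>epowr_suminf_le\<close>, the other makes
  the series of norms converge.\<close>

lemma Nmor_superposition:
  assumes t: "0 < \<theta>" and r: "0 < \<rho>" "\<rho> < (1::real)"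
  shows "\<exists>C>0. \<forall>(U::nat \<Rightarrow> 'a::euclidean_space \<Rightarrow> ennreal) M. (\<forall>i. U i \<in> borel_measurable borel) \<longrightarrow>
    (\<forall>i. Nmor \<tau> (\<lambda>x. epowr (U i x) \<theta>) \<le> ennreal (\<rho> ^ i) * M) \<longrightarrow>
    Nmor \<tau> (\<lambda>x. epowr (\<Sum>i. U i x) \<theta>) \<le> ennreal C * M"
proof -
  define \<sigma> where "\<sigma> = sqrt \<rho>"
  have s: "0 < \<sigma>" "\<sigma> < 1" "\<rho> = \<sigma> * \<sigma>" using r by (auto simp: \<sigma>_def)
  obtain C where C: "0 < C" "\<And>u. epowr (\<Sum>j. u j) \<theta> \<le> ennreal C * (\<Sum>j. ennreal (\<sigma> powr - real j) * epowr (u j) \<theta>)"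
    using epowr_suminf_le[OF t s(1,2)] by blast
  show ?thesis
  proof (intro exI[of _ "C * (1 / (1 - \<sigma>))"] conjI allI impI)
    show "0 < C * (1 / (1 - \<sigma>))" using C s by simp
    fix U :: "nat \<Rightarrow> 'a \<Rightarrow> ennreal" and M
    assume "\<forall>i. U i \<in> borel_measurable borel" and b: "\<forall>i. Nmor \<tau> (\<lambda>x. epowr (U i x) \<theta>) \<le> ennreal (\<rho> ^ i) * M"
    then have [measurable]: "U i \<in> borel_measurable borel" for i by simp
    have "Nmor \<tau> (\<lambda>x. epowr (\<Sum>i. U i x) \<theta>) \<le> Nmor \<tau> (\<lambda>x. ennreal C * (\<Sum>j. ennreal (\<sigma> powr - real j) * epowr (U j x) \<theta>))"
      by (intro Nmor_mono C)
    also have "\<dots> = ennreal C * Nmor \<tau> (\<lambda>x. (\<Sum>j. ennreal (\<sigma> powr - real j) * epowr (U j x) \<theta>))"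
      by (rule Nmor_cmult) measurable
    also have "\<dots> \<le> ennreal C * (\<Sum>j. Nmor \<tau> (\<lambda>x. ennreal (\<sigma> powr - real j) * epowr (U j x) \<theta>))"
      by (intro mult_left_mono Nmor_suminf) auto
    also have "\<dots> \<le> ennreal C * (\<Sum>j. ennreal (\<sigma> ^ j) * M)"
    proof (intro mult_left_mono suminf_le)
      fix j
      have "Nmor \<tau> (\<lambda>x. ennreal (\<sigma> powr - real j) * epowr (U j x) \<theta>) = ennreal (\<sigma> powr - real j) * Nmor \<tau> (\<lambda>x. epowr (U j x) \<theta>)"
        by (rule Nmor_cmult) measurable
      also have "\<dots> \<le> ennreal (\<sigma> powr - real j) * (ennreal (\<rho> ^ j) * M)"
        using b by (intro mult_left_mono) auto
      also have "\<dots> = ennreal (\<sigma> powr - real j * \<rho> ^ j) * M"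
        using r by (simp add: ennreal_mult mult.assoc)
      also have "\<sigma> powr - real j * \<rho> ^ j = \<sigma> ^ j"
        using s by (simp add: power_mult_distrib powr_minus powr_realpow)
      finally show "Nmor \<tau> (\<lambda>x. ennreal (\<sigma> powr - real j) * epowr (U j x) \<theta>) \<le> ennreal (\<sigma> ^ j) * M" .
    qed auto
    also have "(\<Sum>j. ennreal (\<sigma> ^ j) * M) = ennreal (1 / (1 - \<sigma>)) * M"
    proof -
      have "(\<Sum>j. ennreal (\<sigma> ^ j)) = ennreal (1 / (1 - \<sigma>))"
        using s by (intro suminf_ennreal_eq geometric_sums) auto
      then show ?thesis by simp
    qed
    finally show "Nmor \<tau> (\<lambda>x. epowr (\<Sum>i. U i x) \<theta>) \<le> ennreal (C * (1 / (1 - \<sigma>))) * M"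
      using C s by (simp add: ennreal_mult[symmetric] mult.assoc[symmetric])
  qed
qed

text \<open>By Tonelli's theorem each \<open>w\<close> is counted with the volume of the ball of
  radius \<open>2^m\<close> around it, which cancels the normalisation of the average. As
  \<open>m \<le> K\<close>, only \<open>w\<close> within \<open>2^(K+1)\<close> of \<open>x\<close>
  occur.\<close>

lemma nn_integral_ball_Pav_le:
  fixes h :: "'a::euclidean_space \<Rightarrow> ennreal"
  assumes [measurable]: "h \<in> borel_measurable borel" and m: "m \<le> K"
  shows "(\<integral>\<^sup>+y. (if dist x y < 2 powr of_int K then Pav m h y else 0) \<partial>lborel)
     \<le> ennreal (Bvol TYPE('a) * 2 powr ((of_int K + 1) * real DIM('a))) * Pav (K + 1) h x"
proof -
  let ?n = "real DIM('a)"
  have b: "0 < Bvol TYPE('a)" by (rule Bvol_pos)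
  have le: "2 powr of_int m \<le> (2::real) powr of_int K" using m by simp
  have "(\<integral>\<^sup>+y. (if dist x y < 2 powr of_int K then Pav m h y else 0) \<partial>lborel)
    = (\<integral>\<^sup>+y. \<integral>\<^sup>+w. (if dist x y < 2 powr of_int K \<and> dist y w < 2 powr of_int m then ennreal (2 powr - (of_int m * ?n)) * h w else 0) \<partial>lborel \<partial>lborel)"
    unfolding Pav_def by (intro nn_integral_cong) (auto simp: nn_integral_if_cmult)
  also have "\<dots> = (\<integral>\<^sup>+w. \<integral>\<^sup>+y. (if dist x y < 2 powr of_int K \<and> dist y w < 2 powr of_int m then ennreal (2 powr - (of_int m * ?n)) * h w else 0) \<partial>lborel \<partial>lborel)"
    by (rule lborel_pair.Fubini'[symmetric]) measurable
  also have "\<dots> \<le> (\<integral>\<^sup>+w. ennreal (Bvol TYPE('a)) * (if dist x w < 2 powr of_int (K + 1) then h w else 0) \<partial>lborel)"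
  proof (intro nn_integral_mono)
    fix w
    show "(\<integral>\<^sup>+y. (if dist x y < 2 powr of_int K \<and> dist y w < 2 powr of_int m then ennreal (2 powr - (of_int m * ?n)) * h w else 0) \<partial>lborel)
       \<le> ennreal (Bvol TYPE('a)) * (if dist x w < 2 powr of_int (K + 1) then h w else 0)"
    proof (cases "dist x w < 2 powr of_int (K + 1)")
      case True
      have "(\<integral>\<^sup>+y. (if dist x y < 2 powr of_int K \<and> dist y w < 2 powr of_int m then ennreal (2 powr - (of_int m * ?n)) * h w else 0) \<partial>lborel)
        \<le> (\<integral>\<^sup>+y. (if dist w y < 2 powr of_int m then ennreal (2 powr - (of_int m * ?n)) * h w else 0) \<partial>lborel)"
        by (intro nn_integral_mono) (auto simp: dist_commute)
      also have "\<dots> = ennreal (2 powr - (of_int m * ?n)) * h w * ennreal (Bvol TYPE('a) * (2 powr of_int m) ^ DIM('a))"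
        by (rule nn_integral_ball_const) simp
      also have "(2 powr of_int m) ^ DIM('a) = (2::real) powr (of_int m * ?n)"
        by (simp add: powr_realpow[symmetric] powr_powr)
      also have "ennreal (2 powr - (of_int m * ?n)) * h w * ennreal (Bvol TYPE('a) * 2 powr (of_int m * ?n))
         = ennreal (Bvol TYPE('a)) * h w * (ennreal (2 powr - (of_int m * ?n)) * ennreal (2 powr (of_int m * ?n)))"
        using b by (simp only: ennreal_mult[OF less_imp_le[OF b] powr_ge_zero] mult_ac)
      finally show ?thesis using True by simp
    next
      case False
      have "\<not> (dist x y < 2 powr of_int K \<and> dist y w < 2 powr of_int m)" for y
      proof
        assume "dist x y < 2 powr of_int K \<and> dist y w < 2 powr of_int m"
        then have "dist x w < 2 powr of_int K + 2 powr of_int K" using le dist_triangle[of x w y] by linarith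
        then show False using False by (simp add: powr_add)
      qed
      then show ?thesis by (simp only: if_False) simp
    qed
  qed
  also have "\<dots> = ennreal (Bvol TYPE('a)) * (\<integral>\<^sup>+w. (if dist x w < 2 powr of_int (K + 1) then h w else 0) \<partial>lborel)"
    by (rule nn_integral_cmult) measurable
  also have "\<dots> = ennreal (Bvol TYPE('a) * 2 powr ((of_int K + 1) * ?n)) * Pav (K + 1) h x"
    using b unfolding Pav_def by (simp add: ennreal_mult mult.assoc less_imp_le) (simp add: mult.assoc[symmetric])
  finally show ?thesis .
qed

lemma Pav_le_larger:
  fixes h :: "'a::euclidean_space \<Rightarrow> ennreal"
  assumes "dist x y < 2 powr of_int K"
  shows "Pav (K - int j) h y \<le> ennreal (2 powr ((real j + 1) * real DIM('a))) * Pav (K + 1) h x"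
proof -
  let ?n = "real DIM('a)"
  have "2 powr of_int (K - int j) \<le> (2::real) powr of_int K" by simp
  then have sub: "dist x w < 2 powr of_int (K + 1)" if "dist y w < 2 powr of_int (K - int j)" for w
    using assms that dist_triangle[of x w y] by (simp add: powr_add del: powr_le_cancel_iff of_int_diff of_int_of_nat_eq)
  have "Pav (K - int j) h y \<le> ennreal (2 powr - (of_int (K - int j) * ?n)) * (\<integral>\<^sup>+w. (if dist x w < 2 powr of_int (K + 1) then h w else 0) \<partial>lborel)"
    unfolding Pav_def using sub by (intro mult_left_mono nn_integral_mono) auto
  also have "2 powr - (of_int (K - int j) * ?n) = 2 powr ((real j + 1) * ?n) * 2 powr - (of_int (K + 1) * ?n)"
    by (simp add: powr_add[symmetric] algebra_simps)
  finally show ?thesis unfolding Pav_def by (simp add: ennreal_mult mult.assoc)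
qed

text \<open>Chebyshev's inequality for the averages at scale \<open>K - j\<close>, weakened by the power \<open>s \<le> 1\<close> and split according
  to the dyadic size of the average at scale \<open>K + 1\<close>, which cannot be smaller than \<open>T 2^(-(j+1) n)\<close>
  unless the set is empty.\<close>

lemma level_set_Pav_le:
  fixes h :: "'a::euclidean_space \<Rightarrow> ennreal"
  assumes [measurable]: "h \<in> borel_measurable borel" and T: "0 < T" and s: "0 < s" "s \<le> 1"
  shows "(\<integral>\<^sup>+y. (if dist x y < 2 powr of_int K \<and> ennreal T \<le> Pav (K - int j) h y then 1 else 0) \<partial>lborel)
    \<le> ennreal (Bvol TYPE('a) * 2 powr real DIM('a) * 2 powr (of_int K * real DIM('a))) *
       (\<Sum>i. ennreal (2 powr (s * (real i + 1 - (real j + 1) * real DIM('a)))) *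
          (if ennreal (T * 2 powr (real i - (real j + 1) * real DIM('a))) \<le> Pav (K + 1) h x then 1 else 0))"
    (is "?Y \<le> ennreal ?A * ?S")
proof -
  let ?n = "real DIM('a)" and ?b = "Bvol TYPE('a)"
  have b: "0 < ?b" by (rule Bvol_pos)
  have A: "0 < ?A" using b by simp
  define N where "N = (real j + 1) * ?n"
  define z where "z = Pav (K + 1) h x"
  have "?Y \<le> (\<integral>\<^sup>+y. (if dist x y < 2 powr of_int K then 1 else 0) \<partial>lborel)"
    by (intro nn_integral_mono) auto
  also have "\<dots> = 1 * ennreal (?b * (2 powr of_int K) ^ DIM('a))" by (rule nn_integral_ball_const) simp
  also have "\<dots> \<le> ennreal ?A"
  proof -
    have "?b * 2 powr (of_int K * ?n) * 1 \<le> ?b * 2 powr (of_int K * ?n) * 2 powr ?n"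
      using b by (intro mult_left_mono ge_one_powr_ge_zero) auto
    moreover have "(2 powr of_int K) ^ DIM('a) = (2::real) powr (of_int K * ?n)"
      by (simp add: powr_realpow[symmetric] powr_powr)
    ultimately show ?thesis by (simp add: ennreal_leI mult_ac)
  qed
  finally have Y1: "?Y \<le> ennreal ?A" .
  have "ennreal T * ?Y = (\<integral>\<^sup>+y. ennreal T * (if dist x y < 2 powr of_int K \<and> ennreal T \<le> Pav (K - int j) h y then 1 else 0) \<partial>lborel)"
    by (rule nn_integral_cmult[symmetric]) measurable
  also have "\<dots> \<le> (\<integral>\<^sup>+y. (if dist x y < 2 powr of_int K then Pav (K - int j) h y else 0) \<partial>lborel)"
    by (intro nn_integral_mono) auto
  also have "\<dots> \<le> ennreal (?b * 2 powr ((of_int K + 1) * ?n)) * z"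
    unfolding z_def by (rule nn_integral_ball_Pav_le) auto
  also have "?b * 2 powr ((of_int K + 1) * ?n) = ?A" by (simp add: powr_add[symmetric] algebra_simps)
  finally have Y2: "ennreal T * ?Y \<le> ennreal ?A * z" .
  show ?thesis
  proof (cases "\<exists>y. dist x y < 2 powr of_int K \<and> ennreal T \<le> Pav (K - int j) h y")
    case False
    then have "?Y = (\<integral>\<^sup>+y. 0 \<partial>(lborel :: 'a measure))" by (intro nn_integral_cong) auto
    then show ?thesis by simp
  next
    case True
    then have Tz: "ennreal T \<le> ennreal (2 powr N) * z"
      unfolding z_def N_def using Pav_le_larger[of x _ K j h] order_trans by blast
    show ?thesis
    proof (cases "ennreal T \<le> z")
      case True
      \<comment> \<open>Here the average at scale \<open>K + 1\<close> already reaches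
        \<open>T\<close>. This \<open>i\<close> makes the threshold equal to \<open>T\<close> and
        the weight equal to \<open>2^s \<ge> 1\<close>, so a single term of the series outweighs the
        trivial bound \<open>Y1\<close>.\<close>
      define i where "i = (j + 1) * DIM('a)"
      have i: "real i = N" by (simp add: i_def N_def algebra_simps)
      have "1 \<le> ennreal (2 powr (s * (real i + 1 - N)))"
        using s i ge_one_powr_ge_zero[of 2 s] by (simp add: ennreal_leI[of 1, simplified])
      also have "\<dots> = ennreal (2 powr (s * (real i + 1 - N))) * (if ennreal (T * 2 powr (real i - N)) \<le> z then 1 else 0)"
        using True i by simp
      also have "\<dots> \<le> ?S" unfolding N_def z_def by (rule le_suminf_ennreal)
      finally have "ennreal ?A * 1 \<le> ennreal ?A * ?S" by (intro mult_left_mono) auto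
      with Y1 show ?thesis by simp
    next
      case False
      then obtain w where w: "z = ennreal w" "0 \<le> w" by (cases z) auto
      have wT: "w < T" using False w by (simp add: ennreal_le_iff not_le)
      have Tw: "T \<le> 2 powr N * w" using Tz w T by (simp add: ennreal_mult[symmetric] ennreal_le_iff)
      then have w0: "0 < w" using T w by (cases "w = 0") auto
      \<comment> \<open>The dyadic size of \<open>w 2^N / T\<close>. It is at least 1 by
        \<open>Tw\<close>, so the index is a natural number.\<close>
      define i where "i = nat \<lfloor>log 2 (w * 2 powr N / T)\<rfloor>"
      have "0 \<le> log 2 (w * 2 powr N / T)" using Tw T w0 by (simp add: zero_le_log_cancel_iff field_simps)
      then have "real i \<le> log 2 (w * 2 powr N / T)" "log 2 (w * 2 powr N / T) \<le> real i + 1"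
        unfolding i_def by linarith+
      then have i: "2 powr real i \<le> w * 2 powr N / T" "w * 2 powr N / T \<le> 2 powr (real i + 1)"
        using w0 T by (auto simp: le_log_iff log_le_iff)
      have i1: "T * 2 powr (real i - N) \<le> w" using i(1) T by (simp add: powr_diff field_simps)
      have i2: "w / T \<le> 2 powr (real i + 1 - N)" using i(2) T by (simp add: powr_diff field_simps)
      \<comment> \<open>Chebyshev's bound \<open>w / T\<close> is below 1 here, so lowering its
        exponent to \<open>s \<le> 1\<close> only enlarges it.\<close>
      have "w / T \<le> (w / T) powr s"
        using powr_mono'[of s 1 "w / T"] s w0 wT T by simp
      also have "\<dots> \<le> (2 powr (real i + 1 - N)) powr s"
        using i2 s w0 T by (intro powr_mono2) auto
      also have "\<dots> = 2 powr (s * (real i + 1 - N))" by (simp add: powr_powr mult.commute)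
      finally have "ennreal (w / T) \<le> ennreal (2 powr (s * (real i + 1 - N)))" by (rule ennreal_leI)
      also have "\<dots> = ennreal (2 powr (s * (real i + 1 - N))) * (if ennreal (T * 2 powr (real i - N)) \<le> z then 1 else 0)"
        using i1 w by (simp add: ennreal_leI)
      also have "\<dots> \<le> ?S" unfolding N_def z_def by (rule le_suminf_ennreal)
      finally have "ennreal ?A * ennreal (w / T) \<le> ennreal ?A * ?S" by (intro mult_left_mono) auto
      moreover have "?Y \<le> ennreal ?A * ennreal (w / T)"
      proof -
        have "?Y = ennreal (1 / T) * (ennreal T * ?Y)"
          using T by (simp add: mult.assoc[symmetric] ennreal_mult[symmetric])
        also have "\<dots> \<le> ennreal (1 / T) * (ennreal ?A * z)" by (intro mult_left_mono Y2) simp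
        also have "\<dots> = ennreal ?A * ennreal (w / T)"
          using T w A by (simp add: ennreal_mult[symmetric] field_simps)
        finally show ?thesis .
      qed
      ultimately show ?thesis by (rule order_trans[rotated])
    qed
  qed
qed

text \<open>Compares powers of a distance with powers of its dyadic scale when the sign of the
  exponent is unknown.\<close>

lemma powr_le_on_unit:
  assumes "a \<le> x" "x \<le> 1" "0 < (a::real)"
  shows "x powr e \<le> a powr - \<bar>e\<bar>" "a powr \<bar>e\<bar> \<le> x powr e"
proof -
  have a: "a \<le> 1" using assms by simp
  show "x powr e \<le> a powr - \<bar>e\<bar>"
  proof (cases "0 \<le> e")
    case True
    then have "x powr e \<le> 1 powr e" using assms by (intro powr_mono2) auto
    also have "\<dots> \<le> a powr - \<bar>e\<bar>" using a assms powr_mono'[of "- \<bar>e\<bar>" 0 a] by simp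
    finally show ?thesis .
  next
    case False
    then show ?thesis using assms by (auto intro!: powr_mono2')
  qed
  show "a powr \<bar>e\<bar> \<le> x powr e"
  proof (cases "0 \<le> e")
    case True then show ?thesis using assms by (auto intro!: powr_mono2)
  next
    case False
    have "a powr \<bar>e\<bar> \<le> 1 powr \<bar>e\<bar>" using a assms by (intro powr_mono2) auto
    also have "\<dots> \<le> x powr e" using False assms powr_mono'[of e 0 x] by auto
    finally show ?thesis .
  qed
qed

section \<open>The inner integral and its decomposition into dyadic scales\<close>

definition Dint :: "real \<Rightarrow> real \<Rightarrow> real \<Rightarrow> ('a::euclidean_space \<Rightarrow> real) \<Rightarrow> 'a \<Rightarrow> ennreal" where
  "Dint lam \<gamma> q f x = (\<integral>\<^sup>+ y. indicator (Eset lam (\<gamma> / q) f) (x, y) *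
                    ennreal (dist x y powr (\<gamma> - real DIM('a))) \<partial>lborel)"

lemma Efun_eq_Dint: "Efun lam \<gamma> q f x = epowr (Dint lam \<gamma> q f x) (1/q)"
  unfolding Efun_def Dint_def nn_integral_completion ..

lemma pred_Eset [measurable (raw)]:
  assumes [measurable]: "f \<in> borel_measurable borel" "u \<in> borel_measurable M" "v \<in> borel_measurable M"
  shows "Measurable.pred M (\<lambda>x. (u x, v x) \<in> Eset lam \<beta> f)"
  unfolding Eset_def by simp

lemma Dint_altdef:
  "Dint lam \<gamma> q f x = (\<integral>\<^sup>+ y. (if (x, y) \<in> Eset lam (\<gamma> / q) f then ennreal (dist x y powr (\<gamma> - real DIM('a))) else 0) \<partial>lborel)"
  for x :: "'a::euclidean_space"
  unfolding Dint_def by (intro nn_integral_cong) (auto simp: indicator_def)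

lemma borel_measurable_Dint [measurable (raw)]:
  assumes [measurable]: "f \<in> borel_measurable borel"
  shows "Dint lam \<gamma> q f \<in> borel_measurable borel"
  unfolding Dint_altdef[abs_def] by measurable

text \<open>A point \<open>y\<close> of the level set with
  \<open>2^(k-1) \<le> \<bar>x - y\<bar> < 2^k\<close> is charged to the scale
  \<open>K = k + 1\<close>. There some average around \<open>x\<close> or around \<open>y\<close> is
  large; in the first case the whole ball around \<open>x\<close> is counted, in the second only the
  points \<open>y\<close> concerned.\<close>

lemma Dint_le_levels:
  assumes \<eta>: "0 < \<eta>" "\<eta> < 1" and p: "1 \<le> p"
  shows "\<exists>c>0. \<exists>C>0. \<forall>(f::'a::euclidean_space \<Rightarrow> real) G x. C1_grad f G \<longrightarrow>
    Dint 1 \<gamma> q f x \<le> ennreal C * (\<Sum>\<^sub>ZK. ennreal (2 powr (of_int K * (\<gamma> - real DIM('a)))) * (\<Sum>j::nat.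
       (let T = ennreal (c * 2 powr (real j * (\<eta> * p)) * 2 powr (of_int K * (\<gamma> / q * p)));
            P = Pav (K - int j) (\<lambda>y. epowr (ennreal (norm (G y))) p) in
        (if T \<le> P x then ennreal (Bvol TYPE('a) * 2 powr (of_int K * real DIM('a))) else 0) +
        (\<integral>\<^sup>+y. (if dist x y < 2 powr of_int K \<and> T \<le> P y then 1 else 0) \<partial>lborel))))"
proof -
  let ?n = "real DIM('a)" and ?\<beta> = "\<gamma> / q"
  let ?e = "\<gamma> - ?n"
  \<comment> \<open>Comparison constant for \<open>\<bar>x - y\<bar>^(1 + \<gamma>/q)\<close> and
    \<open>2^(k (1 + \<gamma>/q))\<close>: the quotient of the bases lies between 1/2 and 1.\<close>
  define c1 :: real where "c1 = (1/2) powr \<bar>1 + ?\<beta>\<bar>"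
  have c1: "0 < c1" by (simp add: c1_def)
  obtain c where c: "0 < c" and big: "\<And>(f::'a \<Rightarrow> real) G x y (k::int). C1_grad f G \<Longrightarrow> dist x y < 2 powr of_int k \<Longrightarrow>
     c1 * 2 powr (of_int k * (1 + ?\<beta>)) < \<bar>f x - f y\<bar> \<Longrightarrow>
     (\<exists>j::nat. \<exists>z\<in>{x, y}. ennreal (c * 2 powr (real j * (\<eta> * p)) * 2 powr (of_int (k + 1) * (?\<beta> * p)))
        \<le> Pav (k + 1 - int j) (\<lambda>y. epowr (ennreal (norm (G y))) p) z)"
    using C1_grad_large_diff[OF \<eta> p c1, of ?\<beta>, where 'a='a] by blast
  \<comment> \<open>The kernel is compared with the scale \<open>K = k + 1\<close> instead of
    \<open>k\<close>, so the quotient of the bases can be as small as 1/4.\<close>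
  define C :: real where "C = (1/4) powr - \<bar>?e\<bar>"
  have C: "0 < C" by (simp add: C_def)
  show ?thesis
  proof (rule exI[of _ c], rule conjI[OF c], rule exI[of _ C], rule conjI[OF C], intro allI impI)
    fix f :: "'a \<Rightarrow> real" and G x
    assume fG: "C1_grad f G"
    note [measurable] = C1_grad_measurable[OF fG]
    define h where "h y = epowr (ennreal (norm (G y))) p" for y
    have [measurable]: "h \<in> borel_measurable borel" unfolding h_def by measurable
    define T where "T K j = ennreal (c * 2 powr (real j * (\<eta> * p)) * 2 powr (of_int K * (?\<beta> * p)))" for K :: int and j :: nat
    define A where "A K j z \<longleftrightarrow> T K j \<le> Pav (K - int j) h z" for K j z
    have [measurable]: "Measurable.pred borel (A K j)" for K j unfolding A_def by measurable
    define Y where "Y K j y = (if dist x y < 2 powr of_int K then (if A K j x then 1 else 0) + (if A K j y then 1 else 0) else (0::ennreal))" for K j y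
    have [measurable]: "Y K j \<in> borel_measurable borel" for K j unfolding Y_def by measurable
    have ptw: "(if (x, y) \<in> Eset 1 ?\<beta> f then ennreal (dist x y powr ?e) else 0)
       \<le> (\<Sum>\<^sub>ZK. ennreal (C * 2 powr (of_int K * ?e)) * (\<Sum>j. Y K j y))" for y
    proof (cases "(x, y) \<in> Eset 1 ?\<beta> f")
      case True
      define d where "d = dist x y"
      from True have d: "0 < d" "d powr (1 + ?\<beta>) < \<bar>f x - f y\<bar>"
        by (auto simp: Eset_def d_def less_divide_eq)
      define k where "k = \<lfloor>log 2 d\<rfloor> + 1"
      have "of_int k - 1 \<le> log 2 d" "log 2 d < of_int k" unfolding k_def by linarith+
      then have k: "2 powr (of_int k - 1) \<le> d" "d < 2 powr of_int k"
        using d by (auto simp: le_log_iff log_less_iff)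
      have s1: "1/2 \<le> d / 2 powr of_int k" "d / 2 powr of_int k \<le> 1"
        using k by (auto simp: powr_diff field_simps)
      have s2: "1/4 \<le> d / 2 powr of_int (k + 1)" "d / 2 powr of_int (k + 1) \<le> 1"
        using k d by (auto simp: powr_diff powr_add field_simps)
      have "c1 * 2 powr (of_int k * (1 + ?\<beta>)) \<le> (d / 2 powr of_int k) powr (1 + ?\<beta>) * 2 powr (of_int k * (1 + ?\<beta>))"
        unfolding c1_def using powr_le_on_unit(2)[OF s1] by (intro mult_right_mono) auto
      also have "\<dots> = d powr (1 + ?\<beta>)"
        using d by (simp add: powr_divide powr_powr)
      finally have "c1 * 2 powr (of_int k * (1 + ?\<beta>)) < \<bar>f x - f y\<bar>" using d by simp
      then have "\<exists>j. \<exists>z\<in>{x, y}. A (k + 1) j z"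
        unfolding A_def T_def h_def[abs_def] using k by (intro big[OF fG]) (auto simp: d_def)
      then obtain j where j: "A (k + 1) j x \<or> A (k + 1) j y" by blast
      have dk: "dist x y < 2 powr of_int (k + 1)"
      proof -
        have "0 < (2::real) powr of_int k" "2 powr of_int (k + 1) = 2 * (2::real) powr of_int k" by (auto simp: powr_add)
        then show ?thesis using k(2) unfolding d_def by linarith
      qed
      have "d powr ?e = (d / 2 powr of_int (k + 1)) powr ?e * 2 powr (of_int (k + 1) * ?e)"
        using d by (simp add: powr_divide powr_powr)
      also have "\<dots> \<le> C * 2 powr (of_int (k + 1) * ?e)"
        unfolding C_def using powr_le_on_unit(1)[OF s2] by (intro mult_right_mono) auto
      finally have "ennreal (d powr ?e) \<le> ennreal (C * 2 powr (of_int (k + 1) * ?e)) * 1" by (simp add: ennreal_leI)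
      also have "\<dots> \<le> ennreal (C * 2 powr (of_int (k + 1) * ?e)) * (\<Sum>j. Y (k + 1) j y)"
      proof (intro mult_left_mono order_trans[OF _ le_suminf_ennreal])
        show "1 \<le> Y (k + 1) j y" using j dk by (auto simp: Y_def)
      qed simp
      also have "\<dots> \<le> (\<Sum>\<^sub>ZK. ennreal (C * 2 powr (of_int K * ?e)) * (\<Sum>j. Y K j y))"
        by (rule isum_ge)
      finally show ?thesis using True by (simp add: d_def)
    qed simp
    have Yint: "(\<integral>\<^sup>+y. Y K j y \<partial>lborel) = (if A K j x then ennreal (Bvol TYPE('a) * 2 powr (of_int K * ?n)) else 0) +
        (\<integral>\<^sup>+y. (if dist x y < 2 powr of_int K \<and> A K j y then 1 else 0) \<partial>lborel)" for K j
    proof -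
      have "(\<integral>\<^sup>+y. Y K j y \<partial>lborel) = (\<integral>\<^sup>+y. (if dist x y < 2 powr of_int K then (if A K j x then 1 else 0) else 0) +
         (if dist x y < 2 powr of_int K \<and> A K j y then 1 else 0) \<partial>lborel)"
        by (intro nn_integral_cong) (auto simp: Y_def)
      also have "\<dots> = (\<integral>\<^sup>+y. (if dist x y < 2 powr of_int K then (if A K j x then 1 else 0) else 0) \<partial>lborel) +
         (\<integral>\<^sup>+y. (if dist x y < 2 powr of_int K \<and> A K j y then 1 else 0) \<partial>lborel)"
        by (rule nn_integral_add) measurable
      also have "(\<integral>\<^sup>+y. (if dist x y < 2 powr of_int K then (if A K j x then 1 else 0) else 0) \<partial>lborel)
         = (if A K j x then 1 else 0) * ennreal (Bvol TYPE('a) * (2 powr of_int K) ^ DIM('a))"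
        by (rule nn_integral_ball_const) simp
      also have "(2 powr of_int K) ^ DIM('a) = (2::real) powr (of_int K * ?n)"
        by (simp add: powr_realpow[symmetric] powr_powr)
      finally show ?thesis by simp
    qed
    have "Dint 1 \<gamma> q f x \<le> (\<integral>\<^sup>+y. (\<Sum>\<^sub>ZK. ennreal (C * 2 powr (of_int K * ?e)) * (\<Sum>j. Y K j y)) \<partial>lborel)"
      unfolding Dint_altdef by (intro nn_integral_mono ptw)
    also have "\<dots> = (\<Sum>\<^sub>ZK. \<integral>\<^sup>+y. ennreal (C * 2 powr (of_int K * ?e)) * (\<Sum>j. Y K j y) \<partial>lborel)"
      by (rule nn_integral_isum) measurable
    also have "\<dots> = (\<Sum>\<^sub>ZK. ennreal C * (ennreal (2 powr (of_int K * ?e)) * (\<Sum>j. \<integral>\<^sup>+y. Y K j y \<partial>lborel)))"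
      using C by (intro nn_integral_cong) (simp add: nn_integral_cmult nn_integral_suminf ennreal_mult mult.assoc)
    also have "\<dots> = ennreal C * (\<Sum>\<^sub>ZK. ennreal (2 powr (of_int K * ?e)) * (\<Sum>j. \<integral>\<^sup>+y. Y K j y \<partial>lborel))"
      by (rule isum_cmult)
    finally show "Dint 1 \<gamma> q f x \<le> ennreal C * (\<Sum>\<^sub>ZK. ennreal (2 powr (of_int K * (\<gamma> - real DIM('a)))) * (\<Sum>j::nat.
       (let T = ennreal (c * 2 powr (real j * (\<eta> * p)) * 2 powr (of_int K * (\<gamma> / q * p)));
            P = Pav (K - int j) (\<lambda>y. epowr (ennreal (norm (G y))) p) in
        (if T \<le> P x then ennreal (Bvol TYPE('a) * 2 powr (of_int K * real DIM('a))) else 0) +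
        (\<integral>\<^sup>+y. (if dist x y < 2 powr of_int K \<and> T \<le> P y then 1 else 0) \<partial>lborel))))"
      unfolding Yint A_def T_def h_def[abs_def] Let_def .
  qed
qed

text \<open>In the terms for \<open>x\<close> the shift \<open>K \<mapsto> K + j\<close> brings the
  averages to scale \<open>K\<close>, multiplies the weight by \<open>2^(j \<gamma>)\<close> and
  changes the threshold factor \<open>2^(j \<eta> p)\<close> into
  \<open>2^(j p (\<eta> + \<gamma>/q))\<close>. In the terms for \<open>y\<close>,
  \<open>level_set_Pav_le\<close> recentres the averages at \<open>x\<close> on scale
  \<open>K + 1\<close>, and a shift by one returns to scale \<open>K\<close>.\<close>

lemma Dint_le_Hlev:
  assumes \<eta>: "0 < \<eta>" "\<eta> < 1" and p: "1 \<le> p" and q: "0 < q" and s: "0 < s" "s \<le> 1"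
  shows "\<exists>C>0. \<exists>c>0. \<exists>c'>0. \<forall>(f::'a::euclidean_space \<Rightarrow> real) G x. C1_grad f G \<longrightarrow>
    Dint 1 \<gamma> q f x \<le> (\<Sum>j::nat.
       ennreal (C * 2 powr (real j * \<gamma>)) * Hlev p q \<gamma> (\<lambda>y. ennreal (norm (G y))) (c * 2 powr (real j * (p * (\<eta> + \<gamma> / q)))) x +
       (\<Sum>i::nat. ennreal (C * 2 powr (s * (real i - real j * real DIM('a)))) *
          Hlev p q \<gamma> (\<lambda>y. ennreal (norm (G y))) (c' * 2 powr (real j * (\<eta> * p) + real i - real j * real DIM('a))) x))"
proof -
  let ?n = "real DIM('a)" and ?\<beta> = "\<gamma> / q" and ?b = "Bvol TYPE('a)"
  have b: "0 < ?b" by (rule Bvol_pos)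
  obtain c C0 where c: "0 < c" and C0: "0 < C0" and D: "\<And>(f::'a \<Rightarrow> real) G x. C1_grad f G \<Longrightarrow>
    Dint 1 \<gamma> q f x \<le> ennreal C0 * (\<Sum>\<^sub>ZK. ennreal (2 powr (of_int K * (\<gamma> - real DIM('a)))) * (\<Sum>j::nat.
       (let T = ennreal (c * 2 powr (real j * (\<eta> * p)) * 2 powr (of_int K * (\<gamma> / q * p)));
            P = Pav (K - int j) (\<lambda>y. epowr (ennreal (norm (G y))) p) in
        (if T \<le> P x then ennreal (Bvol TYPE('a) * 2 powr (of_int K * real DIM('a))) else 0) +
        (\<integral>\<^sup>+y. (if dist x y < 2 powr of_int K \<and> T \<le> P y then 1 else 0) \<partial>lborel))))"
    using Dint_le_levels[OF \<eta> p, of \<gamma> q, where 'a='a] by blast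
  define C1 where "C1 = C0 * ?b"
  \<comment> \<open>Collects the factor of \<open>level_set_Pav_le\<close>, the part of its weights
    independent of \<open>i\<close> and \<open>j\<close>, and \<open>2^(-\<gamma>)\<close> from the
    shift by one scale. The constant \<open>c'\<close> below arises in the same way from the
    thresholds.\<close>
  define C2 where "C2 = C0 * (?b * 2 powr ?n * 2 powr (s * (1 - ?n)) * 2 powr - \<gamma>)"
  define C where "C = max C1 C2"
  have C12: "0 < C1" "0 < C2" using C0 b by (auto simp: C1_def C2_def)
  then have C: "0 < C" by (simp add: C_def)
  define c' where "c' = c * 2 powr - ?n * 2 powr - (?\<beta> * p)"
  have c': "0 < c'" using c by (simp add: c'_def)
  show ?thesis
  proof (rule exI[of _ C], rule conjI[OF C], rule exI[of _ c], rule conjI[OF c], rule exI[of _ c'], rule conjI[OF c'], intro allI impI)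
    fix f :: "'a \<Rightarrow> real" and G x
    assume fG: "C1_grad f G"
    note [measurable] = C1_grad_measurable[OF fG]
    define g where "g y = ennreal (norm (G y))" for y
    define h where "h y = epowr (g y) p" for y
    have [measurable]: "g \<in> borel_measurable borel" "h \<in> borel_measurable borel" unfolding h_def g_def by measurable
    define T where "T K j = c * 2 powr (real j * (\<eta> * p)) * 2 powr (of_int K * (?\<beta> * p))" for K :: int and j :: nat
    have T: "0 < T K j" for K j using c by (simp add: T_def)
    have e: "ennreal (2 powr (of_int K * (\<gamma> - ?n))) * ennreal (2 powr (of_int K * ?n)) = ennreal (2 powr (of_int K * \<gamma>))" for K :: int
      by (simp add: ennreal_mult[symmetric] powr_add[symmetric] algebra_simps)
    have X: "(\<Sum>\<^sub>ZK. ennreal (2 powr (of_int K * (\<gamma> - ?n))) * (if ennreal (T K j) \<le> Pav (K - int j) h x then ennreal (?b * 2 powr (of_int K * ?n)) else 0))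
       = ennreal (?b * 2 powr (real j * \<gamma>)) * Hlev p q \<gamma> g (c * 2 powr (real j * (p * (\<eta> + ?\<beta>)))) x" for j
    proof -
      have "(\<Sum>\<^sub>ZK. ennreal (2 powr (of_int K * (\<gamma> - ?n))) * (if ennreal (T K j) \<le> Pav (K - int j) h x then ennreal (?b * 2 powr (of_int K * ?n)) else 0))
        = (\<Sum>\<^sub>ZK. ennreal ?b * (if ennreal (T K j) \<le> Pav (K - int j) h x then ennreal (2 powr (of_int K * \<gamma>)) else 0))"
        unfolding e[symmetric] using b by (intro nn_integral_cong) (simp add: ennreal_mult mult_ac)
      also have "\<dots> = (\<Sum>\<^sub>ZK. ennreal ?b * (if ennreal (T (K + int j) j) \<le> Pav (K + int j - int j) h x then ennreal (2 powr (of_int (K + int j) * \<gamma>)) else 0))"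
        by (rule isum_shift[symmetric])
      also have "\<dots> = (\<Sum>\<^sub>ZK. ennreal (?b * 2 powr (real j * \<gamma>)) * (if ennreal (c * 2 powr (real j * (p * (\<eta> + ?\<beta>))) * 2 powr (of_int K * (\<gamma> * p / q))) \<le> Pav K h x then ennreal (2 powr (of_int K * \<gamma>)) else 0))"
      proof (intro nn_integral_cong)
        fix K
        have 1: "T (K + int j) j = c * 2 powr (real j * (p * (\<eta> + ?\<beta>))) * 2 powr (of_int K * (\<gamma> * p / q))"
          unfolding T_def mult.assoc powr_add[symmetric] by (simp add: algebra_simps add_divide_distrib)
        have 2: "2 powr (of_int (K + int j) * \<gamma>) = 2 powr (real j * \<gamma>) * 2 powr (of_int K * \<gamma>)"
          unfolding powr_add[symmetric] by (simp add: algebra_simps)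
        show "ennreal ?b * (if ennreal (T (K + int j) j) \<le> Pav (K + int j - int j) h x then ennreal (2 powr (of_int (K + int j) * \<gamma>)) else 0)
          = ennreal (?b * 2 powr (real j * \<gamma>)) * (if ennreal (c * 2 powr (real j * (p * (\<eta> + ?\<beta>))) * 2 powr (of_int K * (\<gamma> * p / q))) \<le> Pav K h x then ennreal (2 powr (of_int K * \<gamma>)) else 0)"
          unfolding 1 2 using b by (simp add: ennreal_mult mult.assoc)
      qed
      also have "\<dots> = ennreal (?b * 2 powr (real j * \<gamma>)) * Hlev p q \<gamma> g (c * 2 powr (real j * (p * (\<eta> + ?\<beta>)))) x"
        unfolding Hlev_def h_def by (rule isum_cmult)
      finally show ?thesis .
    qed
    let ?A = "?b * 2 powr ?n"
    have Y: "(\<Sum>\<^sub>ZK. ennreal (2 powr (of_int K * (\<gamma> - ?n))) * (\<integral>\<^sup>+y. (if dist x y < 2 powr of_int K \<and> ennreal (T K j) \<le> Pav (K - int j) h y then 1 else 0) \<partial>lborel))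
      \<le> (\<Sum>i. ennreal (?A * 2 powr (s * (1 - ?n)) * 2 powr - \<gamma> * 2 powr (s * (real i - real j * ?n))) * Hlev p q \<gamma> g (c' * 2 powr (real j * (\<eta> * p) + real i - real j * ?n)) x)" for j
    proof -
      let ?w = "\<lambda>i. 2 powr (s * (real i + 1 - (real j + 1) * ?n))" and ?u = "\<lambda>i. 2 powr (real i - (real j + 1) * ?n)"
      have "(\<Sum>\<^sub>ZK. ennreal (2 powr (of_int K * (\<gamma> - ?n))) * (\<integral>\<^sup>+y. (if dist x y < 2 powr of_int K \<and> ennreal (T K j) \<le> Pav (K - int j) h y then 1 else 0) \<partial>lborel))
        \<le> (\<Sum>\<^sub>ZK. ennreal (2 powr (of_int K * (\<gamma> - ?n))) * (ennreal (?A * 2 powr (of_int K * ?n)) * (\<Sum>i. ennreal (?w i) * (if ennreal (T K j * ?u i) \<le> Pav (K + 1) h x then 1 else 0))))"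
        by (intro isum_mono mult_left_mono level_set_Pav_le T s) auto
      also have "\<dots> = (\<Sum>\<^sub>ZK. \<Sum>i. ennreal (?A * ?w i) * (if ennreal (T K j * ?u i) \<le> Pav (K + 1) h x then ennreal (2 powr (of_int K * \<gamma>)) else 0))"
      proof (intro nn_integral_cong)
        fix K
        have "ennreal (2 powr (of_int K * (\<gamma> - ?n))) * (ennreal (?A * 2 powr (of_int K * ?n)) * S) = ennreal ?A * ennreal (2 powr (of_int K * \<gamma>)) * S" for S
          unfolding e[symmetric] using b by (simp add: ennreal_mult mult_ac)
        then have "ennreal (2 powr (of_int K * (\<gamma> - ?n))) * (ennreal (?A * 2 powr (of_int K * ?n)) * (\<Sum>i. ennreal (?w i) * (if ennreal (T K j * ?u i) \<le> Pav (K + 1) h x then 1 else 0)))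
          = ennreal ?A * ennreal (2 powr (of_int K * \<gamma>)) * (\<Sum>i. ennreal (?w i) * (if ennreal (T K j * ?u i) \<le> Pav (K + 1) h x then 1 else 0))" .
        also have "\<dots> = (\<Sum>i. ennreal ?A * ennreal (2 powr (of_int K * \<gamma>)) * (ennreal (?w i) * (if ennreal (T K j * ?u i) \<le> Pav (K + 1) h x then 1 else 0)))"
          by (rule ennreal_suminf_cmult[symmetric])
        also have "\<dots> = (\<Sum>i. ennreal (?A * ?w i) * (if ennreal (T K j * ?u i) \<le> Pav (K + 1) h x then ennreal (2 powr (of_int K * \<gamma>)) else 0))"
        proof (rule suminf_cong)
          fix i
          have w: "ennreal (?A * ?w i) = ennreal ?A * ennreal (?w i)"
            using b by (intro ennreal_mult) auto
          have gen: "a * d * (w * (if Q then 1 else 0)) = a * w * (if Q then d else 0)" for a d w :: ennreal and Q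
            by (auto simp: mult_ac)
          show "ennreal ?A * ennreal (2 powr (of_int K * \<gamma>)) * (ennreal (?w i) * (if ennreal (T K j * ?u i) \<le> Pav (K + 1) h x then 1 else 0))
            = ennreal (?A * ?w i) * (if ennreal (T K j * ?u i) \<le> Pav (K + 1) h x then ennreal (2 powr (of_int K * \<gamma>)) else 0)"
            unfolding w by (rule gen)
        qed
        finally show "ennreal (2 powr (of_int K * (\<gamma> - ?n))) * (ennreal (?A * 2 powr (of_int K * ?n)) * (\<Sum>i. ennreal (?w i) * (if ennreal (T K j * ?u i) \<le> Pav (K + 1) h x then 1 else 0)))
          = (\<Sum>i. ennreal (?A * ?w i) * (if ennreal (T K j * ?u i) \<le> Pav (K + 1) h x then ennreal (2 powr (of_int K * \<gamma>)) else 0))" .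
      qed
      also have "\<dots> = (\<Sum>i. \<Sum>\<^sub>ZK. ennreal (?A * ?w i) * (if ennreal (T K j * ?u i) \<le> Pav (K + 1) h x then ennreal (2 powr (of_int K * \<gamma>)) else 0))"
        by (rule isum_suminf)
      also have "\<dots> = (\<Sum>i. ennreal (?A * 2 powr (s * (1 - ?n)) * 2 powr - \<gamma> * 2 powr (s * (real i - real j * ?n))) * Hlev p q \<gamma> g (c' * 2 powr (real j * (\<eta> * p) + real i - real j * ?n)) x)"
      proof (intro suminf_cong)
        fix i
        have "(\<Sum>\<^sub>ZK. ennreal (?A * ?w i) * (if ennreal (T K j * ?u i) \<le> Pav (K + 1) h x then ennreal (2 powr (of_int K * \<gamma>)) else 0))
          = (\<Sum>\<^sub>ZK. ennreal (?A * ?w i) * (if ennreal (T (K + - 1) j * ?u i) \<le> Pav (K + - 1 + 1) h x then ennreal (2 powr (of_int (K + - 1) * \<gamma>)) else 0))"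
          by (rule isum_shift[symmetric])
        also have "\<dots> = (\<Sum>\<^sub>ZK. ennreal (?A * 2 powr (s * (1 - ?n)) * 2 powr - \<gamma> * 2 powr (s * (real i - real j * ?n))) * (if ennreal (c' * 2 powr (real j * (\<eta> * p) + real i - real j * ?n) * 2 powr (of_int K * (\<gamma> * p / q))) \<le> Pav K h x then ennreal (2 powr (of_int K * \<gamma>)) else 0))"
        proof (intro nn_integral_cong)
          fix K
          have 1: "T (K + - 1) j * ?u i = c' * 2 powr (real j * (\<eta> * p) + real i - real j * ?n) * 2 powr (of_int K * (\<gamma> * p / q))"
            unfolding T_def c'_def mult.assoc powr_add[symmetric] by (simp add: algebra_simps add_divide_distrib diff_divide_distrib)
          have 2: "2 powr (of_int (K + - 1) * \<gamma>) = 2 powr - \<gamma> * 2 powr (of_int K * \<gamma>)"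
            unfolding powr_add[symmetric] by (simp add: algebra_simps)
          have 3: "?w i = 2 powr (s * (1 - ?n)) * 2 powr (s * (real i - real j * ?n))"
            unfolding powr_add[symmetric] by (simp add: algebra_simps)
          show "ennreal (?A * ?w i) * (if ennreal (T (K + - 1) j * ?u i) \<le> Pav (K + - 1 + 1) h x then ennreal (2 powr (of_int (K + - 1) * \<gamma>)) else 0)
            = ennreal (?A * 2 powr (s * (1 - ?n)) * 2 powr - \<gamma> * 2 powr (s * (real i - real j * ?n))) * (if ennreal (c' * 2 powr (real j * (\<eta> * p) + real i - real j * ?n) * 2 powr (of_int K * (\<gamma> * p / q))) \<le> Pav K h x then ennreal (2 powr (of_int K * \<gamma>)) else 0)"
            unfolding 1 2 3 using b by (simp add: ennreal_mult mult_ac)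
        qed
        also have "\<dots> = ennreal (?A * 2 powr (s * (1 - ?n)) * 2 powr - \<gamma> * 2 powr (s * (real i - real j * ?n))) * Hlev p q \<gamma> g (c' * 2 powr (real j * (\<eta> * p) + real i - real j * ?n)) x"
          unfolding Hlev_def h_def by (rule isum_cmult)
        finally show "(\<Sum>\<^sub>ZK. ennreal (?A * ?w i) * (if ennreal (T K j * ?u i) \<le> Pav (K + 1) h x then ennreal (2 powr (of_int K * \<gamma>)) else 0))
          = ennreal (?A * 2 powr (s * (1 - ?n)) * 2 powr - \<gamma> * 2 powr (s * (real i - real j * ?n))) * Hlev p q \<gamma> g (c' * 2 powr (real j * (\<eta> * p) + real i - real j * ?n)) x" .
      qed
      finally show ?thesis .
    qed
    let ?H1 = "\<lambda>j. Hlev p q \<gamma> g (c * 2 powr (real j * (p * (\<eta> + ?\<beta>)))) x"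
    let ?H2 = "\<lambda>j i. Hlev p q \<gamma> g (c' * 2 powr (real j * (\<eta> * p) + real i - real j * ?n)) x"
    have "Dint 1 \<gamma> q f x \<le> ennreal C0 * (\<Sum>\<^sub>ZK. ennreal (2 powr (of_int K * (\<gamma> - ?n))) * (\<Sum>j::nat.
        (if ennreal (T K j) \<le> Pav (K - int j) h x then ennreal (Bvol TYPE('a) * 2 powr (of_int K * ?n)) else 0) +
        (\<integral>\<^sup>+y. (if dist x y < 2 powr of_int K \<and> ennreal (T K j) \<le> Pav (K - int j) h y then 1 else 0) \<partial>lborel)))"
      using D[OF fG, of x] unfolding T_def h_def[abs_def] g_def[abs_def] Let_def .
    also have "\<dots> = ennreal C0 * (\<Sum>j::nat. (\<Sum>\<^sub>ZK. ennreal (2 powr (of_int K * (\<gamma> - ?n))) *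
        (if ennreal (T K j) \<le> Pav (K - int j) h x then ennreal (Bvol TYPE('a) * 2 powr (of_int K * ?n)) else 0)) +
        (\<Sum>\<^sub>ZK. ennreal (2 powr (of_int K * (\<gamma> - ?n))) * (\<integral>\<^sup>+y. (if dist x y < 2 powr of_int K \<and> ennreal (T K j) \<le> Pav (K - int j) h y then 1 else 0) \<partial>lborel)))"
      unfolding ennreal_suminf_cmult[symmetric] isum_suminf
      by (subst nn_integral_add[symmetric]) (auto simp: distrib_left)
    also have "\<dots> \<le> ennreal C0 * (\<Sum>j::nat. ennreal (?b * 2 powr (real j * \<gamma>)) * ?H1 j + (\<Sum>i. ennreal (?A * 2 powr (s * (1 - ?n)) * 2 powr - \<gamma> * 2 powr (s * (real i - real j * ?n))) * ?H2 j i))"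
      unfolding X by (intro mult_left_mono suminf_le add_mono Y order_refl) auto
    also have "\<dots> = (\<Sum>j::nat. ennreal C0 * (ennreal (?b * 2 powr (real j * \<gamma>)) * ?H1 j) + (\<Sum>i. ennreal C0 * (ennreal (?A * 2 powr (s * (1 - ?n)) * 2 powr - \<gamma> * 2 powr (s * (real i - real j * ?n))) * ?H2 j i)))"
      unfolding ennreal_suminf_cmult[symmetric] distrib_left ..
    also have "\<dots> \<le> (\<Sum>j::nat. ennreal (C * 2 powr (real j * \<gamma>)) * ?H1 j + (\<Sum>i. ennreal (C * 2 powr (s * (real i - real j * ?n))) * ?H2 j i))"
    proof (intro suminf_le add_mono)
      fix j
      have "ennreal C0 * (ennreal (?b * 2 powr (real j * \<gamma>)) * ?H1 j) = ennreal (C1 * 2 powr (real j * \<gamma>)) * ?H1 j"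
        using C0 b by (simp add: C1_def ennreal_mult mult.assoc)
      also have "\<dots> \<le> ennreal (C * 2 powr (real j * \<gamma>)) * ?H1 j"
        by (intro mult_right_mono ennreal_leI) (auto simp: C_def)
      finally show "ennreal C0 * (ennreal (?b * 2 powr (real j * \<gamma>)) * ?H1 j) \<le> ennreal (C * 2 powr (real j * \<gamma>)) * ?H1 j" .
      fix i
      have "ennreal C0 * (ennreal (?A * 2 powr (s * (1 - ?n)) * 2 powr - \<gamma> * 2 powr (s * (real i - real j * ?n))) * ?H2 j i) = ennreal (C2 * 2 powr (s * (real i - real j * ?n))) * ?H2 j i"
        using C0 b by (simp add: C2_def ennreal_mult mult.assoc)
      also have "\<dots> \<le> ennreal (C * 2 powr (s * (real i - real j * ?n))) * ?H2 j i"
        by (intro mult_right_mono ennreal_leI) (auto simp: C_def)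
      finally show "ennreal C0 * (ennreal (?A * 2 powr (s * (1 - ?n)) * 2 powr - \<gamma> * 2 powr (s * (real i - real j * ?n))) * ?H2 j i) \<le> ennreal (C * 2 powr (s * (real i - real j * ?n))) * ?H2 j i" .
    qed auto
    finally show "Dint 1 \<gamma> q f x \<le> (\<Sum>j::nat.
       ennreal (C * 2 powr (real j * \<gamma>)) * Hlev p q \<gamma> (\<lambda>y. ennreal (norm (G y))) (c * 2 powr (real j * (p * (\<eta> + \<gamma> / q)))) x +
       (\<Sum>i::nat. ennreal (C * 2 powr (s * (real i - real j * real DIM('a)))) *
          Hlev p q \<gamma> (\<lambda>y. ennreal (norm (G y))) (c' * 2 powr (real j * (\<eta> * p) + real i - real j * real DIM('a))) x))"
      unfolding g_def[abs_def] .
  qed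
qed

section \<open>The upper bound\<close>

text \<open>If \<open>p < q\<close>, full Chebyshev with \<open>s = 1\<close> is available and
  \<open>\<eta>\<close> fits between the Sobolev exponent and 1. Otherwise \<open>s / q\<close> is
  taken slightly below \<open>1 / p\<close>, namely by the factor \<open>1 - 1/(2 n)\<close>; then
  \<open>n (1/p - s/q) = 1/(2 p)\<close> is at most 1/2, and \<open>\<eta> = 3/4\<close> will
  do.\<close>

lemma admissible_exponents:
  fixes n p q :: real
  assumes "1 \<le> n" "1 \<le> p" "0 < q" "n * (1/p - 1/q) < 1"
  shows "\<exists>s \<eta>. 0 < s \<and> s \<le> 1 \<and> s / q < 1 / p \<and> 0 < \<eta> \<and> \<eta> < 1 \<and> n * (1/p - s/q) < \<eta>"
proof (cases "p < q")
  case True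
  obtain \<eta> where \<eta>: "max 0 (n * (1/p - 1/q)) < \<eta>" "\<eta> < 1"
    using dense[of "max 0 (n * (1/p - 1/q))" 1] assms by auto
  have "0 < \<eta>" "n * (1/p - 1/q) < \<eta>" using \<eta> by linarith+
  then show ?thesis
    using \<eta>(2) divide_strict_left_mono[of p q 1] True assms by (intro exI[of _ 1] exI[of _ \<eta>]) auto
next
  case False
  define s where "s = q / p * (1 - 1 / (2 * n))"
  have 1: "1 / (2 * n) \<le> 1 / 2" using assms by (simp add: field_simps)
  have 2: "0 < 1 / (2 * n)" using assms by simp
  have s0: "0 < s" unfolding s_def using 1 assms by (intro mult_pos_pos) auto
  have s1: "s \<le> 1"
    unfolding s_def using False 1 2 assms by (intro mult_le_one) (auto simp: field_simps)
  have sq: "s / q = 1/p * (1 - 1 / (2 * n))" using assms by (simp add: s_def)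
  have "1/p * (1 - 1 / (2 * n)) < 1/p * 1" using 2 assms by (intro mult_strict_left_mono) auto
  then have s2: "s / q < 1 / p" using sq by simp
  have "n * (1/p - s/q) = 1 / (2 * p)" unfolding sq using assms by (simp add: field_simps)
  also have "\<dots> < 3/4" using assms by (simp add: field_simps)
  finally show ?thesis using s0 s1 s2 by (intro exI[of _ s] exI[of _ "3/4"]) auto
qed

text \<open>Every level function enters with a weight \<open>B\<close> and a threshold factor
  \<open>L\<close> and contributes \<open>B^(r/q) L^(-r/p)\<close> times the norm of the gradient.
  The choice of \<open>s\<close> and \<open>\<eta>\<close> makes this decay geometrically in both
  indices, so two superpositions, first over \<open>i\<close> and then over \<open>j\<close>, give
  the bound.\<close>

theorem Nmor_Dint_le:
  assumes hb: "Hbound \<tau> p q r \<gamma> TYPE('a::euclidean_space)" and p: "1 \<le> p" and q: "0 < q" and r: "0 < r"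
    and npq: "real DIM('a) * (1/p - 1/q) < 1"
  shows "\<exists>C>0. \<forall>(f::'a \<Rightarrow> real) G b. C1_grad f G \<longrightarrow> (\<forall>x. norm (G x) \<le> b) \<longrightarrow>
    Nmor \<tau> (\<lambda>x. epowr (Dint 1 \<gamma> q f x) (r/q)) \<le> ennreal C * Nmor \<tau> (\<lambda>x. epowr (ennreal (norm (G x))) r)"
proof -
  let ?n = "real DIM('a)"
  define \<theta> where "\<theta> = r / q"
  have \<theta>: "0 < \<theta>" using q r by (simp add: \<theta>_def)
  have p0: "0 < p" using p by simp
  have n1: "1 \<le> ?n" using DIM_positive[where 'a='a] by (simp add: Suc_leI)
  obtain s \<eta> where s: "0 < s" "s \<le> 1" "s / q < 1 / p" and \<eta>: "0 < \<eta>" "\<eta> < 1" and sn: "?n * (1/p - s/q) < \<eta>"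
    using admissible_exponents[OF n1 p q npq] by blast
  obtain C c c' where C: "0 < C" "0 < c" "0 < c'" and D: "\<And>(f::'a \<Rightarrow> real) G x. C1_grad f G \<Longrightarrow>
    Dint 1 \<gamma> q f x \<le> (\<Sum>j::nat.
       ennreal (C * 2 powr (real j * \<gamma>)) * Hlev p q \<gamma> (\<lambda>y. ennreal (norm (G y))) (c * 2 powr (real j * (p * (\<eta> + \<gamma> / q)))) x +
       (\<Sum>i::nat. ennreal (C * 2 powr (s * (real i - real j * ?n))) *
          Hlev p q \<gamma> (\<lambda>y. ennreal (norm (G y))) (c' * 2 powr (real j * (\<eta> * p) + real i - real j * ?n)) x))"
    using Dint_le_Hlev[OF \<eta> p q s(1,2), of \<gamma>, where 'a='a] by blast
  obtain Ch where Ch: "0 < Ch" "\<And>(g::'a \<Rightarrow> ennreal) b L. g \<in> borel_measurable borel \<Longrightarrow> (\<forall>x. g x \<le> ennreal b) \<Longrightarrow> 0 < L \<Longrightarrow>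
     Nmor \<tau> (\<lambda>x. epowr (Hlev p q \<gamma> g L x) \<theta>) \<le> ennreal (Ch * L powr (- r / p)) * Nmor \<tau> (\<lambda>x. epowr (g x) r)"
    using Nmor_Hlev_le[OF hb p0 q r] unfolding \<theta>_def by blast
  \<comment> \<open>\<open>\<rho>1\<close> is the decay in \<open>i\<close> and
    \<open>\<rho>2\<close> the decay in \<open>j\<close> of the terms for \<open>y\<close>;
    \<open>\<rho>3\<close> is the decay in \<open>j\<close> of the terms for \<open>x\<close>, where
    \<open>\<gamma>\<close> cancels between weight and threshold.\<close>
  define \<rho>1 where "\<rho>1 = 2 powr (r * (s/q - 1/p))"
  define \<rho>2 where "\<rho>2 = 2 powr (r * (?n/p - \<eta> - ?n * s/q))"
  define \<rho>3 where "\<rho>3 = 2 powr (- (r * \<eta>))"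
  define \<rho> where "\<rho> = max \<rho>2 \<rho>3"
  have "r * (s/q - 1/p) < 0" using r s by (simp add: mult_pos_neg)
  moreover have "r * (?n/p - \<eta> - ?n * s/q) < 0" using r sn by (intro mult_pos_neg) (auto simp: algebra_simps)
  ultimately have \<rho>12: "0 < \<rho>1" "\<rho>1 < 1" "0 < \<rho>2" "\<rho>2 < 1" "0 < \<rho>3" "\<rho>3 < 1"
    using r \<eta> by (auto simp: \<rho>1_def \<rho>2_def \<rho>3_def intro!: powr_less_one)
  then have \<rho>: "0 < \<rho>" "\<rho> < 1" by (auto simp: \<rho>_def)
  obtain S1 where S1: "0 < S1" "\<And>(U::nat \<Rightarrow> 'a \<Rightarrow> ennreal) M. (\<forall>i. U i \<in> borel_measurable borel) \<Longrightarrow>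
    (\<forall>i. Nmor \<tau> (\<lambda>x. epowr (U i x) \<theta>) \<le> ennreal (\<rho>1 ^ i) * M) \<Longrightarrow>
    Nmor \<tau> (\<lambda>x. epowr (\<Sum>i. U i x) \<theta>) \<le> ennreal S1 * M"
    using Nmor_superposition[OF \<theta> \<rho>12(1,2), of \<tau>, where 'a='a] by blast
  obtain S2 where S2: "0 < S2" "\<And>(U::nat \<Rightarrow> 'a \<Rightarrow> ennreal) M. (\<forall>i. U i \<in> borel_measurable borel) \<Longrightarrow>
    (\<forall>i. Nmor \<tau> (\<lambda>x. epowr (U i x) \<theta>) \<le> ennreal (\<rho> ^ i) * M) \<Longrightarrow>
    Nmor \<tau> (\<lambda>x. epowr (\<Sum>i. U i x) \<theta>) \<le> ennreal S2 * M"
    using Nmor_superposition[OF \<theta> \<rho>, of \<tau>, where 'a='a] by blast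
  define A1 where "A1 = C powr \<theta> * Ch * c powr (- r / p)"
  define A2 where "A2 = C powr \<theta> * Ch * c' powr (- r / p)"
  define A where "A = 2 powr \<theta> * A1 + 2 powr \<theta> * (S1 * A2)"
  have A12: "0 < A1" "0 < A2" using C Ch by (auto simp: A1_def A2_def)
  have A: "0 < A" unfolding A_def using A12 S1 by (intro add_pos_pos) auto
  show ?thesis
  proof (intro exI[of _ "S2 * A"] conjI allI impI)
    show "0 < S2 * A" using S2 A by simp
    fix f :: "'a \<Rightarrow> real" and G b
    assume fG: "C1_grad f G" and bdd: "\<forall>x. norm (G x) \<le> b"
    note [measurable] = C1_grad_measurable[OF fG]
    define g where "g y = ennreal (norm (G y))" for y
    have [measurable]: "g \<in> borel_measurable borel" unfolding g_def by measurable
    have gb: "\<forall>x. g x \<le> ennreal b" using bdd by (auto simp: g_def intro: ennreal_leI)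
    define X where "X = Nmor \<tau> (\<lambda>x. epowr (g x) r)"
    define H1 where "H1 j = Hlev p q \<gamma> g (c * 2 powr (real j * (p * (\<eta> + \<gamma> / q))))" for j :: nat
    define H2 where "H2 j i = Hlev p q \<gamma> g (c' * 2 powr (real j * (\<eta> * p) + real i - real j * ?n))" for j i :: nat
    have [measurable]: "H1 j \<in> borel_measurable borel" "H2 j i \<in> borel_measurable borel" for j i
      unfolding H1_def H2_def by measurable
    define V where "V j x = (\<Sum>i. ennreal (C * 2 powr (s * (real i - real j * ?n))) * H2 j i x)" for j x
    define W where "W j x = ennreal (C * 2 powr (real j * \<gamma>)) * H1 j x" for j x
    have [measurable]: "V j \<in> borel_measurable borel" "W j \<in> borel_measurable borel" for j
      unfolding V_def W_def by measurable
    have scale: "Nmor \<tau> (\<lambda>x. epowr (ennreal B * Hlev p q \<gamma> g L x) \<theta>) \<le> ennreal (B powr \<theta> * (Ch * L powr (- r / p))) * X"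
      if "0 < B" "0 < L" for B L
    proof -
      have "Nmor \<tau> (\<lambda>x. epowr (ennreal B * Hlev p q \<gamma> g L x) \<theta>) = ennreal (B powr \<theta>) * Nmor \<tau> (\<lambda>x. epowr (Hlev p q \<gamma> g L x) \<theta>)"
        using \<theta> that by (simp add: epowr_mult epowr_ennreal Nmor_cmult)
      also have "\<dots> \<le> ennreal (B powr \<theta>) * (ennreal (Ch * L powr (- r / p)) * X)"
        unfolding X_def using that gb by (intro mult_left_mono Ch(2)) auto
      also have "\<dots> = ennreal (B powr \<theta> * (Ch * L powr (- r / p))) * X"
        using Ch(1) by (simp add: ennreal_mult mult.assoc)
      finally show ?thesis .
    qed
    have Wb: "Nmor \<tau> (\<lambda>x. epowr (W j x) \<theta>) \<le> ennreal (A1 * \<rho> ^ j) * X" for j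
    proof -
      have "(C * 2 powr (real j * \<gamma>)) powr \<theta> * (Ch * (c * 2 powr (real j * (p * (\<eta> + \<gamma> / q)))) powr (- r / p))
         = A1 * (2 powr (real j * \<gamma> * \<theta>) * 2 powr (real j * (p * (\<eta> + \<gamma> / q)) * (- r / p)))"
        using C by (simp add: powr_mult powr_powr A1_def mult_ac)
      also have "2 powr (real j * \<gamma> * \<theta>) * 2 powr (real j * (p * (\<eta> + \<gamma> / q)) * (- r / p)) = \<rho>3 ^ j"
      proof -
        have "real j * \<gamma> * \<theta> + real j * (p * (\<eta> + \<gamma> / q)) * (- r / p) = real j * (- (r * \<eta>))"
          using p0 q by (simp add: \<theta>_def field_simps)
        then show ?thesis by (simp add: \<rho>3_def powr_realpow[symmetric] powr_powr powr_add[symmetric] mult.commute)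
      qed
      also have "A1 * \<rho>3 ^ j \<le> A1 * \<rho> ^ j"
        using A12 \<rho>12 by (intro mult_left_mono power_mono) (auto simp: \<rho>_def)
      finally have le: "ennreal ((C * 2 powr (real j * \<gamma>)) powr \<theta> * (Ch * (c * 2 powr (real j * (p * (\<eta> + \<gamma> / q)))) powr (- r / p))) \<le> ennreal (A1 * \<rho> ^ j)"
        by (rule ennreal_leI)
      have "Nmor \<tau> (\<lambda>x. epowr (W j x) \<theta>) \<le> ennreal ((C * 2 powr (real j * \<gamma>)) powr \<theta> * (Ch * (c * 2 powr (real j * (p * (\<eta> + \<gamma> / q)))) powr (- r / p))) * X"
        unfolding W_def H1_def using C by (intro scale) auto
      also have "\<dots> \<le> ennreal (A1 * \<rho> ^ j) * X" by (intro mult_right_mono le) simp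
      finally show ?thesis .
    qed
    have Vb: "Nmor \<tau> (\<lambda>x. epowr (V j x) \<theta>) \<le> ennreal S1 * (ennreal (A2 * \<rho> ^ j) * X)" for j
      unfolding V_def
    proof (intro S1(2) allI)
      fix i
      have "(C * 2 powr (s * (real i - real j * ?n))) powr \<theta> * (Ch * (c' * 2 powr (real j * (\<eta> * p) + real i - real j * ?n)) powr (- r / p))
         = A2 * (2 powr (s * (real i - real j * ?n) * \<theta>) * 2 powr ((real j * (\<eta> * p) + real i - real j * ?n) * (- r / p)))"
        using C by (simp add: powr_mult powr_powr A2_def mult_ac)
      also have "2 powr (s * (real i - real j * ?n) * \<theta>) * 2 powr ((real j * (\<eta> * p) + real i - real j * ?n) * (- r / p)) = \<rho>1 ^ i * \<rho>2 ^ j"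
      proof -
        have "s * (real i - real j * ?n) * \<theta> + (real j * (\<eta> * p) + real i - real j * ?n) * (- r / p) = r * (s/q - 1/p) * real i + r * (?n/p - \<eta> - ?n * s/q) * real j"
          using p0 q by (simp add: \<theta>_def field_simps)
        then show ?thesis by (simp add: \<rho>1_def \<rho>2_def powr_realpow[symmetric] powr_powr powr_add[symmetric])
      qed
      also have "A2 * (\<rho>1 ^ i * \<rho>2 ^ j) \<le> A2 * (\<rho>1 ^ i * \<rho> ^ j)"
        using A12 \<rho>12 by (intro mult_left_mono power_mono) (auto simp: \<rho>_def)
      finally have le: "ennreal ((C * 2 powr (s * (real i - real j * ?n))) powr \<theta> * (Ch * (c' * 2 powr (real j * (\<eta> * p) + real i - real j * ?n)) powr (- r / p))) \<le> ennreal (A2 * (\<rho>1 ^ i * \<rho> ^ j))"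
        by (rule ennreal_leI)
      have "Nmor \<tau> (\<lambda>x. epowr (ennreal (C * 2 powr (s * (real i - real j * ?n))) * H2 j i x) \<theta>) \<le> ennreal ((C * 2 powr (s * (real i - real j * ?n))) powr \<theta> * (Ch * (c' * 2 powr (real j * (\<eta> * p) + real i - real j * ?n)) powr (- r / p))) * X"
        unfolding H2_def using C by (intro scale) auto
      also have "\<dots> \<le> ennreal (A2 * (\<rho>1 ^ i * \<rho> ^ j)) * X" by (intro mult_right_mono le) simp
      also have "\<dots> = ennreal (\<rho>1 ^ i) * (ennreal (A2 * \<rho> ^ j) * X)"
        using A12 \<rho> \<rho>12 by (simp add: ennreal_mult mult_ac)
      finally show "Nmor \<tau> (\<lambda>x. epowr (ennreal (C * 2 powr (s * (real i - real j * ?n))) * H2 j i x) \<theta>) \<le> ennreal (\<rho>1 ^ i) * (ennreal (A2 * \<rho> ^ j) * X)" .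
    qed measurable
    have WV: "Nmor \<tau> (\<lambda>x. epowr (W j x + V j x) \<theta>) \<le> ennreal (\<rho> ^ j) * (ennreal A * X)" for j
    proof -
      have "epowr (W j x + V j x) \<theta> \<le> ennreal (2 powr \<theta>) * epowr (W j x) \<theta> + ennreal (2 powr \<theta>) * epowr (V j x) \<theta>" for x
        using epowr_add_le[OF \<theta> zero_less_one, of "W j x" "V j x"] by simp
      then have "Nmor \<tau> (\<lambda>x. epowr (W j x + V j x) \<theta>) \<le> Nmor \<tau> (\<lambda>x. ennreal (2 powr \<theta>) * epowr (W j x) \<theta> + ennreal (2 powr \<theta>) * epowr (V j x) \<theta>)"
        by (intro Nmor_mono)
      also have "\<dots> \<le> Nmor \<tau> (\<lambda>x. ennreal (2 powr \<theta>) * epowr (W j x) \<theta>) + Nmor \<tau> (\<lambda>x. ennreal (2 powr \<theta>) * epowr (V j x) \<theta>)"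
        by (rule Nmor_add) measurable
      also have "\<dots> = ennreal (2 powr \<theta>) * Nmor \<tau> (\<lambda>x. epowr (W j x) \<theta>) + ennreal (2 powr \<theta>) * Nmor \<tau> (\<lambda>x. epowr (V j x) \<theta>)"
        by (subst Nmor_cmult, measurable)+
      also have "\<dots> \<le> ennreal (2 powr \<theta>) * (ennreal (A1 * \<rho> ^ j) * X) + ennreal (2 powr \<theta>) * (ennreal S1 * (ennreal (A2 * \<rho> ^ j) * X))"
        by (intro add_mono mult_left_mono Wb Vb) auto
      also have "\<dots> = (ennreal (2 powr \<theta> * (A1 * \<rho> ^ j)) + ennreal (2 powr \<theta> * (S1 * (A2 * \<rho> ^ j)))) * X"
        using A12 S1(1) \<rho> by (simp add: ennreal_mult mult.assoc distrib_right)
      also have "ennreal (2 powr \<theta> * (A1 * \<rho> ^ j)) + ennreal (2 powr \<theta> * (S1 * (A2 * \<rho> ^ j))) = ennreal (\<rho> ^ j * A)"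
        using A12 S1(1) \<rho> by (subst ennreal_plus[symmetric]) (auto simp: A_def algebra_simps)
      finally show ?thesis using A \<rho> by (simp add: ennreal_mult mult.assoc)
    qed
    have "Nmor \<tau> (\<lambda>x. epowr (Dint 1 \<gamma> q f x) (r/q)) \<le> Nmor \<tau> (\<lambda>x. epowr (\<Sum>j. W j x + V j x) \<theta>)"
      using D[OF fG] \<theta> unfolding \<theta>_def[symmetric] W_def V_def H1_def H2_def g_def[abs_def] by (intro Nmor_mono epowr_mono) auto
    also have "\<dots> \<le> ennreal S2 * (ennreal A * X)"
      by (intro S2(2)) (auto intro: WV)
    finally show "Nmor \<tau> (\<lambda>x. epowr (Dint 1 \<gamma> q f x) (r/q)) \<le> ennreal (S2 * A) * Nmor \<tau> (\<lambda>x. epowr (ennreal (norm (G x))) r)"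
      using S2(1) A by (simp add: ennreal_mult mult.assoc X_def g_def[abs_def])
  qed
qed

section \<open>From level 1 to all levels, and the choice of the exponent \<open>p\<close>\<close>

lemma Qfun_eq_Nmor:
  fixes f :: "'a::euclidean_space \<Rightarrow> real"
  assumes "0 < r" "0 < q" "0 < lam" and [measurable]: "f \<in> borel_measurable borel"
  shows "Qfun \<alpha> r \<gamma> q f lam = epowr (Nmor (1 - r/\<alpha>) (\<lambda>x. ennreal (lam powr r) * epowr (Dint lam \<gamma> q f x) (r/q))) (1/r)"
proof -
  have "Qfun \<alpha> r \<gamma> q f lam = epowr (ennreal (lam powr r)) (1/r) * epowr (Nmor (1 - r/\<alpha>) (\<lambda>x. epowr (Dint lam \<gamma> q f x) (r/q))) (1/r)"
    using assms unfolding Qfun_def morrey_norm_eq_Nmor[OF assms(1)] Efun_eq_Dint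
    by (simp add: epowr_epowr epowr_ennreal powr_powr)
  also have "\<dots> = epowr (Nmor (1 - r/\<alpha>) (\<lambda>x. ennreal (lam powr r) * epowr (Dint lam \<gamma> q f x) (r/q))) (1/r)"
    using assms by (simp add: Nmor_cmult epowr_mult)
  finally show ?thesis .
qed

lemma C1_grad_scale: "C1_grad f G \<Longrightarrow> C1_grad (\<lambda>x. c * f x) (\<lambda>x. c *\<^sub>R G x)"
  unfolding C1_grad_def by (auto intro!: derivative_eq_intros continuous_intros)

lemma Dint_scale: "0 < lam \<Longrightarrow> Dint lam \<gamma> q f x = Dint 1 \<gamma> q (\<lambda>x. (1/lam) * f x) x"
proof -
  assume l: "0 < lam"
  have "Eset lam \<beta> f = Eset 1 \<beta> (\<lambda>x. (1/lam) * f x)" for \<beta>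
  proof -
    have "x \<noteq> y \<and> lam < \<bar>f x - f y\<bar> / dist x y powr (1 + \<beta>) \<longleftrightarrow>
      x \<noteq> y \<and> 1 < \<bar>(1/lam) * f x - (1/lam) * f y\<bar> / dist x y powr (1 + \<beta>)" for x y
    proof (cases "x = y")
      case False
      then have d: "0 < dist x y powr (1 + \<beta>)" by simp
      have "\<bar>(1/lam) * f x - (1/lam) * f y\<bar> = \<bar>f x - f y\<bar> / lam"
        using l by (simp add: diff_divide_distrib[symmetric])
      then show ?thesis using l d by (simp only: less_divide_eq_1_pos pos_less_divide_eq) (auto simp: mult.commute)
    qed simp
    then show ?thesis unfolding Eset_def by simp
  qed
  then show ?thesis by (simp add: Dint_def)
qed

text \<open>Replacing \<open>f\<close> by \<open>f / lam\<close> reduces level \<open>lam\<close> to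
  level 1; the factor \<open>lam^(-r)\<close> gained on the gradient side cancels the factor
  \<open>lam^r\<close> in front.\<close>

lemma Qfun_le_of_Hbound:
  assumes hb: "Hbound (1 - r/\<alpha>) p q r \<gamma> TYPE('a::euclidean_space)" and p: "1 \<le> p" and q: "0 < q" and r: "0 < r"
    and npq: "real DIM('a) * (1/p - 1/q) < 1"
  shows "\<exists>C>0. \<forall>(f::'a \<Rightarrow> real) G b lam. C1_grad f G \<longrightarrow> (\<forall>x. norm (G x) \<le> b) \<longrightarrow> 0 < lam \<longrightarrow>
    Qfun \<alpha> r \<gamma> q f lam \<le> ennreal C * morrey_norm \<alpha> r (\<lambda>x. ennreal (norm (G x)))"
proof -
  obtain C where C: "0 < C" "\<And>(f::'a \<Rightarrow> real) G b. C1_grad f G \<Longrightarrow> (\<forall>x. norm (G x) \<le> b) \<Longrightarrow>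
    Nmor (1 - r/\<alpha>) (\<lambda>x. epowr (Dint 1 \<gamma> q f x) (r/q)) \<le> ennreal C * Nmor (1 - r/\<alpha>) (\<lambda>x. epowr (ennreal (norm (G x))) r)"
    using Nmor_Dint_le[OF hb p q r npq] by blast
  show ?thesis
  proof (intro exI[of _ "C powr (1/r)"] conjI allI impI)
    show "0 < C powr (1/r)" using C by simp
    fix f :: "'a \<Rightarrow> real" and G b lam
    assume fG: "C1_grad f G" and bdd: "\<forall>x. norm (G x) \<le> b" and l: "0 < (lam::real)"
    note [measurable] = C1_grad_measurable[OF fG]
    have "Nmor (1 - r/\<alpha>) (\<lambda>x. epowr (Dint lam \<gamma> q f x) (r/q)) \<le> ennreal C * Nmor (1 - r/\<alpha>) (\<lambda>x. epowr (ennreal (norm ((1/lam) *\<^sub>R G x))) r)"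
      unfolding Dint_scale[OF l]
    proof (rule C(2)[OF C1_grad_scale[OF fG]], intro allI)
      show "norm ((1/lam) *\<^sub>R G x) \<le> (1/lam) * b" for x using bdd l by (simp add: divide_right_mono)
    qed
    also have "(\<lambda>x. epowr (ennreal (norm ((1/lam) *\<^sub>R G x))) r) = (\<lambda>x. ennreal (lam powr - r) * epowr (ennreal (norm (G x))) r)"
      using l by (intro ext) (simp add: epowr_ennreal ennreal_mult[symmetric] powr_divide powr_mult inverse_powr powr_minus divide_inverse mult.commute)
    finally have "ennreal (lam powr r) * Nmor (1 - r/\<alpha>) (\<lambda>x. epowr (Dint lam \<gamma> q f x) (r/q))
       \<le> ennreal (lam powr r) * (ennreal C * (ennreal (lam powr - r) * Nmor (1 - r/\<alpha>) (\<lambda>x. epowr (ennreal (norm (G x))) r)))"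
      by (simp add: Nmor_cmult mult_left_mono)
    also have "\<dots> = (ennreal (lam powr r) * ennreal (lam powr - r)) * (ennreal C * Nmor (1 - r/\<alpha>) (\<lambda>x. epowr (ennreal (norm (G x))) r))"
      by (simp only: mult_ac)
    also have "\<dots> = ennreal C * Nmor (1 - r/\<alpha>) (\<lambda>x. epowr (ennreal (norm (G x))) r)"
      using ennreal_powr_uminus_cancel[OF l] by simp
    finally have "epowr (Nmor (1 - r/\<alpha>) (\<lambda>x. ennreal (lam powr r) * epowr (Dint lam \<gamma> q f x) (r/q))) (1/r)
       \<le> epowr (ennreal C * Nmor (1 - r/\<alpha>) (\<lambda>x. epowr (ennreal (norm (G x))) r)) (1/r)"
      using r by (intro epowr_mono) (auto simp: Nmor_cmult)
    then show "Qfun \<alpha> r \<gamma> q f lam \<le> ennreal (C powr (1/r)) * morrey_norm \<alpha> r (\<lambda>x. ennreal (norm (G x)))"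
      using r q l C by (simp add: Qfun_eq_Nmor morrey_norm_eq_Nmor epowr_mult epowr_ennreal)
  qed
qed

text \<open>For \<open>r > 1\<close> each of the possible cases implies
  \<open>n (1/r - 1/q) < 1\<close>, and this strict inequality survives for some
  \<open>p < r\<close>, where the maximal function is available. For \<open>r = 1\<close> only
  \<open>p = 1\<close> is left, with the sign of \<open>\<gamma>\<close> deciding between the two
  kinds of cell argument.\<close>

theorem Qfun_upper_bound:
  assumes "1 \<le> r" and "r \<le> \<alpha>" and "\<gamma> \<noteq> 0" and "0 < q"
    and cases: "r > real DIM('a::euclidean_space)
         \<or> (r \<le> real DIM('a) \<and> \<gamma> > 0 \<and> real DIM('a) * (1/r - 1/q) < 1)
         \<or> (1 < r \<and> r \<le> real DIM('a) \<and> \<gamma> < 0 \<and> q < r)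
         \<or> (r = 1 \<and> DIM('a) = 1 \<and> q = 1 \<and> \<gamma> < -1)"
  shows "\<exists>C>0. \<forall>(f::'a \<Rightarrow> real) G b lam. C1_grad f G \<longrightarrow> (\<forall>x. norm (G x) \<le> b) \<longrightarrow> 0 < lam \<longrightarrow>
    Qfun \<alpha> r \<gamma> q f lam \<le> ennreal C * morrey_norm \<alpha> r (\<lambda>x. ennreal (norm (G x)))"
proof -
  let ?n = "real DIM('a)"
  have n1: "1 \<le> ?n" using DIM_positive[where 'a='a] by (simp add: Suc_leI)
  have tau: "0 \<le> 1 - r/\<alpha>" "1 - r/\<alpha> < 1" using assms by (auto simp: field_simps)
  show ?thesis
  proof (cases "1 < r")
    case True
    have npq: "?n * (1/r - 1/q) < 1"
    proof -
      { assume "r > ?n"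
        then have "?n * (1/r) < 1" using True by simp
        moreover have "?n * (1/r - 1/q) \<le> ?n * (1/r)" using assms(4) by (intro mult_left_mono) auto
        ultimately have ?thesis by simp }
      moreover { assume "q < r"
        then have "1/r - 1/q \<le> 0" using assms(4) True by (simp add: field_simps)
        then have "?n * (1/r - 1/q) \<le> 0" by (simp add: mult_nonneg_nonpos)
        then have ?thesis by simp }
      ultimately show ?thesis using cases True by fastforce
    qed
    \<comment> \<open>The critical exponent: \<open>n (1/p - 1/q) = 1\<close> exactly for
      \<open>p = P0\<close>.\<close>
    define P0 where "P0 = ?n / (1 + ?n/q)"
    have pos: "0 < 1 + ?n/q" using assms(4) by (simp add: add_pos_nonneg)
    have "?n / r < 1 + ?n / q" using npq by (simp add: algebra_simps)
    then have "P0 < r" unfolding P0_def using pos True by (simp add: field_simps)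
    define p where "p = (max 1 P0 + r) / 2"
    have p: "1 \<le> p" "p < r" "P0 < p" using True \<open>P0 < r\<close> by (auto simp: p_def)
    have "?n * (1/p - 1/q) < 1"
    proof -
      have "?n < p * (1 + ?n/q)" using p(3) pos unfolding P0_def by (simp add: pos_divide_less_eq)
      then have "?n / p < 1 + ?n/q" using p(1) by (simp add: pos_divide_less_eq mult.commute)
      then show ?thesis by (simp add: algebra_simps)
    qed
    then show ?thesis
      using Hbound_maximal[OF p(1,2) assms(4,3) tau] p assms True by (intro Qfun_le_of_Hbound[where p=p]) auto
  next
    case False
    then have r: "r = 1" using assms(1) by simp
    show ?thesis
    proof (cases "\<gamma> > 0")
      case True
      then have "?n * (1/1 - 1/q) < 1" using cases r n1 by auto
      then show ?thesis
        using Hbound_pos[OF assms(4) True tau] assms r by (intro Qfun_le_of_Hbound[where p=1]) auto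
    next
      case False
      then have "DIM('a) = 1" "q = 1" "\<gamma> < - ?n" using cases r n1 by auto
      then show ?thesis
        using Hbound_neg[OF _ tau, of \<gamma>, where 'a='a] r by (intro Qfun_le_of_Hbound[where p=1]) auto
    qed
  qed
qed

section \<open>Polar coordinates and the constant kappa\<close>

lemma nn_integral_powr_to_inf:
  assumes "e < -1" "0 < (a::real)"
  shows "(\<integral>\<^sup>+s. (if a < s then ennreal (s powr e) else 0) \<partial>lborel) = ennreal (a powr (e + 1) / - (e + 1))"
proof -
  have "((\<lambda>x. if x \<in> {a..} then x powr e else 0) has_integral -(a powr (e+1)) / (e+1)) UNIV"
    using has_integral_powr_to_inf[OF assms] by (simp only: has_integral_restrict_UNIV)
  then have "(\<integral>\<^sup>+x. ennreal (if x \<in> {a..} then x powr e else 0) \<partial>lborel) = ennreal (-(a powr (e+1)) / (e+1))"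
    by (intro nn_integral_has_integral_lborel) auto
  also have "(\<integral>\<^sup>+x. ennreal (if x \<in> {a..} then x powr e else 0) \<partial>lborel) = (\<integral>\<^sup>+s. (if a < s then ennreal (s powr e) else 0) \<partial>lborel)"
    using AE_lborel_singleton[of a] by (intro nn_integral_cong_AE) (auto elim!: eventually_mono)
  finally show ?thesis by (simp add: minus_divide_left[symmetric] minus_divide_right[symmetric] del: minus_add_distrib)
qed

lemma nn_integral_powr_from_0:
  assumes "-1 < e" "0 \<le> (c::real)"
  shows "(\<integral>\<^sup>+s. (if 0 < s \<and> s < c then ennreal (s powr e) else 0) \<partial>lborel) = ennreal (c powr (e + 1) / (e + 1))"
proof -
  have "((\<lambda>x. if x \<in> {0..c} then x powr e else 0) has_integral c powr (e+1) / (e+1)) UNIV"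
    using has_integral_powr_from_0[OF assms] by (simp only: has_integral_restrict_UNIV)
  then have "(\<integral>\<^sup>+x. ennreal (if x \<in> {0..c} then x powr e else 0) \<partial>lborel) = ennreal (c powr (e+1) / (e+1))"
    by (intro nn_integral_has_integral_lborel) auto
  also have "(\<integral>\<^sup>+x. ennreal (if x \<in> {0..c} then x powr e else 0) \<partial>lborel) = (\<integral>\<^sup>+s. (if 0 < s \<and> s < c then ennreal (s powr e) else 0) \<partial>lborel)"
    using AE_lborel_singleton[of 0] AE_lborel_singleton[of c]
    by (intro nn_integral_cong_AE) (auto elim!: eventually_elim2)
  finally show ?thesis .
qed

text \<open>With \<open>c = a^(q/\<gamma>)\<close> the condition reads \<open>t < c\<close> for
  \<open>\<gamma> > 0\<close> and \<open>t > c\<close> for \<open>\<gamma> < 0\<close>. In both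
  cases the power is integrable on that side and the boundary value is
  \<open>c^\<gamma> = a^q\<close>; this is why one formula with \<open>\<bar>\<gamma>\<bar>\<close>
  serves both signs.\<close>

lemma nn_integral_radial_powr:
  assumes "\<gamma> \<noteq> 0" "0 < q" "0 \<le> (a::real)"
  shows "(\<integral>\<^sup>+t. (if 0 < t \<and> t powr (\<gamma>/q) < a then ennreal (t powr (\<gamma> - 1)) else 0) \<partial>lborel) = ennreal (a powr q / \<bar>\<gamma>\<bar>)"
proof (cases "a = 0")
  case True
  then have "(\<integral>\<^sup>+t. (if 0 < t \<and> t powr (\<gamma>/q) < a then ennreal (t powr (\<gamma> - 1)) else 0) \<partial>lborel) = (\<integral>\<^sup>+t. 0 \<partial>(lborel::real measure))"
    by (intro nn_integral_cong) (auto simp: not_less)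
  then show ?thesis using True by simp
next
  case False
  then have a: "0 < a" using assms by simp
  define c where "c = a powr (q/\<gamma>)"
  have c: "0 < c" "c powr (\<gamma>/q) = a" using a assms by (auto simp: c_def powr_powr)
  show ?thesis
  proof (cases "0 < \<gamma>")
    case True
    have "t powr (\<gamma>/q) < a \<longleftrightarrow> t < c" if "0 < t" for t
      unfolding c(2)[symmetric] using that c(1) True assms
      by (metis divide_pos_pos less_imp_le linorder_not_less powr_less_mono2 powr_mono2)
    then have "(\<integral>\<^sup>+t. (if 0 < t \<and> t powr (\<gamma>/q) < a then ennreal (t powr (\<gamma> - 1)) else 0) \<partial>lborel) = (\<integral>\<^sup>+t. (if 0 < t \<and> t < c then ennreal (t powr (\<gamma> - 1)) else 0) \<partial>lborel)"
      by (intro nn_integral_cong) auto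
    also have "\<dots> = ennreal (c powr (\<gamma> - 1 + 1) / (\<gamma> - 1 + 1))"
      using c True by (intro nn_integral_powr_from_0) auto
    finally show ?thesis using True a by (simp add: c_def powr_powr)
  next
    case False
    then have g: "\<gamma> < 0" using assms by simp
    then have gq: "\<gamma>/q < 0" using assms by (simp add: divide_neg_pos)
    have "t powr (\<gamma>/q) < a \<longleftrightarrow> c < t" if "0 < t" for t
      unfolding c(2)[symmetric] using that c(1) gq
      by (metis less_imp_le linorder_not_less powr_less_mono2_neg powr_mono2')
    then have "(\<integral>\<^sup>+t. (if 0 < t \<and> t powr (\<gamma>/q) < a then ennreal (t powr (\<gamma> - 1)) else 0) \<partial>lborel) = (\<integral>\<^sup>+t. (if c < t then ennreal (t powr (\<gamma> - 1)) else 0) \<partial>lborel)"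
      using c by (intro nn_integral_cong) (auto intro: less_trans)
    also have "\<dots> = ennreal (c powr (\<gamma> - 1 + 1) / - (\<gamma> - 1 + 1))"
      using c g by (intro nn_integral_powr_to_inf) auto
    finally show ?thesis using g a by (simp add: c_def powr_powr)
  qed
qed

lemma AE_lborel_nonzero: "AE x in lborel. x \<noteq> (0::'a::euclidean_space)"
  by (rule AE_lborel_singleton)

text \<open>Polar coordinates, with the sphere measure written as a cone measure. It is proved by
  inserting \<open>1 = n \<bar>h\<bar>^n \<integral>_{\<bar>h\<bar>}^\<infinity> s^(-n-1) ds\<close> and rescaling, which needs nothing beyond
  Tonelli's theorem.\<close>
lemma nn_integral_polar:
  fixes F :: "'a::euclidean_space \<Rightarrow> ennreal"
  assumes [measurable]: "F \<in> borel_measurable borel"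
  shows "(\<integral>\<^sup>+h. F h \<partial>lborel) = ennreal (real DIM('a)) * (\<integral>\<^sup>+x. (if norm x < 1 then
     (\<integral>\<^sup>+t. (if 0 < t then F ((t / norm x) *\<^sub>R x) * ennreal (t powr (real DIM('a) - 1)) else 0) \<partial>lborel) else 0) \<partial>(lborel :: 'a measure))"
proof -
  let ?n = "real DIM('a)"
  have n: "0 < ?n" by simp
  \<comment> \<open>Substituting \<open>t = s \<bar>x\<bar>\<close> replaces the point
    \<open>t x / \<bar>x\<bar>\<close> by \<open>s x\<close>, which prepares the substitution
    \<open>h = s x\<close> for fixed \<open>s\<close>.\<close>
  have rad: "(\<integral>\<^sup>+t. (if 0 < t then F ((t / norm x) *\<^sub>R x) * ennreal (t powr (?n - 1)) else 0) \<partial>lborel)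
     = (\<integral>\<^sup>+s. (if 0 < s then F (s *\<^sub>R x) * ennreal (s powr (?n - 1) * norm x powr ?n) else 0) \<partial>lborel)" if "x \<noteq> 0" for x :: 'a
  proof -
    have nx: "0 < norm x" using that by simp
    define g where "g t = (if 0 < t then F ((t / norm x) *\<^sub>R x) * ennreal (t powr (?n - 1)) else 0)" for t :: real
    have [measurable]: "g \<in> borel_measurable borel" unfolding g_def by measurable
    have "(\<integral>\<^sup>+t. g t \<partial>lborel) = ennreal (norm x) * (\<integral>\<^sup>+s. g (norm x * s) \<partial>lborel)"
      using nn_integral_real_affine[of g "norm x" 0] nx by simp
    then have "(\<integral>\<^sup>+t. (if 0 < t then F ((t / norm x) *\<^sub>R x) * ennreal (t powr (?n - 1)) else 0) \<partial>lborel)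
      = ennreal (norm x) * (\<integral>\<^sup>+s. (if 0 < norm x * s then F ((norm x * s / norm x) *\<^sub>R x) * ennreal ((norm x * s) powr (?n - 1)) else 0) \<partial>lborel)"
      unfolding g_def .
    also have "\<dots> = (\<integral>\<^sup>+s. ennreal (norm x) * (if 0 < norm x * s then F ((norm x * s / norm x) *\<^sub>R x) * ennreal ((norm x * s) powr (?n - 1)) else 0) \<partial>lborel)"
      by (rule nn_integral_cmult[symmetric]) measurable
    also have "\<dots> = (\<integral>\<^sup>+s. (if 0 < s then F (s *\<^sub>R x) * ennreal (s powr (?n - 1) * norm x powr ?n) else 0) \<partial>lborel)"
    proof (intro nn_integral_cong)
      fix s :: real
      have "norm x * (norm x * s) powr (?n - 1) = s powr (?n - 1) * norm x powr ?n" if "0 < s"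
        using nx that by (simp add: powr_mult powr_diff)
      then have "ennreal (norm x) * ennreal ((norm x * s) powr (?n - 1)) = ennreal (s powr (?n - 1) * norm x powr ?n)" if "0 < s"
        using that by (simp add: ennreal_mult[symmetric])
      then show "ennreal (norm x) * (if 0 < norm x * s then F ((norm x * s / norm x) *\<^sub>R x) * ennreal ((norm x * s) powr (?n - 1)) else 0)
        = (if 0 < s then F (s *\<^sub>R x) * ennreal (s powr (?n - 1) * norm x powr ?n) else 0)"
        using nx by (auto simp: zero_less_mult_iff mult.left_commute[of "ennreal (norm x)"])
    qed
    finally show ?thesis .
  qed
  have sc: "(\<integral>\<^sup>+x. (if norm x < 1 then F (s *\<^sub>R x) * ennreal (s powr (?n - 1) * norm x powr ?n) else 0) \<partial>lborel)
     = (\<integral>\<^sup>+h. (if norm h < s then F h * ennreal (norm h powr ?n * s powr (- ?n - 1)) else 0) \<partial>lborel)" if s: "0 < s" for s :: real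
  proof -
    have "(\<integral>\<^sup>+h. (if norm h < s then F h * ennreal (norm h powr ?n * s powr (- ?n - 1)) else 0) \<partial>lborel)
       = ennreal (\<bar>s\<bar> ^ DIM('a)) * (\<integral>\<^sup>+x. (if norm (0 + s *\<^sub>R x) < s then F (0 + s *\<^sub>R x) * ennreal (norm (0 + s *\<^sub>R x) powr ?n * s powr (- ?n - 1)) else 0) \<partial>lborel)"
      using s by (intro nn_integral_lborel_affine) auto
    also have "\<dots> = (\<integral>\<^sup>+x. ennreal (\<bar>s\<bar> ^ DIM('a)) * (if norm (0 + s *\<^sub>R x) < s then F (0 + s *\<^sub>R x) * ennreal (norm (0 + s *\<^sub>R x) powr ?n * s powr (- ?n - 1)) else 0) \<partial>lborel)"
      by (rule nn_integral_cmult[symmetric]) measurable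
    also have "\<dots> = (\<integral>\<^sup>+x. (if norm x < 1 then F (s *\<^sub>R x) * ennreal (s powr (?n - 1) * norm x powr ?n) else 0) \<partial>lborel)"
    proof (intro nn_integral_cong)
      fix x :: 'a
      have "s powr ?n * ((s * norm x) powr ?n * s powr (- ?n - 1)) = s powr (?n - 1) * norm x powr ?n"
        using s by (simp add: powr_mult powr_diff powr_minus field_simps)
      then have "ennreal (\<bar>s\<bar> ^ DIM('a)) * ennreal ((s * norm x) powr ?n * s powr (- ?n - 1)) = ennreal (s powr (?n - 1) * norm x powr ?n)"
        using s by (simp add: ennreal_mult[symmetric] powr_realpow)
      then show "ennreal (\<bar>s\<bar> ^ DIM('a)) * (if norm (0 + s *\<^sub>R x) < s then F (0 + s *\<^sub>R x) * ennreal (norm (0 + s *\<^sub>R x) powr ?n * s powr (- ?n - 1)) else 0)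
        = (if norm x < 1 then F (s *\<^sub>R x) * ennreal (s powr (?n - 1) * norm x powr ?n) else 0)"
        using s by (auto simp: mult.left_commute)
    qed
    finally show ?thesis by simp
  qed
  have fin: "(\<integral>\<^sup>+s. (if 0 < s \<and> norm h < s then F h * ennreal (norm h powr ?n * s powr (- ?n - 1)) else 0) \<partial>lborel) = ennreal (1/?n) * F h" if h: "h \<noteq> 0" for h
  proof -
    have nh: "0 < norm h" using h by simp
    have "(\<integral>\<^sup>+s. (if 0 < s \<and> norm h < s then F h * ennreal (norm h powr ?n * s powr (- ?n - 1)) else 0) \<partial>lborel)
      = (\<integral>\<^sup>+s. F h * ennreal (norm h powr ?n) * (if norm h < s then ennreal (s powr (- ?n - 1)) else 0) \<partial>lborel)"
    proof (intro nn_integral_cong)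
      fix s
      have "0 < s \<and> norm h < s \<longleftrightarrow> norm h < s" using nh by linarith
      then show "(if 0 < s \<and> norm h < s then F h * ennreal (norm h powr ?n * s powr (- ?n - 1)) else 0)
        = F h * ennreal (norm h powr ?n) * (if norm h < s then ennreal (s powr (- ?n - 1)) else 0)"
        by (simp add: ennreal_mult mult.assoc)
    qed
    also have "\<dots> = F h * ennreal (norm h powr ?n) * ennreal (norm h powr (- ?n - 1 + 1) / - (- ?n - 1 + 1))"
      using nh n by (subst nn_integral_cmult) (auto simp: nn_integral_powr_to_inf)
    also have "\<dots> = F h * (ennreal (norm h powr ?n) * ennreal (norm h powr - ?n / ?n))"
      by (simp add: mult.assoc)
    also have "ennreal (norm h powr ?n) * ennreal (norm h powr - ?n / ?n) = ennreal (1/?n)"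
      using nh n by (simp add: ennreal_mult[symmetric] powr_minus)
    finally show ?thesis by (simp add: mult.commute)
  qed
  have "(\<integral>\<^sup>+x. (if norm x < 1 then
     (\<integral>\<^sup>+t. (if 0 < t then F ((t / norm x) *\<^sub>R x) * ennreal (t powr (?n - 1)) else 0) \<partial>lborel) else 0) \<partial>lborel)
     = (\<integral>\<^sup>+x. (\<integral>\<^sup>+s. (if 0 < s \<and> norm x < 1 then F (s *\<^sub>R x) * ennreal (s powr (?n - 1) * norm x powr ?n) else 0) \<partial>lborel) \<partial>lborel)"
    using AE_lborel_nonzero[where 'a='a] by (intro nn_integral_cong_AE) (auto elim!: eventually_mono simp: rad)
  also have "\<dots> = (\<integral>\<^sup>+s. (\<integral>\<^sup>+x. (if 0 < s \<and> norm x < 1 then F (s *\<^sub>R x) * ennreal (s powr (?n - 1) * norm x powr ?n) else 0) \<partial>lborel) \<partial>lborel)"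
    by (rule lborel_pair.Fubini'[symmetric]) measurable
  also have "\<dots> = (\<integral>\<^sup>+s. (\<integral>\<^sup>+h. (if 0 < s \<and> norm h < s then F h * ennreal (norm h powr ?n * s powr (- ?n - 1)) else 0) \<partial>lborel) \<partial>lborel)"
  proof (rule nn_integral_cong)
    fix s :: real
    show "(\<integral>\<^sup>+x. (if 0 < s \<and> norm x < 1 then F (s *\<^sub>R x) * ennreal (s powr (?n - 1) * norm x powr ?n) else 0) \<partial>lborel)
      = (\<integral>\<^sup>+h. (if 0 < s \<and> norm h < s then F h * ennreal (norm h powr ?n * s powr (- ?n - 1)) else 0) \<partial>lborel)"
      by (cases "0 < s") (simp_all add: sc)
  qed
  also have "\<dots> = (\<integral>\<^sup>+h. (\<integral>\<^sup>+s. (if 0 < s \<and> norm h < s then F h * ennreal (norm h powr ?n * s powr (- ?n - 1)) else 0) \<partial>lborel) \<partial>lborel)"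
    by (rule lborel_pair.Fubini'[symmetric]) measurable
  also have "\<dots> = (\<integral>\<^sup>+h. ennreal (1/?n) * F h \<partial>lborel)"
    using AE_lborel_nonzero[where 'a='a] by (intro nn_integral_cong_AE) (auto elim!: eventually_mono simp: fin)
  also have "\<dots> = ennreal (1/?n) * (\<integral>\<^sup>+h. F h \<partial>lborel)"
    by (rule nn_integral_cmult) measurable
  finally show ?thesis
    using n by (simp add: mult.assoc[symmetric] ennreal_mult[symmetric])
qed

text \<open>In polar coordinates \<open>\<psi>\<close> is constant along rays, so
  \<open>nn_integral_radial_powr\<close> evaluates every radial integral with
  \<open>a = \<psi> x\<close>. The formula serves the limit of the inner integral, its upper
  estimate for close points, and tails outside a ball.\<close>

lemma nn_integral_homogeneous_levels:
  fixes \<psi> :: "'a::euclidean_space \<Rightarrow> real"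
  assumes [measurable]: "\<psi> \<in> borel_measurable borel" and g: "\<gamma> \<noteq> 0" and q: "0 < q"
    and nn: "\<And>x. 0 \<le> \<psi> x" and hom: "\<And>c x. 0 < c \<Longrightarrow> \<psi> (c *\<^sub>R x) = \<psi> x"
  shows "(\<integral>\<^sup>+h. (if h \<noteq> 0 \<and> norm h powr (\<gamma>/q) < \<psi> h then ennreal (norm h powr (\<gamma> - real DIM('a))) else 0) \<partial>lborel)
    = ennreal (real DIM('a) / \<bar>\<gamma>\<bar>) * (\<integral>\<^sup>+x. (if norm x < 1 then ennreal (\<psi> x powr q) else 0) \<partial>lborel)"
proof -
  let ?n = "real DIM('a)"
  define F where "F h = (if h \<noteq> 0 \<and> norm h powr (\<gamma>/q) < \<psi> h then ennreal (norm h powr (\<gamma> - ?n)) else 0)" for h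
  have [measurable]: "F \<in> borel_measurable borel" unfolding F_def by measurable
  have in1: "(\<integral>\<^sup>+t. (if 0 < t then F ((t / norm x) *\<^sub>R x) * ennreal (t powr (?n - 1)) else 0) \<partial>lborel) = ennreal (\<psi> x powr q / \<bar>\<gamma>\<bar>)" if "x \<noteq> 0" for x
  proof -
    have "(\<integral>\<^sup>+t. (if 0 < t then F ((t / norm x) *\<^sub>R x) * ennreal (t powr (?n - 1)) else 0) \<partial>lborel)
      = (\<integral>\<^sup>+t. (if 0 < t \<and> t powr (\<gamma>/q) < \<psi> x then ennreal (t powr (\<gamma> - 1)) else 0) \<partial>lborel)"
    proof (intro nn_integral_cong)
      fix t :: real
      have "\<psi> ((t / norm x) *\<^sub>R x) = \<psi> x" "norm ((t / norm x) *\<^sub>R x) = t" "t powr (\<gamma> - ?n) * t powr (?n - 1) = t powr (\<gamma> - 1)" if "0 < t"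
        using that \<open>x \<noteq> 0\<close> by (auto intro!: hom simp: powr_add[symmetric])
      then show "(if 0 < t then F ((t / norm x) *\<^sub>R x) * ennreal (t powr (?n - 1)) else 0) = (if 0 < t \<and> t powr (\<gamma>/q) < \<psi> x then ennreal (t powr (\<gamma> - 1)) else 0)"
        using that by (auto simp: F_def ennreal_mult[symmetric])
    qed
    then show ?thesis using nn_integral_radial_powr[OF g q nn] by simp
  qed
  have "(\<integral>\<^sup>+h. F h \<partial>lborel) = ennreal ?n * (\<integral>\<^sup>+x. (if norm x < 1 then
     (\<integral>\<^sup>+t. (if 0 < t then F ((t / norm x) *\<^sub>R x) * ennreal (t powr (?n - 1)) else 0) \<partial>lborel) else 0) \<partial>lborel)"
    by (rule nn_integral_polar) measurable
  also have "(\<integral>\<^sup>+x. (if norm x < 1 then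
     (\<integral>\<^sup>+t. (if 0 < t then F ((t / norm x) *\<^sub>R x) * ennreal (t powr (?n - 1)) else 0) \<partial>lborel) else 0) \<partial>lborel)
     = (\<integral>\<^sup>+x. ennreal (1/\<bar>\<gamma>\<bar>) * (if norm x < 1 then ennreal (\<psi> x powr q) else 0) \<partial>lborel)"
    using AE_lborel_nonzero[where 'a='a]
    by (intro nn_integral_cong_AE) (auto elim!: eventually_mono simp: in1 ennreal_mult[symmetric])
  also have "\<dots> = ennreal (1/\<bar>\<gamma>\<bar>) * (\<integral>\<^sup>+x. (if norm x < 1 then ennreal (\<psi> x powr q) else 0) \<partial>lborel)"
    by (rule nn_integral_cmult) measurable
  finally show ?thesis unfolding F_def by (simp add: mult.assoc[symmetric] ennreal_mult[symmetric])
qed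

text \<open>Lebesgue measure is invariant under linear isometric involutions: compare the two iterated
  integrals of \<open>F (y - T x)\<close> against the indicator function of the unit ball.\<close>
lemma nn_integral_isometric_involution:
  fixes T :: "'a::euclidean_space \<Rightarrow> 'a"
  assumes [measurable]: "F \<in> borel_measurable borel" "T \<in> borel_measurable borel"
    and diff: "\<And>x y. T (x - y) = T x - T y" and inv: "\<And>x. T (T x) = x" and nrm: "\<And>x. norm (T x) = norm x"
  shows "(\<integral>\<^sup>+x. F (T x) \<partial>lborel) = (\<integral>\<^sup>+x. F x \<partial>lborel)"
proof -
  define b where "b y = (if norm y < 1 then 1 else (0::ennreal))" for y :: 'a
  have [measurable]: "b \<in> borel_measurable borel" unfolding b_def by measurable
  have v: "(\<integral>\<^sup>+y. b y \<partial>lborel) = ennreal (Bvol TYPE('a))"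
    using nn_integral_ball_const[of 1 "0::'a" 1] by (simp add: b_def[abs_def])
  have "(\<integral>\<^sup>+y. b y \<partial>lborel) * (\<integral>\<^sup>+x. F (T x) \<partial>lborel) = (\<integral>\<^sup>+x. (\<integral>\<^sup>+y. b y \<partial>lborel) * F (T x) \<partial>lborel)"
    by (rule nn_integral_cmult[symmetric]) measurable
  also have "\<dots> = (\<integral>\<^sup>+x. (\<integral>\<^sup>+y. b (y - T x) * F (T x) \<partial>lborel) \<partial>lborel)"
  proof (intro nn_integral_cong)
    fix x
    have "(\<integral>\<^sup>+y. b (y - T x) \<partial>lborel) = (\<integral>\<^sup>+y. b y \<partial>lborel)"
      using nn_integral_lborel_shift[of b "- T x"] by simp
    then show "(\<integral>\<^sup>+y. b y \<partial>lborel) * F (T x) = (\<integral>\<^sup>+y. b (y - T x) * F (T x) \<partial>lborel)"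
      by (simp add: nn_integral_multc)
  qed
  also have "\<dots> = (\<integral>\<^sup>+y. (\<integral>\<^sup>+x. b (y - T x) * F (T x) \<partial>lborel) \<partial>lborel)"
    by (rule lborel_pair.Fubini'[symmetric]) measurable
  also have "\<dots> = (\<integral>\<^sup>+y. (\<integral>\<^sup>+x. b x * F (y - T x) \<partial>lborel) \<partial>lborel)"
  proof (rule nn_integral_cong)
    fix y
    have "(\<integral>\<^sup>+x. b (y - T x) * F (T x) \<partial>lborel) = (\<integral>\<^sup>+x. b (y - T (T y - x)) * F (T (T y - x)) \<partial>lborel)"
      by (rule nn_integral_lborel_reflect[symmetric, where f="\<lambda>x. b (y - T x) * F (T x)"]) measurable
    also have "\<dots> = (\<integral>\<^sup>+x. b x * F (y - T x) \<partial>lborel)"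
      by (simp add: diff inv b_def nrm)
    finally show "(\<integral>\<^sup>+x. b (y - T x) * F (T x) \<partial>lborel) = (\<integral>\<^sup>+x. b x * F (y - T x) \<partial>lborel)" .
  qed
  also have "\<dots> = (\<integral>\<^sup>+x. (\<integral>\<^sup>+y. b x * F (y - T x) \<partial>lborel) \<partial>lborel)"
    by (rule lborel_pair.Fubini') measurable
  also have "\<dots> = (\<integral>\<^sup>+x. b x * (\<integral>\<^sup>+y. F y \<partial>lborel) \<partial>lborel)"
  proof (intro nn_integral_cong)
    fix x
    have "(\<integral>\<^sup>+y. F (y - T x) \<partial>lborel) = (\<integral>\<^sup>+y. F y \<partial>lborel)"
      using nn_integral_lborel_shift[of F "- T x"] by simp
    then show "(\<integral>\<^sup>+y. b x * F (y - T x) \<partial>lborel) = b x * (\<integral>\<^sup>+y. F y \<partial>lborel)"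
      by (simp add: nn_integral_cmult)
  qed
  also have "\<dots> = (\<integral>\<^sup>+y. b y \<partial>lborel) * (\<integral>\<^sup>+y. F y \<partial>lborel)"
    by (rule nn_integral_multc) measurable
  finally have eq: "ennreal (Bvol TYPE('a)) * (\<integral>\<^sup>+x. F (T x) \<partial>lborel) = ennreal (Bvol TYPE('a)) * (\<integral>\<^sup>+y. F y \<partial>lborel)"
    by (simp only: v)
  have "ennreal (1 / Bvol TYPE('a)) * ennreal (Bvol TYPE('a)) = 1"
    using Bvol_pos[where 'a='a] by (simp add: ennreal_mult[symmetric])
  with arg_cong[OF eq, of "\<lambda>z. ennreal (1 / Bvol TYPE('a)) * z"] show ?thesis
    by (simp add: mult.assoc[symmetric])
qed

text \<open>The reflection \<open>T\<close> in the hyperplane orthogonal to \<open>u - v\<close> is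
  a symmetric isometric involution and maps \<open>u\<close> to \<open>v\<close>.\<close>

lemma nn_integral_direction_eq:
  fixes u v :: "'a::euclidean_space"
  assumes "norm u = 1" "norm v = 1"
  shows "(\<integral>\<^sup>+x. (if norm x < 1 then ennreal ((\<bar>u \<bullet> x\<bar> / norm x) powr q) else 0) \<partial>lborel)
     = (\<integral>\<^sup>+x. (if norm x < 1 then ennreal ((\<bar>v \<bullet> x\<bar> / norm x) powr q) else 0) \<partial>lborel)"
proof -
  define w where "w = u - v"
  \<comment> \<open>For \<open>w = 0\<close> the quotient is 0 by the convention on division, so
    \<open>T\<close> is then the identity, as wanted for \<open>u = v\<close>.\<close>
  define T where "T x = x - (2 * (x \<bullet> w) / (w \<bullet> w)) *\<^sub>R w" for x
  have uu: "u \<bullet> u = 1" "v \<bullet> v = 1" using assms by (auto simp: norm_eq_1)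
  have [measurable]: "T \<in> borel_measurable borel" unfolding T_def by measurable
  have diff: "T (x - y) = T x - T y" for x y
    by (simp add: T_def inner_diff_left algebra_simps diff_divide_distrib scaleR_diff_left)
  have sa: "T x \<bullet> y = x \<bullet> T y" for x y
    by (simp add: T_def inner_diff_left inner_diff_right inner_commute)
  have inv: "T (T x) = x" for x
    by (cases "w = 0") (simp_all add: T_def inner_diff_left field_simps flip: scaleR_add_left)
  have nrm: "norm (T x) = norm x" for x
    using sa[of x "T x"] by (simp add: inv norm_eq_sqrt_inner)
  have Tu: "T u = v"
  proof (cases "w = 0")
    case True then show ?thesis by (simp add: T_def w_def)
  next
    case False
    have "2 * (u \<bullet> w) = w \<bullet> w" using uu by (simp add: w_def inner_diff_left inner_diff_right inner_commute)
    then show ?thesis using False by (simp add: T_def w_def)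
  qed
  define F where "F x = (if norm x < 1 then ennreal ((\<bar>u \<bullet> x\<bar> / norm x) powr q) else 0)" for x
  have [measurable]: "F \<in> borel_measurable borel" unfolding F_def by measurable
  have "F (T x) = (if norm x < 1 then ennreal ((\<bar>v \<bullet> x\<bar> / norm x) powr q) else 0)" for x
    using sa[of u x] by (simp add: F_def nrm Tu)
  then show ?thesis
    using nn_integral_isometric_involution[of F T, OF _ _ diff inv nrm] by (simp add: F_def)
qed

text \<open>Invariance under reflections frees \<open>kappa\<close> from the chosen basis vector,
  and homogeneity in \<open>v\<close> brings in the length of a general vector.\<close>

lemma kappa_eq_nn_integral:
  fixes v :: "'a::euclidean_space"
  assumes q: "0 < q"
  shows "ennreal (real DIM('a)) * (\<integral>\<^sup>+x. (if norm x < 1 then ennreal ((\<bar>v \<bullet> x\<bar> / norm x) powr q) else 0) \<partial>lborel)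
     = ennreal (kappa q TYPE('a) * norm v powr q)"
proof -
  define e :: 'a where "e = (SOME e. e \<in> Basis)"
  have "e \<in> Basis" unfolding e_def by (rule someI_ex) (use nonempty_Basis in blast)
  then have e1: "norm e = 1" by simp
  define \<phi> where "\<phi> x = \<bar>e \<bullet> (x /\<^sub>R norm x)\<bar> powr q" for x
  have [measurable]: "\<phi> \<in> borel_measurable borel" unfolding \<phi>_def by measurable
  have phi: "\<phi> x = (\<bar>e \<bullet> x\<bar> / norm x) powr q" for x
    by (simp add: \<phi>_def abs_mult divide_inverse mult.commute)
  have phi1: "\<bar>e \<bullet> x\<bar> / norm x \<le> 1" for x
    using Cauchy_Schwarz_ineq2[of e x] e1 by (cases "x = 0") (auto simp: field_simps)
  have "integrable lborel (indicator (ball (0::'a) 1) :: 'a \<Rightarrow> real)"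
    using emeasure_lborel_ball_finite[of "0::'a" 1] by (intro integrable_real_indicator) auto
  then have int: "integrable lborel (\<lambda>x. indicator (ball 0 1) x *\<^sub>R \<phi> x)"
    by (rule Bochner_Integration.integrable_bound)
       (use phi1 q in \<open>auto simp: phi indicator_def intro!: powr_le1\<close>)
  have "(LINT x : ball (0::'a) 1 | lebesgue. \<phi> x) = integral\<^sup>L lborel (\<lambda>x. indicator (ball 0 1) x *\<^sub>R \<phi> x)"
    unfolding set_lebesgue_integral_def
  proof (rule integral_completion)
    have "(\<lambda>x. indicator (ball 0 1) x *\<^sub>R \<phi> x) \<in> borel_measurable borel"
      by (intro borel_measurable_scaleR borel_measurable_indicator) auto
    then show "(\<lambda>x. indicator (ball 0 1) x *\<^sub>R \<phi> x) \<in> borel_measurable lborel" by simp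
  qed
  then have k: "kappa q TYPE('a) = real DIM('a) * integral\<^sup>L lborel (\<lambda>x. indicator (ball 0 1) x *\<^sub>R \<phi> x)"
    unfolding kappa_def e_def[symmetric] \<phi>_def by simp
  have "ennreal (integral\<^sup>L lborel (\<lambda>x. indicator (ball 0 1) x *\<^sub>R \<phi> x)) = (\<integral>\<^sup>+x. ennreal (indicator (ball 0 1) x *\<^sub>R \<phi> x) \<partial>lborel)"
    by (rule nn_integral_eq_integral[OF int, symmetric]) (auto simp: \<phi>_def)
  also have "\<dots> = (\<integral>\<^sup>+x. (if norm x < 1 then ennreal ((\<bar>e \<bullet> x\<bar> / norm x) powr q) else 0) \<partial>lborel)"
    by (intro nn_integral_cong) (auto simp: phi indicator_def)
  finally have E: "ennreal (kappa q TYPE('a)) = ennreal (real DIM('a)) * (\<integral>\<^sup>+x. (if norm x < 1 then ennreal ((\<bar>e \<bullet> x\<bar> / norm x) powr q) else 0) \<partial>lborel)"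
    unfolding k by (simp add: ennreal_mult')
  show ?thesis
  proof (cases "v = 0")
    case True
    then have "(\<lambda>x. if norm x < 1 then ennreal ((\<bar>v \<bullet> x\<bar> / norm x) powr q) else 0) = (\<lambda>x. 0)" by auto
    then show ?thesis using True q by simp
  next
    case False
    define u where "u = v /\<^sub>R norm v"
    have u1: "norm u = 1" using False by (simp add: u_def)
    have "(\<bar>v \<bullet> x\<bar> / norm x) powr q = norm v powr q * (\<bar>u \<bullet> x\<bar> / norm x) powr q" for x
      using False by (simp add: u_def abs_mult powr_mult[symmetric] divide_simps)
    then have "(\<integral>\<^sup>+x. (if norm x < 1 then ennreal ((\<bar>v \<bullet> x\<bar> / norm x) powr q) else 0) \<partial>lborel)
       = (\<integral>\<^sup>+x. ennreal (norm v powr q) * (if norm x < 1 then ennreal ((\<bar>u \<bullet> x\<bar> / norm x) powr q) else 0) \<partial>lborel)"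
      by (intro nn_integral_cong) (auto simp: ennreal_mult)
    also have "\<dots> = ennreal (norm v powr q) * (\<integral>\<^sup>+x. (if norm x < 1 then ennreal ((\<bar>u \<bullet> x\<bar> / norm x) powr q) else 0) \<partial>lborel)"
      by (rule nn_integral_cmult) measurable
    also have "(\<integral>\<^sup>+x. (if norm x < 1 then ennreal ((\<bar>u \<bullet> x\<bar> / norm x) powr q) else 0) \<partial>lborel) = (\<integral>\<^sup>+x. (if norm x < 1 then ennreal ((\<bar>e \<bullet> x\<bar> / norm x) powr q) else 0) \<partial>lborel)"
      by (rule nn_integral_direction_eq[OF u1 e1])
    finally show ?thesis by (simp add: E ennreal_mult'' mult_ac)
  qed
qed

text \<open>On the ball of radius 1/4 around \<open>e / 2\<close> the product
  \<open>e \<bullet> x\<close> is positive, so the integrand cannot vanish almost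
  everywhere.\<close>

lemma kappa_pos:
  assumes q: "0 < q"
  shows "0 < kappa q TYPE('a::euclidean_space)"
proof (rule ccontr)
  assume "\<not> ?thesis"
  then have k: "kappa q TYPE('a) \<le> 0" by simp
  obtain e :: 'a where e: "e \<in> Basis" using nonempty_Basis by blast
  have "ennreal (real DIM('a)) * (\<integral>\<^sup>+x. (if norm x < 1 then ennreal ((\<bar>e \<bullet> x\<bar> / norm x) powr q) else 0) \<partial>lborel) = 0"
    unfolding kappa_eq_nn_integral[OF q] using e k by (simp add: ennreal_neg)
  then have "(\<integral>\<^sup>+x. (if norm x < 1 then ennreal ((\<bar>e \<bullet> x\<bar> / norm x) powr q) else 0) \<partial>lborel) = 0" by simp
  then have "AE x in lborel. (if norm x < 1 then ennreal ((\<bar>e \<bullet> x\<bar> / norm x) powr q) else 0) = 0"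
    by (subst (asm) nn_integral_0_iff_AE) auto
  then have "AE x in lborel. \<not> (x \<in> ball ((1/2) *\<^sub>R e) (1/4))"
  proof (rule eventually_mono)
    fix x :: 'a assume z: "(if norm x < 1 then ennreal ((\<bar>e \<bullet> x\<bar> / norm x) powr q) else 0) = 0"
    show "\<not> (x \<in> ball ((1/2) *\<^sub>R e) (1/4))"
    proof
      assume "x \<in> ball ((1/2) *\<^sub>R e) (1/4)"
      then have d: "norm ((1/2) *\<^sub>R e - x) < 1/4" by (simp add: dist_norm)
      have "norm x \<le> norm ((1/2) *\<^sub>R e) + norm ((1/2) *\<^sub>R e - x)"
        using norm_triangle_sub[of x "(1/2) *\<^sub>R e"] by (simp add: norm_minus_commute)
      then have n1: "norm x < 1" using d e by simp
      have "\<bar>e \<bullet> ((1/2) *\<^sub>R e - x)\<bar> < 1/4" using Cauchy_Schwarz_ineq2[of e "(1/2) *\<^sub>R e - x"] d e by simp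
      moreover have "e \<bullet> ((1/2) *\<^sub>R e - x) = 1/2 - e \<bullet> x" using e by (simp add: inner_diff_right)
      ultimately have "0 < e \<bullet> x" by linarith
      then have "0 < (\<bar>e \<bullet> x\<bar> / norm x) powr q" by auto
      then show False using z n1 by simp
    qed
  qed
  then have "ball ((1/2) *\<^sub>R e) (1/4) \<in> null_sets lborel"
    by (subst AE_iff_null_sets) (simp_all only: sets_lborel borel_open open_ball)
  then have "emeasure lborel (ball ((1/2) *\<^sub>R e) (1/4)) = 0" by (rule null_setsD1)
  then show False using emeasure_lborel_ball_Bvol[of "1/4" "(1/2) *\<^sub>R e"] Bvol_pos[where 'a='a]
    by simp
qed

section \<open>Limits\<close>

text \<open>The mean value inequality for \<open>f\<close> minus a linear function. With
  \<open>v = G x\<close> it gives linear approximation; with \<open>v = 0\<close> it gives Lipschitz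
  bounds, and constancy where the gradient vanishes.\<close>

lemma C1_grad_mvt:
  fixes f :: "'a::euclidean_space \<Rightarrow> real"
  assumes fG: "C1_grad f G" and S: "convex S" "x \<in> S" "y \<in> S" and B: "\<And>z. z \<in> S \<Longrightarrow> norm (G z - v) \<le> B"
  shows "\<bar>f y - f x - v \<bullet> (y - x)\<bar> \<le> B * norm (y - x)"
proof -
  have "norm ((f y - v \<bullet> y) - (f x - v \<bullet> x)) \<le> B * norm (y - x)"
  proof (rule differentiable_bound[OF S(1) _ _ S(3,2)])
    fix z assume z: "z \<in> S"
    have "(f has_derivative (\<lambda>h. G z \<bullet> h)) (at z within S)"
      using fG by (auto simp: C1_grad_def intro: has_derivative_at_withinI)
    then show "((\<lambda>z. f z - v \<bullet> z) has_derivative (\<lambda>h. (G z - v) \<bullet> h)) (at z within S)"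
      by (auto intro!: derivative_eq_intros simp: inner_diff_left)
    show "onorm (\<lambda>h. (G z - v) \<bullet> h) \<le> B"
    proof (rule onorm_bound)
      show "0 \<le> B" using B[OF z] norm_ge_zero order_trans by blast
      show "norm ((G z - v) \<bullet> h) \<le> B * norm h" for h
        using Cauchy_Schwarz_ineq2[of "G z - v" h] mult_right_mono[OF B[OF z] norm_ge_zero[of h]] by simp
    qed
  qed
  then show ?thesis by (simp add: inner_diff_right algebra_simps)
qed

section \<open>Gradients with compact support\<close>

definition C1_comp :: "('a::euclidean_space \<Rightarrow> real) \<Rightarrow> ('a \<Rightarrow> 'a) \<Rightarrow> bool" where
  "C1_comp f G \<longleftrightarrow> C1_grad f G \<and> compact (closure {x. norm (G x) \<noteq> 0})"

lemma C1_comp_grad: "C1_comp f G \<Longrightarrow> C1_grad f G"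
  by (simp add: C1_comp_def)

lemma C1_comp_support:
  fixes f :: "'a::euclidean_space \<Rightarrow> real"
  assumes "C1_comp f G"
  obtains R where "0 < R" "\<And>x. R \<le> norm x \<Longrightarrow> G x = 0"
proof -
  have "bounded (closure {x. norm (G x) \<noteq> 0})" using assms by (auto simp: C1_comp_def compact_imp_bounded)
  then obtain R where R: "0 < R" "closure {x. norm (G x) \<noteq> 0} \<subseteq> ball 0 R"
    using bounded_subset_ballD by blast
  show ?thesis
  proof (rule that[OF R(1)])
    fix x :: 'a assume "R \<le> norm x"
    show "G x = 0"
    proof (rule ccontr)
      assume "G x \<noteq> 0"
      then have "x \<in> {x. norm (G x) \<noteq> 0}" by simp
      then have "x \<in> closure {x. norm (G x) \<noteq> 0}" by (rule subsetD[OF closure_subset])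
      then have "x \<in> ball 0 R" by (rule subsetD[OF R(2)])
      then show False using \<open>R \<le> norm x\<close> by simp
    qed
  qed
qed

lemma C1_comp_bounded:
  fixes f :: "'a::euclidean_space \<Rightarrow> real"
  assumes "C1_comp f G"
  obtains b where "0 < b" "\<And>x. norm (G x) \<le> b"
proof -
  obtain R where R: "0 < R" "\<And>x. R \<le> norm x \<Longrightarrow> G x = 0" using C1_comp_support[OF assms] by blast
  have "compact (G ` cball 0 R)"
    using C1_grad_continuous(2)[OF C1_comp_grad[OF assms]] by (intro compact_continuous_image) (auto intro: continuous_on_subset)
  then obtain b where b: "0 < b" "\<And>x. x \<in> cball 0 R \<Longrightarrow> norm (G x) \<le> b"
    using bounded_pos[of "G ` cball 0 R"] compact_imp_bounded by (metis imageI)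
  show ?thesis
    by (rule that[OF b(1)]) (use b R in \<open>metis linear mem_cball_0 norm_zero less_imp_le\<close>)
qed

lemma C1_comp_uniformly_continuous:
  fixes f :: "'a::euclidean_space \<Rightarrow> real"
  assumes "C1_comp f G" "0 < \<eta>"
  obtains \<delta> where "0 < \<delta>" "\<delta> \<le> 1" "\<And>x z. dist x z \<le> \<delta> \<Longrightarrow> norm (G z - G x) \<le> \<eta>"
proof -
  obtain R where R: "0 < R" "\<And>x. R \<le> norm x \<Longrightarrow> G x = 0" using C1_comp_support[OF assms(1)] by blast
  \<comment> \<open>As \<open>\<delta> \<le> 1\<close>, neighbours of a point in the ball of radius
    \<open>R + 1\<close> stay in this larger ball, while for points farther out both gradients
    vanish.\<close>
  have "uniformly_continuous_on (cball 0 (R + 2)) G"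
    using C1_grad_continuous(2)[OF C1_comp_grad[OF assms(1)]] by (intro compact_uniformly_continuous) (auto intro: continuous_on_subset)
  then obtain d where d: "0 < d" "\<And>x z. x \<in> cball 0 (R + 2) \<Longrightarrow> z \<in> cball 0 (R + 2) \<Longrightarrow> dist z x < d \<Longrightarrow> dist (G z) (G x) < \<eta>"
    using assms(2) unfolding uniformly_continuous_on_def by meson
  show ?thesis
  proof (rule that[of "min 1 (d/2)"])
    fix x z :: 'a assume xz: "dist x z \<le> min 1 (d/2)"
    show "norm (G z - G x) \<le> \<eta>"
    proof (cases "norm x \<le> R + 1")
      case True
      have "norm z \<le> norm x + dist x z" using norm_triangle_sub[of z x] by (simp add: dist_norm norm_minus_commute)
      then have "dist (G z) (G x) < \<eta>" using True xz d(1) by (intro d(2)) (auto simp: dist_commute)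
      then show ?thesis by (simp add: dist_norm)
    next
      case False
      have "norm x \<le> norm z + dist x z" using norm_triangle_sub[of x z] by (simp add: dist_norm)
      then have "R \<le> norm z" using False xz by simp
      then show ?thesis using R False assms(2) by simp
    qed
  qed (use d in auto)
qed

lemma C1_comp_linear_approx:
  fixes f :: "'a::euclidean_space \<Rightarrow> real"
  assumes "C1_comp f G" "0 < \<eta>"
  obtains \<delta> where "0 < \<delta>" "\<delta> \<le> 1" "\<And>x h. norm h \<le> \<delta> \<Longrightarrow> \<bar>f (x + h) - f x - G x \<bullet> h\<bar> \<le> \<eta> * norm h"
proof -
  obtain \<delta> where d: "0 < \<delta>" "\<delta> \<le> 1" "\<And>x z. dist x z \<le> \<delta> \<Longrightarrow> norm (G z - G x) \<le> \<eta>"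
    using C1_comp_uniformly_continuous[OF assms] by blast
  show ?thesis
  proof (rule that[OF d(1,2)])
    fix x h :: 'a assume "norm h \<le> \<delta>"
    then show "\<bar>f (x + h) - f x - G x \<bullet> h\<bar> \<le> \<eta> * norm h"
      using C1_grad_mvt[OF C1_comp_grad[OF assms(1)], of "cball x \<delta>" x "x + h" "G x" \<eta>] d by (auto simp: dist_norm)
  qed
qed

text \<open>Substitute \<open>y = x + s k\<close>. The choice of \<open>lam\<close> turns the
  threshold \<open>lam (s \<bar>k\<bar>)^(1 + \<gamma>/q)\<close> into
  \<open>\<bar>k\<bar>^(\<gamma>/q) s \<bar>k\<bar>\<close>, and the outer factors cancel,
  \<open>s^(-\<gamma>) s^n s^(\<gamma> - n) = 1\<close>. Both limits in \<open>lam\<close> thereby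
  become the limit \<open>s \<rightarrow> 0\<close>.\<close>

lemma Dint_rescale:
  fixes f :: "'a::euclidean_space \<Rightarrow> real" and s q \<gamma> :: real
  assumes [measurable]: "f \<in> borel_measurable borel" and s: "0 < s" and q: "0 < q"
  defines "lam \<equiv> s powr - (\<gamma>/q)"
  shows "ennreal (lam powr q) * Dint lam \<gamma> q f x =
    (\<integral>\<^sup>+k. (if k \<noteq> 0 \<and> norm k powr (\<gamma>/q) < \<bar>f (x + s *\<^sub>R k) - f x\<bar> / (s * norm k) then ennreal (norm k powr (\<gamma> - real DIM('a))) else 0) \<partial>lborel)"
proof -
  let ?n = "real DIM('a)"
  have lamq: "lam powr q = s powr - \<gamma>" using q by (simp add: lam_def powr_powr)
  have E: "(x, x + s *\<^sub>R k) \<in> Eset lam (\<gamma>/q) f \<longleftrightarrow> k \<noteq> 0 \<and> norm k powr (\<gamma>/q) < \<bar>f (x + s *\<^sub>R k) - f x\<bar> / (s * norm k)" for k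
  proof (cases "k = 0")
    case False
    have d: "dist x (x + s *\<^sub>R k) = s * norm k" using s by (simp add: dist_norm)
    have p: "0 < s * norm k" using s False by simp
    have pp: "0 < (s * norm k) powr (1 + \<gamma>/q)" using s False by simp
    have "lam < \<bar>f x - f (x + s *\<^sub>R k)\<bar> / (s * norm k) powr (1 + \<gamma>/q) \<longleftrightarrow> lam * (s * norm k) powr (1 + \<gamma>/q) < \<bar>f x - f (x + s *\<^sub>R k)\<bar>"
      by (rule pos_less_divide_eq[OF pp])
    also have "lam * (s * norm k) powr (1 + \<gamma>/q) = norm k powr (\<gamma>/q) * (s * norm k)"
      using s False by (simp add: lam_def powr_add powr_mult powr_minus)
    also have "norm k powr (\<gamma>/q) * (s * norm k) < \<bar>f x - f (x + s *\<^sub>R k)\<bar> \<longleftrightarrow> norm k powr (\<gamma>/q) < \<bar>f (x + s *\<^sub>R k) - f x\<bar> / (s * norm k)"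
      using p by (simp add: pos_less_divide_eq abs_minus_commute)
    finally show ?thesis using False s by (simp add: Eset_def d)
  qed (simp add: Eset_def)
  have "Dint lam \<gamma> q f x = ennreal (\<bar>s\<bar> ^ DIM('a)) * (\<integral>\<^sup>+k. (if (x, x + s *\<^sub>R k) \<in> Eset lam (\<gamma> / q) f then ennreal (dist x (x + s *\<^sub>R k) powr (\<gamma> - ?n)) else 0) \<partial>lborel)"
    unfolding Dint_altdef using s by (intro nn_integral_lborel_affine) auto
  also have "(\<integral>\<^sup>+k. (if (x, x + s *\<^sub>R k) \<in> Eset lam (\<gamma> / q) f then ennreal (dist x (x + s *\<^sub>R k) powr (\<gamma> - ?n)) else 0) \<partial>lborel)
     = (\<integral>\<^sup>+k. ennreal (s powr (\<gamma> - ?n)) * (if k \<noteq> 0 \<and> norm k powr (\<gamma>/q) < \<bar>f (x + s *\<^sub>R k) - f x\<bar> / (s * norm k) then ennreal (norm k powr (\<gamma> - ?n)) else 0) \<partial>lborel)"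
    unfolding E using s by (intro nn_integral_cong) (auto simp: dist_norm powr_mult ennreal_mult)
  also have "\<dots> = ennreal (s powr (\<gamma> - ?n)) * (\<integral>\<^sup>+k. (if k \<noteq> 0 \<and> norm k powr (\<gamma>/q) < \<bar>f (x + s *\<^sub>R k) - f x\<bar> / (s * norm k) then ennreal (norm k powr (\<gamma> - ?n)) else 0) \<partial>lborel)"
    by (rule nn_integral_cmult) measurable
  finally have "ennreal (lam powr q) * Dint lam \<gamma> q f x = ennreal (lam powr q) * ennreal (\<bar>s\<bar> ^ DIM('a)) * ennreal (s powr (\<gamma> - ?n)) *
     (\<integral>\<^sup>+k. (if k \<noteq> 0 \<and> norm k powr (\<gamma>/q) < \<bar>f (x + s *\<^sub>R k) - f x\<bar> / (s * norm k) then ennreal (norm k powr (\<gamma> - ?n)) else 0) \<partial>lborel)"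
    by (simp only: mult.assoc)
  also have "ennreal (lam powr q) * ennreal (\<bar>s\<bar> ^ DIM('a)) * ennreal (s powr (\<gamma> - ?n)) = 1"
    using s unfolding lamq by (simp add: ennreal_mult[symmetric] powr_realpow[symmetric] powr_add[symmetric])
  finally show ?thesis by simp
qed

text \<open>The level condition is strict, so a vector \<open>k\<close> satisfying it for the linear
  function satisfies it for the difference quotient of \<open>f\<close> as soon as
  \<open>s i \<bar>k\<bar>\<close> is small. Fatou's lemma integrates this pointwise lower
  bound.\<close>

lemma liminf_Dint_ge:
  fixes f :: "'a::euclidean_space \<Rightarrow> real"
  assumes fG: "C1_comp f G" and g: "\<gamma> \<noteq> 0" and q: "0 < q" and s: "\<And>i. 0 < s i" "s \<longlonglongrightarrow> 0"
  shows "ennreal (kappa q TYPE('a) / \<bar>\<gamma>\<bar> * norm (G x) powr q) \<le>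
     liminf (\<lambda>i. ennreal ((s i powr - (\<gamma>/q)) powr q) * Dint (s i powr - (\<gamma>/q)) \<gamma> q f x)"
proof -
  let ?n = "real DIM('a)"
  note [measurable] = C1_grad_measurable[OF C1_comp_grad[OF fG]]
  let ?u = "\<lambda>i k. if k \<noteq> 0 \<and> norm k powr (\<gamma>/q) < \<bar>f (x + s i *\<^sub>R k) - f x\<bar> / (s i * norm k) then ennreal (norm k powr (\<gamma> - ?n)) else 0"
  define \<psi> where "\<psi> k = \<bar>G x \<bullet> k\<bar> / norm k" for k
  have [measurable]: "\<psi> \<in> borel_measurable borel" unfolding \<psi>_def by measurable
  have "ennreal (kappa q TYPE('a) / \<bar>\<gamma>\<bar> * norm (G x) powr q) = ennreal (1 / \<bar>\<gamma>\<bar>) * ennreal (kappa q TYPE('a) * norm (G x) powr q)"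
    using kappa_pos[OF q, where 'a='a] by (simp add: ennreal_mult[symmetric])
  also have "\<dots> = ennreal (?n / \<bar>\<gamma>\<bar>) * (\<integral>\<^sup>+z. (if norm z < 1 then ennreal (\<psi> z powr q) else 0) \<partial>lborel)"
    unfolding kappa_eq_nn_integral[OF q, symmetric] \<psi>_def by (simp add: mult.assoc[symmetric] ennreal_mult[symmetric])
  also have "\<dots> = (\<integral>\<^sup>+h. (if h \<noteq> 0 \<and> norm h powr (\<gamma>/q) < \<psi> h then ennreal (norm h powr (\<gamma> - ?n)) else 0) \<partial>lborel)"
    by (rule nn_integral_homogeneous_levels[symmetric, OF _ g q]) (auto simp: \<psi>_def abs_mult)
  also have "\<dots> \<le> (\<integral>\<^sup>+k. liminf (\<lambda>i. ?u i k) \<partial>lborel)"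
  proof (intro nn_integral_mono)
    fix k :: 'a
    show "(if k \<noteq> 0 \<and> norm k powr (\<gamma>/q) < \<psi> k then ennreal (norm k powr (\<gamma> - ?n)) else 0) \<le> liminf (\<lambda>i. ?u i k)"
    proof (cases "k \<noteq> 0 \<and> norm k powr (\<gamma>/q) < \<psi> k")
      case True
      then have nk: "0 < norm k" by simp
      \<comment> \<open>Half of the margin in the strict inequality, to be used up by the error of
        linear approximation.\<close>
      define \<eta> where "\<eta> = (\<psi> k - norm k powr (\<gamma>/q)) / 2"
      have \<eta>: "0 < \<eta>" using True by (simp add: \<eta>_def)
      obtain \<delta> where d: "0 < \<delta>" "\<And>x h. norm h \<le> \<delta> \<Longrightarrow> \<bar>f (x + h) - f x - G x \<bullet> h\<bar> \<le> \<eta> * norm h"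
        using C1_comp_linear_approx[OF fG \<eta>] by metis
      have "eventually (\<lambda>i. s i < \<delta> / norm k) sequentially"
        using s(2) d(1) nk by (intro order_tendstoD(2)[of s 0]) auto
      then have "eventually (\<lambda>i. ennreal (norm k powr (\<gamma> - ?n)) \<le> ?u i k) sequentially"
      proof eventually_elim
        case (elim i)
        have n: "norm (s i *\<^sub>R k) = s i * norm k" using s(1)[of i] by simp
        have p: "0 < s i * norm k" using s(1)[of i] nk by simp
        have "norm (s i *\<^sub>R k) \<le> \<delta>" using elim nk unfolding n by (simp add: field_simps)
        from d(2)[OF this, of x] have "s i * \<bar>G x \<bullet> k\<bar> - \<eta> * (s i * norm k) \<le> \<bar>f (x + s i *\<^sub>R k) - f x\<bar>"
          using s(1)[of i] unfolding n by (simp add: abs_mult[symmetric])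
        then have "(s i * norm k) * (\<psi> k - \<eta>) \<le> \<bar>f (x + s i *\<^sub>R k) - f x\<bar>"
          using nk by (simp add: \<psi>_def algebra_simps)
        then have "\<psi> k - \<eta> \<le> \<bar>f (x + s i *\<^sub>R k) - f x\<bar> / (s i * norm k)"
          using p by (simp add: pos_le_divide_eq mult.commute)
        moreover have "norm k powr (\<gamma>/q) < \<psi> k - \<eta>" using \<eta> by (simp add: \<eta>_def field_simps)
        ultimately show ?case using nk by auto
      qed
      then have "ennreal (norm k powr (\<gamma> - ?n)) \<le> liminf (\<lambda>i. ?u i k)" by (rule Liminf_bounded)
      then show ?thesis using True by simp
    qed (auto simp only: if_False zero_le)
  qed
  also have "\<dots> \<le> liminf (\<lambda>i. \<integral>\<^sup>+k. ?u i k \<partial>lborel)"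
    by (rule nn_integral_liminf) measurable
  also have "(\<lambda>i. \<integral>\<^sup>+k. ?u i k \<partial>lborel) = (\<lambda>i. ennreal ((s i powr - (\<gamma>/q)) powr q) * Dint (s i powr - (\<gamma>/q)) \<gamma> q f x)"
    by (intro ext Dint_rescale[symmetric] s q) measurable
  finally show ?thesis .
qed

text \<open>Fatou's lemma on each single ball, followed by the supremum over balls.\<close>

lemma Nmor_liminf:
  fixes F :: "nat \<Rightarrow> 'a::euclidean_space \<Rightarrow> ennreal"
  assumes [measurable]: "\<And>i. F i \<in> borel_measurable borel" and le: "\<And>x. h x \<le> liminf (\<lambda>i. F i x)"
  shows "Nmor \<tau> h \<le> liminf (\<lambda>i. Nmor \<tau> (F i))"
  unfolding Nmor_def[of _ h]
proof (rule SUP_least, clarify)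
  fix x :: 'a and \<rho> :: real assume r: "0 < \<rho>"
  let ?c = "ennreal ((Bvol TYPE('a) * \<rho> ^ DIM('a)) powr - \<tau>)"
  have "?c * (\<integral>\<^sup>+y. (if dist x y < \<rho> then h y else 0) \<partial>lborel) \<le> ?c * (\<integral>\<^sup>+y. liminf (\<lambda>i. if dist x y < \<rho> then F i y else 0) \<partial>lborel)"
    using le by (intro mult_left_mono nn_integral_mono) auto
  also have "\<dots> \<le> ?c * liminf (\<lambda>i. \<integral>\<^sup>+y. (if dist x y < \<rho> then F i y else 0) \<partial>lborel)"
    by (intro mult_left_mono nn_integral_liminf) auto
  also have "\<dots> = liminf (\<lambda>i. ?c * (\<integral>\<^sup>+y. (if dist x y < \<rho> then F i y else 0) \<partial>lborel))"
    by (rule Liminf_compose_continuous_mono[symmetric])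
       (auto simp: mono_def intro!: mult_left_mono ennreal_continuous_on_cmult continuous_on_id)
  also have "\<dots> \<le> liminf (\<lambda>i. Nmor \<tau> (F i))"
  proof (rule Liminf_mono, rule always_eventually, rule allI)
    show "?c * (\<integral>\<^sup>+y. (if dist x y < \<rho> then F i y else 0) \<partial>lborel) \<le> Nmor \<tau> (F i)" for i
      unfolding Nmor_def using r by (intro SUP_upper2[of "(x, \<rho>)"]) auto
  qed
  finally show "?c * (\<integral>\<^sup>+y. (if dist x y < \<rho> then h y else 0) \<partial>lborel) \<le> liminf (\<lambda>i. Nmor \<tau> (F i))" .
qed

lemma Qfun_eq_Nmor':
  fixes f :: "'a::euclidean_space \<Rightarrow> real"
  assumes "0 < r" "0 < q" "0 < lam" and "f \<in> borel_measurable borel"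
  shows "Qfun \<alpha> r \<gamma> q f lam = epowr (Nmor (1 - r/\<alpha>) (\<lambda>x. epowr (ennreal (lam powr q) * Dint lam \<gamma> q f x) (r/q))) (1/r)"
  using assms by (simp add: Qfun_eq_Nmor epowr_mult epowr_ennreal powr_powr)

lemma Qfun_liminf:
  fixes f :: "'a::euclidean_space \<Rightarrow> real"
  assumes fG: "C1_comp f G" and g: "\<gamma> \<noteq> 0" and q: "0 < q" and r: "0 < r"
    and X: "\<And>i. 0 < X i" "(\<lambda>i. X i powr - (q/\<gamma>)) \<longlonglongrightarrow> 0"
  shows "ennreal ((kappa q TYPE('a) / \<bar>\<gamma>\<bar>) powr (1/q)) * morrey_norm \<alpha> r (\<lambda>x. ennreal (norm (G x)))
    \<le> liminf (\<lambda>i. Qfun \<alpha> r \<gamma> q f (X i))"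
proof -
  note [measurable] = C1_grad_measurable[OF C1_comp_grad[OF fG]]
  let ?k = "kappa q TYPE('a) / \<bar>\<gamma>\<bar>"
  have k: "0 < ?k" using kappa_pos[OF q, where 'a='a] g by simp
  define s where "s i = X i powr - (q/\<gamma>)" for i
  have Xs: "X i = s i powr - (\<gamma>/q)" for i using X(1)[of i] g q by (simp add: s_def powr_powr)
  have s: "0 < s i" "s \<longlonglongrightarrow> 0" for i
    using X(1)[of i] X(2) by (simp_all add: s_def[abs_def])
  have pw: "ennreal (?k powr (r/q)) * epowr (ennreal (norm (G x))) r \<le> liminf (\<lambda>i. epowr (ennreal (X i powr q) * Dint (X i) \<gamma> q f x) (r/q))" for x
  proof -
    have "ennreal (?k powr (r/q)) * epowr (ennreal (norm (G x))) r = epowr (ennreal (?k * norm (G x) powr q)) (r/q)"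
    proof -
      have 0: "0 \<le> ?k * norm (G x) powr q" by (rule mult_nonneg_nonneg[OF less_imp_le[OF k] powr_ge_zero])
      have "(?k * norm (G x) powr q) powr (r/q) = ?k powr (r/q) * norm (G x) powr r"
        using k q by (subst powr_mult) (simp_all only: powr_powr powr_ge_zero less_imp_le, simp)
      then show ?thesis
        unfolding epowr_ennreal[OF 0] epowr_ennreal[OF norm_ge_zero] by (simp only: ennreal_mult powr_ge_zero)
    qed
    also have "\<dots> \<le> epowr (liminf (\<lambda>i. ennreal (X i powr q) * Dint (X i) \<gamma> q f x)) (r/q)"
      unfolding Xs using r q by (intro epowr_mono liminf_Dint_ge[OF fG g q s]) auto
    also have "\<dots> = liminf (\<lambda>i. epowr (ennreal (X i powr q) * Dint (X i) \<gamma> q f x) (r/q))"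
      using r q by (intro Liminf_compose_continuous_mono[symmetric] continuous_on_epowr) (auto simp: mono_def intro: epowr_mono)
    finally show ?thesis .
  qed
  have "ennreal (?k powr (r/q)) * Nmor (1 - r/\<alpha>) (\<lambda>x. epowr (ennreal (norm (G x))) r) = Nmor (1 - r/\<alpha>) (\<lambda>x. ennreal (?k powr (r/q)) * epowr (ennreal (norm (G x))) r)"
    by (rule Nmor_cmult[symmetric]) measurable
  also have "\<dots> \<le> liminf (\<lambda>i. Nmor (1 - r/\<alpha>) (\<lambda>x. epowr (ennreal (X i powr q) * Dint (X i) \<gamma> q f x) (r/q)))"
    by (intro Nmor_liminf pw) measurable
  finally have "epowr (ennreal (?k powr (r/q)) * Nmor (1 - r/\<alpha>) (\<lambda>x. epowr (ennreal (norm (G x))) r)) (1/r)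
    \<le> epowr (liminf (\<lambda>i. Nmor (1 - r/\<alpha>) (\<lambda>x. epowr (ennreal (X i powr q) * Dint (X i) \<gamma> q f x) (r/q)))) (1/r)"
    using r by (intro epowr_mono) auto
  also have "\<dots> = liminf (\<lambda>i. epowr (Nmor (1 - r/\<alpha>) (\<lambda>x. epowr (ennreal (X i powr q) * Dint (X i) \<gamma> q f x) (r/q))) (1/r))"
    using r by (intro Liminf_compose_continuous_mono[symmetric] continuous_on_epowr) (auto simp: mono_def intro: epowr_mono)
  also have "\<dots> = liminf (\<lambda>i. Qfun \<alpha> r \<gamma> q f (X i))"
    using r q X(1) by (simp add: Qfun_eq_Nmor')
  also have "epowr (ennreal (?k powr (r/q)) * Nmor (1 - r/\<alpha>) (\<lambda>x. epowr (ennreal (norm (G x))) r)) (1/r)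
    = ennreal (?k powr (1/q)) * morrey_norm \<alpha> r (\<lambda>x. ennreal (norm (G x)))"
    using r k by (simp add: morrey_norm_eq_Nmor epowr_mult epowr_ennreal powr_powr)
  finally show ?thesis .
qed

text \<open>The levels \<open>X i\<close> correspond to \<open>s = 1 / (i + 1)\<close>; a lower
  limit along them cannot exceed the supremum over all levels.\<close>

lemma Qfun_lower_bound:
  fixes f :: "'a::euclidean_space \<Rightarrow> real"
  assumes fG: "C1_comp f G" and g: "\<gamma> \<noteq> 0" and q: "0 < q" and r: "0 < r"
  shows "ennreal ((kappa q TYPE('a) / \<bar>\<gamma>\<bar>) powr (1/q)) * morrey_norm \<alpha> r (\<lambda>x. ennreal (norm (G x)))
    \<le> (SUP lam \<in> {0<..}. Qfun \<alpha> r \<gamma> q f lam)"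
proof -
  define X where "X i = (1 / real (Suc i)) powr - (\<gamma>/q)" for i
  have X: "0 < X i" for i by (simp add: X_def)
  have "(\<lambda>i. X i powr - (q/\<gamma>)) = (\<lambda>i. 1 / real (Suc i))"
    using g q by (intro ext) (simp add: X_def powr_powr)
  then have X0: "(\<lambda>i. X i powr - (q/\<gamma>)) \<longlonglongrightarrow> 0" using LIMSEQ_inverse_real_of_nat by (simp add: inverse_eq_divide)
  have "ennreal ((kappa q TYPE('a) / \<bar>\<gamma>\<bar>) powr (1/q)) * morrey_norm \<alpha> r (\<lambda>x. ennreal (norm (G x)))
    \<le> liminf (\<lambda>i. Qfun \<alpha> r \<gamma> q f (X i))"
    by (rule Qfun_liminf[OF fG g q r X X0])
  also have "\<dots> \<le> limsup (\<lambda>i. Qfun \<alpha> r \<gamma> q f (X i))" by (rule Liminf_le_Limsup) simp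
  also have "\<dots> \<le> (SUP lam \<in> {0<..}. Qfun \<alpha> r \<gamma> q f lam)"
    using X by (intro Limsup_bounded always_eventually allI SUP_upper) auto
  finally show ?thesis .
qed

section \<open>Upper estimate of the limit: close and distant points\<close>

definition Drem :: "real \<Rightarrow> real \<Rightarrow> real \<Rightarrow> real \<Rightarrow> ('a::euclidean_space \<Rightarrow> real) \<Rightarrow> 'a \<Rightarrow> ennreal" where
  "Drem \<delta> lam \<gamma> q f x = (\<integral>\<^sup>+ y. (if (x, y) \<in> Eset lam (\<gamma> / q) f \<and> \<delta> < dist x y then ennreal (dist x y powr (\<gamma> - real DIM('a))) else 0) \<partial>lborel)"

text \<open>Linear approximation bounds the difference quotient by \<open>A h + \<eta>\<close>,
  which depends only on the direction of \<open>h\<close>, so the enlarged integral can be evaluated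
  exactly. Splitting the \<open>q\<close>-th power of the sum with parameter
  \<open>\<epsilon>\<close> then leaves the \<open>kappa\<close> term with a factor close to
  1.\<close>

lemma Dint_local_le:
  fixes f :: "'a::euclidean_space \<Rightarrow> real"
  assumes [measurable]: "f \<in> borel_measurable borel" and lam: "0 < lam" and g: "\<gamma> \<noteq> 0" and q: "0 < q"
    and \<eta>: "0 < \<eta>" and \<epsilon>: "0 < \<epsilon>"
    and approx: "\<And>h. norm h \<le> \<delta> \<Longrightarrow> \<bar>f (x + h) - f x - v \<bullet> h\<bar> \<le> \<eta> * norm h"
  shows "ennreal (lam powr q) * (\<integral>\<^sup>+ y. (if (x, y) \<in> Eset lam (\<gamma> / q) f \<and> dist x y \<le> \<delta> then ennreal (dist x y powr (\<gamma> - real DIM('a))) else 0) \<partial>lborel)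
    \<le> ennreal ((1 + \<epsilon>) powr q * (kappa q TYPE('a) / \<bar>\<gamma>\<bar>) * norm v powr q)
      + ennreal ((1 + 1/\<epsilon>) powr q * (real DIM('a) * Bvol TYPE('a) / \<bar>\<gamma>\<bar>) * \<eta> powr q)"
proof -
  let ?n = "real DIM('a)" and ?b = "Bvol TYPE('a)"
  have b: "0 < ?b" by (rule Bvol_pos)
  define A where "A z = \<bar>v \<bullet> z\<bar> / norm z" for z
  have A: "0 \<le> A z" for z by (simp add: A_def)
  have [measurable]: "A \<in> borel_measurable borel" unfolding A_def by measurable
  define \<psi> where "\<psi> z = (A z + \<eta>) / lam" for z
  have [measurable]: "\<psi> \<in> borel_measurable borel" unfolding \<psi>_def by measurable
  have lq: "0 < lam powr q" using lam by simp
  have "(\<integral>\<^sup>+ y. (if (x, y) \<in> Eset lam (\<gamma> / q) f \<and> dist x y \<le> \<delta> then ennreal (dist x y powr (\<gamma> - ?n)) else 0) \<partial>lborel)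
    = (\<integral>\<^sup>+ h. (if (x, x + h) \<in> Eset lam (\<gamma> / q) f \<and> dist x (x + h) \<le> \<delta> then ennreal (dist x (x + h) powr (\<gamma> - ?n)) else 0) \<partial>lborel)"
    by (rule nn_integral_lborel_shift[symmetric, where f="\<lambda>y. if (x, y) \<in> Eset lam (\<gamma> / q) f \<and> dist x y \<le> \<delta> then ennreal (dist x y powr (\<gamma> - ?n)) else 0"]) measurable
  also have "\<dots> \<le> (\<integral>\<^sup>+h. (if h \<noteq> 0 \<and> norm h powr (\<gamma>/q) < \<psi> h then ennreal (norm h powr (\<gamma> - ?n)) else 0) \<partial>lborel)"
  proof (rule nn_integral_mono)
    fix h :: 'a
    have "h \<noteq> 0 \<and> norm h powr (\<gamma>/q) < \<psi> h" if E: "(x, x + h) \<in> Eset lam (\<gamma> / q) f" and d: "dist x (x + h) \<le> \<delta>"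
    proof -
      have h: "h \<noteq> 0" using E by (auto simp: Eset_def)
      then have nh: "0 < norm h" by simp
      then have pp: "0 < norm h powr (1 + \<gamma>/q)" by simp
      have "lam < \<bar>f x - f (x + h)\<bar> / norm h powr (1 + \<gamma>/q)" using E by (simp add: Eset_def dist_norm)
      then have "lam * norm h powr (1 + \<gamma>/q) < \<bar>f x - f (x + h)\<bar>" by (simp only: pos_less_divide_eq[OF pp])
      also have "\<dots> \<le> \<bar>v \<bullet> h\<bar> + \<eta> * norm h" using approx[of h] d by (simp add: dist_norm)
      also have "\<dots> = (A h + \<eta>) * norm h" using nh by (simp add: A_def distrib_right)
      also have "lam * norm h powr (1 + \<gamma>/q) = lam * norm h powr (\<gamma>/q) * norm h" using nh by (simp add: powr_add)
      finally have "lam * norm h powr (\<gamma>/q) < A h + \<eta>" using nh by simp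
      then have "norm h powr (\<gamma>/q) < \<psi> h" using lam by (simp add: \<psi>_def pos_less_divide_eq mult.commute)
      then show ?thesis using h by simp
    qed
    then show "(if (x, x + h) \<in> Eset lam (\<gamma> / q) f \<and> dist x (x + h) \<le> \<delta> then ennreal (dist x (x + h) powr (\<gamma> - ?n)) else 0)
      \<le> (if h \<noteq> 0 \<and> norm h powr (\<gamma>/q) < \<psi> h then ennreal (norm h powr (\<gamma> - ?n)) else 0)"
      by (auto simp: dist_norm)
  qed
  also have "\<dots> = ennreal (?n / \<bar>\<gamma>\<bar>) * (\<integral>\<^sup>+z. (if norm z < 1 then ennreal (\<psi> z powr q) else 0) \<partial>lborel)"
    using A \<eta> lam by (intro nn_integral_homogeneous_levels g q) (auto simp: \<psi>_def A_def abs_mult)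
  finally have "ennreal (lam powr q) * (\<integral>\<^sup>+ y. (if (x, y) \<in> Eset lam (\<gamma> / q) f \<and> dist x y \<le> \<delta> then ennreal (dist x y powr (\<gamma> - ?n)) else 0) \<partial>lborel)
    \<le> ennreal (lam powr q) * (ennreal (?n / \<bar>\<gamma>\<bar>) * (\<integral>\<^sup>+z. (if norm z < 1 then ennreal (\<psi> z powr q) else 0) \<partial>lborel))"
    by (rule mult_left_mono) simp
  also have "\<dots> = ennreal (?n / \<bar>\<gamma>\<bar>) * (\<integral>\<^sup>+z. ennreal (lam powr q) * (if norm z < 1 then ennreal (\<psi> z powr q) else 0) \<partial>lborel)"
    by (subst nn_integral_cmult) (auto simp: mult_ac)
  also have "\<dots> \<le> ennreal (?n / \<bar>\<gamma>\<bar>) * (\<integral>\<^sup>+z. ennreal ((1 + \<epsilon>) powr q) * (if norm z < 1 then ennreal (A z powr q) else 0)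
       + (if dist 0 z < 1 then ennreal ((1 + 1/\<epsilon>) powr q * \<eta> powr q) else 0) \<partial>lborel)"
  proof (intro mult_left_mono nn_integral_mono)
    fix z :: 'a
    have "ennreal (lam powr q) * ennreal (\<psi> z powr q) = ennreal ((A z + \<eta>) powr q)"
      using lam A[of z] \<eta> by (simp add: \<psi>_def powr_divide ennreal_mult[symmetric])
    also have "\<dots> = epowr (ennreal (A z) + ennreal \<eta>) q"
      using A[of z] \<eta> by (simp add: epowr_ennreal flip: ennreal_plus)
    also have "\<dots> \<le> ennreal ((1 + \<epsilon>) powr q) * ennreal (A z powr q) + ennreal ((1 + 1/\<epsilon>) powr q * \<eta> powr q)"
      using epowr_add_le[OF q \<epsilon>, of "ennreal (A z)" "ennreal \<eta>"] A[of z] \<eta> by (simp add: epowr_ennreal ennreal_mult)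
    finally show "ennreal (lam powr q) * (if norm z < 1 then ennreal (\<psi> z powr q) else 0) \<le> ennreal ((1 + \<epsilon>) powr q) * (if norm z < 1 then ennreal (A z powr q) else 0)
       + (if dist 0 z < 1 then ennreal ((1 + 1/\<epsilon>) powr q * \<eta> powr q) else 0)"
      by auto
  qed simp
  also have "(\<integral>\<^sup>+z. ennreal ((1 + \<epsilon>) powr q) * (if norm z < 1 then ennreal (A z powr q) else 0)
       + (if dist 0 z < 1 then ennreal ((1 + 1/\<epsilon>) powr q * \<eta> powr q) else 0) \<partial>lborel)
     = ennreal ((1 + \<epsilon>) powr q) * (\<integral>\<^sup>+z. (if norm z < 1 then ennreal (A z powr q) else 0) \<partial>lborel)
       + ennreal ((1 + 1/\<epsilon>) powr q * \<eta> powr q) * ennreal (?b * 1 ^ DIM('a))"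
    by (subst nn_integral_add, measurable, subst nn_integral_cmult, measurable, subst nn_integral_ball_const) auto
  also have "ennreal (?n / \<bar>\<gamma>\<bar>) * \<dots> = ennreal ((1 + \<epsilon>) powr q) * (ennreal (1 / \<bar>\<gamma>\<bar>) * (ennreal ?n * (\<integral>\<^sup>+z. (if norm z < 1 then ennreal (A z powr q) else 0) \<partial>lborel)))
       + ennreal (?n / \<bar>\<gamma>\<bar>) * (ennreal ((1 + 1/\<epsilon>) powr q * \<eta> powr q) * ennreal (?b * 1 ^ DIM('a)))"
  proof -
    have "ennreal (?n / \<bar>\<gamma>\<bar>) = ennreal (1 / \<bar>\<gamma>\<bar>) * ennreal ?n" by (simp add: ennreal_mult[symmetric])
    then show ?thesis unfolding distrib_left by (simp only: mult_ac)
  qed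
  also have "ennreal ?n * (\<integral>\<^sup>+z. (if norm z < 1 then ennreal (A z powr q) else 0) \<partial>lborel) = ennreal (kappa q TYPE('a) * norm v powr q)"
    unfolding A_def by (rule kappa_eq_nn_integral[OF q])
  also have "ennreal ((1 + \<epsilon>) powr q) * (ennreal (1 / \<bar>\<gamma>\<bar>) * ennreal (kappa q TYPE('a) * norm v powr q)) = ennreal ((1 + \<epsilon>) powr q * (kappa q TYPE('a) / \<bar>\<gamma>\<bar>) * norm v powr q)"
    using kappa_pos[OF q, where 'a='a] by (simp add: ennreal_mult[symmetric])
  also have "ennreal (?n / \<bar>\<gamma>\<bar>) * (ennreal ((1 + 1/\<epsilon>) powr q * \<eta> powr q) * ennreal (?b * 1 ^ DIM('a))) = ennreal ((1 + 1/\<epsilon>) powr q * (?n * ?b / \<bar>\<gamma>\<bar>) * \<eta> powr q)"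
    using b by (simp add: ennreal_mult[symmetric] mult_ac)
  finally show ?thesis .
qed

text \<open>On balls of volume \<open>V \<le> 1\<close> boundedness gives an integral of order
  \<open>V \<le> V^\<tau>\<close>; on larger balls integrability suffices, as
  \<open>V^\<tau> \<ge> 1\<close>.\<close>

lemma Nmor_finite:
  fixes h :: "'a::euclidean_space \<Rightarrow> ennreal"
  assumes [measurable]: "h \<in> borel_measurable borel" and tau: "0 \<le> \<tau>" "\<tau> \<le> 1"
    and bdd: "\<And>x. h x \<le> ennreal b" and fin: "(\<integral>\<^sup>+x. h x \<partial>lborel) < top"
  shows "Nmor \<tau> h < top"
proof -
  have "Nmor \<tau> h \<le> ennreal (max b 0) + (\<integral>\<^sup>+x. h x \<partial>lborel)"
  proof (rule Nmor_le)
    fix x :: 'a and \<rho> :: real assume r: "0 < \<rho>"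
    let ?V = "Bvol TYPE('a) * \<rho> ^ DIM('a)"
    have V: "0 < ?V" using r Bvol_pos[where 'a='a] by simp
    show "(\<integral>\<^sup>+y. (if dist x y < \<rho> then h y else 0) \<partial>lborel) \<le> ennreal (?V powr \<tau>) * (ennreal (max b 0) + (\<integral>\<^sup>+x. h x \<partial>lborel))"
    proof (cases "?V \<le> 1")
      case True
      have "(\<integral>\<^sup>+y. (if dist x y < \<rho> then h y else 0) \<partial>lborel) \<le> (\<integral>\<^sup>+y. (if dist x y < \<rho> then ennreal (max b 0) else 0) \<partial>lborel)"
        by (intro nn_integral_mono) (auto intro!: order_trans[OF bdd ennreal_leI])
      also have "\<dots> = ennreal (max b 0) * ennreal ?V" using r by (intro nn_integral_ball_const) simp
      also have "\<dots> \<le> ennreal (max b 0) * ennreal (?V powr \<tau>)"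
        using powr_mono'[of \<tau> 1 ?V] True V tau by (intro mult_left_mono ennreal_leI) auto
      also have "\<dots> \<le> ennreal (?V powr \<tau>) * (ennreal (max b 0) + (\<integral>\<^sup>+x. h x \<partial>lborel))"
        unfolding distrib_left by (subst mult.commute) (rule add_increasing2, auto)
      finally show ?thesis .
    next
      case False
      have "(\<integral>\<^sup>+y. (if dist x y < \<rho> then h y else 0) \<partial>lborel) \<le> 1 * (\<integral>\<^sup>+x. h x \<partial>lborel)"
        unfolding mult_1 by (intro nn_integral_mono) auto
      also have "\<dots> \<le> ennreal (?V powr \<tau>) * (ennreal (max b 0) + (\<integral>\<^sup>+x. h x \<partial>lborel))"
      proof (intro mult_mono)
        show "1 \<le> ennreal (?V powr \<tau>)" using False tau by (simp add: ennreal_leI[of 1, simplified] ge_one_powr_ge_zero)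
      qed auto
      finally show ?thesis .
    qed
  qed
  also have "\<dots> < top" using fin by simp
  finally show ?thesis .
qed

text \<open>The parameters are chosen in this order: \<open>\<epsilon>\<close> brings the main term
  within \<open>e / 2\<close> of its limit, then \<open>\<eta>\<close> (and with it
  \<open>\<delta>\<close>) makes the approximation error at most \<open>e / 4\<close>, and finally
  \<open>lam\<close> makes the remainder at most \<open>e / 4\<close>. The hypothesis on the
  remainder asks for one fixed \<open>W\<close> of finite norm and a factor
  \<open>\<omega> lam\<close> tending to 0.\<close>

lemma Nmor_Dint_limsup:
  fixes f :: "'a::euclidean_space \<Rightarrow> real"
  assumes fG: "C1_comp f G" and g: "\<gamma> \<noteq> 0" and q: "0 < q" and r: "0 < r" and tau: "0 \<le> \<tau>" "\<tau> \<le> 1"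
    and rem: "\<And>\<delta>. 0 < \<delta> \<Longrightarrow> \<delta> \<le> 1 \<Longrightarrow> \<exists>W \<omega>. W \<in> borel_measurable borel \<and> Nmor \<tau> (\<lambda>x. epowr (W x) (r/q)) < top \<and>
        (\<omega> \<longlongrightarrow> 0) \<F> \<and> eventually (\<lambda>lam. 0 < lam \<and> 0 \<le> \<omega> lam \<and> (\<forall>x. ennreal (lam powr q) * Drem \<delta> lam \<gamma> q f x \<le> ennreal (\<omega> lam) * W x)) \<F>"
    and e: "0 < e"
  shows "eventually (\<lambda>lam. Nmor \<tau> (\<lambda>x. epowr (ennreal (lam powr q) * Dint lam \<gamma> q f x) (r/q))
     \<le> ennreal ((kappa q TYPE('a) / \<bar>\<gamma>\<bar>) powr (r/q)) * Nmor \<tau> (\<lambda>x. epowr (ennreal (norm (G x))) r) + ennreal e) \<F>"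
proof -
  let ?k = "kappa q TYPE('a) / \<bar>\<gamma>\<bar>" and ?n = "real DIM('a)"
  note [measurable] = C1_grad_measurable[OF C1_comp_grad[OF fG]]
  define \<theta> where "\<theta> = r / q"
  have \<theta>: "0 < \<theta>" using q r by (simp add: \<theta>_def)
  have k: "0 < ?k" using kappa_pos[OF q, where 'a='a] g by simp
  obtain R where R: "0 < R" "\<And>x. R \<le> norm x \<Longrightarrow> G x = 0" using C1_comp_support[OF fG] by blast
  obtain b where b: "0 < b" "\<And>x. norm (G x) \<le> b" using C1_comp_bounded[OF fG] by blast
  \<comment> \<open>The indicator of a ball outside which close points contribute nothing. It keeps
    the additive error of \<open>Dint_local_le\<close>, a constant in \<open>x\<close>, of finite
    norm.\<close>
  define I where "I x = (if dist 0 x < R + 1 then 1 else (0::ennreal))" for x :: 'a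
  have [measurable]: "I \<in> borel_measurable borel" unfolding I_def by measurable
  have Iint: "(\<integral>\<^sup>+x. I x \<partial>lborel) < top"
    using R nn_integral_ball_const[of "R + 1" "0::'a" 1] by (simp add: I_def[abs_def])
  have "Nmor \<tau> I < top"
    by (rule Nmor_finite[OF _ tau _ Iint, of 1]) (auto simp: I_def)
  then obtain n1 where n1: "0 \<le> n1" "Nmor \<tau> I = ennreal n1" by (cases "Nmor \<tau> I") auto
  have "Nmor \<tau> (\<lambda>x. epowr (ennreal (norm (G x))) r) \<le> Nmor \<tau> (\<lambda>x. ennreal (b powr r) * I x)"
  proof (rule Nmor_mono)
    fix x
    show "epowr (ennreal (norm (G x))) r \<le> ennreal (b powr r) * I x"
      using R(2)[of x] b(2)[of x] r by (cases "norm x < R + 1") (auto simp: I_def epowr_ennreal intro!: ennreal_leI powr_mono2)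
  qed
  also have "\<dots> = ennreal (b powr r) * Nmor \<tau> I" by (rule Nmor_cmult) measurable
  also have "\<dots> < top" using n1 by (simp add: ennreal_mult_less_top)
  finally obtain n0 where n0: "0 \<le> n0" "Nmor \<tau> (\<lambda>x. epowr (ennreal (norm (G x))) r) = ennreal n0"
    by (cases "Nmor \<tau> (\<lambda>x. epowr (ennreal (norm (G x))) r)") auto
  have "((\<lambda>\<epsilon>. (1 + \<epsilon>) powr \<theta> * ((1 + \<epsilon>) powr q * ?k) powr \<theta> * n0) \<longlongrightarrow> (1 + 0) powr \<theta> * ((1 + 0) powr q * ?k) powr \<theta> * n0) (at_right 0)"
    using k by (intro tendsto_intros) auto
  then have "eventually (\<lambda>\<epsilon>. (1 + \<epsilon>) powr \<theta> * ((1 + \<epsilon>) powr q * ?k) powr \<theta> * n0 < ?k powr \<theta> * n0 + e / 2) (at_right 0)"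
    by (rule order_tendstoD) (use e in simp)
  then have "eventually (\<lambda>\<epsilon>. 0 < \<epsilon> \<and> (1 + \<epsilon>) powr \<theta> * ((1 + \<epsilon>) powr q * ?k) powr \<theta> * n0 < ?k powr \<theta> * n0 + e / 2) (at_right 0)"
    using eventually_at_right_less[of "0::real"] by eventually_elim auto
  then obtain \<epsilon> where \<epsilon>: "0 < \<epsilon>" "(1 + \<epsilon>) powr \<theta> * ((1 + \<epsilon>) powr q * ?k) powr \<theta> * n0 < ?k powr \<theta> * n0 + e / 2"
    using eventually_happens'[OF trivial_limit_at_right_real] by blast
  have \<epsilon>1: "0 < 1 + 1/\<epsilon>" using \<epsilon>(1) by (simp add: add_pos_pos)
  define c2 where "c2 = (1 + 1/\<epsilon>) powr q * (?n * Bvol TYPE('a) / \<bar>\<gamma>\<bar>)"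
  have c2: "0 < c2" using \<epsilon>1 g Bvol_pos[where 'a='a] by (auto simp: c2_def)
  \<comment> \<open>The first factor comes from separating the main term with parameter
    \<open>\<epsilon>\<close>, the second from separating the two error terms with parameter
    1.\<close>
  define C\<epsilon> where "C\<epsilon> = (1 + 1/\<epsilon>) powr \<theta> * 2 powr \<theta>"
  have C\<epsilon>: "0 < C\<epsilon>" using \<epsilon>1 by (auto simp: C\<epsilon>_def)
  define A where "A = C\<epsilon> * c2 powr \<theta> * n1"
  have A: "0 \<le> A" using C\<epsilon> n1 by (simp add: A_def)
  \<comment> \<open>Solves \<open>A \<eta>^r \<le> e / 4\<close>; dividing by \<open>A + 1\<close>
    instead of \<open>A\<close> covers \<open>A = 0\<close>. The bound \<open>w0\<close> below is
    built in the same way.\<close>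
  define \<eta> where "\<eta> = (e / 4 / (A + 1)) powr (1/r)"
  have \<eta>: "0 < \<eta>" using e A by (simp add: \<eta>_def)
  have \<eta>r: "\<eta> powr r = e / 4 / (A + 1)" using e A r by (simp add: \<eta>_def powr_powr)
  obtain \<delta> where d: "0 < \<delta>" "\<delta> \<le> 1" "\<And>x h. norm h \<le> \<delta> \<Longrightarrow> \<bar>f (x + h) - f x - G x \<bullet> h\<bar> \<le> \<eta> * norm h"
    using C1_comp_linear_approx[OF fG \<eta>] by metis
  obtain W \<omega> where W[measurable]: "W \<in> borel_measurable borel" and Wfin: "Nmor \<tau> (\<lambda>x. epowr (W x) \<theta>) < top"
    and \<omega>: "(\<omega> \<longlongrightarrow> 0) \<F>" and ev: "eventually (\<lambda>lam. 0 < lam \<and> 0 \<le> \<omega> lam \<and> (\<forall>x. ennreal (lam powr q) * Drem \<delta> lam \<gamma> q f x \<le> ennreal (\<omega> lam) * W x)) \<F>"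
    using rem[OF d(1,2)] unfolding \<theta>_def by blast
  obtain n2 where n2: "0 \<le> n2" "Nmor \<tau> (\<lambda>x. epowr (W x) \<theta>) = ennreal n2" using Wfin by (cases "Nmor \<tau> (\<lambda>x. epowr (W x) \<theta>)") auto
  define A' where "A' = C\<epsilon> * n2"
  have A': "0 \<le> A'" using C\<epsilon> n2 by (simp add: A'_def)
  define w0 where "w0 = (e / 4 / (A' + 1)) powr (1/\<theta>)"
  have w0: "0 < w0" using e A' by (simp add: w0_def)
  have w0r: "w0 powr \<theta> = e / 4 / (A' + 1)" using e A' \<theta> by (simp add: w0_def powr_powr)
  have "eventually (\<lambda>lam. \<omega> lam < w0) \<F>" using order_tendstoD(2)[OF \<omega> w0] .
  with ev show ?thesis
  proof eventually_elim
    case (elim lam)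
    then have lam: "0 < lam" and om: "0 \<le> \<omega> lam" "\<omega> lam < w0" and Rem: "\<And>x. ennreal (lam powr q) * Drem \<delta> lam \<gamma> q f x \<le> ennreal (\<omega> lam) * W x" by auto
    define a where "a x = ennreal ((1 + \<epsilon>) powr q * ?k * norm (G x) powr q)" for x
    define b1 where "b1 x = ennreal (c2 * \<eta> powr q) * I x" for x
    define b2 where "b2 x = ennreal (\<omega> lam) * W x" for x
    have [measurable]: "a \<in> borel_measurable borel" "b1 \<in> borel_measurable borel" "b2 \<in> borel_measurable borel"
      unfolding a_def b1_def b2_def by measurable
    have main: "ennreal (lam powr q) * Dint lam \<gamma> q f x \<le> a x + (b1 x + b2 x)" for x
    proof -
      let ?L = "\<integral>\<^sup>+ y. (if (x, y) \<in> Eset lam (\<gamma> / q) f \<and> dist x y \<le> \<delta> then ennreal (dist x y powr (\<gamma> - ?n)) else 0) \<partial>lborel"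
      have "Dint lam \<gamma> q f x = (\<integral>\<^sup>+ y. (if (x, y) \<in> Eset lam (\<gamma> / q) f \<and> dist x y \<le> \<delta> then ennreal (dist x y powr (\<gamma> - ?n)) else 0)
          + (if (x, y) \<in> Eset lam (\<gamma> / q) f \<and> \<delta> < dist x y then ennreal (dist x y powr (\<gamma> - ?n)) else 0) \<partial>lborel)"
        unfolding Dint_altdef by (intro nn_integral_cong) auto
      also have "\<dots> = ?L + Drem \<delta> lam \<gamma> q f x"
        unfolding Drem_def by (rule nn_integral_add) measurable
      finally have split: "ennreal (lam powr q) * Dint lam \<gamma> q f x = ennreal (lam powr q) * ?L + ennreal (lam powr q) * Drem \<delta> lam \<gamma> q f x"
        by (simp add: distrib_left)
      have "ennreal (lam powr q) * ?L \<le> a x + b1 x"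
      proof (cases "norm x < R + 1")
        case True
        then show ?thesis
          using Dint_local_le[where x=x and v="G x", OF C1_grad_measurable(1)[OF C1_comp_grad[OF fG]] lam g q \<eta> \<epsilon>(1) d(3)]
          unfolding a_def b1_def I_def c2_def by simp
      next
        case False
        \<comment> \<open>Beyond \<open>R + 1\<close> the ball of radius
          \<open>\<delta> \<le> 1\<close> around \<open>x\<close> misses the support of the
          gradient, so \<open>f\<close> is constant on it.\<close>
        have "(if (x, y) \<in> Eset lam (\<gamma> / q) f \<and> dist x y \<le> \<delta> then ennreal (dist x y powr (\<gamma> - ?n)) else 0) = 0" for y
        proof -
          have "f y = f x" if "dist x y \<le> \<delta>"
          proof -
            have "\<bar>f y - f x - 0 \<bullet> (y - x)\<bar> \<le> 0 * norm (y - x)"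
            proof (rule C1_grad_mvt[OF C1_comp_grad[OF fG], of "cball x \<delta>"])
              fix z assume "z \<in> cball x \<delta>"
              then have "R \<le> norm z" using False d(2) norm_triangle_sub[of x z] by (simp add: dist_norm)
              then show "norm (G z - 0) \<le> 0" using R by simp
            qed (use that d in auto)
            then show ?thesis by simp
          qed
          then show ?thesis using lam by (auto simp: Eset_def)
        qed
        then have "?L = 0" by (simp only: nn_integral_const mult_zero_left)
        then show ?thesis by simp
      qed
      then show ?thesis unfolding split b2_def using Rem[of x] by (simp add: add.assoc[symmetric] add_mono)
    qed
    have pw: "epowr (ennreal (lam powr q) * Dint lam \<gamma> q f x) \<theta> \<le> ennreal ((1 + \<epsilon>) powr \<theta> * ((1 + \<epsilon>) powr q * ?k) powr \<theta>) * epowr (ennreal (norm (G x))) r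
       + (ennreal (C\<epsilon> * (c2 powr \<theta> * \<eta> powr r)) * I x + ennreal (C\<epsilon> * \<omega> lam powr \<theta>) * epowr (W x) \<theta>)" for x
    proof -
      have "epowr (ennreal (lam powr q) * Dint lam \<gamma> q f x) \<theta> \<le> epowr (a x + (b1 x + b2 x)) \<theta>"
        using \<theta> by (intro epowr_mono main) auto
      also have "\<dots> \<le> ennreal ((1 + \<epsilon>) powr \<theta>) * epowr (a x) \<theta> + ennreal ((1 + 1/\<epsilon>) powr \<theta>) * epowr (b1 x + b2 x) \<theta>"
        by (rule epowr_add_le[OF \<theta> \<epsilon>(1)])
      also have "\<dots> \<le> ennreal ((1 + \<epsilon>) powr \<theta>) * epowr (a x) \<theta> + ennreal ((1 + 1/\<epsilon>) powr \<theta>) * (ennreal (2 powr \<theta>) * epowr (b1 x) \<theta> + ennreal (2 powr \<theta>) * epowr (b2 x) \<theta>)"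
        using epowr_add_le[OF \<theta> zero_less_one, of "b1 x" "b2 x"] by (intro add_left_mono mult_left_mono) auto
      also have "epowr (a x) \<theta> = ennreal (((1 + \<epsilon>) powr q * ?k) powr \<theta>) * epowr (ennreal (norm (G x))) r"
      proof -
        have 0: "0 \<le> (1 + \<epsilon>) powr q * ?k * norm (G x) powr q" by (intro mult_nonneg_nonneg less_imp_le[OF k] powr_ge_zero)
        have "((1 + \<epsilon>) powr q * ?k * norm (G x) powr q) powr \<theta> = ((1 + \<epsilon>) powr q * ?k) powr \<theta> * (norm (G x) powr q) powr \<theta>"
          by (rule powr_mult)
        also have "(norm (G x) powr q) powr \<theta> = norm (G x) powr r" using q by (simp add: powr_powr \<theta>_def)
        finally show ?thesis
          unfolding a_def epowr_ennreal[OF 0] epowr_ennreal[OF norm_ge_zero] by (simp only: ennreal_mult powr_ge_zero)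
      qed
      also have "epowr (b1 x) \<theta> = ennreal (c2 powr \<theta> * \<eta> powr r) * I x"
      proof -
        have "(c2 * \<eta> powr q) powr \<theta> = c2 powr \<theta> * \<eta> powr r"
          using c2 \<eta> q by (simp add: powr_mult powr_powr \<theta>_def)
        moreover have "epowr (I x) \<theta> = I x" by (simp add: I_def)
        ultimately show ?thesis unfolding b1_def using \<theta> c2 by (simp add: epowr_mult epowr_ennreal)
      qed
      also have "epowr (b2 x) \<theta> = ennreal (\<omega> lam powr \<theta>) * epowr (W x) \<theta>"
        unfolding b2_def using \<theta> om by (simp add: epowr_mult epowr_ennreal)
      finally show ?thesis by (simp add: C\<epsilon>_def ennreal_mult distrib_left mult.assoc)
    qed
    have "Nmor \<tau> (\<lambda>x. epowr (ennreal (lam powr q) * Dint lam \<gamma> q f x) \<theta>) \<le> Nmor \<tau> (\<lambda>x. ennreal ((1 + \<epsilon>) powr \<theta> * ((1 + \<epsilon>) powr q * ?k) powr \<theta>) * epowr (ennreal (norm (G x))) r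
       + (ennreal (C\<epsilon> * (c2 powr \<theta> * \<eta> powr r)) * I x + ennreal (C\<epsilon> * \<omega> lam powr \<theta>) * epowr (W x) \<theta>))"
      by (rule Nmor_mono[OF pw])
    also have "\<dots> \<le> Nmor \<tau> (\<lambda>x. ennreal ((1 + \<epsilon>) powr \<theta> * ((1 + \<epsilon>) powr q * ?k) powr \<theta>) * epowr (ennreal (norm (G x))) r)
       + (Nmor \<tau> (\<lambda>x. ennreal (C\<epsilon> * (c2 powr \<theta> * \<eta> powr r)) * I x) + Nmor \<tau> (\<lambda>x. ennreal (C\<epsilon> * \<omega> lam powr \<theta>) * epowr (W x) \<theta>))"
      by (rule order_trans[OF Nmor_add add_left_mono[OF Nmor_add]]) measurable
    also have "\<dots> = ennreal ((1 + \<epsilon>) powr \<theta> * ((1 + \<epsilon>) powr q * ?k) powr \<theta>) * ennreal n0 + (ennreal (C\<epsilon> * (c2 powr \<theta> * \<eta> powr r)) * ennreal n1 + ennreal (C\<epsilon> * \<omega> lam powr \<theta>) * ennreal n2)"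
      unfolding n0(2)[symmetric] n1(2)[symmetric] n2(2)[symmetric]
      by (intro arg_cong2[where f="(+)"] Nmor_cmult) measurable
    also have "\<dots> = ennreal ((1 + \<epsilon>) powr \<theta> * ((1 + \<epsilon>) powr q * ?k) powr \<theta> * n0 + (C\<epsilon> * (c2 powr \<theta> * \<eta> powr r) * n1 + C\<epsilon> * \<omega> lam powr \<theta> * n2))"
    proof -
      have "0 \<le> C\<epsilon> * (c2 powr \<theta> * \<eta> powr r)" "0 \<le> C\<epsilon> * \<omega> lam powr \<theta>" "0 \<le> (1 + \<epsilon>) powr \<theta> * ((1 + \<epsilon>) powr q * ?k) powr \<theta>"
        using C\<epsilon> by auto
      then show ?thesis using n0(1) n1(1) n2(1)
        by (simp only: ennreal_mult[symmetric] ennreal_plus[symmetric] mult_nonneg_nonneg add_nonneg_nonneg)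
    qed
    also have "\<dots> \<le> ennreal (?k powr \<theta> * n0 + e)"
    proof (rule ennreal_leI)
      have "C\<epsilon> * (c2 powr \<theta> * \<eta> powr r) * n1 = A * (e / 4 / (A + 1))" by (simp add: A_def \<eta>r)
      also have "\<dots> \<le> e / 4" using A e by (simp add: field_simps)
      finally have 1: "C\<epsilon> * (c2 powr \<theta> * \<eta> powr r) * n1 \<le> e / 4" .
      have "C\<epsilon> * \<omega> lam powr \<theta> * n2 = A' * \<omega> lam powr \<theta>" by (simp add: A'_def)
      also have "\<dots> \<le> A' * w0 powr \<theta>" using A' om \<theta> by (intro mult_left_mono powr_mono2) auto
      also have "\<dots> \<le> e / 4" unfolding w0r using A' e by (simp add: field_simps)
      finally have "C\<epsilon> * \<omega> lam powr \<theta> * n2 \<le> e / 4" .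
      with 1 \<epsilon>(2) show "(1 + \<epsilon>) powr \<theta> * ((1 + \<epsilon>) powr q * ?k) powr \<theta> * n0 + (C\<epsilon> * (c2 powr \<theta> * \<eta> powr r) * n1 + C\<epsilon> * \<omega> lam powr \<theta> * n2) \<le> ?k powr \<theta> * n0 + e"
        by linarith
    qed
    also have "\<dots> = ennreal (?k powr \<theta>) * ennreal n0 + ennreal e"
      using n0(1) e by (simp add: ennreal_mult)
    finally show ?case unfolding \<theta>_def[symmetric] n0(2) .
  qed
qed

text \<open>The case of the constant function \<open>\<psi> = \<rho>^a\<close> with exponent 1 in
  \<open>nn_integral_homogeneous_levels\<close>: as \<open>a < 0\<close>, the condition
  \<open>\<bar>h\<bar>^a < \<rho>^a\<close> means \<open>\<bar>h\<bar> > \<rho>\<close>.\<close>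

lemma nn_integral_outside_ball_powr:
  assumes a: "a < 0" and \<rho>: "0 < \<rho>"
  shows "(\<integral>\<^sup>+h. (if \<rho> < norm h then ennreal (norm h powr (a - real DIM('a))) else 0) \<partial>(lborel :: 'a::euclidean_space measure))
    = ennreal (real DIM('a) * Bvol TYPE('a) / \<bar>a\<bar> * \<rho> powr a)"
proof -
  let ?n = "real DIM('a)"
  have "h \<noteq> 0 \<and> norm h powr (a/1) < \<rho> powr a \<longleftrightarrow> \<rho> < norm h" for h :: 'a
  proof (cases "h = 0")
    case False
    then have "0 < norm h" by simp
    then show ?thesis using a \<rho> False
      by (metis div_by_1 less_imp_le linorder_not_less powr_less_mono2_neg powr_mono2')
  qed (use \<rho> in simp)
  then have "(\<integral>\<^sup>+h. (if \<rho> < norm h then ennreal (norm h powr (a - ?n)) else 0) \<partial>(lborel :: 'a measure))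
    = (\<integral>\<^sup>+h. (if h \<noteq> 0 \<and> norm h powr (a/1) < \<rho> powr a then ennreal (norm h powr (a - ?n)) else 0) \<partial>(lborel :: 'a measure))"
    by simp
  also have "\<dots> = ennreal (?n / \<bar>a\<bar>) * (\<integral>\<^sup>+x. (if norm (x::'a) < 1 then ennreal ((\<rho> powr a) powr 1) else 0) \<partial>lborel)"
    using a by (intro nn_integral_homogeneous_levels) auto
  also have "(\<integral>\<^sup>+x. (if norm (x::'a) < 1 then ennreal ((\<rho> powr a) powr 1) else 0) \<partial>lborel) = ennreal (\<rho> powr a) * ennreal (Bvol TYPE('a) * 1 ^ DIM('a))"
  proof -
    have e: "(\<rho> powr a) powr 1 = \<rho> powr a" by simp
    show ?thesis
      unfolding e using nn_integral_ball_const[of 1 "0::'a" "ennreal (\<rho> powr a)"] unfolding dist_0_norm by simp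
  qed
  also have "ennreal (?n / \<bar>a\<bar>) * (ennreal (\<rho> powr a) * ennreal (Bvol TYPE('a) * 1 ^ DIM('a))) = ennreal (?n * Bvol TYPE('a) / \<bar>a\<bar> * \<rho> powr a)"
    using Bvol_pos[where 'a='a] by (simp add: ennreal_mult[symmetric] mult_ac)
  finally show ?thesis .
qed

lemma nn_integral_outside_ball_powr':
  fixes x :: "'a::euclidean_space"
  assumes a: "a < 0" and \<rho>: "0 < \<rho>"
  shows "(\<integral>\<^sup>+y. (if \<rho> < dist x y then ennreal (dist x y powr (a - real DIM('a))) else 0) \<partial>lborel)
    = ennreal (real DIM('a) * Bvol TYPE('a) / \<bar>a\<bar> * \<rho> powr a)"
proof -
  have "(\<integral>\<^sup>+y. (if \<rho> < dist x y then ennreal (dist x y powr (a - real DIM('a))) else 0) \<partial>lborel)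
    = (\<integral>\<^sup>+h. (if \<rho> < dist x (x + h) then ennreal (dist x (x + h) powr (a - real DIM('a))) else 0) \<partial>lborel)"
    by (rule nn_integral_lborel_shift[symmetric, where f="\<lambda>y. if \<rho> < dist x y then ennreal (dist x y powr (a - real DIM('a))) else 0"]) measurable
  also have "\<dots> = (\<integral>\<^sup>+h. (if \<rho> < norm h then ennreal (norm h powr (a - real DIM('a))) else 0) \<partial>(lborel :: 'a measure))"
  proof -
    have e: "dist x (x + h) = norm h" for h by (simp add: dist_norm)
    show ?thesis unfolding e ..
  qed
  finally show ?thesis using nn_integral_outside_ball_powr[OF a \<rho>, where 'a='a] by simp
qed

text \<open>The \<open>t\<close>-th power is bounded, and it is integrable at infinity because
  \<open>a t < -n\<close>.\<close>

lemma Nmor_powr_tail_finite: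
  fixes a t R c0 c1 :: real
  assumes tau: "0 \<le> \<tau>" "\<tau> \<le> 1" and \<theta>: "0 < t" and R: "0 < R" and a: "a * t < - real DIM('a)" and c: "0 \<le> c0" "0 \<le> c1"
  shows "Nmor \<tau> (\<lambda>x::'a::euclidean_space. epowr (if norm x \<le> R then ennreal c0 else ennreal (c1 * norm x powr a)) t) < top"
proof -
  let ?n = "real DIM('a)"
  define h where "h x = epowr (if norm x \<le> R then ennreal c0 else ennreal (c1 * norm x powr a)) t" for x :: 'a
  have [measurable]: "h \<in> borel_measurable borel" unfolding h_def by measurable
  have at: "a < 0" using a \<theta> by (metis mult_nonneg_nonneg less_imp_le linorder_not_less neg_less_0_iff_less of_nat_0_le_iff order_less_le_trans neg_le_0_iff_le)
  have heq: "h x = (if norm x \<le> R then ennreal (c0 powr t) else ennreal (c1 powr t * norm x powr (a * t)))" for x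
    using c by (simp add: h_def epowr_ennreal powr_mult powr_powr)
  have b: "h x \<le> ennreal (max (c0 powr t) (c1 powr t * R powr (a * t)))" for x
  proof (cases "norm x \<le> R")
    case False
    have "norm x powr (a * t) \<le> R powr (a * t)"
      using False R at \<theta> by (intro powr_mono2') (auto simp: mult_neg_pos less_imp_le)
    then have "c1 powr t * norm x powr (a * t) \<le> c1 powr t * R powr (a * t)" by (intro mult_left_mono) auto
    then show ?thesis using False by (auto simp: heq intro!: ennreal_leI simp: max.coboundedI2)
  qed (auto simp: heq intro!: ennreal_leI)
  have "(\<integral>\<^sup>+x. h x \<partial>lborel) \<le> (\<integral>\<^sup>+x. (if dist 0 x < 2 * R then ennreal (c0 powr t) else 0) +
      ennreal (c1 powr t) * (if R < norm x then ennreal (norm x powr ((a * t + ?n) - ?n)) else 0) \<partial>(lborel :: 'a measure))"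
    using R by (intro nn_integral_mono) (auto simp: heq ennreal_mult)
  also have "\<dots> = ennreal (c0 powr t) * ennreal (Bvol TYPE('a) * (2 * R) ^ DIM('a)) +
     ennreal (c1 powr t) * ennreal (?n * Bvol TYPE('a) / \<bar>a * t + ?n\<bar> * R powr (a * t + ?n))"
    using R a by (subst nn_integral_add, measurable, subst nn_integral_ball_const, simp, subst nn_integral_cmult, measurable, subst nn_integral_outside_ball_powr) auto
  also have "\<dots> < top" by (simp add: ennreal_mult_less_top)
  finally have "(\<integral>\<^sup>+x. h x \<partial>lborel) < top" .
  from Nmor_finite[OF _ tau b this] show ?thesis unfolding h_def[abs_def] by simp
qed

lemma C1_comp_eq_of_far:
  fixes f :: "'a::euclidean_space \<Rightarrow> real"
  assumes fG: "C1_grad f G" and R: "\<And>x. R \<le> norm x \<Longrightarrow> G x = 0" and S: "convex S" "x \<in> S" "y \<in> S" "\<And>z. z \<in> S \<Longrightarrow> R \<le> norm z"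
  shows "f y = f x"
proof -
  have "\<bar>f y - f x - 0 \<bullet> (y - x)\<bar> \<le> 0 * norm (y - x)"
    by (rule C1_grad_mvt[OF fG S(1-3)]) (use R S(4) in simp)
  then show ?thesis by simp
qed

text \<open>In dimension at least 2 the complement of a ball is connected, so vanishing of the
  gradient there yields a single constant value.\<close>

lemma C1_comp_eq_outside_ball:
  fixes f :: "'a::euclidean_space \<Rightarrow> real"
  assumes fG: "C1_grad f G" and R: "0 < R" "\<And>x. R \<le> norm x \<Longrightarrow> G x = 0" and n: "2 \<le> DIM('a)" and xy: "R < norm x" "R < norm y"
  shows "f y = f x"
proof -
  let ?S = "- cball (0::'a) R"
  have con: "connected ?S" using n by (intro connected_complement_bounded_convex) auto
  have op: "open ?S" by (simp add: open_Compl)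
  have "f constant_on ?S"
  proof (rule has_derivative_zero_connected_constant_on[OF con op, of "{}"])
    show "continuous_on ?S f" using C1_grad_continuous(1)[OF fG] by (rule continuous_on_subset) simp
    show "\<forall>z\<in>?S - {}. (f has_derivative (\<lambda>h. 0)) (at z within ?S)"
    proof
      fix z assume "z \<in> ?S - {}"
      then have "G z = 0" using R by auto
      moreover have "(f has_derivative (\<lambda>h. G z \<bullet> h)) (at z)" using fG by (simp add: C1_grad_def)
      ultimately have "(f has_derivative (\<lambda>h. 0)) (at z)" by simp
      then show "(f has_derivative (\<lambda>h. 0)) (at z within ?S)" by (rule has_derivative_at_withinI)
    qed
  qed simp
  moreover have "x \<in> ?S" "y \<in> ?S" using xy by auto
  ultimately show ?thesis unfolding constant_on_def by metis
qed

text \<open>For large \<open>x\<close> every \<open>y\<close> with \<open>f y \<noteq> f x\<close>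
  is farther away than \<open>\<bar>x\<bar> / 4\<close>, and the kernel integrated over that region
  decays like \<open>\<bar>x\<bar>^\<gamma>\<close>. If \<open>n \<ge> 2\<close>, such
  \<open>y\<close> lie in a fixed ball, and the better rate
  \<open>\<bar>x\<bar>^(\<gamma> - n)\<close> results. The two rates are the origin of the two
  ranges of \<open>q\<close> in the limit for negative \<open>\<gamma>\<close>.\<close>

lemma Drem_le_neg:
  fixes f :: "'a::euclidean_space \<Rightarrow> real"
  assumes fG: "C1_comp f G" and g: "\<gamma> < 0" and q: "0 < q" and d: "0 < \<delta>"
    and a: "a = \<gamma> \<or> (a = \<gamma> - real DIM('a) \<and> 2 \<le> DIM('a))"
  shows "\<exists>R>0. \<exists>c0\<ge>0. \<exists>c1\<ge>0. \<forall>lam>0. \<forall>x. Drem \<delta> lam \<gamma> q f x \<le> (if norm x \<le> R then ennreal c0 else ennreal (c1 * norm x powr a))"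
proof -
  let ?n = "real DIM('a)" and ?b = "Bvol TYPE('a)"
  have b: "0 < ?b" by (rule Bvol_pos)
  note fG' = C1_comp_grad[OF fG]
  note [measurable] = C1_grad_measurable[OF fG']
  obtain R where R: "0 < R" "\<And>x. R \<le> norm x \<Longrightarrow> G x = 0" using C1_comp_support[OF fG] by blast
  define c0 where "c0 = ?n * ?b / \<bar>\<gamma>\<bar> * \<delta> powr \<gamma>"
  define c1 where "c1 = ?n * ?b / \<bar>\<gamma>\<bar> * 4 powr - \<gamma> + ?b * (2 * R) ^ DIM('a) * 2 powr - (\<gamma> - ?n)"
  have c: "0 \<le> c0" "0 \<le> c1"
    unfolding c0_def c1_def
    by (intro add_nonneg_nonneg mult_nonneg_nonneg divide_nonneg_nonneg powr_ge_zero zero_le_power; use b R(1) in simp)+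
  have "Drem \<delta> lam \<gamma> q f x \<le> (if norm x \<le> 2 * R then ennreal c0 else ennreal (c1 * norm x powr a))" if lam: "0 < lam" for lam and x :: 'a
  proof (cases "norm x \<le> 2 * R")
    case True
    have "Drem \<delta> lam \<gamma> q f x \<le> (\<integral>\<^sup>+y. (if \<delta> < dist x y then ennreal (dist x y powr (\<gamma> - ?n)) else 0) \<partial>lborel)"
      unfolding Drem_def by (intro nn_integral_mono) auto
    also have "\<dots> = ennreal c0" unfolding c0_def by (rule nn_integral_outside_ball_powr'[OF g d])
    finally show ?thesis using True by simp
  next
    case False
    then have x: "2 * R < norm x" by simp
    then have nx: "0 < norm x" using R by linarith
    have fne: "f y \<noteq> f x" if "(x, y) \<in> Eset lam (\<gamma>/q) f" for y using that lam by (auto simp: Eset_def)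
    have far: "norm x / 4 < dist x y" if "(x, y) \<in> Eset lam (\<gamma>/q) f" for y
    proof (rule ccontr)
      assume "\<not> ?thesis"
      then have y: "dist x y \<le> norm x / 4" by simp
      have "f y = f x"
      proof (rule C1_comp_eq_of_far[where S="cball x (norm x / 4)", OF fG' R(2)])
        fix z assume "z \<in> cball x (norm x / 4)"
        then have "norm x \<le> norm z + norm x / 4" using norm_triangle_sub[of x z] by (simp add: dist_norm)
        then show "R \<le> norm z" using x R(1) by linarith
      qed (use y nx in auto)
      then show False using fne[OF that] by simp
    qed
    from a have "Drem \<delta> lam \<gamma> q f x \<le> ennreal (c1 * norm x powr a)"
    proof
      assume a: "a = \<gamma>"
      have "Drem \<delta> lam \<gamma> q f x \<le> (\<integral>\<^sup>+y. (if norm x / 4 < dist x y then ennreal (dist x y powr (\<gamma> - ?n)) else 0) \<partial>lborel)"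
        unfolding Drem_def using far by (intro nn_integral_mono) auto
      also have "\<dots> = ennreal (?n * ?b / \<bar>\<gamma>\<bar> * (norm x / 4) powr \<gamma>)"
        using nx by (intro nn_integral_outside_ball_powr'[OF g]) simp
      also have "\<dots> \<le> ennreal (c1 * norm x powr a)"
      proof (rule ennreal_leI)
        have "?n * ?b / \<bar>\<gamma>\<bar> * (norm x / 4) powr \<gamma> = ?n * ?b / \<bar>\<gamma>\<bar> * 4 powr - \<gamma> * norm x powr a"
          unfolding a powr_divide powr_minus unfolding divide_inverse by (simp only: mult_ac)
        also have "\<dots> \<le> c1 * norm x powr a"
          unfolding c1_def using b R by (intro mult_right_mono) auto
        finally show "?n * ?b / \<bar>\<gamma>\<bar> * (norm x / 4) powr \<gamma> \<le> c1 * norm x powr a" .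
      qed
      finally show ?thesis .
    next
      assume "a = \<gamma> - ?n \<and> 2 \<le> DIM('a)"
      then have a: "a = \<gamma> - ?n" "2 \<le> DIM('a)" by auto
      have an: "a < 0" using a g by simp
      have "Drem \<delta> lam \<gamma> q f x \<le> (\<integral>\<^sup>+y. (if dist 0 y < 2 * R then ennreal ((norm x / 2) powr a) else 0) \<partial>(lborel :: 'a measure))"
        unfolding Drem_def
      proof (rule nn_integral_mono)
        fix y
        show "(if (x, y) \<in> Eset lam (\<gamma>/q) f \<and> \<delta> < dist x y then ennreal (dist x y powr (\<gamma> - ?n)) else 0) \<le> (if dist 0 y < 2 * R then ennreal ((norm x / 2) powr a) else 0)"
        proof (cases "(x, y) \<in> Eset lam (\<gamma>/q) f")
          case True
          have y: "norm y \<le> R"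
            using C1_comp_eq_outside_ball[OF fG' R a(2), of x y] fne[OF True] x R(1) by force
          have "norm x \<le> norm y + dist x y" using norm_triangle_sub[of x y] by (simp add: dist_norm)
          then have "norm x / 2 \<le> dist x y" using x y by linarith
          then have "dist x y powr a \<le> (norm x / 2) powr a" using an nx by (intro powr_mono2') auto
          then show ?thesis using y R(1) a(1) by (auto intro: ennreal_leI)
        qed simp
      qed
      also have "\<dots> = ennreal ((norm x / 2) powr a) * ennreal (?b * (2 * R) ^ DIM('a))"
        using R by (intro nn_integral_ball_const) simp
      also have "\<dots> \<le> ennreal (c1 * norm x powr a)"
      proof -
        have "(norm x / 2) powr a * (?b * (2 * R) ^ DIM('a)) = ?b * (2 * R) ^ DIM('a) * 2 powr - (\<gamma> - ?n) * norm x powr a"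
          unfolding a(1) powr_divide powr_minus unfolding divide_inverse by (simp only: mult_ac)
        also have "\<dots> \<le> c1 * norm x powr a"
          unfolding c1_def using b R by (intro mult_right_mono) auto
        finally show ?thesis using b R by (simp add: ennreal_mult[symmetric] ennreal_leI)
      qed
      finally show ?thesis .
    qed
    then show ?thesis using False by simp
  qed
  then have *: "\<forall>lam>0. \<forall>x. Drem \<delta> lam \<gamma> q f x \<le> (if norm x \<le> 2 * R then ennreal c0 else ennreal (c1 * norm x powr a))"
    by (intro allI impI)
  have "0 < 2 * R" using R(1) by simp
  show ?thesis
    by (rule exI[of _ "2 * R"], rule conjI[OF \<open>0 < 2 * R\<close>], rule exI[of _ c0], rule conjI[OF c(1)],
        rule exI[of _ c1], rule conjI[OF c(2) *])
qed

text \<open>With \<open>b\<close> a Lipschitz constant of \<open>f\<close>, the quotient in the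
  level set is at most \<open>b \<delta>^(-\<gamma>/q)\<close> at distances above
  \<open>\<delta>\<close>, so no such pair survives for larger \<open>lam\<close>.\<close>

lemma Drem_eq_0_pos:
  fixes f :: "'a::euclidean_space \<Rightarrow> real"
  assumes fG: "C1_comp f G" and g: "0 < \<gamma>" and q: "0 < q" and d: "0 < \<delta>"
  shows "eventually (\<lambda>lam. \<forall>x. Drem \<delta> lam \<gamma> q f x = 0) at_top"
proof -
  obtain b where b: "0 < b" "\<And>x. norm (G x) \<le> b" using C1_comp_bounded[OF fG] by blast
  have "Drem \<delta> lam \<gamma> q f x = 0" if lam: "b / \<delta> powr (\<gamma>/q) \<le> lam" for lam and x :: 'a
  proof -
    have l0: "0 < lam" using less_le_trans[OF _ lam] b d by simp
    have "\<not> ((x, y) \<in> Eset lam (\<gamma>/q) f \<and> \<delta> < dist x y)" for y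
    proof
      assume "(x, y) \<in> Eset lam (\<gamma>/q) f \<and> \<delta> < dist x y"
      then have E: "lam < \<bar>f x - f y\<bar> / dist x y powr (1 + \<gamma>/q)" and D: "\<delta> < dist x y" by (auto simp: Eset_def)
      have dp: "0 < dist x y" using D d by linarith
      then have pp: "0 < dist x y powr (1 + \<gamma>/q)" by simp
      have "\<bar>f x - f y - 0 \<bullet> (x - y)\<bar> \<le> b * norm (x - y)"
        by (rule C1_grad_mvt[OF C1_comp_grad[OF fG] convex_UNIV]) (use b in auto)
      then have 1: "\<bar>f x - f y\<bar> \<le> b * dist x y" by (simp add: dist_norm)
      have "lam * dist x y powr (1 + \<gamma>/q) < \<bar>f x - f y\<bar>" using E by (simp only: pos_less_divide_eq[OF pp])
      also have "lam * dist x y powr (1 + \<gamma>/q) = lam * dist x y powr (\<gamma>/q) * dist x y" using dp by (simp add: powr_add)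
      finally have "lam * dist x y powr (\<gamma>/q) * dist x y < b * dist x y" using 1 by simp
      then have "lam * dist x y powr (\<gamma>/q) < b" using dp by simp
      moreover have "lam * \<delta> powr (\<gamma>/q) \<le> lam * dist x y powr (\<gamma>/q)"
        using l0 D d g q by (intro mult_left_mono powr_mono2) auto
      moreover have "b \<le> lam * \<delta> powr (\<gamma>/q)" using lam d by (simp add: pos_divide_le_eq)
      ultimately show False by simp
    qed
    then have "Drem \<delta> lam \<gamma> q f x = (\<integral>\<^sup>+y. 0 \<partial>(lborel :: 'a measure))"
      unfolding Drem_def by (intro nn_integral_cong) (simp only: if_False)
    then show ?thesis by simp
  qed
  then show ?thesis by (intro eventually_mono[OF eventually_ge_at_top[of "b / \<delta> powr (\<gamma>/q)"]]) blast
qed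

text \<open>Fatou's lemma works along sequences, hence the sequence \<open>X\<close>; the remainder
  estimate lives on the filter that \<open>X\<close> follows. This form serves \<open>at_top\<close>
  for \<open>\<gamma> > 0\<close> and \<open>at_right 0\<close> for
  \<open>\<gamma> < 0\<close>.\<close>

lemma Qfun_tendsto_sequentially:
  fixes f :: "'a::euclidean_space \<Rightarrow> real"
  assumes fG: "C1_comp f G" and g: "\<gamma> \<noteq> 0" and q: "0 < q" and r: "1 \<le> r" "r \<le> \<alpha>"
    and X: "\<And>i. 0 < X i" "(\<lambda>i. X i powr - (q/\<gamma>)) \<longlonglongrightarrow> 0" and Xlim: "filterlim X \<F> sequentially"
    and rem: "\<And>\<delta>. 0 < \<delta> \<Longrightarrow> \<delta> \<le> 1 \<Longrightarrow> \<exists>W \<omega>. W \<in> borel_measurable borel \<and> Nmor (1 - r/\<alpha>) (\<lambda>x. epowr (W x) (r/q)) < top \<and>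
        (\<omega> \<longlongrightarrow> 0) \<F> \<and> eventually (\<lambda>lam. 0 < lam \<and> 0 \<le> \<omega> lam \<and> (\<forall>x. ennreal (lam powr q) * Drem \<delta> lam \<gamma> q f x \<le> ennreal (\<omega> lam) * W x)) \<F>"
  shows "(\<lambda>i. Qfun \<alpha> r \<gamma> q f (X i)) \<longlonglongrightarrow> ennreal ((kappa q TYPE('a) / \<bar>\<gamma>\<bar>) powr (1/q)) * morrey_norm \<alpha> r (\<lambda>x. ennreal (norm (G x)))"
proof -
  let ?k = "kappa q TYPE('a) / \<bar>\<gamma>\<bar>"
  note [measurable] = C1_grad_measurable[OF C1_comp_grad[OF fG]]
  have k: "0 < ?k" using kappa_pos[OF q, where 'a='a] g by simp
  have r0: "0 < r" using r by simp
  have tau: "0 \<le> 1 - r/\<alpha>" "1 - r/\<alpha> \<le> 1" using r by (auto simp: field_simps)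
  define N where "N i = Nmor (1 - r/\<alpha>) (\<lambda>x. epowr (ennreal (X i powr q) * Dint (X i) \<gamma> q f x) (r/q))" for i
  define L where "L = ennreal (?k powr (r/q)) * Nmor (1 - r/\<alpha>) (\<lambda>x. epowr (ennreal (norm (G x))) r)"
  have Qi: "Qfun \<alpha> r \<gamma> q f (X i) = epowr (N i) (1/r)" for i
    unfolding N_def using r0 q X(1) by (intro Qfun_eq_Nmor') auto
  have Lr: "epowr L (1/r) = ennreal (?k powr (1/q)) * morrey_norm \<alpha> r (\<lambda>x. ennreal (norm (G x)))"
    unfolding L_def using r0 k by (simp add: morrey_norm_eq_Nmor epowr_mult epowr_ennreal powr_powr)
  have cont: "continuous_on UNIV (\<lambda>x. epowr x (1/r))" using r0 by (intro continuous_on_epowr) simp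
  have sup: "limsup N \<le> L"
  proof (rule ennreal_le_epsilon)
    fix e :: real assume e: "0 < e"
    have "eventually (\<lambda>i. N i \<le> L + ennreal e) sequentially"
      unfolding N_def L_def
      by (rule filterlim_iff[THEN iffD1, rule_format, OF Xlim Nmor_Dint_limsup[OF fG g q r0 tau rem e]])
    then show "limsup N \<le> L + ennreal e" by (rule Limsup_bounded)
  qed
  have "limsup (\<lambda>i. epowr (N i) (1/r)) = epowr (limsup N) (1/r)"
    using r0 by (intro Limsup_compose_continuous_mono cont) (auto simp: mono_def intro: epowr_mono)
  also have "\<dots> \<le> epowr L (1/r)" using r0 sup by (intro epowr_mono) auto
  finally have 1: "limsup (\<lambda>i. Qfun \<alpha> r \<gamma> q f (X i)) \<le> ennreal (?k powr (1/q)) * morrey_norm \<alpha> r (\<lambda>x. ennreal (norm (G x)))"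
    unfolding Qi Lr .
  have 2: "ennreal (?k powr (1/q)) * morrey_norm \<alpha> r (\<lambda>x. ennreal (norm (G x))) \<le> liminf (\<lambda>i. Qfun \<alpha> r \<gamma> q f (X i))"
    by (rule Qfun_liminf[OF fG g q r0 X])
  show ?thesis
    using 1 2 Liminf_le_Limsup[of sequentially "\<lambda>i. Qfun \<alpha> r \<gamma> q f (X i)"]
    by (intro Liminf_eq_Limsup) (auto intro: antisym order_trans)
qed

lemma Qfun_tendsto_at_top:
  fixes f :: "'a::euclidean_space \<Rightarrow> real"
  assumes fG: "C1_comp f G" and g: "0 < \<gamma>" and q: "0 < q" and r: "1 \<le> r" "r \<le> \<alpha>"
  shows "(Qfun \<alpha> r \<gamma> q f \<longlongrightarrow> ennreal ((kappa q TYPE('a) / \<gamma>) powr (1/q)) * morrey_norm \<alpha> r (\<lambda>x. ennreal (norm (G x)))) at_top"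
proof (rule tendsto_at_topI_sequentially)
  fix X :: "nat \<Rightarrow> real" assume X: "filterlim X at_top sequentially"
  have "eventually (\<lambda>i. 0 < X i) sequentially" using X by (simp add: filterlim_at_top_dense)
  then obtain N where N: "\<And>i. N \<le> i \<Longrightarrow> 0 < X i" by (auto simp: eventually_sequentially)
  \<comment> \<open>Drops the finitely many terms that may fail to be positive.\<close>
  define Y where "Y i = X (i + N)" for i
  have Y: "filterlim Y at_top sequentially" unfolding Y_def
    by (rule filterlim_compose[OF X filterlim_add_const_nat_at_top])
  have Yp: "0 < Y i" for i unfolding Y_def by (rule N) simp
  have Y0: "(\<lambda>i. Y i powr - (q/\<gamma>)) \<longlonglongrightarrow> 0"
    using Y g q by (intro tendsto_neg_powr) auto
  have "(\<lambda>i. Qfun \<alpha> r \<gamma> q f (Y i)) \<longlonglongrightarrow> ennreal ((kappa q TYPE('a) / \<bar>\<gamma>\<bar>) powr (1/q)) * morrey_norm \<alpha> r (\<lambda>x. ennreal (norm (G x)))"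
  proof (rule Qfun_tendsto_sequentially[OF fG _ q r Yp Y0 Y])
    fix \<delta> :: real assume d: "0 < \<delta>"
    have "eventually (\<lambda>lam. 0 < lam \<and> (0::real) \<le> 0 \<and> (\<forall>x. ennreal (lam powr q) * Drem \<delta> lam \<gamma> q f x \<le> ennreal 0 * 0)) at_top"
      using Drem_eq_0_pos[OF fG g q d] eventually_gt_at_top[of 0] by eventually_elim simp
    moreover have "Nmor (1 - r/\<alpha>) (\<lambda>x::'a. epowr 0 (r/q)) < top"
      by (simp add: Nmor_def)
    ultimately show "\<exists>W \<omega>. W \<in> borel_measurable borel \<and> Nmor (1 - r/\<alpha>) (\<lambda>x. epowr (W x) (r/q)) < top \<and>
        (\<omega> \<longlongrightarrow> 0) at_top \<and> eventually (\<lambda>lam. 0 < lam \<and> 0 \<le> \<omega> lam \<and> (\<forall>x. ennreal (lam powr q) * Drem \<delta> lam \<gamma> q f x \<le> ennreal (\<omega> lam) * W x)) at_top"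
      by (intro exI[of _ "\<lambda>x. 0"] exI[of _ "\<lambda>lam. 0"]) simp
  qed (use g in simp)
  then show "(\<lambda>i. Qfun \<alpha> r \<gamma> q f (X i)) \<longlonglongrightarrow> ennreal ((kappa q TYPE('a) / \<gamma>) powr (1/q)) * morrey_norm \<alpha> r (\<lambda>x. ennreal (norm (G x)))"
    unfolding Y_def using g LIMSEQ_offset[of "\<lambda>i. Qfun \<alpha> r \<gamma> q f (X i)" N] by simp
qed

lemma Qfun_tendsto_at_right_0:
  fixes f :: "'a::euclidean_space \<Rightarrow> real"
  assumes fG: "C1_comp f G" and g: "\<gamma> < 0" and q: "0 < q" and r: "1 \<le> r" "r \<le> \<alpha>"
    and range: "(2 \<le> DIM('a) \<and> q < (real DIM('a) - \<gamma>) / real DIM('a) * r) \<or> (DIM('a) = 1 \<and> q < - \<gamma> * r)"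
  shows "(Qfun \<alpha> r \<gamma> q f \<longlongrightarrow> ennreal ((- kappa q TYPE('a) / \<gamma>) powr (1/q)) * morrey_norm \<alpha> r (\<lambda>x. ennreal (norm (G x)))) (at_right 0)"
proof (rule tendsto_at_right_sequentially[of 0 1])
  fix X :: "nat \<Rightarrow> real" assume X: "\<And>i. 0 < X i" "X \<longlonglongrightarrow> 0"
  let ?n = "real DIM('a)"
  have r0: "0 < r" using r by simp
  have tau: "0 \<le> 1 - r/\<alpha>" "1 - r/\<alpha> \<le> 1" using r by (auto simp: field_simps)
  have Xr: "filterlim X (at_right 0) sequentially"
    using X by (intro tendsto_imp_filterlim_at_right) auto
  have "0 < - (q/\<gamma>)" using g q by (simp add: divide_neg_neg divide_pos_neg)
  then have X0: "(\<lambda>i. X i powr - (q/\<gamma>)) \<longlonglongrightarrow> 0"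
    using X by (intro tendsto_zero_powrI[where b="- (q/\<gamma>)"]) (auto intro!: always_eventually less_imp_le)
  \<comment> \<open>The decay rate of the remainder that makes its power \<open>r / q\<close>
    integrable at infinity: \<open>\<gamma> - n\<close> if \<open>n \<ge> 2\<close>, and
    \<open>\<gamma>\<close> if \<open>n = 1\<close>. Each inequality is a rearrangement of the
    assumed range of \<open>q\<close>.\<close>
  obtain a where a: "a = \<gamma> \<or> (a = \<gamma> - ?n \<and> 2 \<le> DIM('a))" "a * (r/q) < - ?n"
  proof (cases "2 \<le> DIM('a)")
    case True
    then have "q < (?n - \<gamma>) / ?n * r" using range by auto
    then have "?n * q < (?n - \<gamma>) * r" by (simp add: field_simps)
    then have "(\<gamma> - ?n) * (r/q) < - ?n" using q by (simp add: field_simps)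
    then show ?thesis using True that by blast
  next
    case False
    then have "q < - \<gamma> * r" "?n = 1" using range by auto
    then have "\<gamma> * (r/q) < - ?n" using q by (simp add: field_simps)
    then show ?thesis using that by blast
  qed
  have "(\<lambda>i. Qfun \<alpha> r \<gamma> q f (X i)) \<longlonglongrightarrow> ennreal ((kappa q TYPE('a) / \<bar>\<gamma>\<bar>) powr (1/q)) * morrey_norm \<alpha> r (\<lambda>x. ennreal (norm (G x)))"
  proof (rule Qfun_tendsto_sequentially[OF fG _ q r X(1) X0 Xr])
    fix \<delta> :: real assume d: "0 < \<delta>"
    obtain R c0 c1 where R: "0 < R" "0 \<le> c0" "0 \<le> c1"
      and D: "\<And>lam x. 0 < lam \<Longrightarrow> Drem \<delta> lam \<gamma> q f x \<le> (if norm x \<le> R then ennreal c0 else ennreal (c1 * norm x powr a))"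
      using Drem_le_neg[OF fG g q d a(1)] by metis
    let ?W = "\<lambda>x::'a. if norm x \<le> R then ennreal c0 else ennreal (c1 * norm x powr a)"
    have "Nmor (1 - r/\<alpha>) (\<lambda>x. epowr (?W x) (r/q)) < top"
      using r0 q R a(2) by (intro Nmor_powr_tail_finite tau) auto
    moreover have "((\<lambda>lam. lam powr q) \<longlongrightarrow> 0) (at_right (0::real))"
      using q by (intro tendsto_zero_powrI[where b=q]) (auto simp: eventually_at_filter intro!: tendsto_ident_at)
    moreover have "eventually (\<lambda>lam. 0 < lam \<and> 0 \<le> lam powr q \<and> (\<forall>x. ennreal (lam powr q) * Drem \<delta> lam \<gamma> q f x \<le> ennreal (lam powr q) * ?W x)) (at_right 0)"
    proof (rule eventually_mono[OF eventually_at_right_less[of 0]])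
      fix lam :: real assume "0 < lam"
      then show "0 < lam \<and> 0 \<le> lam powr q \<and> (\<forall>x. ennreal (lam powr q) * Drem \<delta> lam \<gamma> q f x \<le> ennreal (lam powr q) * ?W x)"
        by (intro conjI allI mult_left_mono D) simp_all
    qed
    ultimately show "\<exists>W \<omega>. W \<in> borel_measurable borel \<and> Nmor (1 - r/\<alpha>) (\<lambda>x. epowr (W x) (r/q)) < top \<and>
        (\<omega> \<longlongrightarrow> 0) (at_right 0) \<and> eventually (\<lambda>lam. 0 < lam \<and> 0 \<le> \<omega> lam \<and> (\<forall>x. ennreal (lam powr q) * Drem \<delta> lam \<gamma> q f x \<le> ennreal (\<omega> lam) * W x)) (at_right 0)"
      by (intro exI[of _ ?W] exI[of _ "\<lambda>lam. lam powr q"]) simp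
  qed (use g in simp)
  then show "(\<lambda>i. Qfun \<alpha> r \<gamma> q f (X i)) \<longlonglongrightarrow> ennreal ((- kappa q TYPE('a) / \<gamma>) powr (1/q)) * morrey_norm \<alpha> r (\<lambda>x. ennreal (norm (G x)))"
    using g by (simp add: abs_of_neg)
qed simp

theorem theorem5p1:
  fixes \<alpha> r \<gamma> q :: real
  assumes "1 \<le> r" and "r \<le> \<alpha>" and "\<gamma> \<noteq> 0" and "0 < q"
    and "r > real DIM('a::euclidean_space)
         \<or> (r \<le> real DIM('a) \<and> \<gamma> > 0 \<and> real DIM('a) * (1/r - 1/q) < 1)
         \<or> (1 < r \<and> r \<le> real DIM('a) \<and> \<gamma> < 0 \<and> q < r)
         \<or> (r = 1 \<and> DIM('a) = 1 \<and> q = 1 \<and> \<gamma> < -1)"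
  shows
    "(\<exists>C1 C2. 0 < C1 \<and> 0 < C2 \<and>
       (\<forall>(f :: 'a \<Rightarrow> real) (G :: 'a \<Rightarrow> 'a).
          (\<forall>x. (f has_derivative (\<lambda>h. G x \<bullet> h)) (at x)) \<and> continuous_on UNIV G \<and>
          compact (closure {x. norm (G x) \<noteq> 0}) \<longrightarrow>
            ennreal C1 * morrey_norm \<alpha> r (\<lambda>x. ennreal (norm (G x)))
              \<le> (SUP lam \<in> {0<..}. Qfun \<alpha> r \<gamma> q f lam) \<and>
            (SUP lam \<in> {0<..}. Qfun \<alpha> r \<gamma> q f lam)
              \<le> ennreal C2 * morrey_norm \<alpha> r (\<lambda>x. ennreal (norm (G x)))))
     \<and>
     (\<forall>(f :: 'a \<Rightarrow> real) (G :: 'a \<Rightarrow> 'a).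
          (\<forall>x. (f has_derivative (\<lambda>h. G x \<bullet> h)) (at x)) \<and> continuous_on UNIV G \<and>
          compact (closure {x. norm (G x) \<noteq> 0}) \<longrightarrow>
            (\<gamma> > 0 \<longrightarrow>
               (Qfun \<alpha> r \<gamma> q f \<longlongrightarrow>
                  ennreal ((kappa q TYPE('a) / \<gamma>) powr (1/q)) *
                  morrey_norm \<alpha> r (\<lambda>x. ennreal (norm (G x)))) at_top) \<and>
            (\<gamma> < 0 \<and>
             ((DIM('a) \<ge> 2 \<and> q < (real DIM('a) - \<gamma>) / real DIM('a) * r) \<or>
              (DIM('a) = 1 \<and> \<gamma> < -1 \<and> q < - \<gamma> * r)) \<longrightarrow>
               (Qfun \<alpha> r \<gamma> q f \<longlongrightarrow>
                  ennreal ((- kappa q TYPE('a) / \<gamma>) powr (1/q)) *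
                  morrey_norm \<alpha> r (\<lambda>x. ennreal (norm (G x)))) (at_right 0)))"
proof -
  have r: "0 < r" using assms(1) by simp
  have comp: "C1_comp f G" if "(\<forall>x. (f has_derivative (\<lambda>h. G x \<bullet> h)) (at x)) \<and> continuous_on UNIV G \<and>
          compact (closure {x. norm (G x) \<noteq> 0})" for f :: "'a \<Rightarrow> real" and G
    using that by (simp add: C1_comp_def C1_grad_def)
  \<comment> \<open>The lower constant is the constant of the limits, because the lower bound is
    read off from the same application of Fatou's lemma.\<close>
  let ?C1 = "(kappa q TYPE('a) / \<bar>\<gamma>\<bar>) powr (1/q)"
  have C1: "0 < ?C1" using kappa_pos[OF assms(4), where 'a='a] assms(3) by simp
  obtain C2 where C2: "0 < C2" "\<And>(f::'a \<Rightarrow> real) G b lam. C1_grad f G \<Longrightarrow> (\<forall>x. norm (G x) \<le> b) \<Longrightarrow> 0 < lam \<Longrightarrow>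
    Qfun \<alpha> r \<gamma> q f lam \<le> ennreal C2 * morrey_norm \<alpha> r (\<lambda>x. ennreal (norm (G x)))"
    using Qfun_upper_bound[OF assms] by blast
  have upper: "(SUP lam \<in> {0<..}. Qfun \<alpha> r \<gamma> q f lam) \<le> ennreal C2 * morrey_norm \<alpha> r (\<lambda>x. ennreal (norm (G x)))"
    if fG: "C1_comp f G" for f :: "'a \<Rightarrow> real" and G
  proof -
    obtain b where b: "\<And>x. norm (G x) \<le> b" using C1_comp_bounded[OF fG] by blast
    show ?thesis
    proof (rule SUP_least)
      fix lam :: real assume "lam \<in> {0<..}"
      then show "Qfun \<alpha> r \<gamma> q f lam \<le> ennreal C2 * morrey_norm \<alpha> r (\<lambda>x. ennreal (norm (G x)))"
        using b by (intro C2(2)[of f G b] C1_comp_grad[OF fG]) auto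
    qed
  qed
  show ?thesis (is "?bounds \<and> ?limits")
  proof
    show ?bounds
    proof (rule exI[of _ ?C1], rule exI[of _ C2], intro conjI C1 C2(1) allI impI)
      fix f :: "'a \<Rightarrow> real" and G :: "'a \<Rightarrow> 'a"
      assume fG: "(\<forall>x. (f has_derivative (\<lambda>h. G x \<bullet> h)) (at x)) \<and> continuous_on UNIV G \<and> compact (closure {x. norm (G x) \<noteq> 0})"
      show "ennreal ?C1 * morrey_norm \<alpha> r (\<lambda>x. ennreal (norm (G x))) \<le> (SUP lam \<in> {0<..}. Qfun \<alpha> r \<gamma> q f lam)"
        by (rule Qfun_lower_bound[OF comp[OF fG] assms(3,4) r])
      show "(SUP lam \<in> {0<..}. Qfun \<alpha> r \<gamma> q f lam) \<le> ennreal C2 * morrey_norm \<alpha> r (\<lambda>x. ennreal (norm (G x)))"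
        by (rule upper[OF comp[OF fG]])
    qed
    show ?limits
    proof (intro allI impI conjI)
      fix f :: "'a \<Rightarrow> real" and G :: "'a \<Rightarrow> 'a"
      assume fG: "(\<forall>x. (f has_derivative (\<lambda>h. G x \<bullet> h)) (at x)) \<and> continuous_on UNIV G \<and> compact (closure {x. norm (G x) \<noteq> 0})"
      { assume "\<gamma> > 0"
        then show "(Qfun \<alpha> r \<gamma> q f \<longlongrightarrow> ennreal ((kappa q TYPE('a) / \<gamma>) powr (1/q)) * morrey_norm \<alpha> r (\<lambda>x. ennreal (norm (G x)))) at_top"
          by (rule Qfun_tendsto_at_top[OF comp[OF fG] _ assms(4,1,2)]) }
      { assume neg: "\<gamma> < 0 \<and> ((DIM('a) \<ge> 2 \<and> q < (real DIM('a) - \<gamma>) / real DIM('a) * r) \<or> (DIM('a) = 1 \<and> \<gamma> < -1 \<and> q < - \<gamma> * r))"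
        then show "(Qfun \<alpha> r \<gamma> q f \<longlongrightarrow> ennreal ((- kappa q TYPE('a) / \<gamma>) powr (1/q)) * morrey_norm \<alpha> r (\<lambda>x. ennreal (norm (G x)))) (at_right 0)"
          by (intro Qfun_tendsto_at_right_0[OF comp[OF fG] _ assms(4,1,2)]) auto }
    qed
  qed
qed

end
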